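(* Let $F$ be a field of characteristic zero, $V$ a two-dimensional $F$-vector space, $L\subseteq V$ a line, $P\subseteq \mathrm{SL}(V)$ the stabilizer of $L$, $\mathbf{P}=\mathrm{SL}(V)/P$ the projective line of lines in $V$, and $e\in\mathbf{P}$ the point corresponding to $L$. Let $k\geq 1$ be an integer. Consider the sheaves of jets with their right $\mathcal{O}_{\mathbf{P}}$-module structure, denoted $\mathcal{P}^k(-)^R$, and their fibers at $e$, with the natural $P$-module structure. (1) If $d>0$ is an integer, there is an isomorphism of $P$-modules $$\mathcal{P}^k(\mathcal{O}(-d))^R(e)\cong \mathrm{Sym}^d(L)\oplus \bigl(\mathrm{Sym}^{k+d+1}(L)\otimes \mathrm{Sym}^{k-1}(V)\bigr).$$ (2) If $d\geq 0$ is an integer, there is an isomorphism of $P$-modules $$\mathcal{P}^k(\mathcal{O}(d))^R(e)\cong \mathrm{Sym}^{d}(L^* )\oplus \bigl(\mathrm{Sym}^{d-k-1}(L^* )\otimes \mathrm{Sym}^{k-1}(V)\bigr),$$ where for $m>0$ one sets $\mathrm{Sym}^{-m}(L^* )=\mathrm{Sym}^m(L)$.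
   Context: Let $p,q:\mathbf{P}\times\mathbf{P}\to\mathbf{P}$ be the two projections and $I\subseteq\mathcal{O}_{\mathbf{P}\times\mathbf{P}}$ the ideal sheaf of the diagonal $\Delta$; put $\mathcal{O}_{\Delta^k}=\mathcal{O}_{\mathbf{P}\times\mathbf{P}}/I^{k+1}$. For an $\mathcal{O}_{\mathbf{P}}$-module $\mathcal{E}$, the $k$-th order sheaf of jets is $\mathcal{P}^k(\mathcal{E})=p_*(\mathcal{O}_{\Delta^k}\otimes q^*\mathcal{E})$. It is a sheaf of $\mathcal{O}_{\mathbf{P}}$-bimodules. With its right structure (the one coming from the second projection) it is $\mathcal{P}^k(\mathcal{E})^R=q_*(\mathcal{O}_{\Delta^k}\otimes q^*\mathcal{E})$. The line bundle $\mathcal{O}(d)$ on $\mathbf{P}$ carries its unique $\mathrm{SL}(V)$-linearization; its fiber at $e$ is the $P$-module $(L^* )^{\otimes d}$ (with $(L^* )^{\otimes -m}=L^{\otimes m}$), so that $\mathcal{O}(-1)(e)=L$. The sheaf $\mathcal{P}^k(\mathcal{O}(d))^R$ then has a canonical $\mathrm{SL}(V)$-linearization (from the diagonal action on $\mathbf{P}\times\mathbf{P}$), so its fiber at the $P$-fixed point $e$ is a finite-dimensional $P$-module. $V$ is regarded as a $P$-module by restriction from $\mathrm{SL}(V)$, and $L\subseteq V$ is a $P$-submodule. *)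

theory Defs
  imports
    "HOL-Algebra.Ideal_Product"
    "HOL-Algebra.Module"
    "HOL-Algebra.Free_Abelian_Groups"
    "HOL-Algebra.Algebraic_Closure_Type"
    "HOL-Library.Product_Plus"
begin

section \<open>Quotients, tensor products and symmetric powers of modules\<close>

text \<open>
  Module records extend ring records; their fields \<open>mult\<close> and \<open>one\<close> play no role for modules and
  are left undefined where no ring structure is around.
\<close>

definition quot_module :: "('r, 'm, 'z) module_scheme \<Rightarrow> 'm set \<Rightarrow> ('r, 'm set) module" where
  "quot_module M N =
     \<lparr>carrier = a_rcosets\<^bsub>M\<^esub> N, monoid.mult = undefined, one = undefined,
      ring.zero = N, ring.add = set_add M,
      module.smult = (\<lambda>r A. \<Union>x\<in>A. N +>\<^bsub>M\<^esub> (r \<odot>\<^bsub>M\<^esub> x))\<rparr>"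

text \<open>
  The abelian group presented by generators \<open>S\<close> and relations \<open>E\<close>.  Scalars act on the generators
  (by \<open>act\<close>); in the two uses below the relations make this a module structure.
\<close>

definition presented_module ::
    "'s set \<Rightarrow> ('s \<Rightarrow>\<^sub>0 int) set \<Rightarrow> ('r \<Rightarrow> 's \<Rightarrow> 's) \<Rightarrow> ('r, ('s \<Rightarrow>\<^sub>0 int) set) module" where
  "presented_module S E act =
     quot_module
       \<lparr>carrier = carrier (free_Abelian_group S), monoid.mult = undefined, one = undefined,
        ring.zero = 0, ring.add = (+), module.smult = (\<lambda>r. frag_extend (frag_of \<circ> act r))\<rparr>
       (generate (free_Abelian_group S) E)"

definition tensor_relations ::
    "('r, 'y) ring_scheme \<Rightarrow> ('r, 'm, 'z) module_scheme \<Rightarrow> ('r, 'n, 'w) module_scheme \<Rightarrow>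
     ('m \<times> 'n \<Rightarrow>\<^sub>0 int) set" where
  "tensor_relations R M N =
     {frag_of (x \<oplus>\<^bsub>M\<^esub> x', y) - frag_of (x, y) - frag_of (x', y) | x x' y.
        x \<in> carrier M \<and> x' \<in> carrier M \<and> y \<in> carrier N} \<union>
     {frag_of (x, y \<oplus>\<^bsub>N\<^esub> y') - frag_of (x, y) - frag_of (x, y') | x y y'.
        x \<in> carrier M \<and> y \<in> carrier N \<and> y' \<in> carrier N} \<union>
     {frag_of (r \<odot>\<^bsub>M\<^esub> x, y) - frag_of (x, r \<odot>\<^bsub>N\<^esub> y) | r x y.
        r \<in> carrier R \<and> x \<in> carrier M \<and> y \<in> carrier N}"

definition tensor ::
    "('r, 'y) ring_scheme \<Rightarrow> ('r, 'm, 'z) module_scheme \<Rightarrow> ('r, 'n, 'w) module_scheme \<Rightarrow>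
     ('r, ('m \<times> 'n \<Rightarrow>\<^sub>0 int) set) module" where
  "tensor R M N =
     presented_module (carrier M \<times> carrier N) (tensor_relations R M N)
       (\<lambda>r (x, y). (r \<odot>\<^bsub>M\<^esub> x, y))"

text \<open>The \<open>S\<close>-module \<open>S \<otimes>\<^bsub>R\<^esub> N\<close> for a ring homomorphism \<open>h\<close> from \<open>R\<close> to \<open>S\<close>.\<close>

definition base_change ::
    "('r, 'y) ring_scheme \<Rightarrow> ('s, 'z) ring_scheme \<Rightarrow> ('r \<Rightarrow> 's) \<Rightarrow> ('r, 'n, 'w) module_scheme \<Rightarrow>
     ('s, ('s \<times> 'n \<Rightarrow>\<^sub>0 int) set) module" where
  "base_change R S h N =
     presented_module (carrier S \<times> carrier N)
       (tensor_relations R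
          \<lparr>carrier = carrier S, monoid.mult = monoid.mult S, one = \<one>\<^bsub>S\<^esub>, ring.zero = \<zero>\<^bsub>S\<^esub>, ring.add = ring.add S,
           module.smult = (\<lambda>r s. h r \<otimes>\<^bsub>S\<^esub> s)\<rparr> N)
       (\<lambda>s (x, y). (s \<otimes>\<^bsub>S\<^esub> x, y))"

text \<open>The class of the generator \<open>x \<otimes> y\<close> in \<open>tensor\<close> resp. \<open>base_change\<close>, whose zero is the
  subgroup of relations.\<close>

definition pure :: "('r, ('m \<times> 'n \<Rightarrow>\<^sub>0 int) set, 'z) module_scheme \<Rightarrow> 'm \<Rightarrow> 'n \<Rightarrow> ('m \<times> 'n \<Rightarrow>\<^sub>0 int) set"
  where "pure T x y = (\<lambda>c. c + frag_of (x, y)) ` \<zero>\<^bsub>T\<^esub>"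

definition tensor_map ::
    "('m \<Rightarrow> 'm') \<Rightarrow> ('n \<Rightarrow> 'n') \<Rightarrow> ('m \<times> 'n \<Rightarrow>\<^sub>0 int) set \<Rightarrow> ('m' \<times> 'n' \<Rightarrow>\<^sub>0 int) set" where
  "tensor_map f g = (`) (frag_extend (frag_of \<circ> map_prod f g))"

text \<open>
  \<open>Sym\<^sup>n M\<close>: the generator \<open>(r, [x\<^sub>1, \<dots>, x\<^sub>n])\<close> stands for \<open>r x\<^sub>1 \<cdots> x\<^sub>n\<close>.  Keeping the coefficient
  \<open>r\<close> in the generators gives \<open>Sym\<^sup>0 M = R\<close>.
\<close>

definition sym_generators ::
    "('r, 'y) ring_scheme \<Rightarrow> nat \<Rightarrow> ('r, 'm, 'z) module_scheme \<Rightarrow> ('r \<times> 'm list) set" where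
  "sym_generators R n M = carrier R \<times> {xs. length xs = n \<and> set xs \<subseteq> carrier M}"

definition sym_relations ::
    "('r, 'y) ring_scheme \<Rightarrow> nat \<Rightarrow> ('r, 'm, 'z) module_scheme \<Rightarrow> ('r \<times> 'm list \<Rightarrow>\<^sub>0 int) set" where
  "sym_relations R n M =
     {frag_of (r \<oplus>\<^bsub>R\<^esub> r', xs) - frag_of (r, xs) - frag_of (r', xs) | r r' xs.
        (r, xs) \<in> sym_generators R n M \<and> r' \<in> carrier R} \<union>
     {frag_of (r, xs[i := x \<oplus>\<^bsub>M\<^esub> y]) - frag_of (r, xs[i := x]) - frag_of (r, xs[i := y]) | r xs i x y.
        (r, xs) \<in> sym_generators R n M \<and> i < n \<and> x \<in> carrier M \<and> y \<in> carrier M} \<union>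
     {frag_of (r, xs[i := c \<odot>\<^bsub>M\<^esub> x]) - frag_of (c \<otimes>\<^bsub>R\<^esub> r, xs[i := x]) | r xs i c x.
        (r, xs) \<in> sym_generators R n M \<and> i < n \<and> c \<in> carrier R \<and> x \<in> carrier M} \<union>
     {frag_of (r, xs) - frag_of (r, ys) | r xs ys.
        (r, xs) \<in> sym_generators R n M \<and> mset ys = mset xs}"

definition sym_power ::
    "('r, 'y) ring_scheme \<Rightarrow> nat \<Rightarrow> ('r, 'm, 'z) module_scheme \<Rightarrow> ('r, ('r \<times> 'm list \<Rightarrow>\<^sub>0 int) set) module"
  where
  "sym_power R n M =
     presented_module (sym_generators R n M) (sym_relations R n M) (\<lambda>c (r, xs). (c \<otimes>\<^bsub>R\<^esub> r, xs))"

definition dual_module ::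
    "('r, 'y) ring_scheme \<Rightarrow> ('r, 'm, 'z) module_scheme \<Rightarrow> ('r, 'm \<Rightarrow> 'r) module" where
  "dual_module R M =
     \<lparr>carrier = {\<phi> \<in> carrier M \<rightarrow>\<^sub>E carrier R.
        (\<forall>x\<in>carrier M. \<forall>y\<in>carrier M. \<phi> (x \<oplus>\<^bsub>M\<^esub> y) = \<phi> x \<oplus>\<^bsub>R\<^esub> \<phi> y) \<and>
        (\<forall>r\<in>carrier R. \<forall>x\<in>carrier M. \<phi> (r \<odot>\<^bsub>M\<^esub> x) = r \<otimes>\<^bsub>R\<^esub> \<phi> x)},
      monoid.mult = undefined, one = undefined,
      ring.zero = (\<lambda>x\<in>carrier M. \<zero>\<^bsub>R\<^esub>),
      ring.add = (\<lambda>\<phi> \<psi>. \<lambda>x\<in>carrier M. \<phi> x \<oplus>\<^bsub>R\<^esub> \<psi> x),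
      module.smult = (\<lambda>r \<phi>. \<lambda>x\<in>carrier M. r \<otimes>\<^bsub>R\<^esub> \<phi> x)\<rparr>"

definition direct_sum ::
    "('r, 'm, 'z) module_scheme \<Rightarrow> ('r, 'n, 'w) module_scheme \<Rightarrow> ('r, 'm \<times> 'n) module" where
  "direct_sum M N =
     \<lparr>carrier = carrier M \<times> carrier N, monoid.mult = undefined, one = undefined,
      ring.zero = (\<zero>\<^bsub>M\<^esub>, \<zero>\<^bsub>N\<^esub>),
      ring.add = (\<lambda>(x, y) (x', y'). (x \<oplus>\<^bsub>M\<^esub> x', y \<oplus>\<^bsub>N\<^esub> y')),
      module.smult = (\<lambda>r (x, y). (r \<odot>\<^bsub>M\<^esub> x, r \<odot>\<^bsub>N\<^esub> y))\<rparr>"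


section \<open>Modules over a group of bijections\<close>

text \<open>
  A representation is a module together with an action of a group \<open>G\<close>, where \<open>G\<close> is a set of
  bijections of a type \<open>'v\<close> that is closed under composition and inverse.
\<close>

type_synonym ('r, 'm, 'v) rep = "('r, 'm) module \<times> (('v \<Rightarrow> 'v) \<Rightarrow> 'm \<Rightarrow> 'm)"

definition is_rep :: "('v \<Rightarrow> 'v) set \<Rightarrow> ('r, 'y) ring_scheme \<Rightarrow> ('r, 'm, 'v) rep \<Rightarrow> bool" where
  "is_rep G R = (\<lambda>(M, a).
     Module.module R M \<and>
     (\<forall>g\<in>G. a g \<in> carrier M \<rightarrow> carrier M \<and>
        (\<forall>x\<in>carrier M. \<forall>y\<in>carrier M. a g (x \<oplus>\<^bsub>M\<^esub> y) = a g x \<oplus>\<^bsub>M\<^esub> a g y) \<and>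
        (\<forall>r\<in>carrier R. \<forall>x\<in>carrier M. a g (r \<odot>\<^bsub>M\<^esub> x) = r \<odot>\<^bsub>M\<^esub> a g x)) \<and>
     (\<forall>x\<in>carrier M. a id x = x) \<and>
     (\<forall>g\<in>G. \<forall>h\<in>G. \<forall>x\<in>carrier M. a (g \<circ> h) x = a g (a h x)))"

definition rep_iso ::
    "('v \<Rightarrow> 'v) set \<Rightarrow> ('r, 'y) ring_scheme \<Rightarrow> ('r, 'm, 'v) rep \<Rightarrow> ('r, 'n, 'v) rep \<Rightarrow> bool" where
  "rep_iso G R = (\<lambda>(M, a) (N, b).
     is_rep G R (M, a) \<and> is_rep G R (N, b) \<and>
     (\<exists>\<phi>. bij_betw \<phi> (carrier M) (carrier N) \<and>
        (\<forall>x\<in>carrier M. \<forall>y\<in>carrier M. \<phi> (x \<oplus>\<^bsub>M\<^esub> y) = \<phi> x \<oplus>\<^bsub>N\<^esub> \<phi> y) \<and>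
        (\<forall>r\<in>carrier R. \<forall>x\<in>carrier M. \<phi> (r \<odot>\<^bsub>M\<^esub> x) = r \<odot>\<^bsub>N\<^esub> \<phi> x) \<and>
        (\<forall>g\<in>G. \<forall>x\<in>carrier M. \<phi> (a g x) = b g (\<phi> x))))"

definition rep_sum :: "('r, 'm, 'v) rep \<Rightarrow> ('r, 'n, 'v) rep \<Rightarrow> ('r, 'm \<times> 'n, 'v) rep" where
  "rep_sum = (\<lambda>(M, a) (N, b). (direct_sum M N, \<lambda>g. map_prod (a g) (b g)))"

definition rep_tensor ::
    "('r, 'y) ring_scheme \<Rightarrow> ('r, 'm, 'v) rep \<Rightarrow> ('r, 'n, 'v) rep \<Rightarrow>
     ('r, ('m \<times> 'n \<Rightarrow>\<^sub>0 int) set, 'v) rep" where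
  "rep_tensor R = (\<lambda>(M, a) (N, b). (tensor R M N, \<lambda>g. tensor_map (a g) (b g)))"

definition rep_sym ::
    "('r, 'y) ring_scheme \<Rightarrow> nat \<Rightarrow> ('r, 'm, 'v) rep \<Rightarrow> ('r, ('r \<times> 'm list \<Rightarrow>\<^sub>0 int) set, 'v) rep"
  where
  "rep_sym R n = (\<lambda>(M, a).
     (sym_power R n M, \<lambda>g. (`) (frag_extend (frag_of \<circ> map_prod id (map (a g))))))"

definition rep_dual :: "('r, 'y) ring_scheme \<Rightarrow> ('r, 'm, 'v) rep \<Rightarrow> ('r, 'm \<Rightarrow> 'r, 'v) rep" where
  "rep_dual R = (\<lambda>(M, a). (dual_module R M, \<lambda>g \<phi>. \<lambda>x\<in>carrier M. \<phi> (a (inv_into UNIV g) x)))"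


section \<open>The group \<open>SL(V)\<close> and its standard representations\<close>

definition alternating_form ::
    "('f::field \<Rightarrow> 'v::ab_group_add \<Rightarrow> 'v) \<Rightarrow> ('v \<Rightarrow> 'v \<Rightarrow> 'f) \<Rightarrow> bool" where
  "alternating_form scale \<omega> \<longleftrightarrow>
     (\<forall>x. Vector_Spaces.linear scale (*) (\<omega> x)) \<and>
     (\<forall>y. Vector_Spaces.linear scale (*) (\<lambda>x. \<omega> x y)) \<and>
     (\<forall>x. \<omega> x x = 0)"

text \<open>The determinant of an endomorphism of a plane: the scalar by which it acts on the top exterior
  power (equivalently, on alternating bilinear forms).\<close>

definition plane_det :: "('f::field \<Rightarrow> 'v::ab_group_add \<Rightarrow> 'v) \<Rightarrow> ('v \<Rightarrow> 'v) \<Rightarrow> 'f" where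
  "plane_det scale g =
     (THE c. \<forall>\<omega>. alternating_form scale \<omega> \<longrightarrow> (\<forall>x y. \<omega> (g x) (g y) = c * \<omega> x y))"

definition SL :: "('f::field \<Rightarrow> 'v::ab_group_add \<Rightarrow> 'v) \<Rightarrow> ('v \<Rightarrow> 'v) set" where
  "SL scale = {g. Vector_Spaces.linear scale scale g \<and> plane_det scale g = 1}"

definition line_stabilizer :: "('f::field \<Rightarrow> 'v::ab_group_add \<Rightarrow> 'v) \<Rightarrow> 'v set \<Rightarrow> ('v \<Rightarrow> 'v) set" where
  "line_stabilizer scale L = {g \<in> SL scale. g ` L = L}"

text \<open>A subspace \<open>W\<close> of \<open>V\<close> as a representation of any group of automorphisms of \<open>V\<close> preserving it.\<close>

definition sub_rep :: "('f \<Rightarrow> 'v::ab_group_add \<Rightarrow> 'v) \<Rightarrow> 'v set \<Rightarrow> ('f, 'v, 'v) rep" where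
  "sub_rep scale W =
     (\<lparr>carrier = W, monoid.mult = undefined, one = undefined, ring.zero = 0, ring.add = (+), module.smult = scale\<rparr>, \<lambda>g. g)"


section \<open>Projective spectra and twisting sheaves\<close>

text \<open>
  A graded domain with degrees in the group \<open>'d\<close>: \<open>degree_part\<close> gives the homogeneous parts,
  \<open>irrelevant_gens\<close> a set of generating sets of irrelevant ideals.  For the homogeneous coordinate
  ring of a projective space there is one irrelevant ideal; for a product of two projective spaces
  (degrees in \<open>\<int> \<times> \<int>\<close>) there is one for each factor.
\<close>

record ('a, 'd) graded_ring = "'a ring" +
  degree_part :: "'d \<Rightarrow> 'a set"
  irrelevant_gens :: "'a set set"

definition homogeneous :: "('a, 'd, 'z) graded_ring_scheme \<Rightarrow> 'a set" where
  "homogeneous R = (\<Union>d. degree_part R d)"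

definition Proj :: "('a, 'd, 'z) graded_ring_scheme \<Rightarrow> 'a set set" where
  "Proj R = {p. primeideal p R \<and> p = genideal R (p \<inter> homogeneous R) \<and>
                (\<forall>S\<in>irrelevant_gens R. \<not> S \<subseteq> p)}"

definition zariski_open :: "('a, 'd, 'z) graded_ring_scheme \<Rightarrow> 'a set set \<Rightarrow> bool" where
  "zariski_open R U \<longleftrightarrow> (\<exists>T\<subseteq>homogeneous R. U = {p \<in> Proj R. \<not> T \<subseteq> p})"

definition nbhd :: "('a, 'd, 'z) graded_ring_scheme \<Rightarrow> 'a set \<Rightarrow> 'a set set \<Rightarrow> bool" where
  "nbhd R p U \<longleftrightarrow> zariski_open R U \<and> p \<in> U"

text \<open>Fractions over the domain \<open>R\<close> as equivalence classes of pairs.\<close>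

definition fraction :: "('a, 'z) ring_scheme \<Rightarrow> 'a \<Rightarrow> 'a \<Rightarrow> ('a \<times> 'a) set" where
  "fraction R a b =
     {(c, e). c \<in> carrier R \<and> e \<in> carrier R \<and> e \<noteq> \<zero>\<^bsub>R\<^esub> \<and> a \<otimes>\<^bsub>R\<^esub> e = c \<otimes>\<^bsub>R\<^esub> b}"

definition fraction_add ::
    "('a, 'z) ring_scheme \<Rightarrow> ('a \<times> 'a) set \<Rightarrow> ('a \<times> 'a) set \<Rightarrow> ('a \<times> 'a) set" where
  "fraction_add R A B =
     (\<Union>(a, b)\<in>A. \<Union>(c, e)\<in>B. fraction R (a \<otimes>\<^bsub>R\<^esub> e \<oplus>\<^bsub>R\<^esub> c \<otimes>\<^bsub>R\<^esub> b) (b \<otimes>\<^bsub>R\<^esub> e))"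

definition fraction_mult ::
    "('a, 'z) ring_scheme \<Rightarrow> ('a \<times> 'a) set \<Rightarrow> ('a \<times> 'a) set \<Rightarrow> ('a \<times> 'a) set" where
  "fraction_mult R A B = (\<Union>(a, b)\<in>A. \<Union>(c, e)\<in>B. fraction R (a \<otimes>\<^bsub>R\<^esub> c) (b \<otimes>\<^bsub>R\<^esub> e))"

text \<open>
  The stalk at \<open>p\<close> of the twisting sheaf \<open>\<O>(d)\<close>: the homogeneous fractions of degree \<open>d\<close> whose
  denominator is not in \<open>p\<close>.  For \<open>d = 0\<close> this is the local ring, acting on all the others.
\<close>

definition twist_stalk ::
    "('a, 'd::ab_group_add, 'z) graded_ring_scheme \<Rightarrow> 'd \<Rightarrow> 'a set \<Rightarrow>
     (('a \<times> 'a) set, ('a \<times> 'a) set) module" where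
  "twist_stalk R d p =
     \<lparr>carrier = {fraction R a b | a b m n.
        a \<in> degree_part R m \<and> b \<in> degree_part R n \<and> m - n = d \<and> b \<notin> p},
      monoid.mult = fraction_mult R, one = fraction R \<one>\<^bsub>R\<^esub> \<one>\<^bsub>R\<^esub>,
      ring.zero = fraction R \<zero>\<^bsub>R\<^esub> \<one>\<^bsub>R\<^esub>, ring.add = fraction_add R,
      module.smult = fraction_mult R\<rparr>"

abbreviation local_ring ::
    "('a, 'd::ab_group_add, 'z) graded_ring_scheme \<Rightarrow> 'a set \<Rightarrow> (('a \<times> 'a) set, ('a \<times> 'a) set) module" where
  "local_ring R \<equiv> twist_stalk R 0"

definition local_max ::
    "('a, 'd::ab_group_add, 'z) graded_ring_scheme \<Rightarrow> 'a set \<Rightarrow> ('a \<times> 'a) set set" where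
  "local_max R p =
     {fraction R a b | a b m. a \<in> degree_part R m \<and> b \<in> degree_part R m \<and> a \<in> p \<and> b \<notin> p}"

text \<open>Sections of \<open>\<O>(d)\<close> over \<open>U\<close>: families of elements of the stalks that are locally given by one
  fraction.\<close>

definition twist_sections ::
    "('a, 'd::ab_group_add, 'z) graded_ring_scheme \<Rightarrow> 'd \<Rightarrow> 'a set set \<Rightarrow> ('a set \<Rightarrow> ('a \<times> 'a) set) set"
  where
  "twist_sections R d U =
     {s \<in> extensional U. \<forall>p\<in>U. \<exists>W a b m n. nbhd R p W \<and> W \<subseteq> U \<and>
        a \<in> degree_part R m \<and> b \<in> degree_part R n \<and> m - n = d \<and>
        (\<forall>r\<in>W. b \<notin> r \<and> s r = fraction R a b)}"


section \<open>Stalks and fibers of sheaves of modules\<close>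

text \<open>
  Let \<open>M\<close> be a sheaf of modules on \<open>Proj R\<close>, given by the \<open>twist_sections R 0 U\<close>-module \<open>M U\<close> for
  open \<open>U\<close> and by the restriction maps \<open>res W\<close> to open sets \<open>W\<close>.  Its stalk is considered as a
  module over a ground ring \<open>'c\<close>, which acts through constant sections (\<open>const\<close> embeds \<open>'c\<close> into \<open>R\<close>).
\<close>

definition germ ::
    "('a, 'd, 'z) graded_ring_scheme \<Rightarrow> ('a set set \<Rightarrow> ('t, 's) module) \<Rightarrow> ('a set set \<Rightarrow> 's \<Rightarrow> 's) \<Rightarrow>
     'a set \<Rightarrow> 'a set set \<Rightarrow> 's \<Rightarrow> ('a set set \<times> 's) set" where
  "germ R M res p U s =
     {(U', s'). nbhd R p U' \<and> s' \<in> carrier (M U') \<and>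
        (\<exists>W. nbhd R p W \<and> W \<subseteq> U \<inter> U' \<and> res W s = res W s')}"

definition const_section ::
    "('a, 'd, 'z) graded_ring_scheme \<Rightarrow> ('c \<Rightarrow> 'a) \<Rightarrow> 'a set set \<Rightarrow> 'c \<Rightarrow> ('a set \<Rightarrow> ('a \<times> 'a) set)" where
  "const_section R const U c = (\<lambda>p\<in>U. fraction R (const c) \<one>\<^bsub>R\<^esub>)"

definition sheaf_stalk ::
    "('a, 'd, 'z) graded_ring_scheme \<Rightarrow> ('c \<Rightarrow> 'a) \<Rightarrow>
     ('a set set \<Rightarrow> ('a set \<Rightarrow> ('a \<times> 'a) set, 's) module) \<Rightarrow> ('a set set \<Rightarrow> 's \<Rightarrow> 's) \<Rightarrow>
     'a set \<Rightarrow> ('c, ('a set set \<times> 's) set) module" where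
  "sheaf_stalk R const M res p =
     \<lparr>carrier = {germ R M res p U s | U s. nbhd R p U \<and> s \<in> carrier (M U)},
      monoid.mult = undefined, one = undefined,
      ring.zero = germ R M res p (Proj R) \<zero>\<^bsub>M (Proj R)\<^esub>,
      ring.add = (\<lambda>A B. \<Union>(U, s)\<in>A. \<Union>(U', s')\<in>B.
        germ R M res p (U \<inter> U') (res (U \<inter> U') s \<oplus>\<^bsub>M (U \<inter> U')\<^esub> res (U \<inter> U') s')),
      module.smult = (\<lambda>c A. \<Union>(U, s)\<in>A. germ R M res p U (const_section R const U c \<odot>\<^bsub>M U\<^esub> s))\<rparr>"

text \<open>The fiber \<open>M\<^sub>p / \<mm>\<^sub>p M\<^sub>p\<close>.\<close>

definition sheaf_fiber ::
    "('a, 'd::ab_group_add, 'z) graded_ring_scheme \<Rightarrow> ('c \<Rightarrow> 'a) \<Rightarrow>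
     ('a set set \<Rightarrow> ('a set \<Rightarrow> ('a \<times> 'a) set, 's) module) \<Rightarrow> ('a set set \<Rightarrow> 's \<Rightarrow> 's) \<Rightarrow>
     'a set \<Rightarrow> ('c, ('a set set \<times> 's) set set) module" where
  "sheaf_fiber R const M res p =
     quot_module (sheaf_stalk R const M res p)
       (generate (add_monoid (sheaf_stalk R const M res p))
          {germ R M res p U (t \<odot>\<^bsub>M U\<^esub> s) | U t s.
             nbhd R p U \<and> t \<in> twist_sections R 0 U \<and> t p \<in> local_max R p \<and> s \<in> carrier (M U)})"


section \<open>The projective line of a plane and its square\<close>

inductive_set poly_functions :: "('f::field \<Rightarrow> 'v::ab_group_add \<Rightarrow> 'v) \<Rightarrow> ('v \<Rightarrow> 'f) set"
  for scale where
  const: "(\<lambda>_. c) \<in> poly_functions scale"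
| linear: "Vector_Spaces.linear scale (*) l \<Longrightarrow> l \<in> poly_functions scale"
| add: "f \<in> poly_functions scale \<Longrightarrow> g \<in> poly_functions scale \<Longrightarrow> (\<lambda>x. f x + g x) \<in> poly_functions scale"
| mult: "f \<in> poly_functions scale \<Longrightarrow> g \<in> poly_functions scale \<Longrightarrow> (\<lambda>x. f x * g x) \<in> poly_functions scale"

definition pair_scale :: "('f \<Rightarrow> 'v \<Rightarrow> 'v) \<Rightarrow> 'f \<Rightarrow> 'v \<times> 'v \<Rightarrow> 'v \<times> 'v" where
  "pair_scale scale c = map_prod (scale c) (scale c)"

text \<open>
  The homogeneous coordinate ring \<open>Sym(V\<^sup>*)\<close> of the projective line \<open>\<bbbP>\<close> of lines in \<open>V\<close>, realised as
  the ring of polynomial functions on \<open>V\<close> (the ground field being infinite).  Thus the fiber of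
  \<open>\<O>(d)\<close> at a line consists of the functions on the line that are homogeneous of degree \<open>d\<close>.
\<close>

definition line_ring ::
    "('f::field_char_0 \<Rightarrow> 'v::ab_group_add \<Rightarrow> 'v) \<Rightarrow> ('v \<Rightarrow> 'f, int) graded_ring" where
  "line_ring scale =
     \<lparr>carrier = poly_functions scale, monoid.mult = (\<lambda>f g x. f x * g x), one = (\<lambda>_. 1),
      ring.zero = (\<lambda>_. 0), ring.add = (\<lambda>f g x. f x + g x),
      degree_part = (\<lambda>d. {f \<in> poly_functions scale.
        \<exists>n. d = int n \<and> (\<forall>c x. f (scale c x) = c ^ n * f x)}),
      irrelevant_gens = {{l. Vector_Spaces.linear scale (*) l}}\<rparr>"

text \<open>The bihomogeneous coordinate ring \<open>Sym(V\<^sup>*) \<otimes> Sym(V\<^sup>*)\<close> of \<open>\<bbbP> \<times> \<bbbP>\<close>: polynomial functions on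
  \<open>V \<times> V\<close>.  The points of the scheme \<open>\<bbbP> \<times> \<bbbP>\<close> are the bihomogeneous primes that contain neither of
  the two irrelevant ideals.\<close>

definition square_ring ::
    "('f::field_char_0 \<Rightarrow> 'v::ab_group_add \<Rightarrow> 'v) \<Rightarrow> ('v \<times> 'v \<Rightarrow> 'f, int \<times> int) graded_ring" where
  "square_ring scale =
     \<lparr>carrier = poly_functions (pair_scale scale), monoid.mult = (\<lambda>f g x. f x * g x), one = (\<lambda>_. 1),
      ring.zero = (\<lambda>_. 0), ring.add = (\<lambda>f g x. f x + g x),
      degree_part = (\<lambda>d. {f \<in> poly_functions (pair_scale scale).
        \<exists>m n. d = (int m, int n) \<and>
          (\<forall>c x y. f (scale c x, y) = c ^ m * f (x, y)) \<and>
          (\<forall>c x y. f (x, scale c y) = c ^ n * f (x, y))}),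
      irrelevant_gens =
        {(\<lambda>l. l \<circ> fst) ` {l. Vector_Spaces.linear scale (*) l},
         (\<lambda>l. l \<circ> snd) ` {l. Vector_Spaces.linear scale (*) l}}\<rparr>"

text \<open>The point of \<open>\<bbbP>\<close> given by a line \<open>L\<close>.\<close>

definition line_point :: "('f::field_char_0 \<Rightarrow> 'v::ab_group_add \<Rightarrow> 'v) \<Rightarrow> 'v set \<Rightarrow> ('v \<Rightarrow> 'f) set" where
  "line_point scale L = {f \<in> poly_functions scale. \<forall>x\<in>L. f x = 0}"

text \<open>The second projection \<open>q\<close> and its comorphisms on the local rings.\<close>

definition proj2 ::
    "('f::field_char_0 \<Rightarrow> 'v::ab_group_add \<Rightarrow> 'v) \<Rightarrow> ('v \<times> 'v \<Rightarrow> 'f) set \<Rightarrow> ('v \<Rightarrow> 'f) set" where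
  "proj2 scale P = {f \<in> poly_functions scale. f \<circ> snd \<in> P}"

definition proj2_preimage ::
    "('f::field_char_0 \<Rightarrow> 'v::ab_group_add \<Rightarrow> 'v) \<Rightarrow> ('v \<Rightarrow> 'f) set set \<Rightarrow> ('v \<times> 'v \<Rightarrow> 'f) set set" where
  "proj2_preimage scale U = {P \<in> Proj (square_ring scale). proj2 scale P \<in> U}"

definition proj2_pullback ::
    "('f::field_char_0 \<Rightarrow> 'v::ab_group_add \<Rightarrow> 'v) \<Rightarrow> (('v \<Rightarrow> 'f) \<times> ('v \<Rightarrow> 'f)) set \<Rightarrow>
     (('v \<times> 'v \<Rightarrow> 'f) \<times> ('v \<times> 'v \<Rightarrow> 'f)) set" where
  "proj2_pullback scale A = (\<Union>(a, b)\<in>A. fraction (square_ring scale) (a \<circ> snd) (b \<circ> snd))"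

text \<open>The stalk at \<open>P\<close> of the ideal sheaf of the diagonal, i.e. of the sheaf attached to the
  bihomogeneous ideal of the polynomials vanishing on the diagonal.  (Away from the diagonal this is
  the whole local ring: numerator and denominator may both vanish on the diagonal.)\<close>

definition diagonal_stalk ::
    "('f::field_char_0 \<Rightarrow> 'v::ab_group_add \<Rightarrow> 'v) \<Rightarrow> ('v \<times> 'v \<Rightarrow> 'f) set \<Rightarrow>
     (('v \<times> 'v \<Rightarrow> 'f) \<times> ('v \<times> 'v \<Rightarrow> 'f)) set set" where
  "diagonal_stalk scale P =
     {fraction (square_ring scale) a b | a b m.
        a \<in> degree_part (square_ring scale) m \<and> b \<in> degree_part (square_ring scale) m \<and>
        b \<notin> P \<and> (\<forall>x. a (x, x) = 0)}"


section \<open>Sheaves of jets\<close>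

definition diagonal_power ::
    "('f::field_char_0 \<Rightarrow> 'v::ab_group_add \<Rightarrow> 'v) \<Rightarrow> nat \<Rightarrow> ('v \<times> 'v \<Rightarrow> 'f) set \<Rightarrow>
     (('v \<times> 'v \<Rightarrow> 'f) \<times> ('v \<times> 'v \<Rightarrow> 'f)) set set" where
  "diagonal_power scale j P =
     (ideal_prod (local_ring (square_ring scale) P) (diagonal_stalk scale P) ^^ j)
       (carrier (local_ring (square_ring scale) P))"

text \<open>The stalks at \<open>P\<close> of \<open>\<O>\<^bsub>\<Delta>\<^sup>k\<^esub> = \<O> / I\<^bsup>k+1\<^esup>\<close>, of \<open>q\<^sup>*\<O>(d)\<close> and of their tensor product.\<close>

definition thick_stalk where
  "thick_stalk scale k P =
     quot_module (local_ring (square_ring scale) P) (diagonal_power scale (k + 1) P)"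

definition pullback_stalk where
  "pullback_stalk scale d P =
     base_change (local_ring (line_ring scale) (proj2 scale P)) (local_ring (square_ring scale) P)
       (proj2_pullback scale) (twist_stalk (line_ring scale) d (proj2 scale P))"

definition jet_stalk where
  "jet_stalk scale k d P =
     tensor (local_ring (square_ring scale) P) (thick_stalk scale k P) (pullback_stalk scale d P)"

type_synonym ('f, 'v) jet_germ =
  "(((('v \<times> 'v \<Rightarrow> 'f) \<times> ('v \<times> 'v \<Rightarrow> 'f)) set set \<times>
     ((('v \<times> 'v \<Rightarrow> 'f) \<times> ('v \<times> 'v \<Rightarrow> 'f)) set \<times> (('v \<Rightarrow> 'f) \<times> ('v \<Rightarrow> 'f)) set \<Rightarrow>\<^sub>0 int) set) \<Rightarrow>\<^sub>0 int) set"

text \<open>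
  Sections of the sheaf \<open>\<O>\<^bsub>\<Delta>\<^sup>k\<^esub> \<otimes> q\<^sup>*\<O>(d)\<close> over an open subset of \<open>\<bbbP> \<times> \<bbbP>\<close>: families of elements of
  the stalks that are locally of the form \<open>\<Sum>\<^sub>i [f\<^sub>i] \<otimes> (h\<^sub>i \<otimes> s\<^sub>i)\<close> with \<open>f\<^sub>i\<close>, \<open>h\<^sub>i\<close> sections of \<open>\<O>\<close> on
  some \<open>W\<close> and \<open>s\<^sub>i\<close> sections of \<open>\<O>(d)\<close> on some open set containing the image of \<open>W\<close>.
\<close>

definition jet_sections ::
    "('f::field_char_0 \<Rightarrow> 'v::ab_group_add \<Rightarrow> 'v) \<Rightarrow> nat \<Rightarrow> int \<Rightarrow> ('v \<times> 'v \<Rightarrow> 'f) set set \<Rightarrow>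
     (('v \<times> 'v \<Rightarrow> 'f) set \<Rightarrow> ('f, 'v) jet_germ) set" where
  "jet_sections scale k d Z =
     {\<sigma> \<in> extensional Z. \<forall>P\<in>Z. \<exists>W U (n::nat) f h s.
        nbhd (square_ring scale) P W \<and> W \<subseteq> Z \<and>
        zariski_open (line_ring scale) U \<and> W \<subseteq> proj2_preimage scale U \<and>
        (\<forall>i<n. f i \<in> twist_sections (square_ring scale) 0 W \<and>
               h i \<in> twist_sections (square_ring scale) 0 W \<and>
               s i \<in> twist_sections (line_ring scale) d U) \<and>
        (\<forall>Q\<in>W. \<sigma> Q =
           (\<Oplus>\<^bsub>jet_stalk scale k d Q\<^esub>i\<in>{..<n}.
              pure (jet_stalk scale k d Q)
                (diagonal_power scale (k + 1) Q +>\<^bsub>local_ring (square_ring scale) Q\<^esub> f i Q)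
                (pure (pullback_stalk scale d Q) (h i Q) (s i (proj2 scale Q)))))}"

text \<open>
  The sheaf \<open>\<P>\<^sup>k(\<O>(d))\<^sup>R = q\<^sub>*(\<O>\<^bsub>\<Delta>\<^sup>k\<^esub> \<otimes> q\<^sup>*\<O>(d))\<close> of jets with its right \<open>\<O>\<close>-module structure, and its
  restriction maps.
\<close>

definition right_jets ::
    "('f::field_char_0 \<Rightarrow> 'v::ab_group_add \<Rightarrow> 'v) \<Rightarrow> nat \<Rightarrow> int \<Rightarrow> ('v \<Rightarrow> 'f) set set \<Rightarrow>
     (('v \<Rightarrow> 'f) set \<Rightarrow> (('v \<Rightarrow> 'f) \<times> ('v \<Rightarrow> 'f)) set,
      ('v \<times> 'v \<Rightarrow> 'f) set \<Rightarrow> ('f, 'v) jet_germ) module" where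
  "right_jets scale k d U =
     \<lparr>carrier = jet_sections scale k d (proj2_preimage scale U), monoid.mult = undefined, one = undefined,
      ring.zero = (\<lambda>P\<in>proj2_preimage scale U. \<zero>\<^bsub>jet_stalk scale k d P\<^esub>),
      ring.add = (\<lambda>\<sigma> \<tau>. \<lambda>P\<in>proj2_preimage scale U. \<sigma> P \<oplus>\<^bsub>jet_stalk scale k d P\<^esub> \<tau> P),
      module.smult = (\<lambda>t \<sigma>. \<lambda>P\<in>proj2_preimage scale U.
        proj2_pullback scale (t (proj2 scale P)) \<odot>\<^bsub>jet_stalk scale k d P\<^esub> \<sigma> P)\<rparr>"

definition right_jets_res where
  "right_jets_res scale U \<sigma> = restrict \<sigma> (proj2_preimage scale U)"


section \<open>The linearization\<close>

text \<open>An automorphism \<open>g\<close> of \<open>V\<close> acts on functions by \<open>f \<mapsto> f \<circ> g\<^sup>-\<^sup>1\<close>, on points (homogeneous primes)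
  by taking images and diagonally on everything attached to \<open>V \<times> V\<close>.\<close>

definition translate :: "('x \<Rightarrow> 'x) \<Rightarrow> ('x \<Rightarrow> 'f) \<Rightarrow> ('x \<Rightarrow> 'f)" where
  "translate g f = f \<circ> inv_into UNIV g"

definition point_act :: "('x \<Rightarrow> 'x) \<Rightarrow> ('x \<Rightarrow> 'f) set \<Rightarrow> ('x \<Rightarrow> 'f) set" where
  "point_act g = (`) (translate g)"

definition fraction_act ::
    "('x \<Rightarrow> 'x) \<Rightarrow> (('x \<Rightarrow> 'f) \<times> ('x \<Rightarrow> 'f)) set \<Rightarrow> (('x \<Rightarrow> 'f) \<times> ('x \<Rightarrow> 'f)) set" where
  "fraction_act g = (`) (map_prod (translate g) (translate g))"

definition jet_act :: "('v \<Rightarrow> 'v) \<Rightarrow> ('f, 'v) jet_germ \<Rightarrow> ('f, 'v) jet_germ" where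
  "jet_act g =
     tensor_map ((`) (fraction_act (map_prod g g)))
       (tensor_map (fraction_act (map_prod g g)) (fraction_act g))"

text \<open>A section \<open>\<sigma>\<close> of the jets over \<open>U\<close> is sent to the section
  \<open>P \<mapsto> g (\<sigma> (g\<^sup>-\<^sup>1 P))\<close> over \<open>g U\<close>.\<close>

definition jet_section_act where
  "jet_section_act scale g = (\<lambda>(U, \<sigma>).
     (point_act g ` U,
      \<lambda>P\<in>proj2_preimage scale (point_act g ` U).
        jet_act g (\<sigma> (point_act (map_prod (inv_into UNIV g) (inv_into UNIV g)) P))))"

text \<open>The fiber of \<open>\<P>\<^sup>k(\<O>(d))\<^sup>R\<close> at the point given by \<open>L\<close>, with the action of the stabilizer of \<open>L\<close>;
  its elements are sets of germs.\<close>

definition jet_fiber where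
  "jet_fiber scale k d L =
     (sheaf_fiber (line_ring scale) (\<lambda>c _. c) (right_jets scale k d) (right_jets_res scale)
        (line_point scale L),
      \<lambda>g. (`) ((`) (jet_section_act scale g)))"

end

theory Submission
  imports Defs
begin

text \<open>
  In the coordinates of a basis \<open>u \<in> L\<close>, \<open>v\<close> of \<open>V\<close>, all modules in question are identified with spaces of
  truncated power series over \<open>F\<close>, and only the resulting actions have to be compared.

  For the jets, expanding along the first factor at the fixed point sends a germ \<open>f \<otimes> x\<^sup>d\<close> at \<open>(e, e)\<close> to
  its Taylor polynomial \<open>f(t, 0) mod t\<^bsup>k+1\<^esup>\<close>: the ideal of the diagonal becomes \<open>(t)\<close> in the fiber, and
  because \<open>O / I\<^bsup>k+1\<^esup>\<close> is supported on the diagonal, a germ at \<open>(e, e)\<close> extends over \<open>q\<^sup>-\<^sup>1(U)\<close> for some \<open>U\<close>.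
  An element \<open>g\<close> of \<open>P\<close> with \<open>g u = a u\<close> then acts by the substitution of a fractional linear series and the
  factor \<open>a\<^bsup>-d\<^esup>\<close>. The constants split off, and on the multiples of \<open>t\<close> a rescaling by binomial
  coefficients (characteristic zero) turns the substitution into \<open>Sym\<^bsup>k-1\<^esup> V\<close> twisted by the character
  \<open>a\<^bsup>k+1-d\<^esup>\<close>.
\<close>

text \<open>The modules of the statement are cosets of words and sets of germs, with no preferred
  representatives. No map between them is built directly: an isomorphism arises from two charts into
  the power series that have the same image and the same operators. Two obstacles shape the
  geometric half. The direct image along \<open>q\<close> asks for sections over the preimage of a
  neighbourhood of \<open>e\<close>, which reaches far from the diagonal, while an expansion sees
  only \<open>(e, e)\<close>; vanishing off the diagonal bridges this gap, for the existence of
  sections as well as for their equality. Over such a preimage the form \<open>x\<close> may vanish,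
  and under \<open>P\<close> it changes, so \<open>O(d)\<close> is trivialized by powers of an
  arbitrary linear form. The exponent \<open>k + 1 - d\<close> is a count of weights:
  \<open>x ^ d\<close> has weight \<open>- d\<close> at \<open>e\<close>, the coordinate
  \<open>t\<close> has weight 2, and \<open>t ^ (j + 1)\<close> is matched with
  \<open>u ^ j v ^ (n - j)\<close> for \<open>n = k - 1\<close>, of weight \<open>2 j - n\<close>.
  The difference \<open>2 (j + 1) - (2 j - n) = k + 1\<close> is the same for all \<open>j\<close>,
  as a twist by a character requires.\<close>

type_synonym ('f, 'v) sqfrac = "(('v \<times> 'v \<Rightarrow> 'f) \<times> ('v \<times> 'v \<Rightarrow> 'f)) set"
abbreviation "ground \<equiv> ring_of_type_algebra"
abbreviation "supp \<equiv> Poly_Mapping.keys"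
abbreviation "scalars \<equiv> range fps_const"
abbreviation "gen_map m \<equiv> frag_extend (frag_of \<circ> m)"

lemma ring_of_type_algebra_simps [simp]:
  "carrier ground = UNIV"
  "x \<otimes>\<^bsub>ground\<^esub> y = x * y"
  "x \<oplus>\<^bsub>ground\<^esub> y = x + y"
  "\<zero>\<^bsub>ground\<^esub> = 0"
  "\<one>\<^bsub>ground\<^esub> = 1"
  by (simp_all add: ring_of_type_algebra_def)

section \<open>Linear models in power series\<close>

text \<open>Closure under the operations is part of the notion: the module axioms of
  \<open>M\<close> are afterwards pulled back from the power series along the injection.\<close>

definition fps_lin_iso :: "('f::field, 'm, 'z) module_scheme \<Rightarrow> ('m \<Rightarrow> 'f fps) \<Rightarrow> 'f fps set \<Rightarrow> bool" where
  "fps_lin_iso M \<Phi> W \<longleftrightarrow>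
     bij_betw \<Phi> (carrier M) W \<and> \<zero>\<^bsub>M\<^esub> \<in> carrier M \<and> \<Phi> \<zero>\<^bsub>M\<^esub> = 0 \<and>
     (\<forall>x\<in>carrier M. \<forall>y\<in>carrier M. x \<oplus>\<^bsub>M\<^esub> y \<in> carrier M \<and> \<Phi> (x \<oplus>\<^bsub>M\<^esub> y) = \<Phi> x + \<Phi> y) \<and>
     (\<forall>c. \<forall>x\<in>carrier M. c \<odot>\<^bsub>M\<^esub> x \<in> carrier M \<and> \<Phi> (c \<odot>\<^bsub>M\<^esub> x) = fps_const c * \<Phi> x)"

lemma fps_lin_isoD:
  assumes "fps_lin_iso M \<Phi> W"
  shows "bij_betw \<Phi> (carrier M) W" "inj_on \<Phi> (carrier M)" "\<Phi> ` carrier M = W"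
    "\<zero>\<^bsub>M\<^esub> \<in> carrier M" "\<Phi> \<zero>\<^bsub>M\<^esub> = 0"
    "\<And>x y. x \<in> carrier M \<Longrightarrow> y \<in> carrier M \<Longrightarrow> x \<oplus>\<^bsub>M\<^esub> y \<in> carrier M"
    "\<And>x y. x \<in> carrier M \<Longrightarrow> y \<in> carrier M \<Longrightarrow> \<Phi> (x \<oplus>\<^bsub>M\<^esub> y) = \<Phi> x + \<Phi> y"
    "\<And>c x. x \<in> carrier M \<Longrightarrow> c \<odot>\<^bsub>M\<^esub> x \<in> carrier M"
    "\<And>c x. x \<in> carrier M \<Longrightarrow> \<Phi> (c \<odot>\<^bsub>M\<^esub> x) = fps_const c * \<Phi> x"
  using assms by (auto simp: fps_lin_iso_def bij_betw_def)

text \<open>The axioms are identities and can be checked after the injective map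
  \<open>\<Phi>\<close>; the one existence claim, a negative of \<open>x\<close>, is met by the
  multiple of \<open>x\<close> with -1.\<close>

lemma fps_lin_iso_module:
  fixes M :: "('f::field, 'm, 'z) module_scheme"
  assumes "fps_lin_iso M \<Phi> W"
  shows "Module.module (ground :: 'f ring) M"
proof -
  note D = fps_lin_isoD[OF assms]
  have inj: "x = y" if "\<Phi> x = \<Phi> y" "x \<in> carrier M" "y \<in> carrier M" for x y using D(2) that by (auto simp: inj_on_def)
  have "\<exists>y\<in>carrier M. y \<oplus>\<^bsub>M\<^esub> x = \<zero>\<^bsub>M\<^esub>" if "x \<in> carrier M" for x
  proof (rule bexI[of _ "(-1) \<odot>\<^bsub>M\<^esub> x"])
    have "fps_const (- 1) * \<Phi> x + \<Phi> x = 0" by (metis fps_const_neg fps_const_1_eq_1 mult_minus1 add.left_inverse)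
    then show "(-1) \<odot>\<^bsub>M\<^esub> x \<oplus>\<^bsub>M\<^esub> x = \<zero>\<^bsub>M\<^esub>" using that by (intro inj) (simp_all add: D)
  qed (simp add: D that)
  then have "abelian_group M" by (intro abelian_groupI inj) (auto simp: D algebra_simps intro: inj)
  moreover have "cring (ground :: 'f ring)" by (rule cring_from_type_algebra)
  ultimately show ?thesis by (intro moduleI inj)
      (auto simp: D algebra_simps fps_const_add[symmetric] fps_const_mult[symmetric]
        simp del: fps_const_add fps_const_mult intro!: inj)
qed

text \<open>The representation laws for the operators on \<open>W\<close> alone. Stability of
  \<open>W\<close> under \<open>\<beta> g\<close> is not recorded here: it comes from a model, where
  \<open>\<beta> g (\<Phi> x)\<close> is again a value of \<open>\<Phi>\<close>.\<close>

definition lin_act :: "('v \<Rightarrow> 'v) set \<Rightarrow> 'f::field fps set \<Rightarrow> (('v \<Rightarrow> 'v) \<Rightarrow> 'f fps \<Rightarrow> 'f fps) \<Rightarrow> bool" where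
  "lin_act G W \<beta> \<longleftrightarrow>
     (\<forall>g\<in>G. (\<forall>w\<in>W. \<forall>w'\<in>W. \<beta> g (w + w') = \<beta> g w + \<beta> g w') \<and>
             (\<forall>c. \<forall>w\<in>W. \<beta> g (fps_const c * w) = fps_const c * \<beta> g w)) \<and>
     (\<forall>w\<in>W. \<beta> id w = w) \<and>
     (\<forall>g\<in>G. \<forall>h\<in>G. \<forall>w\<in>W. \<beta> (g \<circ> h) w = \<beta> g (\<beta> h w))"

definition fps_model ::
  "('v \<Rightarrow> 'v) set \<Rightarrow> ('f::field, 'm, 'v) rep \<Rightarrow> ('m \<Rightarrow> 'f fps) \<Rightarrow> 'f fps set \<Rightarrow>
   (('v \<Rightarrow> 'v) \<Rightarrow> 'f fps \<Rightarrow> 'f fps) \<Rightarrow> bool" where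
  "fps_model G = (\<lambda>(M, a) \<Phi> W \<beta>. fps_lin_iso M \<Phi> W \<and>
     (\<forall>g\<in>G. \<forall>x\<in>carrier M. a g x \<in> carrier M \<and> \<Phi> (a g x) = \<beta> g (\<Phi> x)))"

definition trans_group :: "('v \<Rightarrow> 'v) set \<Rightarrow> bool" where
  "trans_group G \<longleftrightarrow> id \<in> G \<and> (\<forall>g\<in>G. \<forall>h\<in>G. g \<circ> h \<in> G) \<and>
     (\<forall>g\<in>G. \<exists>h\<in>G. g \<circ> h = id \<and> h \<circ> g = id)"

lemma fps_model_is_rep:
  assumes "fps_model G (M, a) \<Phi> W \<beta>" and "lin_act G W \<beta>" and "trans_group G"
  shows "is_rep G ground (M, a)"
proof -
  have li: "fps_lin_iso M \<Phi> W"
    and a: "\<And>g x. g \<in> G \<Longrightarrow> x \<in> carrier M \<Longrightarrow> a g x \<in> carrier M"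
      "\<And>g x. g \<in> G \<Longrightarrow> x \<in> carrier M \<Longrightarrow> \<Phi> (a g x) = \<beta> g (\<Phi> x)"
    using assms(1) by (auto simp: fps_model_def)
  note D = fps_lin_isoD[OF li]
  have inj: "x = y" if "\<Phi> x = \<Phi> y" "x \<in> carrier M" "y \<in> carrier M" for x y using D(2) that by (auto simp: inj_on_def)
  have W: "\<Phi> x \<in> W" if "x \<in> carrier M" for x using D(3) that by auto
  have G: "id \<in> G" "\<And>g h. g \<in> G \<Longrightarrow> h \<in> G \<Longrightarrow> g \<circ> h \<in> G"
    using assms(3) by (auto simp: trans_group_def)
  show ?thesis using fps_lin_iso_module[OF li] assms(2) by (auto simp: is_rep_def lin_act_def a D W G intro!: inj)
qed

text \<open>Go forward along one chart and back along the other. The whole theorem is reduced to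
  this by finding \<open>polys_upto k\<close> with the operators \<open>jet_model_act k\<close> on
  both sides.\<close>

lemma rep_iso_of_models:
  assumes A: "fps_model G (M, a) \<Phi> W \<beta>" and B: "fps_model G (N, b) \<Psi> W \<beta>"
    and l: "lin_act G W \<beta>" and G: "trans_group G"
  shows "rep_iso G ground (M, a) (N, b)"
proof -
  have li: "fps_lin_iso M \<Phi> W" "fps_lin_iso N \<Psi> W"
    and a: "\<And>g x. g \<in> G \<Longrightarrow> x \<in> carrier M \<Longrightarrow> a g x \<in> carrier M"
      "\<And>g x. g \<in> G \<Longrightarrow> x \<in> carrier M \<Longrightarrow> \<Phi> (a g x) = \<beta> g (\<Phi> x)"
    and b: "\<And>g x. g \<in> G \<Longrightarrow> x \<in> carrier N \<Longrightarrow> b g x \<in> carrier N"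
      "\<And>g x. g \<in> G \<Longrightarrow> x \<in> carrier N \<Longrightarrow> \<Psi> (b g x) = \<beta> g (\<Psi> x)"
    using A B by (auto simp: fps_model_def)
  note D = fps_lin_isoD[OF li(1)] and E = fps_lin_isoD[OF li(2)]
  define \<phi> where "\<phi> x = inv_into (carrier N) \<Psi> (\<Phi> x)" for x
  have W: "\<Phi> x \<in> W" if "x \<in> carrier M" for x using D(3) that by auto
  have p: "\<phi> x \<in> carrier N" "\<Psi> (\<phi> x) = \<Phi> x" if "x \<in> carrier M" for x
    using W[OF that] E(3) by (auto simp: \<phi>_def inv_into_into f_inv_into_f)
  have inj: "x = y" if "\<Psi> x = \<Psi> y" "x \<in> carrier N" "y \<in> carrier N" for x y using E(2) that by (auto simp: inj_on_def)
  have "bij_betw \<phi> (carrier M) (carrier N)" using bij_betw_trans[OF D(1) bij_betw_inv_into[OF E(1)]] by (simp add: \<phi>_def[abs_def] comp_def)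
  then show ?thesis unfolding rep_iso_def using fps_model_is_rep[OF A l G] fps_model_is_rep[OF B l G]
    by (auto intro!: exI[of _ \<phi>] inj simp: p D E a b)
qed

text \<open>Cosets of the kernel are the level sets of \<open>\<Psi>\<close>, so evaluating
  \<open>\<Psi>\<close> at a chosen representative is harmless. The explicit level sets in the
  further conclusions are needed later, when a group acts on cosets by taking images of
  sets.\<close>

lemma fps_lin_iso_quot:
  fixes S :: "('f::field, 'm, 'z) module_scheme"
  assumes S: "abelian_group S"
    and add: "\<And>x y. x \<in> carrier S \<Longrightarrow> y \<in> carrier S \<Longrightarrow> \<Psi> (x \<oplus>\<^bsub>S\<^esub> y) = \<Psi> x + \<Psi> y"
    and W: "\<Psi> ` carrier S = W"
    and N: "N = {x \<in> carrier S. \<Psi> x = 0}"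
    and sm: "\<And>c x. x \<in> carrier S \<Longrightarrow> c \<odot>\<^bsub>S\<^esub> x \<in> carrier S"
      "\<And>c x. x \<in> carrier S \<Longrightarrow> \<Psi> (c \<odot>\<^bsub>S\<^esub> x) = fps_const c * \<Psi> x"
  defines "\<Phi> \<equiv> \<lambda>A. \<Psi> (SOME x. x \<in> A)"
  shows "fps_lin_iso (quot_module S N) \<Phi> W"
    and "carrier (quot_module S N) = (\<lambda>x. {y \<in> carrier S. \<Psi> y = \<Psi> x}) ` carrier S"
    and "\<And>x. x \<in> carrier S \<Longrightarrow> \<Phi> {y \<in> carrier S. \<Psi> y = \<Psi> x} = \<Psi> x"
    and "\<And>x. x \<in> carrier S \<Longrightarrow> N +>\<^bsub>S\<^esub> x = {y \<in> carrier S. \<Psi> y = \<Psi> x}"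
proof -
  interpret abelian_group S by (rule S)
  define fib where "fib = (\<lambda>x. {y \<in> carrier S. \<Psi> y = \<Psi> x})"
  have z: "\<Psi> \<zero>\<^bsub>S\<^esub> = 0" using add[of "\<zero>\<^bsub>S\<^esub>" "\<zero>\<^bsub>S\<^esub>"] by (simp only: zero_closed l_zero add_cancel_right_right)
  have neg: "\<Psi> (\<ominus>\<^bsub>S\<^esub> x) = - \<Psi> x" if "x \<in> carrier S" for x
    using add[of "\<ominus>\<^bsub>S\<^esub> x" x] that by (simp add: l_neg z eq_neg_iff_add_eq_0)
  have cos: "N +>\<^bsub>S\<^esub> x = fib x" if x: "x \<in> carrier S" for x
  proof -
    have "y \<in> N +>\<^bsub>S\<^esub> x" if "y \<in> fib x" for y
    proof -
      have y: "y \<in> carrier S" "\<Psi> y = \<Psi> x" using that by (auto simp: fib_def)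
      have "y \<oplus>\<^bsub>S\<^esub> \<ominus>\<^bsub>S\<^esub> x \<in> N" using x y by (simp add: N add neg)
      moreover have "y = (y \<oplus>\<^bsub>S\<^esub> \<ominus>\<^bsub>S\<^esub> x) \<oplus>\<^bsub>S\<^esub> x" using x y by (simp add: a_assoc l_neg)
      ultimately show ?thesis unfolding a_r_coset_def r_coset_def by auto
    qed
    then show ?thesis unfolding a_r_coset_def r_coset_def using x by (auto simp: N add fib_def)
  qed
  have car: "carrier (quot_module S N) = fib ` carrier S"
    by (auto simp: fib_def quot_module_def A_RCOSETS_def RCOSETS_def a_r_coset_def[symmetric] cos[unfolded fib_def])
  have val: "\<Phi> (fib x) = \<Psi> x" if "x \<in> carrier S" for x
    unfolding \<Phi>_def using someI[of "\<lambda>y. y \<in> fib x" x] that by (simp add: fib_def)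
  have addq: "fib x \<oplus>\<^bsub>quot_module S N\<^esub> fib y = fib (x \<oplus>\<^bsub>S\<^esub> y)"
    if x: "x \<in> carrier S" and y: "y \<in> carrier S" for x y
  proof -
    have "z \<in> fib x <+>\<^bsub>S\<^esub> fib y" if z: "z \<in> fib (x \<oplus>\<^bsub>S\<^esub> y)" for z
    proof -
      have "z \<oplus>\<^bsub>S\<^esub> \<ominus>\<^bsub>S\<^esub> y \<in> fib x" using x y z by (simp add: add neg fib_def)
      moreover have "z = (z \<oplus>\<^bsub>S\<^esub> \<ominus>\<^bsub>S\<^esub> y) \<oplus>\<^bsub>S\<^esub> y" using y z by (simp add: fib_def a_assoc l_neg)
      moreover have "y \<in> fib y" using y by (simp add: fib_def)
      ultimately show ?thesis unfolding set_add_def set_mult_def by auto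
    qed
    then show ?thesis using x y by (auto simp: quot_module_def set_add_def set_mult_def add fib_def)
  qed
  have smq: "c \<odot>\<^bsub>quot_module S N\<^esub> fib x = fib (c \<odot>\<^bsub>S\<^esub> x)" if x: "x \<in> carrier S" for c x
    using x by (auto simp: quot_module_def cos sm fib_def)
  have zq: "\<zero>\<^bsub>quot_module S N\<^esub> = fib \<zero>\<^bsub>S\<^esub>" by (simp add: quot_module_def N z fib_def)
  have "inj_on \<Phi> (fib ` carrier S)" by (rule inj_onI) (auto simp: val, auto simp: fib_def)
  moreover have "\<Phi> ` (fib ` carrier S) = W" unfolding W[symmetric] image_image using val by (rule image_cong[OF refl])
  ultimately show "fps_lin_iso (quot_module S N) \<Phi> W" unfolding fps_lin_iso_def car bij_betw_def by (auto simp: addq smq zq val add sm z)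
  show "carrier (quot_module S N) = (\<lambda>x. {y \<in> carrier S. \<Psi> y = \<Psi> x}) ` carrier S"
    and "\<And>x. x \<in> carrier S \<Longrightarrow> \<Phi> {y \<in> carrier S. \<Psi> y = \<Psi> x} = \<Psi> x"
    and "\<And>x. x \<in> carrier S \<Longrightarrow> N +>\<^bsub>S\<^esub> x = {y \<in> carrier S. \<Psi> y = \<Psi> x}"
    using car val cos unfolding fib_def by blast+
qed

section \<open>Presented modules\<close>

text \<open>The universal property of the free abelian group on the generators, with values in a
  ring of power series.\<close>

definition zlift :: "('s \<Rightarrow> 'w::comm_ring_1) \<Rightarrow> ('s \<Rightarrow>\<^sub>0 int) \<Rightarrow> 'w" where
  "zlift f c = (\<Sum>s\<in>supp c. of_int (Poly_Mapping.lookup c s) * f s)"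

lemma zlift_superset:
  "finite A \<Longrightarrow> supp c \<subseteq> A \<Longrightarrow> zlift f c = (\<Sum>s\<in>A. of_int (Poly_Mapping.lookup c s) * f s)"
  unfolding zlift_def by (rule sum.mono_neutral_left) (auto simp: in_keys_iff)

lemma zlift_0 [simp]: "zlift f 0 = 0"
  by (simp add: zlift_def)

lemma zlift_of [simp]: "zlift f (frag_of s) = f s"
  by (simp add: zlift_def)

lemma zlift_diff [simp]: "zlift f (c - d) = zlift f c - zlift f d"
proof -
  let ?A = "supp c \<union> supp d"
  have "supp (c - d) \<subseteq> ?A" by (rule keys_diff)
  then show ?thesis by (simp add: zlift_superset[of ?A] lookup_minus sum_subtractf algebra_simps)
qed

lemma zlift_minus [simp]: "zlift f (- c) = - zlift f c"
  using zlift_diff[of f 0 c] by simp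

lemma zlift_add [simp]: "zlift f (c + d) = zlift f c + zlift f d"
  using zlift_diff[of f c "- d"] by simp

lemma zlift_sum [simp]: "zlift f (sum c A) = (\<Sum>i\<in>A. zlift f (c i))"
  by (induction A rule: infinite_finite_induct) auto

lemma zlift_frag_extend:
  "supp c \<subseteq> S \<Longrightarrow> zlift f (gen_map m c) = zlift (f \<circ> m) c"
  by (induction c rule: frag_induction) (auto simp: frag_extend_diff)

lemma keys_frag_extend_of:
  assumes "supp c \<subseteq> S" and "\<And>s. s \<in> S \<Longrightarrow> m s \<in> S'"
  shows "supp (gen_map m c) \<subseteq> S'"
proof
  fix x assume "x \<in> supp (gen_map m c)"
  then obtain s where "s \<in> supp c" "x \<in> supp ((frag_of \<circ> m) s)" using subsetD[OF keys_frag_extend[of "frag_of \<circ> m" c]] by blast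
  then show "x \<in> S'" using assms by (auto simp: keys_frag_of)
qed

abbreviation span_rel :: "'s set \<Rightarrow> ('s \<Rightarrow>\<^sub>0 int) set \<Rightarrow> ('s \<Rightarrow>\<^sub>0 int) set" where
  "span_rel S E \<equiv> generate (free_Abelian_group S) E"

definition rel_class :: "'s set \<Rightarrow> ('s \<Rightarrow>\<^sub>0 int) set \<Rightarrow> ('s \<Rightarrow>\<^sub>0 int) \<Rightarrow> ('s \<Rightarrow>\<^sub>0 int) set" where
  "rel_class S E c = (\<lambda>h. h + c) ` span_rel S E"

locale presentation =
  fixes S :: "'s set" and E :: "('s \<Rightarrow>\<^sub>0 int) set"
  assumes rel: "\<And>e. e \<in> E \<Longrightarrow> supp e \<subseteq> S"
begin

lemma rel_subset: "E \<subseteq> carrier (free_Abelian_group S)"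
  using rel by auto

lemma span_subgroup: "subgroup (span_rel S E) (free_Abelian_group S)"
  by (rule group.generate_is_subgroup[OF group_free_Abelian_group rel_subset])

lemma span_keys: "h \<in> span_rel S E \<Longrightarrow> supp h \<subseteq> S"
  using subgroup.mem_carrier[OF span_subgroup, of h] by simp

lemma span_0: "0 \<in> span_rel S E"
  using subgroup.one_closed[OF span_subgroup] by simp

lemma span_add: "h \<in> span_rel S E \<Longrightarrow> h' \<in> span_rel S E \<Longrightarrow> h + h' \<in> span_rel S E"
  using subgroup.m_closed[OF span_subgroup] by simp

lemma span_minus: "h \<in> span_rel S E \<Longrightarrow> - h \<in> span_rel S E"
  using subgroup.m_inv_closed[OF span_subgroup, of h] span_keys[of h] by simp

lemma span_diff: "h \<in> span_rel S E \<Longrightarrow> h' \<in> span_rel S E \<Longrightarrow> h - h' \<in> span_rel S E"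
  using span_add[OF _ span_minus] by fastforce

lemma span_incl: "e \<in> E \<Longrightarrow> e \<in> span_rel S E"
  by (rule generate.incl)

lemma span_sum: "(\<And>i. i \<in> A \<Longrightarrow> c i \<in> span_rel S E) \<Longrightarrow> sum c A \<in> span_rel S E"
  by (induction A rule: infinite_finite_induct) (auto intro: span_0 span_add)

lemma span_induct [consumes 1, case_names zero rel add minus]:
  assumes "h \<in> span_rel S E"
    and z: "P 0" and r: "\<And>e. e \<in> E \<Longrightarrow> P e"
    and a: "\<And>h h'. P h \<Longrightarrow> P h' \<Longrightarrow> P (h + h')" and m: "\<And>h. P h \<Longrightarrow> P (- h)"
  shows "P h"
  using assms(1)
proof (induction rule: generate.induct)
  case (inv h)
  then show ?case using m[OF r[of h]] rel[of h] by simp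
qed (use z r a in auto)

lemma class_eq_iff: "rel_class S E c = rel_class S E d \<longleftrightarrow> c - d \<in> span_rel S E"
proof
  assume "rel_class S E c = rel_class S E d"
  moreover have "c \<in> rel_class S E c" using span_0 by (auto simp: rel_class_def intro: image_eqI[of _ _ 0])
  ultimately obtain h where "c = h + d" "h \<in> span_rel S E" by (auto simp: rel_class_def)
  then show "c - d \<in> span_rel S E" by simp
next
  assume *: "c - d \<in> span_rel S E"
  have "h + c \<in> rel_class S E d" if "h \<in> span_rel S E" for h
    unfolding rel_class_def by (rule image_eqI[of _ _ "h + (c - d)"]) (use that * span_add in auto)
  moreover have "h + d \<in> rel_class S E c" if "h \<in> span_rel S E" for h
    unfolding rel_class_def by (rule image_eqI[of _ _ "h - (c - d)"]) (use that * span_diff in auto)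
  ultimately show "rel_class S E c = rel_class S E d" by (auto simp: rel_class_def)
qed

lemma class_self: "c \<in> rel_class S E c"
  using span_0 by (auto simp: rel_class_def intro: image_eqI[of _ _ 0])

lemma mem_class_iff: "d \<in> rel_class S E c \<longleftrightarrow> d - c \<in> span_rel S E"
  by (auto simp: rel_class_def intro: image_eqI[of _ _ "d - c"])

lemma presented_zero: "\<zero>\<^bsub>presented_module S E act\<^esub> = rel_class S E 0"
  by (simp add: presented_module_def quot_module_def rel_class_def)

lemma presented_carrier:
  "carrier (presented_module S E act) = rel_class S E ` {c. supp c \<subseteq> S}"
proof -
  have "(\<Union>h\<in>span_rel S E. {h + c}) = rel_class S E c" for c by (auto simp: rel_class_def)
  then show ?thesis by (auto simp: presented_module_def quot_module_def A_RCOSETS_def RCOSETS_def r_coset_def)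
qed

lemma presented_add:
  "rel_class S E c \<oplus>\<^bsub>presented_module S E act\<^esub> rel_class S E d = rel_class S E (c + d)"
proof -
  have "x \<in> rel_class S E (c + d) \<longleftrightarrow> (\<exists>a\<in>rel_class S E c. \<exists>b\<in>rel_class S E d. x = a + b)" for x
  proof
    assume "x \<in> rel_class S E (c + d)"
    then show "\<exists>a\<in>rel_class S E c. \<exists>b\<in>rel_class S E d. x = a + b"
      by (intro bexI[of _ "x - d"] bexI[of _ d]) (auto simp: mem_class_iff span_0 algebra_simps)
  next
    assume "\<exists>a\<in>rel_class S E c. \<exists>b\<in>rel_class S E d. x = a + b"
    then obtain a b where "a \<in> rel_class S E c" "b \<in> rel_class S E d" "x = a + b" by blast
    then show "x \<in> rel_class S E (c + d)" using span_add[of "a - c" "b - d"] by (simp add: mem_class_iff algebra_simps)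
  qed
  then show ?thesis by (auto simp: presented_module_def quot_module_def set_add_def set_mult_def)
qed

text \<open>Scalar multiplication is defined by multiplying all representatives and uniting the
  cosets obtained. As the scalar carries relations to relations, these cosets all coincide.\<close>

lemma presented_smult:
  assumes "\<And>e. e \<in> E \<Longrightarrow> gen_map (act r) e \<in> span_rel S E"
  shows "r \<odot>\<^bsub>presented_module S E act\<^esub> rel_class S E c = rel_class S E (gen_map (act r) c)"
proof -
  let ?m = "gen_map (act r)"
  have H: "?m h \<in> span_rel S E" if "h \<in> span_rel S E" for h using that by (induction rule: span_induct)
      (auto simp: frag_extend_add frag_extend_minus assms[unfolded comp_def] comp_def span_0 intro: span_add span_minus)
  have "rel_class S E (?m x) = rel_class S E (?m c)" if "x \<in> rel_class S E c" for x
    using H[of "x - c"] that by (simp add: class_eq_iff mem_class_iff frag_extend_diff)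
  moreover have "c \<in> rel_class S E c" by (rule class_self)
  ultimately have "(\<Union>x\<in>rel_class S E c. rel_class S E (?m x)) = rel_class S E (?m c)" by (intro SUP_eq_const) blast+
  then show ?thesis by (simp add: presented_module_def quot_module_def a_r_coset_def r_coset_def rel_class_def UNION_singleton_eq_range)
qed

lemma presented_abelian_group: "abelian_group (presented_module S E act)"
proof (rule abelian_groupI)
  fix x assume "x \<in> carrier (presented_module S E act)"
  then obtain c where "x = rel_class S E c" "supp c \<subseteq> S" by (auto simp: presented_carrier)
  then show "\<exists>y\<in>carrier (presented_module S E act). y \<oplus>\<^bsub>presented_module S E act\<^esub> x = \<zero>\<^bsub>presented_module S E act\<^esub>"
    by (intro bexI[of _ "rel_class S E (- c)"]) (auto simp: presented_add presented_zero presented_carrier)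
next
  fix x y assume "x \<in> carrier (presented_module S E act)" "y \<in> carrier (presented_module S E act)"
  then show "x \<oplus>\<^bsub>presented_module S E act\<^esub> y \<in> carrier (presented_module S E act)"
    using keys_add by (fastforce simp: presented_carrier presented_add)
qed (auto simp: presented_carrier presented_add presented_zero algebra_simps)

lemma zlift_class:
  assumes "\<And>e. e \<in> E \<Longrightarrow> zlift f e = 0" and "x \<in> rel_class S E c"
  shows "zlift f x = zlift f c"
proof -
  have "zlift f h = 0" if "h \<in> span_rel S E" for h using that by (induction rule: span_induct) (auto simp: assms)
  from this[of "x - c"] assms(2) show ?thesis by (simp add: mem_class_iff)
qed

end

definition class_lift :: "('s \<Rightarrow> 'w::comm_ring_1) \<Rightarrow> ('s \<Rightarrow>\<^sub>0 int) set \<Rightarrow> 'w" where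
  "class_lift f A = zlift f (SOME c. c \<in> A)"

lemma (in presentation) class_lift_class:
  assumes "\<And>e. e \<in> E \<Longrightarrow> zlift f e = 0"
  shows "class_lift f (rel_class S E c) = zlift f c"
  unfolding class_lift_def using class_self zlift_class[OF assms] by (rule someI2)

text \<open>The relations are killed, so a map to \<open>W\<close> exists; \<open>nf\<close> chooses
  a word for every value. Being additive modulo relations and correct on generators,
  \<open>nf\<close> is correct on all words, and this yields injectivity, the hard half for a module
  given by generators and relations.\<close>

lemma (in presentation) presented_fps_lin_iso:
  fixes f :: "'s \<Rightarrow> 'f::field fps"
  assumes kill: "\<And>e. e \<in> E \<Longrightarrow> zlift f e = 0"
    and W: "0 \<in> W" "\<And>w w'. w \<in> W \<Longrightarrow> w' \<in> W \<Longrightarrow> w - w' \<in> W"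
    and f: "\<And>s. s \<in> S \<Longrightarrow> f s \<in> W"
    and nf: "\<And>w. w \<in> W \<Longrightarrow> supp (nf w) \<subseteq> S" "\<And>w. w \<in> W \<Longrightarrow> zlift f (nf w) = w"
      "\<And>w w'. w \<in> W \<Longrightarrow> w' \<in> W \<Longrightarrow> nf (w - w') - (nf w - nf w') \<in> span_rel S E"
      "\<And>s. s \<in> S \<Longrightarrow> frag_of s - nf (f s) \<in> span_rel S E"
    and act: "\<And>r s. s \<in> S \<Longrightarrow> act r s \<in> S" "\<And>r s. s \<in> S \<Longrightarrow> f (act r s) = fps_const r * f s"
      "\<And>r e. e \<in> E \<Longrightarrow> gen_map (act r) e \<in> span_rel S E"
  shows "fps_lin_iso (presented_module S E act) (class_lift f) W"
proof -
  \<comment> \<open>Every word is congruent to the normal form of its value, by induction on the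
    word.\<close>
  have lift: "zlift f c \<in> W \<and> c - nf (zlift f c) \<in> span_rel S E" if "supp c \<subseteq> S" for c using that
  proof (induction c rule: frag_induction)
    case zero
    have "nf 0 \<in> span_rel S E" using span_minus[OF nf(3)[OF W(1) W(1)]] nf(3)[OF W(1) W(1)] by simp
    then show ?case using W span_minus by simp
  next
    case (one s)
    then show ?case using f nf(4) by simp
  next
    case (diff a b)
    have "(a - nf (zlift f a)) - (b - nf (zlift f b)) - (nf (zlift f a - zlift f b) - (nf (zlift f a) - nf (zlift f b)))
      \<in> span_rel S E" using diff by (intro span_diff[OF span_diff] nf(3)) auto
    then show ?case using diff W by (simp add: algebra_simps)
  qed
  have cl: "class_lift f (rel_class S E c) = zlift f c" for c by (rule class_lift_class) (rule kill)
  have nf0: "nf 0 \<in> span_rel S E" using lift[of 0] span_minus by fastforce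
  \<comment> \<open>Words of equal value are congruent to one and the same normal form.\<close>
  have eq: "rel_class S E c = rel_class S E d"
    if "supp c \<subseteq> S" "supp d \<subseteq> S" "zlift f c = zlift f d" for c d
  proof -
    have "(c - nf (zlift f c)) - (d - nf (zlift f d)) \<in> span_rel S E" using lift that by (intro span_diff[of "c - nf (zlift f c)"]) blast+
    then show ?thesis using that by (simp add: class_eq_iff)
  qed
  have C1: "inj_on (class_lift f) (carrier (presented_module S E act))" by (rule inj_onI) (clarsimp simp: presented_carrier cl, erule (2) eq)
  have C2: "class_lift f ` carrier (presented_module S E act) = W"
  proof
    show "class_lift f ` carrier (presented_module S E act) \<subseteq> W" using lift by (auto simp: presented_carrier cl)
    show "W \<subseteq> class_lift f ` carrier (presented_module S E act)"
    proof
      fix w assume w: "w \<in> W"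
      show "w \<in> class_lift f ` carrier (presented_module S E act)"
        by (rule image_eqI[of _ _ "rel_class S E (nf w)"]) (use nf(1,2)[OF w] in \<open>simp_all add: presented_carrier cl\<close>)
    qed
  qed
  have C3: "rel_class S E c \<oplus>\<^bsub>presented_module S E act\<^esub> rel_class S E d \<in> carrier (presented_module S E act)"
    "class_lift f (rel_class S E c \<oplus>\<^bsub>presented_module S E act\<^esub> rel_class S E d) =
      class_lift f (rel_class S E c) + class_lift f (rel_class S E d)"
    if "supp c \<subseteq> S" "supp d \<subseteq> S" for c d unfolding presented_add cl presented_carrier
    using that order_trans[OF keys_add[of c d]] by (simp_all add: imageI)
  have sm: "r \<odot>\<^bsub>presented_module S E act\<^esub> rel_class S E c = rel_class S E (gen_map (act r) c)"
    for r c by (rule presented_smult) (rule act(3))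
  have C4: "r \<odot>\<^bsub>presented_module S E act\<^esub> rel_class S E c \<in> carrier (presented_module S E act)"
    "class_lift f (r \<odot>\<^bsub>presented_module S E act\<^esub> rel_class S E c) = fps_const r * class_lift f (rel_class S E c)"
    if c: "supp c \<subseteq> S" for r c
  proof -
    have "zlift f (gen_map (act r) c) = fps_const r * zlift f c"
      using c by (induction c rule: frag_induction) (simp_all add: frag_extend_diff act(2) right_diff_distrib)
    then show "class_lift f (r \<odot>\<^bsub>presented_module S E act\<^esub> rel_class S E c) = fps_const r * class_lift f (rel_class S E c)"
      unfolding sm cl .
    show "r \<odot>\<^bsub>presented_module S E act\<^esub> rel_class S E c \<in> carrier (presented_module S E act)" unfolding sm presented_carrier
      using keys_frag_extend_of[OF c act(1)] by (intro imageI) simp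
  qed
  have C5: "\<zero>\<^bsub>presented_module S E act\<^esub> \<in> carrier (presented_module S E act)"
    "class_lift f \<zero>\<^bsub>presented_module S E act\<^esub> = 0" unfolding presented_zero cl presented_carrier by (simp_all add: imageI)
  have ex: "\<exists>c. x = rel_class S E c \<and> supp c \<subseteq> S"
    if "x \<in> carrier (presented_module S E act)" for x using that by (auto simp: presented_carrier)
  show ?thesis unfolding fps_lin_iso_def bij_betw_def
  proof (intro conjI ballI allI C1 C2 C5)
    fix x y assume "x \<in> carrier (presented_module S E act)" "y \<in> carrier (presented_module S E act)"
    then obtain c d where "x = rel_class S E c" "supp c \<subseteq> S"
      "y = rel_class S E d" "supp d \<subseteq> S" using ex by meson
    then show "x \<oplus>\<^bsub>presented_module S E act\<^esub> y \<in> carrier (presented_module S E act)"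
      "class_lift f (x \<oplus>\<^bsub>presented_module S E act\<^esub> y) = class_lift f x + class_lift f y" using C3 by simp_all
  next
    fix r x assume "x \<in> carrier (presented_module S E act)"
    then obtain c where "x = rel_class S E c" "supp c \<subseteq> S" using ex by meson
    then show "r \<odot>\<^bsub>presented_module S E act\<^esub> x \<in> carrier (presented_module S E act)"
      "class_lift f (r \<odot>\<^bsub>presented_module S E act\<^esub> x) = fps_const r * class_lift f x" using C4 by simp_all
  qed
qed

text \<open>The image of a coset is a full coset because \<open>m'\<close> supplies preimages: a
  relation \<open>h\<close> in the target is the image of the relation \<open>gen_map m' h\<close>.
  Group actions on presented modules are defined by images of sets, so inclusion would not be
  enough.\<close>

lemma image_rel_class:
  assumes "presentation S E" "presentation S' E'"
    and m: "\<And>s. s \<in> S \<Longrightarrow> m s \<in> S'" "\<And>s. s \<in> S' \<Longrightarrow> m' s \<in> S" "\<And>s. s \<in> S' \<Longrightarrow> m (m' s) = s"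
    and E: "\<And>e. e \<in> E \<Longrightarrow> gen_map m e \<in> span_rel S' E'"
      "\<And>e. e \<in> E' \<Longrightarrow> gen_map m' e \<in> span_rel S E"
  shows "gen_map m ` rel_class S E c = rel_class S' E' (gen_map m c)"
proof -
  interpret A: presentation S E by fact
  interpret B: presentation S' E' by fact
  have H: "gen_map m h \<in> span_rel S' E'" if "h \<in> span_rel S E" for h using that by (induction rule: A.span_induct)
      (auto simp: frag_extend_add frag_extend_minus E[unfolded comp_def] comp_def intro: B.span_0 B.span_add B.span_minus)
  have H': "gen_map m' h \<in> span_rel S E" if "h \<in> span_rel S' E'" for h using that by (induction rule: B.span_induct)
      (auto simp: frag_extend_add frag_extend_minus E[unfolded comp_def] comp_def intro: A.span_0 A.span_add A.span_minus)
  have inv: "gen_map m (gen_map m' h) = h"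
    if "supp h \<subseteq> S'" for h
  proof -
    have "frag_extend ((frag_of \<circ> m) \<circ> m') h = frag_extend frag_of h" by (rule frag_extend_eq) (use that m(3) in auto)
    then show ?thesis by (simp add: frag_extend_compose flip: frag_expansion)
  qed
  have "y \<in> gen_map m ` rel_class S E c"
    if "y \<in> rel_class S' E' (gen_map m c)" for y
  proof -
    let ?h = "y - gen_map m c"
    have h: "?h \<in> span_rel S' E'" using that by (simp add: B.mem_class_iff)
    have "y = gen_map m (gen_map m' ?h + c)" using inv[OF B.span_keys[OF h]] by (simp add: frag_extend_add)
    moreover have "gen_map m' ?h + c \<in> rel_class S E c" using H'[OF h] by (simp add: A.mem_class_iff)
    ultimately show ?thesis by blast
  qed
  moreover have "gen_map m x \<in> rel_class S' E' (gen_map m c)"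
    if "x \<in> rel_class S E c" for x using H[of "x - c"] that by (simp add: A.mem_class_iff B.mem_class_iff frag_extend_diff)
  ultimately show ?thesis by blast
qed

section \<open>Symmetric powers and tensor products in coordinates\<close>

lemma prod_list_update:
  fixes ys :: "'a::comm_monoid_mult list"
  assumes "i < length ys"
  shows "prod_list (ys[i := y]) = y * prod_list (take i ys @ drop (Suc i) ys)"
  using assms by (simp add: upd_conv_take_nth_drop mult_ac)

lemma keys_diff2: "supp (frag_of x - frag_of y) \<subseteq> {x, y}"
  using keys_diff[of "frag_of x" "frag_of y"] by (auto simp: keys_frag_of)

lemma keys_diff3: "supp (frag_of x - frag_of y - frag_of z) \<subseteq> {x, y, z}"
  using keys_diff[of "frag_of x - frag_of y" "frag_of z"] keys_diff2[of x y] by (auto simp: keys_frag_of)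

lemma sym_presentation:
  fixes M :: "('f::field, 'm, 'z) module_scheme"
  assumes "fps_lin_iso M \<Phi> W"
  shows "presentation (sym_generators ground n M) (sym_relations ground n M)"
proof
  fix e assume e: "e \<in> sym_relations (ground :: 'f ring) n M"
  note D = fps_lin_isoD[OF assms]
  let ?S = "sym_generators (ground :: 'f ring) n M"
  have up: "(r', xs[i := x]) \<in> ?S" if "(r, xs) \<in> ?S" "x \<in> carrier M" for r r' xs i x
    using that set_update_subset_insert[of xs i x] by (auto simp: sym_generators_def)
  have pm: "(r, ys) \<in> ?S" if "(r, xs) \<in> ?S" "mset ys = mset xs" for r xs ys
    using that mset_eq_length[of ys xs] mset_eq_setD[of ys xs] by (auto simp: sym_generators_def)
  have fst: "(r', xs) \<in> ?S" if "(r, xs) \<in> ?S" for r r' xs using that by (auto simp: sym_generators_def)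
  note k3 = order_trans[OF keys_diff3] and k2 = order_trans[OF keys_diff2]
  from e consider
      (1) r r' xs where "(r, xs) \<in> ?S" "e = frag_of (r + r', xs) - frag_of (r, xs) - frag_of (r', xs)"
    | (2) r xs i x y where "(r, xs) \<in> ?S" "x \<in> carrier M" "y \<in> carrier M"
        "e = frag_of (r, xs[i := x \<oplus>\<^bsub>M\<^esub> y]) - frag_of (r, xs[i := x]) - frag_of (r, xs[i := y])"
    | (3) r xs i c x where "(r, xs) \<in> ?S" "x \<in> carrier M"
        "e = frag_of (r, xs[i := c \<odot>\<^bsub>M\<^esub> x]) - frag_of (c * r, xs[i := x])"
    | (4) r xs ys where "(r, xs) \<in> ?S" "mset ys = mset xs" "e = frag_of (r, xs) - frag_of (r, ys)" unfolding sym_relations_def by fastforce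
  then show "supp e \<subseteq> ?S"
  proof cases
    case 1 show ?thesis unfolding 1(2) by (rule k3) (simp add: fst[OF 1(1)])
  next
    case 2 show ?thesis unfolding 2(4) by (rule k3) (simp add: up[OF 2(1)] D(6) 2)
  next
    case 3 show ?thesis unfolding 3(3) by (rule k2) (simp add: up[OF 3(1)] D(8) 3)
  next
    case 4 show ?thesis unfolding 4(3) by (rule k2) (simp add: pm[OF 4(1)] 4)
  qed
qed

text \<open>Multiplication of series is commutative and multilinear, hence compatible with the
  relations of a symmetric power. A line goes to constants; a plane goes to polynomials of degree at
  most 1, whose products of length \<open>n\<close> are dehomogenized forms of degree
  \<open>n\<close>.\<close>

definition sym_val :: "('m \<Rightarrow> 'f::field fps) \<Rightarrow> 'f \<times> 'm list \<Rightarrow> 'f fps" where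
  "sym_val \<Phi> = (\<lambda>(r, xs). fps_const r * prod_list (map \<Phi> xs))"

lemma sym_val_kill:
  fixes M :: "('f::field, 'm, 'z) module_scheme"
  assumes li: "fps_lin_iso M \<Phi> W" and e: "e \<in> sym_relations (ground :: 'f ring) n M"
  shows "zlift (sym_val \<Phi>) e = 0"
proof -
  note D = fps_lin_isoD[OF li]
  let ?S = "sym_generators (ground :: 'f ring) n M"
  have len: "length xs = n" if "(r, xs) \<in> ?S" for r xs using that by (auto simp: sym_generators_def)
  from e consider
      (1) r r' xs where "(r, xs) \<in> ?S" "e = frag_of (r + r', xs) - frag_of (r, xs) - frag_of (r', xs)"
    | (2) r xs i x y where "(r, xs) \<in> ?S" "i < n" "x \<in> carrier M" "y \<in> carrier M"
        "e = frag_of (r, xs[i := x \<oplus>\<^bsub>M\<^esub> y]) - frag_of (r, xs[i := x]) - frag_of (r, xs[i := y])"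
    | (3) r xs i c x where "(r, xs) \<in> ?S" "i < n" "x \<in> carrier M"
        "e = frag_of (r, xs[i := c \<odot>\<^bsub>M\<^esub> x]) - frag_of (c * r, xs[i := x])"
    | (4) r xs ys where "(r, xs) \<in> ?S" "mset ys = mset xs" "e = frag_of (r, xs) - frag_of (r, ys)" unfolding sym_relations_def by fastforce
  then show ?thesis
  proof cases
    case 1 show ?thesis unfolding 1(2) by (simp add: sym_val_def distrib_right flip: fps_const_add)
  next
    case 2 show ?thesis unfolding 2(5)
      using 2 by (simp add: sym_val_def map_update prod_list_update len[OF 2(1)] D distrib_left distrib_right del: prod_list.append)
  next
    case 3 show ?thesis unfolding 3(4)
      using 3 by (simp add: sym_val_def map_update prod_list_update len[OF 3(1)] D mult_ac flip: fps_const_mult del: prod_list.append)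
  next
    case 4
    have "prod_list (map \<Phi> ys) = prod_list (map \<Phi> xs)" using 4(2) by (metis mset_map prod_mset_prod_list)
    then show ?thesis using 4 by (simp add: sym_val_def)
  qed
qed

text \<open>Multilinear expansion, one position after the other, with the scalars collected in the
  coefficient. The two spanning vectors may coincide, which covers a line as well as a
  plane.\<close>

lemma sym_basis_reduction:
  fixes M :: "('f::field, 'm, 'z) module_scheme"
  assumes li: "fps_lin_iso M \<Phi> W"
    and e: "e1 \<in> carrier M" "e2 \<in> carrier M"
    and dec: "\<And>x. x \<in> carrier M \<Longrightarrow> \<exists>\<alpha> \<beta>. x = \<alpha> \<odot>\<^bsub>M\<^esub> e1 \<oplus>\<^bsub>M\<^esub> \<beta> \<odot>\<^bsub>M\<^esub> e2"
    and add: "\<And>a b. P a \<Longrightarrow> P b \<Longrightarrow> P (a + b)"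
    and cong: "\<And>a b. a - b \<in> span_rel (sym_generators ground n M)
      (sym_relations ground n M) \<Longrightarrow> P b \<Longrightarrow> P a"
    and base: "\<And>r xs. length xs = n \<Longrightarrow> set xs \<subseteq> {e1, e2} \<Longrightarrow> P (frag_of (r, xs))"
    and gen: "(r, xs) \<in> sym_generators (ground :: 'f ring) n M"
  shows "P (frag_of (r, xs))"
proof -
  note D = fps_lin_isoD[OF li]
  let ?F = "ground :: 'f ring"
  interpret presentation "sym_generators ?F n M" "sym_relations ?F n M" by (rule sym_presentation[OF li])
  \<comment> \<open>Induction on the number \<open>i\<close> of leading entries that may still be
    arbitrary; from position \<open>i\<close> on all entries are already spanning vectors.\<close>
  have "P (frag_of (r, xs))"
    if "i \<le> n" "length xs = n" "set xs \<subseteq> carrier M" "\<forall>j. i \<le> j \<longrightarrow> j < n \<longrightarrow> xs ! j \<in> {e1, e2}" for i r xs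
    using that
  proof (induction i arbitrary: r xs)
    case 0
    then have "set xs \<subseteq> {e1, e2}" by (auto simp: in_set_conv_nth)
    then show ?case using base 0 by blast
  next
    case (Suc i)
    have i: "i < n" "xs ! i \<in> carrier M" using Suc.prems by auto
    then obtain \<alpha> \<beta> where x: "xs ! i = \<alpha> \<odot>\<^bsub>M\<^esub> e1 \<oplus>\<^bsub>M\<^esub> \<beta> \<odot>\<^bsub>M\<^esub> e2" using dec by blast
    have g: "(r, xs) \<in> sym_generators ?F n M" using Suc.prems by (auto simp: sym_generators_def)
    have IH: "P (frag_of (s, xs[i := y]))" if "y \<in> {e1, e2}" for s y
    proof (rule Suc.IH)
      show "set (xs[i := y]) \<subseteq> carrier M" using set_update_subset_insert[of xs i y] that e Suc.prems(3) by blast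
      show "\<forall>j. i \<le> j \<longrightarrow> j < n \<longrightarrow> xs[i := y] ! j \<in> {e1, e2}"
      proof (intro allI impI)
        fix j assume "i \<le> j" "j < n"
        then show "xs[i := y] ! j \<in> {e1, e2}"
        proof (cases "j = i")
          case True then show ?thesis using that i Suc.prems(2) by simp
        next
          case False
          then have "Suc i \<le> j" using \<open>i \<le> j\<close> by simp
          then show ?thesis using Suc.prems(4) False \<open>j < n\<close> by simp
        qed
      qed
    qed (use Suc.prems in auto)
    have P1: "P (frag_of (r, xs[i := c \<odot>\<^bsub>M\<^esub> y]))" if "y \<in> {e1, e2}" for c y
    proof (rule cong[OF _ IH[OF that, of "c * r"]], rule span_incl)
      have "y \<in> carrier M" using that e by auto
      then show "frag_of (r, xs[i := c \<odot>\<^bsub>M\<^esub> y]) - frag_of (c * r, xs[i := y]) \<in> sym_relations ?F n M"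
        unfolding sym_relations_def using g i
        by - (rule UnI1, rule UnI2, intro CollectI exI[of _ r] exI[of _ xs] exI[of _ i] exI[of _ c] exI[of _ y], simp)
    qed
    have "frag_of (r, xs[i := \<alpha> \<odot>\<^bsub>M\<^esub> e1 \<oplus>\<^bsub>M\<^esub> \<beta> \<odot>\<^bsub>M\<^esub> e2]) - frag_of (r, xs[i := \<alpha> \<odot>\<^bsub>M\<^esub> e1])
        - frag_of (r, xs[i := \<beta> \<odot>\<^bsub>M\<^esub> e2]) \<in> sym_relations ?F n M" unfolding sym_relations_def using g i D(8) e
      by - (rule UnI1, rule UnI1, rule UnI2, intro CollectI exI[of _ r] exI[of _ xs] exI[of _ i]
          exI[of _ "\<alpha> \<odot>\<^bsub>M\<^esub> e1"] exI[of _ "\<beta> \<odot>\<^bsub>M\<^esub> e2"], simp)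
    then have "frag_of (r, xs) - (frag_of (r, xs[i := \<alpha> \<odot>\<^bsub>M\<^esub> e1]) + frag_of (r, xs[i := \<beta> \<odot>\<^bsub>M\<^esub> e2]))
        \<in> span_rel (sym_generators ?F n M) (sym_relations ?F n M)" unfolding x[symmetric] list_update_id diff_diff_add by (rule span_incl)
    then show ?case by (rule cong) (intro add P1; simp)
  qed
  from this[of n xs r] gen show ?thesis by (auto simp: sym_generators_def)
qed

text \<open>The right inverse \<open>m'\<close> guarantees that the image of a coset is again a
  coset; after that only the effect of \<open>m\<close> on the values of generators matters.\<close>

lemma presented_action:
  fixes f :: "'s \<Rightarrow> 'f::field fps"
  assumes "presentation S E" and kill: "\<And>e. e \<in> E \<Longrightarrow> zlift f e = 0"
    and m: "\<And>s. s \<in> S \<Longrightarrow> m s \<in> S" "\<And>s. s \<in> S \<Longrightarrow> m' s \<in> S" "\<And>s. s \<in> S \<Longrightarrow> m (m' s) = s"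
    and E: "\<And>e. e \<in> E \<Longrightarrow> gen_map m e \<in> E"
      "\<And>e. e \<in> E \<Longrightarrow> gen_map m' e \<in> E"
    and \<beta>: "\<And>w w'. \<beta> (w - w') = \<beta> w - \<beta> w'" "\<And>s. s \<in> S \<Longrightarrow> f (m s) = \<beta> (f s)"
    and A: "A \<in> carrier (presented_module S E act)"
  shows "gen_map m ` A \<in> carrier (presented_module S E act)"
    and "class_lift f (gen_map m ` A) = \<beta> (class_lift f A)"
proof -
  interpret presentation S E by fact
  obtain c where c: "A = rel_class S E c" "supp c \<subseteq> S" using A by (auto simp: presented_carrier)
  have im: "gen_map m ` A = rel_class S E (gen_map m c)" unfolding c by (rule image_rel_class[where m' = m']) (use assms(1) m E span_incl in auto)
  show "gen_map m ` A \<in> carrier (presented_module S E act)"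
    unfolding im presented_carrier using keys_frag_extend_of[OF c(2) m(1)] by (intro imageI) simp
  have cl: "class_lift f (rel_class S E d) = zlift f d" for d by (rule class_lift_class) (rule kill)
  have \<beta>0: "\<beta> 0 = 0" using \<beta>(1)[of 0 0] by simp
  have "zlift f (gen_map m c) = \<beta> (zlift f c)" by (rule frag_induction[OF c(2)]) (simp_all add: frag_extend_diff \<beta> \<beta>0)
  then show "class_lift f (gen_map m ` A) = \<beta> (class_lift f A)" unfolding im unfolding c cl .
qed

lemma is_rep_inverse:
  assumes "is_rep G R (M, a)" "trans_group G" "g \<in> G"
  obtains h where "h \<in> G" "g \<circ> h = id" "\<And>x. x \<in> carrier M \<Longrightarrow> a g (a h x) = x"
proof -
  obtain h where h: "h \<in> G" "g \<circ> h = id" using assms(2,3) unfolding trans_group_def by blast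
  have "a g (a h x) = x" if "x \<in> carrier M" for x
  proof -
    have "a (g \<circ> h) x = a g (a h x)" "a id x = x" using assms(1,3) h(1) that by (auto simp: is_rep_def)
    then show ?thesis using h(2) by simp
  qed
  then show ?thesis using that h by blast
qed

lemma sym_relations_map:
  fixes M :: "('f::field, 'm) module"
  assumes rep: "is_rep G ground (M, a)" and g: "g \<in> G"
    and e: "e \<in> sym_relations (ground :: 'f ring) n M"
  shows "gen_map (map_prod id (map (a g))) e \<in> sym_relations ground n M"
proof -
  let ?F = "ground :: 'f ring"
  let ?S = "sym_generators ?F n M"
  have a: "a g x \<in> carrier M" "a g (x \<oplus>\<^bsub>M\<^esub> y) = a g x \<oplus>\<^bsub>M\<^esub> a g y" "a g (c \<odot>\<^bsub>M\<^esub> x) = c \<odot>\<^bsub>M\<^esub> a g x"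
    if "x \<in> carrier M" "y \<in> carrier M" for x y c using rep g that by (auto simp: is_rep_def)
  have S: "(r, map (a g) xs) \<in> ?S" if "(r, xs) \<in> ?S" for r xs using that a by (auto simp: sym_generators_def)
  from e consider
      (1) r r' xs where "(r, xs) \<in> ?S" "e = frag_of (r + r', xs) - frag_of (r, xs) - frag_of (r', xs)"
    | (2) r xs i x y where "(r, xs) \<in> ?S" "i < n" "x \<in> carrier M" "y \<in> carrier M"
        "e = frag_of (r, xs[i := x \<oplus>\<^bsub>M\<^esub> y]) - frag_of (r, xs[i := x]) - frag_of (r, xs[i := y])"
    | (3) r xs i c x where "(r, xs) \<in> ?S" "i < n" "x \<in> carrier M"
        "e = frag_of (r, xs[i := c \<odot>\<^bsub>M\<^esub> x]) - frag_of (c * r, xs[i := x])"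
    | (4) r xs ys where "(r, xs) \<in> ?S" "mset ys = mset xs" "e = frag_of (r, xs) - frag_of (r, ys)" unfolding sym_relations_def by fastforce
  then show ?thesis
  proof cases
    case 1
    show ?thesis unfolding sym_relations_def by (rule UnI1, rule UnI1, rule UnI1, rule CollectI, rule exI[of _ r], rule exI[of _ r'],
          rule exI[of _ "map (a g) xs"]) (use S 1 in \<open>simp add: frag_extend_diff\<close>)
  next
    case 2
    show ?thesis unfolding sym_relations_def by (rule UnI1, rule UnI1, rule UnI2, rule CollectI, rule exI[of _ r], rule exI[of _ "map (a g) xs"],
          rule exI[of _ i], rule exI[of _ "a g x"], rule exI[of _ "a g y"])
        (use S 2 a in \<open>simp add: frag_extend_diff map_update\<close>)
  next
    case 3
    show ?thesis unfolding sym_relations_def by (rule UnI1, rule UnI2, rule CollectI, rule exI[of _ r], rule exI[of _ "map (a g) xs"],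
          rule exI[of _ i], rule exI[of _ c], rule exI[of _ "a g x"])
        (use S 3 a in \<open>simp add: frag_extend_diff map_update\<close>)
  next
    case 4
    show ?thesis unfolding sym_relations_def by (rule UnI2, rule CollectI, rule exI[of _ r], rule exI[of _ "map (a g) xs"],
          rule exI[of _ "map (a g) ys"]) (use S 4 in \<open>simp add: frag_extend_diff mset_map\<close>)
  qed
qed

text \<open>Reduces the action on a symmetric power to its effect on the value of a single product
  of vectors.\<close>

lemma rep_sym_fps_model:
  fixes M :: "('f::field, 'm) module"
  assumes li: "fps_lin_iso M \<Phi> W" and rep: "is_rep G ground (M, a)" and G: "trans_group G"
    and sym: "fps_lin_iso (sym_power ground n M) (class_lift (sym_val \<Phi>)) W'"
    and \<beta>: "\<And>g w w'. g \<in> G \<Longrightarrow> \<beta> g (w - w') = \<beta> g w - \<beta> g w'"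
      "\<And>g r xs. g \<in> G \<Longrightarrow> (r, xs) \<in> sym_generators (ground :: 'f ring) n M \<Longrightarrow>
        sym_val \<Phi> (r, map (a g) xs) = \<beta> g (sym_val \<Phi> (r, xs))"
  shows "fps_model G (rep_sym ground n (M, a)) (class_lift (sym_val \<Phi>)) W' \<beta>"
proof -
  let ?F = "ground :: 'f ring"
  have "gen_map (map_prod id (map (a g))) ` A \<in> carrier (sym_power ?F n M) \<and>
      class_lift (sym_val \<Phi>) (gen_map (map_prod id (map (a g))) ` A) = \<beta> g (class_lift (sym_val \<Phi>) A)"
    if g: "g \<in> G" and A: "A \<in> carrier (sym_power ?F n M)" for g A
  proof -
    obtain h where h: "h \<in> G" "g \<circ> h = id" and inv: "\<And>x. x \<in> carrier M \<Longrightarrow> a g (a h x) = x"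
      using is_rep_inverse[OF rep G g] by blast
    have cl: "a g x \<in> carrier M" if "g \<in> G" "x \<in> carrier M" for g x using rep that by (auto simp: is_rep_def)
    have gen: "map_prod id (map (a g)) s \<in> sym_generators ?F n M"
      if "g \<in> G" "s \<in> sym_generators ?F n M" for g s using that(2) cl[OF that(1)] by (auto simp: sym_generators_def subset_iff)
    have "map (a g) (map (a h) xs) = xs" if "set xs \<subseteq> carrier M" for xs using that inv by (induction xs) auto
    then have mm: "map_prod id (map (a g)) (map_prod id (map (a h)) s) = s" if "s \<in> sym_generators ?F n M" for s
      using that by (auto simp: sym_generators_def)
    have b2: "sym_val \<Phi> (map_prod id (map (a g)) s) = \<beta> g (sym_val \<Phi> s)" if "s \<in> sym_generators ?F n M" for s
      using \<beta>(2)[OF g] that by (cases s) simp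
    note act = presented_action[OF sym_presentation[OF li], where f = "sym_val \<Phi>" and \<beta> = "\<beta> g"
        and m' = "map_prod id (map (a h))"]
    show ?thesis unfolding sym_power_def by (rule conjI; rule act, (erule sym_val_kill[OF li] gen[OF g] gen[OF h(1)] mm b2 sym_relations_map[OF rep g]
            sym_relations_map[OF rep h(1)] | rule \<beta>(1)[OF g] A[unfolded sym_power_def])+)
  qed
  then show ?thesis using sym by (simp add: fps_model_def rep_sym_def)
qed

lemma sym_act_rel:
  fixes M :: "('f::field, 'm, 'z) module_scheme"
  assumes "e \<in> sym_relations (ground :: 'f ring) n M"
  shows "gen_map (\<lambda>(r, xs). (c \<otimes>\<^bsub>ground\<^esub> r, xs)) e \<in> sym_relations ground n M"
proof -
  let ?F = "ground :: 'f ring"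
  let ?S = "sym_generators ?F n M"
  have S: "(s, xs) \<in> ?S" if "(r, xs) \<in> ?S" for r s xs using that by (auto simp: sym_generators_def)
  from assms consider
      (1) r r' xs where "(r, xs) \<in> ?S" "e = frag_of (r + r', xs) - frag_of (r, xs) - frag_of (r', xs)"
    | (2) r xs i x y where "(r, xs) \<in> ?S" "i < n" "x \<in> carrier M" "y \<in> carrier M"
        "e = frag_of (r, xs[i := x \<oplus>\<^bsub>M\<^esub> y]) - frag_of (r, xs[i := x]) - frag_of (r, xs[i := y])"
    | (3) r xs i d x where "(r, xs) \<in> ?S" "i < n" "x \<in> carrier M"
        "e = frag_of (r, xs[i := d \<odot>\<^bsub>M\<^esub> x]) - frag_of (d * r, xs[i := x])"
    | (4) r xs ys where "(r, xs) \<in> ?S" "mset ys = mset xs" "e = frag_of (r, xs) - frag_of (r, ys)" unfolding sym_relations_def by fastforce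
  then show ?thesis
  proof cases
    case 1
    show ?thesis unfolding sym_relations_def by (rule UnI1, rule UnI1, rule UnI1, rule CollectI, rule exI[of _ "c * r"], rule exI[of _ "c * r'"],
          rule exI[of _ xs], unfold 1(2)) (use S[OF 1(1)] in \<open>simp add: frag_extend_diff distrib_left\<close>)
  next
    case 2
    show ?thesis unfolding sym_relations_def by (rule UnI1, rule UnI1, rule UnI2, rule CollectI, rule exI[of _ "c * r"], rule exI[of _ xs],
          rule exI[of _ i], rule exI[of _ x], rule exI[of _ y])
        (use S 2 in \<open>simp add: frag_extend_diff\<close>)
  next
    case 3
    show ?thesis unfolding sym_relations_def by (rule UnI1, rule UnI2, rule CollectI, rule exI[of _ "c * r"], rule exI[of _ xs],
          rule exI[of _ i], rule exI[of _ d], rule exI[of _ x])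
        (use S 3 in \<open>simp add: frag_extend_diff mult_ac\<close>)
  next
    case 4
    show ?thesis unfolding sym_relations_def by (rule UnI2, rule CollectI, rule exI[of _ "c * r"], rule exI[of _ xs],
          rule exI[of _ ys]) (use S 4 in \<open>simp add: frag_extend_diff\<close>)
  qed
qed

text \<open>Additivity in the coefficient, applied to \<open>0 + 0 = 0\<close>, collapses to the
  negative of this generator.\<close>

lemma sym_zero_coeff:
  fixes M :: "('f::field, 'm, 'z) module_scheme"
  assumes "(0, xs) \<in> sym_generators (ground :: 'f ring) n M"
  shows "frag_of (0, xs) \<in> span_rel (sym_generators (ground :: 'f ring) n M) (sym_relations ground n M)"
    (is "_ \<in> ?H")
proof -
  have "frag_of (0 + 0, xs) - frag_of (0, xs) - frag_of (0, xs) \<in> sym_relations (ground :: 'f ring) n M" unfolding sym_relations_def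
    by (rule UnI1, rule UnI1, rule UnI1, rule CollectI, rule exI[of _ 0], rule exI[of _ 0], rule exI[of _ xs])
      (use assms in simp)
  then have *: "- frag_of (0, xs) \<in> sym_relations (ground :: 'f ring) n M" by simp
  have "inv\<^bsub>free_Abelian_group (sym_generators (ground :: 'f ring) n M)\<^esub> (- frag_of (0, xs)) \<in> ?H" by (rule generate.inv[OF *])
  moreover have "supp (- frag_of (0 :: 'f, xs)) \<subseteq> sym_generators (ground :: 'f ring) n M" using assms by (simp add: keys_frag_of)
  ultimately show ?thesis by simp
qed

lemma sym_add_coeff:
  fixes M :: "('f::field, 'm, 'z) module_scheme"
  assumes "fps_lin_iso M \<Phi> W" and "(r, xs) \<in> sym_generators (ground :: 'f ring) n M"
  shows "frag_of (r - r', xs) - (frag_of (r, xs) - frag_of (r', xs))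
    \<in> span_rel (sym_generators (ground :: 'f ring) n M) (sym_relations ground n M)"
    (is "_ \<in> ?H")
proof -
  let ?F = "ground :: 'f ring"
  interpret presentation "sym_generators ?F n M" "sym_relations ?F n M" by (rule sym_presentation[OF assms(1)])
  have "frag_of ((r - r') + r', xs) - frag_of (r - r', xs) - frag_of (r', xs) \<in> sym_relations ?F n M" unfolding sym_relations_def
    by (rule UnI1, rule UnI1, rule UnI1, rule CollectI, rule exI[of _ "r - r'"], rule exI[of _ r'], rule exI[of _ xs])
      (use assms in \<open>simp add: sym_generators_def\<close>)
  from span_minus[OF span_incl[OF this]] show ?thesis by (simp add: algebra_simps)
qed

text \<open>For the vector \<open>e\<close> of value 1, the product of \<open>n\<close> copies of
  \<open>e\<close> has value 1 too, so a word is recovered by putting its value in front of that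
  product.\<close>

lemma sym_power_line:
  fixes M :: "('f::field, 'm, 'z) module_scheme"
  assumes li: "fps_lin_iso M \<Phi> scalars"
  shows "fps_lin_iso (sym_power ground n M) (class_lift (sym_val \<Phi>)) scalars"
proof -
  note D = fps_lin_isoD[OF li]
  let ?F = "ground :: 'f ring"
  let ?S = "sym_generators ?F n M" and ?E = "sym_relations ?F n M"
  interpret presentation ?S ?E by (rule sym_presentation[OF li])
  have "fps_const 1 \<in> \<Phi> ` carrier M" unfolding D(3) by blast
  then obtain e where e: "e \<in> carrier M" "\<Phi> e = 1" by auto
  have dec: "\<exists>\<alpha> \<beta>. x = \<alpha> \<odot>\<^bsub>M\<^esub> e \<oplus>\<^bsub>M\<^esub> \<beta> \<odot>\<^bsub>M\<^esub> e" if x: "x \<in> carrier M" for x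
  proof -
    obtain c where c: "\<Phi> x = fps_const c" using x D(3) by blast
    \<comment> \<open>The second coefficient is a dummy 0, since the reduction lemma speaks of two
      spanning vectors.\<close>
    have "x = c \<odot>\<^bsub>M\<^esub> e \<oplus>\<^bsub>M\<^esub> 0 \<odot>\<^bsub>M\<^esub> e"
      by (rule inj_onD[OF D(2)]) (use x e c in \<open>simp_all add: D\<close>)
    then show ?thesis by blast
  qed
  have val: "sym_val \<Phi> (r, replicate n e) = fps_const r" for r by (simp add: sym_val_def e)
  have gen: "(r, replicate n e) \<in> ?S" for r using e by (auto simp: sym_generators_def)
  define nf where "nf w = frag_of (w $ 0, replicate n e)" for w :: "'f fps"
  have nf_diff: "nf (w - w') - (nf w - nf w') \<in> span_rel ?S ?E" for w w' unfolding nf_def using sym_add_coeff[OF li gen] by simp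
  show ?thesis unfolding sym_power_def
  proof (rule presented_fps_lin_iso[where nf = nf])
    fix s assume s: "s \<in> ?S"
    have pl: "\<exists>c. prod_list (map \<Phi> xs) = fps_const c" if "set xs \<subseteq> carrier M" for xs using that
    proof (induction xs)
      case Nil then show ?case by (metis fps_const_1_eq_1 list.simps(8) prod_list.Nil)
    next
      case (Cons x xs)
      moreover obtain c where "\<Phi> x = fps_const c" using Cons.prems D(3) by auto
      ultimately show ?case by (metis fps_const_mult insert_subset list.simps(15) list.simps(9) prod_list.Cons)
    qed
    obtain r xs where rx: "s = (r, xs)" "set xs \<subseteq> carrier M" using s by (auto simp: sym_generators_def)
    obtain c where "prod_list (map \<Phi> xs) = fps_const c" using pl[OF rx(2)] by blast
    then show "sym_val \<Phi> s \<in> scalars" using rx by (simp add: sym_val_def)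
    have "frag_of (r, xs) - nf (zlift (sym_val \<Phi>) (frag_of (r, xs))) \<in> span_rel ?S ?E"
    proof (rule sym_basis_reduction[OF li e(1) e(1) dec, where P = "\<lambda>c. c - nf (zlift (sym_val \<Phi>) c) \<in> span_rel ?S ?E"])
      show "(r, xs) \<in> ?S" using s rx by simp
    next
      fix a b assume a: "a - nf (zlift (sym_val \<Phi>) a) \<in> span_rel ?S ?E" and b: "b - nf (zlift (sym_val \<Phi>) b) \<in> span_rel ?S ?E"
      have "(a - nf (zlift (sym_val \<Phi>) a)) + (b - nf (zlift (sym_val \<Phi>) b)) +
          (nf (zlift (sym_val \<Phi>) (a + b) - zlift (sym_val \<Phi>) b) - (nf (zlift (sym_val \<Phi>) (a + b)) - nf (zlift (sym_val \<Phi>) b)))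
          \<in> span_rel ?S ?E" by (rule span_add[OF span_add[OF a b] nf_diff])
      then show "a + b - nf (zlift (sym_val \<Phi>) (a + b)) \<in> span_rel ?S ?E" by (simp add: algebra_simps)
    next
      fix a b assume ab: "a - b \<in> span_rel ?S ?E" and b: "b - nf (zlift (sym_val \<Phi>) b) \<in> span_rel ?S ?E"
      have "zlift (sym_val \<Phi>) a = zlift (sym_val \<Phi>) b"
        by (rule zlift_class[of _ _ b]) (use sym_val_kill[OF li] ab in \<open>auto simp: mem_class_iff\<close>)
      then show "a - nf (zlift (sym_val \<Phi>) a) \<in> span_rel ?S ?E" using span_add[OF ab b] by simp
    next
      fix r and xs :: "'m list" assume "length xs = n" "set xs \<subseteq> {e, e}"
      then have "xs = replicate n e" by (metis insert_absorb2 replicate_length_same singletonD subsetD)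
      then show "frag_of (r, xs) - nf (zlift (sym_val \<Phi>) (frag_of (r, xs))) \<in> span_rel ?S ?E" by (simp add: nf_def val span_0)
    qed
    then show "frag_of s - nf (sym_val \<Phi> s) \<in> span_rel ?S ?E" using rx by simp
  next
    fix w :: "'f fps" assume "w \<in> scalars"
    then show "zlift (sym_val \<Phi>) (nf w) = w" by (auto simp: nf_def val)
    show "supp (nf w) \<subseteq> ?S" using gen by (simp add: nf_def keys_frag_of)
  next
    fix w w' :: "'f fps" assume "w \<in> scalars" "w' \<in> scalars"
    then show "w - w' \<in> scalars" by auto
  next
    fix r :: 'f and s assume "s \<in> ?S"
    then show "(case s of (ra, xs) \<Rightarrow> (r \<otimes>\<^bsub>?F\<^esub> ra, xs)) \<in> ?S"
      "sym_val \<Phi> (case s of (ra, xs) \<Rightarrow> (r \<otimes>\<^bsub>?F\<^esub> ra, xs)) = fps_const r * sym_val \<Phi> s"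
      by (auto simp: sym_generators_def sym_val_def mult_ac simp flip: fps_const_mult)
  next
    show "0 \<in> range (fps_const :: 'f \<Rightarrow> 'f fps)" by (metis fps_const_0_eq_0 rangeI)
  qed (use sym_val_kill[OF li] nf_diff in \<open>auto intro!: span_incl simp: sym_act_rel[simplified]\<close>)
qed

lemma lin_act_line:
  assumes "\<chi> id = (1::'f::field)" "\<And>g h. g \<in> G \<Longrightarrow> h \<in> G \<Longrightarrow> \<chi> (g \<circ> h) = \<chi> g * \<chi> h"
  shows "lin_act G W (\<lambda>g w. fps_const (\<chi> g) * w)"
  using assms by (auto simp: lin_act_def algebra_simps simp flip: fps_const_mult)

lemma line_model_sym:
  fixes M :: "('f::field, 'm) module"
  assumes m: "fps_model G (M, a) \<Phi> scalars (\<lambda>g w. fps_const (\<chi> g) * w)"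
    and \<chi>: "\<chi> id = 1" "\<And>g h. g \<in> G \<Longrightarrow> h \<in> G \<Longrightarrow> \<chi> (g \<circ> h) = \<chi> g * \<chi> h" and G: "trans_group G"
  shows "fps_model G (rep_sym ground n (M, a)) (class_lift (sym_val \<Phi>)) scalars
    (\<lambda>g w. fps_const (\<chi> g ^ n) * w)"
proof -
  have li: "fps_lin_iso M \<Phi> scalars"
    and ac: "\<And>g x. g \<in> G \<Longrightarrow> x \<in> carrier M \<Longrightarrow> \<Phi> (a g x) = fps_const (\<chi> g) * \<Phi> x"
    using m by (auto simp: fps_model_def)
  have pr: "prod_list (map \<Phi> (map (a g) xs)) = fps_const (\<chi> g ^ length xs) * prod_list (map \<Phi> xs)"
    if "g \<in> G" "set xs \<subseteq> carrier M" for g xs using that(2) by (induction xs) (simp_all add: ac[OF that(1)] mult_ac flip: fps_const_mult)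
  show ?thesis
  proof (rule rep_sym_fps_model[OF li fps_model_is_rep[OF m lin_act_line[OF \<chi>] G] G sym_power_line[OF li]])
    fix g r and xs :: "'m list"
    assume "g \<in> G" "(r, xs) \<in> sym_generators (ground :: 'f ring) n M"
    then show "sym_val \<Phi> (r, map (a g) xs) = fps_const (\<chi> g ^ n) * sym_val \<Phi> (r, xs)"
      using pr[of g xs] unfolding sym_generators_def sym_val_def by (auto simp: mult_ac)
  qed (simp_all only: right_diff_distrib)
qed

lemma is_repD:
  assumes "is_rep G R (M, a)" "g \<in> G" "x \<in> carrier M"
  shows "a g x \<in> carrier M" "y \<in> carrier M \<Longrightarrow> a g (x \<oplus>\<^bsub>M\<^esub> y) = a g x \<oplus>\<^bsub>M\<^esub> a g y"
    "r \<in> carrier R \<Longrightarrow> a g (r \<odot>\<^bsub>M\<^esub> x) = r \<odot>\<^bsub>M\<^esub> a g x"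
    "a id x = x" "h \<in> G \<Longrightarrow> a (g \<circ> h) x = a g (a h x)"
  using assms by (auto simp: is_rep_def)

definition polys_upto :: "nat \<Rightarrow> 'f::zero fps set" where
  "polys_upto n = {w. \<forall>i>n. w $ i = 0}"

lemma polys_upto_sum:
  "w \<in> polys_upto n \<Longrightarrow> w = (\<Sum>j\<le>n. fps_const (w $ j) * fps_X ^ j)" for w :: "'f::comm_ring_1 fps"
  by (rule fps_ext) (auto simp: polys_upto_def fps_sum_nth if_distrib[of "(*) _"] cong: if_cong)

text \<open>With \<open>u\<close> of value \<open>fps_X\<close> and \<open>v\<close> of value 1, the
  monomial with \<open>j\<close> factors \<open>u\<close> has value \<open>fps_X ^ j\<close>.
  Different monomials thus have independent values, and the coefficients of a polynomial dictate the
  normal form.\<close>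

lemma sym_power_plane:
  fixes M :: "('f::field, 'm, 'z) module_scheme"
  assumes li: "fps_lin_iso M \<Phi> (polys_upto 1)"
  shows "fps_lin_iso (sym_power ground n M) (class_lift (sym_val \<Phi>)) (polys_upto n)"
proof -
  note D = fps_lin_isoD[OF li]
  let ?F = "ground :: 'f ring"
  let ?S = "sym_generators ?F n M" and ?E = "sym_relations ?F n M"
  interpret presentation ?S ?E by (rule sym_presentation[OF li])
  have "fps_X \<in> \<Phi> ` carrier M" "1 \<in> \<Phi> ` carrier M" unfolding D(3) by (auto simp: polys_upto_def fps_X_def)
  then obtain u v where u: "u \<in> carrier M" "\<Phi> u = fps_X" and v: "v \<in> carrier M" "\<Phi> v = 1" by force
  have dec: "\<exists>\<alpha> \<beta>. x = \<alpha> \<odot>\<^bsub>M\<^esub> u \<oplus>\<^bsub>M\<^esub> \<beta> \<odot>\<^bsub>M\<^esub> v" if x: "x \<in> carrier M" for x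
  proof (intro exI)
    have "\<Phi> x \<in> polys_upto 1" using x D(3) by blast
    then have "\<Phi> x = fps_const (\<Phi> x $ 1) * fps_X + fps_const (\<Phi> x $ 0)" by (subst polys_upto_sum[of _ 1]) (simp_all add: mult.commute)
    then show "x = (\<Phi> x $ 1) \<odot>\<^bsub>M\<^esub> u \<oplus>\<^bsub>M\<^esub> (\<Phi> x $ 0) \<odot>\<^bsub>M\<^esub> v"
      by (intro inj_onD[OF D(2)]) (use x u v in \<open>simp_all add: D\<close>)
  qed
  define ws where "ws j = replicate j u @ replicate (n - j) v" for j
  have val: "sym_val \<Phi> (r, ws j) = fps_const r * fps_X ^ j" for r j by (simp add: sym_val_def ws_def u v)
  have gen: "(r, ws j) \<in> ?S" if "j \<le> n" for r j using u v that by (auto simp: sym_generators_def ws_def)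
  define nf where "nf w = (\<Sum>j\<le>n. frag_of (w $ j, ws j))" for w :: "'f fps"
  have nf_diff: "nf (w - w') - (nf w - nf w') \<in> span_rel ?S ?E" for w w'
    unfolding nf_def sum_subtractf[symmetric] using sym_add_coeff[OF li gen] by (intro span_sum) simp
  show ?thesis unfolding sym_power_def
  proof (rule presented_fps_lin_iso[where nf = nf])
    fix s assume s: "s \<in> ?S"
    have pl: "prod_list (map \<Phi> xs) \<in> polys_upto (length xs)" if "set xs \<subseteq> carrier M" for xs using that
    proof (induction xs)
      case Nil then show ?case by (simp add: polys_upto_def)
    next
      case (Cons x xs)
      have x: "\<Phi> x \<in> polys_upto 1" using Cons.prems D(3) by auto
      have p: "prod_list (map \<Phi> xs) \<in> polys_upto (length xs)" using Cons by simp
      have "(\<Phi> x * prod_list (map \<Phi> xs)) $ i = 0" if i: "i > Suc (length xs)" for i unfolding fps_mult_nth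
      proof (rule sum.neutral, intro ballI)
        fix j assume "j \<in> {0..i}"
        then show "\<Phi> x $ j * prod_list (map \<Phi> xs) $ (i - j) = 0" using x p i by (cases "j > 1") (auto simp: polys_upto_def)
      qed
      then show ?case by (simp add: polys_upto_def)
    qed
    obtain r xs where rx: "s = (r, xs)" "set xs \<subseteq> carrier M" "length xs = n" using s by (auto simp: sym_generators_def)
    show "sym_val \<Phi> s \<in> polys_upto n" using pl[OF rx(2)] rx by (simp add: sym_val_def polys_upto_def)
    have "frag_of (r, xs) - nf (zlift (sym_val \<Phi>) (frag_of (r, xs))) \<in> span_rel ?S ?E"
    proof (rule sym_basis_reduction[OF li u(1) v(1) dec, where P = "\<lambda>c. c - nf (zlift (sym_val \<Phi>) c) \<in> span_rel ?S ?E"])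
      show "(r, xs) \<in> ?S" using s rx by simp
    next
      fix a b assume a: "a - nf (zlift (sym_val \<Phi>) a) \<in> span_rel ?S ?E" and b: "b - nf (zlift (sym_val \<Phi>) b) \<in> span_rel ?S ?E"
      have "(a - nf (zlift (sym_val \<Phi>) a)) + (b - nf (zlift (sym_val \<Phi>) b)) +
          (nf (zlift (sym_val \<Phi>) (a + b) - zlift (sym_val \<Phi>) b) - (nf (zlift (sym_val \<Phi>) (a + b)) - nf (zlift (sym_val \<Phi>) b)))
          \<in> span_rel ?S ?E" by (rule span_add[OF span_add[OF a b] nf_diff])
      then show "a + b - nf (zlift (sym_val \<Phi>) (a + b)) \<in> span_rel ?S ?E" by (simp add: algebra_simps)
    next
      fix a b assume ab: "a - b \<in> span_rel ?S ?E" and b: "b - nf (zlift (sym_val \<Phi>) b) \<in> span_rel ?S ?E"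
      have "zlift (sym_val \<Phi>) a = zlift (sym_val \<Phi>) b"
        by (rule zlift_class[of _ _ b]) (use sym_val_kill[OF li] ab in \<open>auto simp: mem_class_iff\<close>)
      then show "a - nf (zlift (sym_val \<Phi>) a) \<in> span_rel ?S ?E" using span_add[OF ab b] by simp
    next
      fix r and xs :: "'m list" assume xs: "length xs = n" "set xs \<subseteq> {u, v}"
      \<comment> \<open>Up to order, which the relations ignore, a list over \<open>{u, v}\<close>
        is determined by its number of entries \<open>u\<close>.\<close>
      define j where "j = count (mset xs) u"
      have uv: "u \<noteq> v" using u v by auto
      have j: "j \<le> n" unfolding j_def using xs(1) count_le_length[of xs u] by (simp add: count_mset)
      have "mset xs = replicate_mset j u + replicate_mset (length xs - j) v" unfolding j_def using xs(2)
      proof (induction xs)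
        case (Cons x xs)
        have "count (mset xs) u \<le> length xs" by (simp add: count_mset count_le_length)
        then show ?case using Cons uv by (auto simp: Suc_diff_le)
      qed simp
      then have ms: "mset xs = mset (ws j)" using xs(1) by (simp add: ws_def)
      have g: "(r, xs) \<in> ?S" using xs u v by (auto simp: sym_generators_def)
      have "frag_of (r, xs) - frag_of (r, ws j) \<in> ?E" unfolding sym_relations_def
        by (rule UnI2, intro CollectI exI[of _ r] exI[of _ xs] exI[of _ "ws j"]) (use g ms in simp)
      then have "frag_of (r, xs) - frag_of (r, ws j) \<in> span_rel ?S ?E" by (rule span_incl)
      moreover have "sym_val \<Phi> (r, xs) = fps_const r * fps_X ^ j"
        using val[of r j] ms unfolding sym_val_def by (metis (no_types, lifting) case_prod_conv mset_map prod_mset_prod_list)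
      \<comment> \<open>The normal form lists all \<open>n + 1\<close> monomials, also those with
        coefficient 0; the latter are consequences of the relations and drop out.\<close>
      moreover have "nf (fps_const r * fps_X ^ j) - frag_of (r, ws j) \<in> span_rel ?S ?E"
      proof -
        have "nf (fps_const r * fps_X ^ j) = frag_of (r, ws j) + (\<Sum>i\<in>{..n} - {j}. frag_of (0, ws i))" unfolding nf_def using j
          by (subst sum.remove[of _ j]) (auto intro!: sum.cong)
        moreover have "(\<Sum>i\<in>{..n} - {j}. frag_of (0, ws i)) \<in> span_rel ?S ?E" by (intro span_sum sym_zero_coeff gen) simp
        ultimately show ?thesis by simp
      qed
      ultimately show "frag_of (r, xs) - nf (zlift (sym_val \<Phi>) (frag_of (r, xs))) \<in> span_rel ?S ?E"
        using span_diff[of "frag_of (r, xs) - frag_of (r, ws j)" "nf (fps_const r * fps_X ^ j) - frag_of (r, ws j)"] by simp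
    qed
    then show "frag_of s - nf (sym_val \<Phi> s) \<in> span_rel ?S ?E" using rx by simp
  next
    fix w :: "'f fps" assume "w \<in> polys_upto n"
    then show "zlift (sym_val \<Phi>) (nf w) = w" using polys_upto_sum[of w n] by (simp add: nf_def val)
    have "supp (nf w) \<subseteq> (\<Union>j\<le>n. supp (frag_of (w $ j, ws j)))" unfolding nf_def by (rule keys_sum)
    then show "supp (nf w) \<subseteq> ?S" using gen by (fastforce simp: keys_frag_of)
  next
    fix w w' :: "'f fps" assume "w \<in> polys_upto n" "w' \<in> polys_upto n"
    then show "w - w' \<in> polys_upto n" by (auto simp: polys_upto_def)
  next
    fix r :: 'f and s assume "s \<in> ?S"
    then show "(case s of (ra, xs) \<Rightarrow> (r \<otimes>\<^bsub>?F\<^esub> ra, xs)) \<in> ?S"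
      "sym_val \<Phi> (case s of (ra, xs) \<Rightarrow> (r \<otimes>\<^bsub>?F\<^esub> ra, xs)) = fps_const r * sym_val \<Phi> s"
      by (auto simp: sym_generators_def sym_val_def mult_ac simp flip: fps_const_mult)
  qed (use sym_val_kill[OF li] nf_diff in \<open>auto intro!: span_incl simp: sym_act_rel[simplified] polys_upto_def\<close>)
qed

section \<open>Tensor products with a line, and the dual of a line\<close>

lemma tensor_relations_cases [consumes 1, case_names left right bal]:
  assumes "e \<in> tensor_relations R M N"
  obtains x x' y where "x \<in> carrier M" "x' \<in> carrier M" "y \<in> carrier N"
      "e = frag_of (x \<oplus>\<^bsub>M\<^esub> x', y) - frag_of (x, y) - frag_of (x', y)"
  | x y y' where "x \<in> carrier M" "y \<in> carrier N" "y' \<in> carrier N"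
      "e = frag_of (x, y \<oplus>\<^bsub>N\<^esub> y') - frag_of (x, y) - frag_of (x, y')"
  | r x y where "r \<in> carrier R" "x \<in> carrier M" "y \<in> carrier N"
      "e = frag_of (r \<odot>\<^bsub>M\<^esub> x, y) - frag_of (x, r \<odot>\<^bsub>N\<^esub> y)"
  using assms unfolding tensor_relations_def by blast

lemma tensor_relationsI:
  "x \<in> carrier M \<Longrightarrow> x' \<in> carrier M \<Longrightarrow> y \<in> carrier N \<Longrightarrow>
     frag_of (x \<oplus>\<^bsub>M\<^esub> x', y) - frag_of (x, y) - frag_of (x', y) \<in> tensor_relations R M N"
  "x \<in> carrier M \<Longrightarrow> y \<in> carrier N \<Longrightarrow> y' \<in> carrier N \<Longrightarrow>
     frag_of (x, y \<oplus>\<^bsub>N\<^esub> y') - frag_of (x, y) - frag_of (x, y') \<in> tensor_relations R M N"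
  "r \<in> carrier R \<Longrightarrow> x \<in> carrier M \<Longrightarrow> y \<in> carrier N \<Longrightarrow>
     frag_of (r \<odot>\<^bsub>M\<^esub> x, y) - frag_of (x, r \<odot>\<^bsub>N\<^esub> y) \<in> tensor_relations R M N"
  unfolding tensor_relations_def by blast+

lemma tensor_presentation:
  assumes "\<And>x y. x \<in> carrier M \<Longrightarrow> y \<in> carrier M \<Longrightarrow> x \<oplus>\<^bsub>M\<^esub> y \<in> carrier M"
    and "\<And>x y. x \<in> carrier N \<Longrightarrow> y \<in> carrier N \<Longrightarrow> x \<oplus>\<^bsub>N\<^esub> y \<in> carrier N"
    and "\<And>r x. r \<in> carrier R \<Longrightarrow> x \<in> carrier M \<Longrightarrow> r \<odot>\<^bsub>M\<^esub> x \<in> carrier M"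
    and "\<And>r x. r \<in> carrier R \<Longrightarrow> x \<in> carrier N \<Longrightarrow> r \<odot>\<^bsub>N\<^esub> x \<in> carrier N"
  shows "presentation (carrier M \<times> carrier N) (tensor_relations R M N)"
proof
  fix e assume "e \<in> tensor_relations R M N"
  then show "supp e \<subseteq> carrier M \<times> carrier N" by (cases rule: tensor_relations_cases)
      (simp, rule order_trans[OF keys_diff3] order_trans[OF keys_diff2], simp add: assms)+
qed

text \<open>The map \<open>\<rho>\<close> says how scalars act on values. Over the ground field it
  is \<open>fps_const\<close>; over a local ring of the projective line it will be the expansion of
  a pulled back germ.\<close>

lemma tensor_val_kill:
  assumes e: "e \<in> tensor_relations R M N"
    and M: "\<And>x y. x \<in> carrier M \<Longrightarrow> y \<in> carrier M \<Longrightarrow> \<Phi> (x \<oplus>\<^bsub>M\<^esub> y) = \<Phi> x + \<Phi> y"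
      "\<And>r x. r \<in> carrier R \<Longrightarrow> x \<in> carrier M \<Longrightarrow> \<Phi> (r \<odot>\<^bsub>M\<^esub> x) = \<rho> r * \<Phi> x"
    and N: "\<And>x y. x \<in> carrier N \<Longrightarrow> y \<in> carrier N \<Longrightarrow> \<Psi> (x \<oplus>\<^bsub>N\<^esub> y) = \<Psi> x + \<Psi> y"
      "\<And>r x. r \<in> carrier R \<Longrightarrow> x \<in> carrier N \<Longrightarrow> \<Psi> (r \<odot>\<^bsub>N\<^esub> x) = \<rho> r * \<Psi> x"
  shows "zlift (\<lambda>(x, y). \<Phi> x * \<Psi> y :: 'w::comm_ring_1) e = 0"
  using e by (cases rule: tensor_relations_cases) (simp_all add: M N distrib_left distrib_right mult_ac)

text \<open>Allowing a change of rings along \<open>\<rho>\<close> covers linear maps, with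
  \<open>\<rho> = id\<close>, as well as the maps between stalks at different points that an
  automorphism induces.\<close>

lemma tensor_relations_map:
  assumes e: "e \<in> tensor_relations R M N"
    and \<rho>: "\<And>r. r \<in> carrier R \<Longrightarrow> \<rho> r \<in> carrier R'"
    and M: "\<And>x. x \<in> carrier M \<Longrightarrow> \<Phi> x \<in> carrier M'"
      "\<And>x y. x \<in> carrier M \<Longrightarrow> y \<in> carrier M \<Longrightarrow> \<Phi> (x \<oplus>\<^bsub>M\<^esub> y) = \<Phi> x \<oplus>\<^bsub>M'\<^esub> \<Phi> y"
      "\<And>r x. r \<in> carrier R \<Longrightarrow> x \<in> carrier M \<Longrightarrow> \<Phi> (r \<odot>\<^bsub>M\<^esub> x) = \<rho> r \<odot>\<^bsub>M'\<^esub> \<Phi> x"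
    and N: "\<And>x. x \<in> carrier N \<Longrightarrow> \<Psi> x \<in> carrier N'"
      "\<And>x y. x \<in> carrier N \<Longrightarrow> y \<in> carrier N \<Longrightarrow> \<Psi> (x \<oplus>\<^bsub>N\<^esub> y) = \<Psi> x \<oplus>\<^bsub>N'\<^esub> \<Psi> y"
      "\<And>r x. r \<in> carrier R \<Longrightarrow> x \<in> carrier N \<Longrightarrow> \<Psi> (r \<odot>\<^bsub>N\<^esub> x) = \<rho> r \<odot>\<^bsub>N'\<^esub> \<Psi> x"
  shows "gen_map (map_prod \<Phi> \<Psi>) e \<in> tensor_relations R' M' N'"
  using e by (cases rule: tensor_relations_cases)
    (simp_all add: frag_extend_diff M N \<rho> tensor_relationsI)

text \<open>Scalars move across the tensor sign, so every element is \<open>e\<close> tensored with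
  some \<open>y\<close>, for the vector \<open>e\<close> of value 1. The picture of the second
  factor is thereby that of the product, and the character of the line enters as a factor.\<close>

lemma rep_tensor_line:
  fixes M :: "('f::field, 'm) module" and N :: "('f, 'n) module"
  assumes m: "fps_model G (M, a) \<Phi> scalars (\<lambda>g w. fps_const (\<chi> g) * w)"
    and \<chi>: "\<chi> id = 1" "\<And>g h. g \<in> G \<Longrightarrow> h \<in> G \<Longrightarrow> \<chi> (g \<circ> h) = \<chi> g * \<chi> h" and G: "trans_group G"
    and n: "fps_model G (N, b) \<Psi> W \<beta>" and \<beta>: "lin_act G W \<beta>" "\<And>g w w'. g \<in> G \<Longrightarrow> \<beta> g (w - w') = \<beta> g w - \<beta> g w'"
      "\<And>g c w. g \<in> G \<Longrightarrow> \<beta> g (fps_const c * w) = fps_const c * \<beta> g w"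
  shows "fps_model G (rep_tensor ground (M, a) (N, b)) (class_lift (\<lambda>(x, y). \<Phi> x * \<Psi> y)) W
    (\<lambda>g w. fps_const (\<chi> g) * \<beta> g w)"
proof -
  let ?F = "ground :: 'f ring"
  let ?S = "carrier M \<times> carrier N" and ?E = "tensor_relations ?F M N"
  let ?f = "\<lambda>(x, y). \<Phi> x * \<Psi> y"
  have li: "fps_lin_iso M \<Phi> scalars" "fps_lin_iso N \<Psi> W"
    and ac: "\<And>g x. g \<in> G \<Longrightarrow> x \<in> carrier M \<Longrightarrow> \<Phi> (a g x) = fps_const (\<chi> g) * \<Phi> x"
      "\<And>g x. g \<in> G \<Longrightarrow> x \<in> carrier N \<Longrightarrow> \<Psi> (b g x) = \<beta> g (\<Psi> x)"
    using m n by (auto simp: fps_model_def)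
  note D = fps_lin_isoD[OF li(1)] and D' = fps_lin_isoD[OF li(2)]
  have repM: "is_rep G ?F (M, a)" by (rule fps_model_is_rep[OF m lin_act_line G]) (use \<chi> in auto)
  have repN: "is_rep G ?F (N, b)" by (rule fps_model_is_rep[OF n \<beta>(1) G])
  have pres: "presentation ?S ?E" by (rule tensor_presentation) (auto simp: D D')
  interpret presentation ?S ?E by (rule pres)
  have kill: "zlift ?f e = 0" if "e \<in> ?E" for e using that by (rule tensor_val_kill[where \<rho> = fps_const]) (auto simp: D D')
  have "fps_const 1 \<in> \<Phi> ` carrier M" unfolding D(3) by blast
  then obtain e where e: "e \<in> carrier M" "\<Phi> e = 1" by auto
  define iv where "iv = inv_into (carrier N) \<Psi>"
  have iv: "iv w \<in> carrier N" "\<Psi> (iv w) = w" if "w \<in> W" for w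
    using that D'(3) unfolding iv_def by (auto intro: inv_into_into f_inv_into_f)
  have Wd: "w - w' \<in> W" if w: "w \<in> W" "w' \<in> W" for w w'
  proof -
    have "\<Psi> (iv w \<oplus>\<^bsub>N\<^esub> (-1) \<odot>\<^bsub>N\<^esub> iv w') = w + fps_const (-1) * w'"
      using iv[OF w(1)] iv[OF w(2)] by (simp add: D')
    also have "\<dots> = w - w'" by (simp flip: fps_const_neg)
    finally show ?thesis using iv[OF w(1)] iv[OF w(2)] D' by (metis image_eqI)
  qed
  define nf where "nf w = frag_of (e, iv w)" for w
  have "fps_lin_iso (presented_module ?S ?E (\<lambda>r (x, y). (r \<odot>\<^bsub>M\<^esub> x, y))) (class_lift ?f) W"
  proof (rule presented_fps_lin_iso[where nf = nf])
    show "0 \<in> W" using D' by (metis image_eqI)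
    fix s assume s: "s \<in> ?S"
    then obtain x y c where xy: "s = (x, y)" "x \<in> carrier M" "y \<in> carrier N" "\<Phi> x = fps_const c" using D(3) by blast
    have "x = c \<odot>\<^bsub>M\<^esub> e" by (rule inj_onD[OF D(2)]) (use xy e in \<open>simp_all add: D\<close>)
    moreover have f: "?f s = \<Psi> (c \<odot>\<^bsub>N\<^esub> y)" using xy by (simp add: D')
    moreover have "iv (\<Psi> (c \<odot>\<^bsub>N\<^esub> y)) = c \<odot>\<^bsub>N\<^esub> y"
      unfolding iv_def by (rule inv_into_f_f[OF D'(2)]) (simp add: D' xy)
    ultimately show "frag_of s - nf (?f s) \<in> span_rel ?S ?E"
      unfolding nf_def xy(1) using tensor_relationsI(3)[of c ?F e M y N] e xy by (intro span_incl) simp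
    show "?f s \<in> W" unfolding f using D' xy by blast
  next
    fix w w' assume w: "w \<in> W" "w' \<in> W"
    have "iv w = iv (w - w') \<oplus>\<^bsub>N\<^esub> iv w'"
      by (rule inj_onD[OF D'(2)]) (use iv[OF w(1)] iv[OF w(2)] iv[OF Wd[OF w]] in \<open>simp_all add: D'\<close>)
    then have "nf w - nf (w - w') - nf w' \<in> span_rel ?S ?E"
      unfolding nf_def using tensor_relationsI(2)[of e M "iv (w - w')" N "iv w'" ?F] e iv[OF w(2)] iv[OF Wd[OF w]] by (intro span_incl) simp
    from span_minus[OF this] show "nf (w - w') - (nf w - nf w') \<in> span_rel ?S ?E" by (simp add: algebra_simps)
  next
    fix r e assume "e \<in> ?E"
    then have "gen_map (map_prod (\<lambda>x. r \<odot>\<^bsub>M\<^esub> x) id) e \<in> ?E"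
    proof (rule tensor_relations_map[where \<rho> = id])
      fix x y assume "x \<in> carrier M" "y \<in> carrier M"
      then show "r \<odot>\<^bsub>M\<^esub> (x \<oplus>\<^bsub>M\<^esub> y) = r \<odot>\<^bsub>M\<^esub> x \<oplus>\<^bsub>M\<^esub> r \<odot>\<^bsub>M\<^esub> y"
        by (intro inj_onD[OF D(2)]) (simp_all add: D distrib_left)
    next
      fix c x assume "x \<in> carrier M"
      then show "r \<odot>\<^bsub>M\<^esub> (c \<odot>\<^bsub>M\<^esub> x) = id c \<odot>\<^bsub>M\<^esub> (r \<odot>\<^bsub>M\<^esub> x)"
        by (intro inj_onD[OF D(2)]) (simp_all add: D mult_ac)
    qed (simp_all add: D)
    then show "gen_map (\<lambda>(x, y). (r \<odot>\<^bsub>M\<^esub> x, y)) e \<in> span_rel ?S ?E" by (simp add: map_prod_def span_incl)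
  qed (use kill Wd iv e in \<open>auto simp: nf_def keys_frag_of D mult_ac\<close>)
  moreover have "tensor_map (a g) (b g) A \<in> carrier (tensor ?F M N) \<and>
      class_lift ?f (tensor_map (a g) (b g) A) = fps_const (\<chi> g) * \<beta> g (class_lift ?f A)"
    if g: "g \<in> G" and A: "A \<in> carrier (tensor ?F M N)" for g A
  proof -
    obtain h where h: "h \<in> G" "g \<circ> h = id" and inv: "\<And>x. x \<in> carrier M \<Longrightarrow> a g (a h x) = x"
      using is_rep_inverse[OF repM G g] by blast
    have inv': "b g (b h y) = y" if "y \<in> carrier N" for y using is_repD(5)[OF repN g that h(1)] is_repD(4)[OF repN g that] unfolding h(2) by simp
    note act = is_repD(1-3)[OF repM] and act' = is_repD(1-3)[OF repN]
    have rel: "gen_map (map_prod (a g) (b g)) e \<in> ?E" if "e \<in> ?E" "g \<in> G" for e g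
      using that(1) by (rule tensor_relations_map[where \<rho> = id]) (simp_all add: act[OF that(2)] act'[OF that(2)])
    have f: "?f (map_prod (a g) (b g) s) = fps_const (\<chi> g) * \<beta> g (?f s)" if s: "s \<in> ?S" for s
    proof -
      obtain x y c where xy: "s = (x, y)" "x \<in> carrier M" "y \<in> carrier N" "\<Phi> x = fps_const c" using s D(3) by blast
      then show ?thesis using g by (simp add: ac \<beta> mult_ac)
    qed
    have d: "fps_const (\<chi> g) * \<beta> g (w - w') = fps_const (\<chi> g) * \<beta> g w - fps_const (\<chi> g) * \<beta> g w'" for w w'
      by (simp add: \<beta> g right_diff_distrib)
    have gen: "map_prod (a g) (b g) s \<in> ?S" if "g \<in> G" "s \<in> ?S" for g s using that(2) act(1)[OF that(1)] act'(1)[OF that(1)] by auto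
    have mm: "map_prod (a g) (b g) (map_prod (a h) (b h) s) = s" if "s \<in> ?S" for s using that inv inv' by auto
    show ?thesis unfolding tensor_def tensor_map_def
      by (rule conjI; rule presented_action[OF pres, where f = ?f and \<beta> = "\<lambda>w. fps_const (\<chi> g) * \<beta> g w"
            and m' = "map_prod (a h) (b h)"],
          (erule kill gen[OF g] gen[OF h(1)] mm f rel[OF _ g] rel[OF _ h(1)] | rule d A[unfolded tensor_def])+)
  qed
  ultimately show ?thesis by (simp add: fps_model_def rep_tensor_def tensor_def)
qed

text \<open>A functional on a line is determined by its value at a basis vector, and the
  contragredient action evaluates it at the vector moved by the inverse of \<open>g\<close>.\<close>

lemma rep_dual_line:
  fixes M :: "('f::field, 'm) module"
  assumes m: "fps_model G (M, a) \<Phi> scalars (\<lambda>g w. fps_const (\<chi> g) * w)"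
    and e: "e \<in> carrier M" "\<Phi> e = 1"
    and G: "\<And>g. g \<in> G \<Longrightarrow> inv_into UNIV g \<in> G"
  shows "fps_model G (rep_dual ground (M, a)) (\<lambda>\<phi>. fps_const (\<phi> e)) scalars
     (\<lambda>g w. fps_const (\<chi> (inv_into UNIV g)) * w)"
proof -
  let ?F = "ground :: 'f ring"
  have li: "fps_lin_iso M \<Phi> scalars"
    and ac: "\<And>g x. g \<in> G \<Longrightarrow> x \<in> carrier M \<Longrightarrow> a g x \<in> carrier M"
      "\<And>g x. g \<in> G \<Longrightarrow> x \<in> carrier M \<Longrightarrow> \<Phi> (a g x) = fps_const (\<chi> g) * \<Phi> x"
    using m by (auto simp: fps_model_def)
  note D = fps_lin_isoD[OF li]
  define \<xi> where "\<xi> x = \<Phi> x $ 0" for x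
  have \<Phi>: "\<Phi> x = fps_const (\<xi> x)" if "x \<in> carrier M" for x
  proof -
    have "\<Phi> x \<in> \<Phi> ` carrier M" using that by (rule imageI)
    then have "\<Phi> x \<in> scalars" unfolding D(3) .
    then show ?thesis by (auto simp: \<xi>_def)
  qed
  have xe: "x = \<xi> x \<odot>\<^bsub>M\<^esub> e" if "x \<in> carrier M" for x
  proof (rule inj_onD[OF D(2)])
    show "\<Phi> x = \<Phi> (\<xi> x \<odot>\<^bsub>M\<^esub> e)" using \<Phi>[OF that] e by (simp add: D(9))
  qed (use that e in \<open>simp_all add: D(8)\<close>)
  let ?C = "carrier (dual_module ?F M)"
  have ev: "\<phi> x = \<xi> x * \<phi> e" if "\<phi> \<in> ?C" "x \<in> carrier M" for \<phi> x
    using xe[OF that(2)] that(1) e unfolding dual_module_def by simp metis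
  have \<xi>: "\<xi> (x \<oplus>\<^bsub>M\<^esub> y) = \<xi> x + \<xi> y" "\<xi> (c \<odot>\<^bsub>M\<^esub> x) = c * \<xi> x" "\<xi> e = 1" if "x \<in> carrier M" "y \<in> carrier M" for x y c
    using that e by (simp_all add: \<xi>_def D)
  have mem: "(\<lambda>x\<in>carrier M. c * \<xi> x) \<in> ?C" for c by (auto simp: dual_module_def D \<xi> algebra_simps)
  have rep: "\<phi> = (\<lambda>x\<in>carrier M. \<phi> e * \<xi> x)" if "\<phi> \<in> ?C" for \<phi>
  proof
    fix x show "\<phi> x = (\<lambda>x\<in>carrier M. \<phi> e * \<xi> x) x"
      using that ev[OF that, of x] by (cases "x \<in> carrier M") (auto simp: dual_module_def PiE_def extensional_def mult.commute)
  qed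
  have op: "\<phi> \<oplus>\<^bsub>dual_module ?F M\<^esub> \<psi> = (\<lambda>x\<in>carrier M. (\<phi> e + \<psi> e) * \<xi> x)" if "\<phi> \<in> ?C" "\<psi> \<in> ?C" for \<phi> \<psi>
    by (subst rep[OF that(1)], subst rep[OF that(2)]) (auto simp: dual_module_def algebra_simps fun_eq_iff)
  have sm: "c \<odot>\<^bsub>dual_module ?F M\<^esub> \<phi> = (\<lambda>x\<in>carrier M. (c * \<phi> e) * \<xi> x)" if "\<phi> \<in> ?C" for \<phi> c
    by (subst rep[OF that(1)]) (auto simp: dual_module_def algebra_simps fun_eq_iff)
  have z: "\<zero>\<^bsub>dual_module ?F M\<^esub> = (\<lambda>x\<in>carrier M. 0 * \<xi> x)" by (auto simp: dual_module_def)
  have "inj_on (\<lambda>\<phi>. fps_const (\<phi> e)) ?C"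
  proof (rule inj_onI)
    fix \<phi> \<psi> assume "\<phi> \<in> ?C" "\<psi> \<in> ?C" "fps_const (\<phi> e) = fps_const (\<psi> e)"
    then show "\<phi> = \<psi>" using rep[of \<phi>] rep[of \<psi>] by simp
  qed
  moreover have "(\<lambda>\<phi>. fps_const (\<phi> e)) ` ?C = scalars"
  proof -
    have "fps_const c \<in> (\<lambda>\<phi>. fps_const (\<phi> e)) ` ?C" for c by (rule image_eqI[OF _ mem[of c]]) (use e \<xi> in simp)
    then show ?thesis by auto
  qed
  ultimately have "fps_lin_iso (dual_module ?F M) (\<lambda>\<phi>. fps_const (\<phi> e)) scalars"
    unfolding fps_lin_iso_def bij_betw_def using e mem mem[of 0] \<xi>(3)[OF e(1) e(1)] by (simp add: op sm z)
  moreover have "(\<lambda>x\<in>carrier M. \<phi> (a (inv_into UNIV g) x)) = (\<lambda>x\<in>carrier M. (\<chi> (inv_into UNIV g) * \<phi> e) * \<xi> x)"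
    if "g \<in> G" "\<phi> \<in> ?C" for g \<phi>
  proof (rule restrict_ext)
    fix x assume x: "x \<in> carrier M"
    have "\<xi> (a (inv_into UNIV g) x) = \<chi> (inv_into UNIV g) * \<xi> x" unfolding \<xi>_def ac(2)[OF G[OF that(1)] x] by simp
    then show "\<phi> (a (inv_into UNIV g) x) = (\<chi> (inv_into UNIV g) * \<phi> e) * \<xi> x"
      using ev[OF that(2) ac(1)[OF G[OF that(1)] x]] by (simp add: mult_ac)
  qed
  ultimately show ?thesis using e mem \<xi>(3)[OF e(1) e(1)] by (simp add: fps_model_def rep_dual_def)
qed

section \<open>The stabilizer of a line in a plane\<close>

text \<open>A basis adapted to the line, with its dual basis: \<open>u\<close> spans the line to be
  stabilized. The functions \<open>xc\<close> and \<open>yc\<close> double as homogeneous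
  coordinates, and \<open>yc / xc\<close> is a local parameter at the fixed point.\<close>

locale plane = vector_space scale for scale :: "'f::field_char_0 \<Rightarrow> 'v::ab_group_add \<Rightarrow> 'v" +
  fixes u v :: 'v and xc yc :: "'v \<Rightarrow> 'f"
  assumes X_simps1 [simp]: "\<And>w w'. xc (w + w') = xc w + xc w'" "\<And>c w. xc (scale c w) = c * xc w"
    and Y_simps1 [simp]: "\<And>w w'. yc (w + w') = yc w + yc w'" "\<And>c w. yc (scale c w) = c * yc w"
    and coords: "\<And>w. w = scale (xc w) u + scale (yc w) v"
    and basis [simp]: "xc u = 1" "yc u = 0" "xc v = 0" "yc v = 1"
begin

abbreviation "linfun \<equiv> Vector_Spaces.linear scale times"

lemma XY_simps [simp]: "xc 0 = 0" "xc (- w) = - xc w" "xc (w - w') = xc w - xc w'"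
    "yc 0 = 0" "yc (- w) = - yc w" "yc (w - w') = yc w - yc w'"
proof -
  have z: "xc 0 = 0" "yc 0 = 0" using X_simps1(1)[of 0 0] Y_simps1(1)[of 0 0] by simp_all
  have n: "xc (- w) = - xc w" "yc (- w) = - yc w" for w
    using X_simps1(1)[of w "- w"] Y_simps1(1)[of w "- w"] z by (simp_all add: eq_neg_iff_add_eq_0 add.commute)
  show "xc 0 = 0" "xc (- w) = - xc w" "xc (w - w') = xc w - xc w'"
    "yc 0 = 0" "yc (- w) = - yc w" "yc (w - w') = yc w - yc w'" using z n X_simps1(1)[of w "- w'"] Y_simps1(1)[of w "- w'"] by simp_all
qed

lemma coords_eqI: "xc w = xc w' \<Longrightarrow> yc w = yc w' \<Longrightarrow> w = w'"
  using coords[of w] coords[of w'] by simp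

lemma linear_endoI:
  assumes "\<And>x y. g (x + y) = g x + g y" "\<And>c x. g (scale c x) = scale c (g x)"
  shows "Vector_Spaces.linear scale scale g"
  using assms vector_space_axioms module_axioms
  by (simp add: Vector_Spaces.linear_def Modules.module_hom_def module_hom_axioms_def)

lemma linear_funcI:
  assumes "\<And>x y. l (x + y) = l x + l y" "\<And>c x. l (scale c x) = c * l x"
  shows "linfun l"
proof -
  have "vector_space (times :: 'f \<Rightarrow> 'f \<Rightarrow> 'f)" by unfold_locales (auto simp: algebra_simps)
  moreover have "Modules.module (times :: 'f \<Rightarrow> 'f \<Rightarrow> 'f)" by unfold_locales (auto simp: algebra_simps)
  ultimately show ?thesis using assms vector_space_axioms module_axioms
    by (simp add: Vector_Spaces.linear_def Modules.module_hom_def module_hom_axioms_def)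
qed

lemma endo_coords:
  assumes "Vector_Spaces.linear scale scale g"
  shows "xc (g w) = xc w * xc (g u) + yc w * xc (g v)" "yc (g w) = xc w * yc (g u) + yc w * yc (g v)"
proof -
  interpret g: Vector_Spaces.linear scale scale g by fact
  have "g w = scale (xc w) (g u) + scale (yc w) (g v)" by (subst coords[of w]) (simp add: g.add g.scale)
  then show "xc (g w) = xc w * xc (g u) + yc w * xc (g v)" "yc (g w) = xc w * yc (g u) + yc w * yc (g v)" by simp_all
qed

lemma func_coords:
  assumes "linfun l"
  shows "l w = xc w * l u + yc w * l v"
proof -
  interpret l: Vector_Spaces.linear scale times l by fact
  show ?thesis by (subst coords[of w]) (simp add: l.add l.scale)
qed

text \<open>The alternating forms of a plane are the multiples of \<open>\<omega>0\<close>, so the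
  scalar by which \<open>g\<close> acts on all of them is the one by which it acts on
  \<open>\<omega>0\<close>, the familiar expression in matrix entries.\<close>

lemma plane_det_eq:
  assumes g: "Vector_Spaces.linear scale scale g"
  shows "plane_det scale g = xc (g u) * yc (g v) - xc (g v) * yc (g u)"
proof -
  define \<omega>0 where "\<omega>0 x y = xc x * yc y - xc y * yc x" for x y
  have alt0: "alternating_form scale \<omega>0" unfolding alternating_form_def \<omega>0_def by (auto intro!: linear_funcI simp: algebra_simps)
  have all: "\<omega> x y = \<omega>0 x y * \<omega> u v" if "alternating_form scale \<omega>" for \<omega> x y
  proof -
    have l1: "linfun (\<omega> x)" and l2: "linfun (\<lambda>x. \<omega> x y)"
      and z: "\<omega> x x = 0" for x y using that by (auto simp: alternating_form_def)
    \<comment> \<open>Polarization: the vanishing value at \<open>u + v\<close> gives antisymmetry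
      on the basis.\<close>
    have "\<omega> (u + v) (u + v) = \<omega> u v + \<omega> v u"
      using func_coords[OF l1[of "u + v"], of "u + v"] func_coords[OF l2[of u], of "u + v"] func_coords[OF l2[of v], of "u + v"]
      by (simp add: z add.commute)
    then have "\<omega> v u = - \<omega> u v" by (simp add: z eq_neg_iff_add_eq_0 add.commute)
    then show ?thesis using func_coords[OF l1[of x], of y] func_coords[OF l2[of u], of x] func_coords[OF l2[of v], of x]
      by (simp add: z \<omega>0_def algebra_simps)
  qed
  let ?D = "xc (g u) * yc (g v) - xc (g v) * yc (g u)"
  have "\<omega>0 (g x) (g y) = ?D * \<omega>0 x y" for x y
    unfolding \<omega>0_def endo_coords[OF g, of x] endo_coords[OF g, of y] by (simp add: algebra_simps)
  then have "\<omega> (g x) (g y) = ?D * \<omega> x y" if "alternating_form scale \<omega>" for \<omega> x y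
    using all[OF that, of "g x" "g y"] all[OF that, of x y] by simp
  moreover have "c = ?D" if "\<forall>\<omega>. alternating_form scale \<omega> \<longrightarrow> (\<forall>x y. \<omega> (g x) (g y) = c * \<omega> x y)" for c
    using that[rule_format, OF alt0, of u v] by (simp add: \<omega>0_def)
  ultimately show ?thesis unfolding plane_det_def by (intro the_equality) blast+
qed

definition line :: "'v set" where "line = {w. yc w = 0}"

definition stab :: "('v \<Rightarrow> 'v) set" where "stab = line_stabilizer scale line"

text \<open>Upper triangular matrices of determinant 1. That the line is mapped onto itself, and not
  merely into itself, follows since the first diagonal entry is nonzero.\<close>

lemma stab_iff: "g \<in> stab \<longleftrightarrow> Vector_Spaces.linear scale scale g \<and> yc (g u) = 0 \<and> xc (g u) * yc (g v) = 1"
proof -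
  have "g ` line = line \<longleftrightarrow> yc (g u) = 0" if g: "Vector_Spaces.linear scale scale g"
    and det: "xc (g u) * yc (g v) - xc (g v) * yc (g u) = 1"
  proof
    assume "g ` line = line"
    then show "yc (g u) = 0" by (auto simp: line_def)
  next
    assume u: "yc (g u) = 0"
    then have nz: "xc (g u) \<noteq> 0" using det by auto
    have "w \<in> g ` line" if "w \<in> line" for w
    proof (rule image_eqI)
      show "scale (xc w / xc (g u)) u \<in> line" by (simp add: line_def)
      show "w = g (scale (xc w / xc (g u)) u)"
        by (rule coords_eqI) (use that u nz endo_coords[OF g, of "scale (xc w / xc (g u)) u"] in \<open>auto simp: line_def\<close>)
    qed
    moreover have "g w \<in> line" if "w \<in> line" for w using that u endo_coords(2)[OF g, of w] by (simp add: line_def)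
    ultimately show "g ` line = line" by blast
  qed
  moreover have "yc (g u) = 0" if "Vector_Spaces.linear scale scale g" "g ` line = line"
  proof -
    have "g u \<in> g ` line" by (simp add: line_def)
    then show ?thesis unfolding that(2) by (simp add: line_def)
  qed
  moreover have "g \<in> stab \<longleftrightarrow> Vector_Spaces.linear scale scale g \<and>
      xc (g u) * yc (g v) - xc (g v) * yc (g u) = 1 \<and> g ` line = line"
    unfolding stab_def line_stabilizer_def SL_def using plane_det_eq[of g] by auto
  ultimately show ?thesis by (metis diff_zero mult_zero_right)
qed

lemma stab_coords:
  assumes "g \<in> stab"
  shows "xc (g u) \<noteq> 0" "xc (g w) = xc w * xc (g u) + yc w * xc (g v)" "yc (g w) = yc w / xc (g u)"
    "g (w + w') = g w + g w'" "g (scale c w) = scale c (g w)" "g 0 = 0"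
proof -
  have g: "Vector_Spaces.linear scale scale g" "yc (g u) = 0" "xc (g u) * yc (g v) = 1" using assms by (auto simp: stab_iff)
  then interpret g: Vector_Spaces.linear scale scale g by simp
  show nz: "xc (g u) \<noteq> 0" using g by auto
  show "xc (g w) = xc w * xc (g u) + yc w * xc (g v)" by (rule endo_coords[OF g(1)])
  show "yc (g w) = yc w / xc (g u)" using endo_coords(2)[OF g(1), of w] g nz by (simp add: field_simps)
  show "g (w + w') = g w + g w'" "g (scale c w) = scale c (g w)" "g 0 = 0" by (simp_all add: g.add g.scale g.zero)
qed

lemma stab_comp:
  assumes "g \<in> stab" "h \<in> stab" shows "g \<circ> h \<in> stab"
proof -
  note G = stab_coords[OF assms(1)] and H = stab_coords[OF assms(2)]
  have "Vector_Spaces.linear scale scale (g \<circ> h)" by (rule linear_endoI) (simp_all add: G(4,5) H(4,5))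
  moreover have "yc ((g \<circ> h) u) = 0" using G(3)[of "h u"] H(3)[of u] by simp
  moreover have "xc ((g \<circ> h) u) * yc ((g \<circ> h) v) = 1" using G(1) H(1) G(2)[of "h u"] H(3)[of u] G(3)[of "h v"] H(3)[of v] by simp
  ultimately show ?thesis by (simp add: stab_iff)
qed

lemma stab_group: "trans_group stab"
  unfolding trans_group_def
proof (intro conjI ballI)
  show "id \<in> stab" by (auto simp: stab_iff intro!: linear_endoI)
  fix g assume g: "g \<in> stab"
  note G = stab_coords[OF g]
  \<comment> \<open>The inverse of the triangular matrix with diagonal entries
    \<open>xc (g u)\<close>, \<open>1 / xc (g u)\<close> and corner entry
    \<open>xc (g v)\<close>.\<close>
  define h where "h w = scale (xc w / xc (g u) - xc (g v) * yc w) u + scale (xc (g u) * yc w) v" for w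
  have h: "h \<in> stab" using G(1) unfolding stab_iff by (auto simp: h_def field_simps intro!: linear_endoI coords_eqI)
  moreover have hx: "xc (h w) = xc w / xc (g u) - xc (g v) * yc w" "yc (h w) = xc (g u) * yc w" for w by (simp_all add: h_def)
  have "g (h w) = w" "h (g w) = w" for w by (rule coords_eqI; simp add: hx G(2)[of "h w"] G(3)[of "h w"] G(2)[of w] G(3)[of w] field_simps G(1))+
  then have "g \<circ> h = id" "h \<circ> g = id" by (auto simp: fun_eq_iff)
  ultimately show "\<exists>h\<in>stab. g \<circ> h = id \<and> h \<circ> g = id" by blast
qed (rule stab_comp)

lemma stab_inv:
  assumes "g \<in> stab"
  shows "inv_into UNIV g \<in> stab" "bij g" "g (inv_into UNIV g w) = w" "inv_into UNIV g (g w) = w"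
    "xc (inv_into UNIV g u) = inverse (xc (g u))"
proof -
  obtain h where h: "h \<in> stab" "g \<circ> h = id" "h \<circ> g = id" using stab_group assms unfolding trans_group_def by blast
  then have "inv_into UNIV g = h" by (metis inv_unique_comp)
  then show "inv_into UNIV g \<in> stab" using h by simp
  show b: "bij g" using h by (metis o_bij)
  show gi: "g (inv_into UNIV g w) = w" "inv_into UNIV g (g w) = w" for w using b by (simp_all add: bij_is_surj surj_f_inv_f bij_is_inj inv_f_f)
  have "xc (g (inv_into UNIV g u)) = xc (inv_into UNIV g u) * xc (g u)"
    using stab_coords(2)[OF assms, of "inv_into UNIV g u"] stab_coords(3)[OF \<open>inv_into UNIV g \<in> stab\<close>, of u] by simp
  then show "xc (inv_into UNIV g u) = inverse (xc (g u))" using stab_coords(1)[OF assms] by (simp add: gi field_simps)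
qed

text \<open>The eigenvalue on the stable line. As the determinant is 1, its inverse is the
  eigenvalue on the quotient of the plane by the line.\<close>

definition char :: "('v \<Rightarrow> 'v) \<Rightarrow> 'f" where "char g = xc (g u)"

lemma char_hom: "char id = 1" "g \<in> stab \<Longrightarrow> h \<in> stab \<Longrightarrow> char (g \<circ> h) = char g * char h"
  "g \<in> stab \<Longrightarrow> char g \<noteq> 0" "g \<in> stab \<Longrightarrow> char (inv_into UNIV g) = inverse (char g)"
proof -
  show "char (g \<circ> h) = char g * char h" if "g \<in> stab" "h \<in> stab"
    using stab_coords(2)[OF that(1), of "h u"] stab_coords(3)[OF that(2), of u] by (simp add: char_def)
qed (simp_all add: char_def stab_coords(1) stab_inv(5))

lemma line_model:
  "fps_model stab (sub_rep scale line) (\<lambda>w. fps_const (xc w)) scalars (\<lambda>g w. fps_const (char g) * w)"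
proof -
  have "bij_betw (\<lambda>w. fps_const (xc w)) line scalars" unfolding bij_betw_def
  proof
    show "inj_on (\<lambda>w. fps_const (xc w)) line" by (rule inj_onI) (auto simp: line_def intro: coords_eqI)
    have "fps_const c \<in> (\<lambda>w. fps_const (xc w)) ` line" for c by (rule image_eqI[of _ _ "scale c u"]) (simp_all add: line_def)
    then show "(\<lambda>w. fps_const (xc w)) ` line = scalars" by auto
  qed
  moreover have "g w \<in> line \<and> xc (g w) = char g * xc w" if "g \<in> stab" "w \<in> line" for g w
    using that stab_coords(2)[of g w] stab_coords(3)[of g w] by (simp add: line_def char_def)
  ultimately show ?thesis unfolding fps_model_def sub_rep_def fps_lin_iso_def by (simp add: line_def flip: fps_const_mult)
qed

lemma dual_line_model:
  "fps_model stab (rep_dual ground (sub_rep scale line)) (\<lambda>\<phi>. fps_const (\<phi> u)) scalars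
    (\<lambda>g w. fps_const (inverse (char g)) * w)"
proof -
  have "fps_model stab (rep_dual ground (sub_rep scale line)) (\<lambda>\<phi>. fps_const (\<phi> u)) scalars
    (\<lambda>g w. fps_const (char (inv_into UNIV g)) * w)" unfolding sub_rep_def
    by (rule rep_dual_line[OF line_model[unfolded sub_rep_def]]) (auto simp: line_def stab_inv)
  then show ?thesis by (auto simp: fps_model_def char_hom split: prod.splits)
qed

text \<open>Sending \<open>u\<close> to \<open>fps_X\<close> and \<open>v\<close> to 1, not the
  other way round, makes powers of the stable line correspond to high powers of \<open>t\<close>; so
  the stable filtration of the symmetric power matches that of the jets by order of
  vanishing.\<close>

definition plane_val :: "'v \<Rightarrow> 'f fps" where
  "plane_val w = fps_const (yc w) + fps_const (xc w) * fps_X"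

text \<open>The action on \<open>Sym\<^sup>n V\<close>, where the monomial \<open>t\<^sup>j\<close> stands for \<open>u\<^sup>j v\<^bsup>n-j\<^esup>\<close>.\<close>

definition sym_act :: "nat \<Rightarrow> ('v \<Rightarrow> 'v) \<Rightarrow> 'f fps \<Rightarrow> 'f fps" where
  "sym_act n g w = (\<Sum>j\<le>n. fps_const (w $ j) * plane_val (g u) ^ j * plane_val (g v) ^ (n - j))"

lemma sym_act_diff: "sym_act n g (w - w') = sym_act n g w - sym_act n g w'"
  by (simp add: sym_act_def sum_subtractf left_diff_distrib flip: fps_const_sub)

lemma sym_act_add: "sym_act n g (w + w') = sym_act n g w + sym_act n g w'"
  by (simp add: sym_act_def sum.distrib distrib_right flip: fps_const_add)

lemma sym_act_scale: "sym_act n g (fps_const c * w) = fps_const c * sym_act n g w"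
  by (simp add: sym_act_def sum_distrib_left mult_ac flip: fps_const_mult)

lemma plane_lin_iso: "fps_lin_iso (fst (sub_rep scale UNIV)) plane_val (polys_upto 1)"
proof -
  have "bij_betw plane_val UNIV (polys_upto 1)" unfolding bij_betw_def
  proof
    show "inj plane_val"
    proof (rule injI)
      fix w w' assume *: "plane_val w = plane_val w'"
      show "w = w'" using arg_cong[OF *, of "\<lambda>f. f $ 0"] arg_cong[OF *, of "\<lambda>f. f $ 1"]
        by (intro coords_eqI) (simp_all add: plane_val_def)
    qed
    have "p \<in> range plane_val" if "p \<in> polys_upto 1" for p
    proof (rule range_eqI)
      show "p = plane_val (scale (p $ 1) u + scale (p $ 0) v)" by (subst polys_upto_sum[OF that]) (simp add: plane_val_def)
    qed
    then show "range plane_val = polys_upto 1" by (auto simp: plane_val_def polys_upto_def)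
  qed
  then show ?thesis by (auto simp: sub_rep_def fps_lin_iso_def plane_val_def algebra_simps simp flip: fps_const_add fps_const_mult)
qed

lemma plane_val_act:
  assumes "g \<in> stab"
  shows "plane_val (g w) = fps_const (yc w) * plane_val (g v) + fps_const (xc w) * plane_val (g u)"
  unfolding plane_val_def stab_coords(2,3)[OF assms, of w] stab_coords(3)[OF assms, of u] stab_coords(3)[OF assms, of v]
  by (simp add: algebra_simps divide_inverse flip: fps_const_add fps_const_mult)

text \<open>A polynomial is rehomogenized to degree \<open>n\<close> before \<open>g\<close> is
  applied, so the operator depends on \<open>n\<close>; one more linear factor raises that degree by
  one. This permits induction on the number of factors of a product.\<close>

lemma sym_act_cons:
  assumes g: "g \<in> stab" and w: "w \<in> polys_upto n"
  shows "sym_act (Suc n) g (plane_val x * w) = plane_val (g x) * sym_act n g w"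
proof -
  let ?U = "plane_val (g u)" and ?V = "plane_val (g v)"
  have 1: "sym_act (Suc n) g w = ?V * sym_act n g w"
  proof -
    have "w $ Suc n = 0" using w by (simp add: polys_upto_def)
    then have "sym_act (Suc n) g w = (\<Sum>j\<le>n. fps_const (w $ j) * ?U ^ j * ?V ^ (Suc n - j))" by (simp add: sym_act_def)
    also have "\<dots> = ?V * sym_act n g w" unfolding sym_act_def sum_distrib_left by (rule sum.cong) (auto simp: Suc_diff_le mult_ac)
    finally show ?thesis .
  qed
  have 2: "sym_act (Suc n) g (fps_X * w) = ?U * sym_act n g w"
    unfolding sym_act_def sum_distrib_left by (subst sum.atMost_Suc_shift) (simp add: mult_ac)
  have "plane_val x * w = fps_const (yc x) * w + fps_const (xc x) * (fps_X * w)" by (simp add: plane_val_def algebra_simps)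
  then show ?thesis unfolding plane_val_act[OF g, of x] by (simp only: sym_act_add sym_act_scale 1 2 distrib_right mult.assoc)
qed

lemma plane_rep: "is_rep stab ground (sub_rep scale UNIV)"
  using fps_lin_iso_module[OF plane_lin_iso]
  by (auto simp: is_rep_def sub_rep_def stab_coords(4,5))

lemma sym_plane_model:
  "fps_model stab (rep_sym ground n (sub_rep scale UNIV)) (class_lift (sym_val plane_val)) (polys_upto n) (sym_act n)"
  unfolding sub_rep_def
proof (rule rep_sym_fps_model[OF plane_lin_iso[unfolded sub_rep_def fst_conv] plane_rep[unfolded sub_rep_def] stab_group
      sym_power_plane[OF plane_lin_iso[unfolded sub_rep_def fst_conv]]])
  fix g r and xs :: "'v list" assume g: "g \<in> stab"
    and "(r, xs) \<in> sym_generators (ground :: 'f ring) n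
      \<lparr>carrier = UNIV, monoid.mult = undefined, one = undefined, ring.zero = 0, ring.add = (+), module.smult = scale\<rparr>"
  then have n: "length xs = n" by (simp add: sym_generators_def)
  have "prod_list (map plane_val xs) \<in> polys_upto (length xs) \<and>
    prod_list (map plane_val (map g xs)) = sym_act (length xs) g (prod_list (map plane_val xs))"
  proof (induction xs)
    case Nil then show ?case by (simp add: polys_upto_def sym_act_def)
  next
    case (Cons x xs)
    let ?p = "prod_list (map plane_val xs)"
    have "(plane_val x * ?p) $ i = 0" if "i > Suc (length xs)" for i
    proof -
      have "i - 1 > length xs" using that by simp
      then have "?p $ i = 0" "?p $ (i - 1) = 0" using Cons that by (auto simp: polys_upto_def)
      then show ?thesis by (simp add: plane_val_def distrib_right mult.assoc)
    qed
    then show ?case using Cons by (simp add: polys_upto_def sym_act_cons[OF g])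
  qed
  then show "sym_val plane_val (r, map g xs) = sym_act n g (sym_val plane_val (r, xs))" by (simp add: sym_val_def sym_act_scale n)
qed (rule sym_act_diff)

text \<open>The composition law is inherited from the symmetric power itself, where the group acts
  by mapping over lists and functoriality is evident; on polynomials it would be an identity between
  double sums.\<close>

lemma sym_lin_act: "lin_act stab (polys_upto n) (sym_act n)"
proof -
  obtain M a where Ma: "rep_sym ground n (sub_rep scale UNIV) = (M, a)" by (rule prod.exhaust)
  let ?\<Phi> = "class_lift (sym_val plane_val)"
  have a: "a g = (`) (gen_map (map_prod id (map g)))" for g using Ma by (auto simp: rep_sym_def sub_rep_def)
  have m: "fps_lin_iso M ?\<Phi> (polys_upto n)"
    and ac: "\<And>g x. g \<in> stab \<Longrightarrow> x \<in> carrier M \<Longrightarrow> a g x \<in> carrier M \<and> ?\<Phi> (a g x) = sym_act n g (?\<Phi> x)"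
    using sym_plane_model[of n] by (auto simp: fps_model_def Ma)
  have ex: "\<exists>x\<in>carrier M. ?\<Phi> x = w" if "w \<in> polys_upto n" for w
  proof -
    have "w \<in> ?\<Phi> ` carrier M" unfolding fps_lin_isoD(3)[OF m] by (rule that)
    then show ?thesis by (auto simp: image_iff)
  qed
  have aid: "a id x = x" for x
  proof -
    have "frag_of \<circ> map_prod id (map id) = (frag_of :: 'f \<times> 'v list \<Rightarrow> _)" by (auto simp: fun_eq_iff)
    then show ?thesis unfolding a by (simp flip: frag_expansion)
  qed
  have acomp: "a (g \<circ> h) x = a g (a h x)" for g h x
  proof -
    have "frag_of \<circ> map_prod id (map (g \<circ> h)) =
        ((frag_of \<circ> map_prod id (map g)) \<circ> map_prod id (map h) :: 'f \<times> 'v list \<Rightarrow> _)" by (auto simp: fun_eq_iff)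
    then show ?thesis unfolding a image_image by (simp only: frag_extend_compose)
  qed
  have id: "id \<in> stab" using stab_group by (simp add: trans_group_def)
  show ?thesis unfolding lin_act_def
  proof (intro conjI ballI allI)
    fix w :: "'f fps" assume w: "w \<in> polys_upto n"
    then obtain x where x: "x \<in> carrier M" "?\<Phi> x = w" using ex by blast
    show "sym_act n id w = w" using ac[OF id x(1)] x aid by simp
    fix g h assume g: "g \<in> stab" and h: "h \<in> stab"
    show "sym_act n (g \<circ> h) w = sym_act n g (sym_act n h w)"
      using ac[OF stab_comp[OF g h] x(1)] ac[OF h x(1)] ac[OF g, of "a h x"] x acomp by simp
  qed (simp_all add: sym_act_add sym_act_scale)
qed

text \<open>With respect to the coordinate \<open>t\<close> at the fixed point, \<open>g\<^sup>-\<^sup>1\<close> acts as a fractional linear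
  transformation; twisting by a character gives the action on truncated power series.\<close>

definition moebius :: "('v \<Rightarrow> 'v) \<Rightarrow> 'f fps" where
  "moebius g = fps_const (char g ^ 2) * fps_X * inverse (1 - fps_const (char g * xc (g v)) * fps_X)"

definition jet_model_act :: "nat \<Rightarrow> (('v \<Rightarrow> 'v) \<Rightarrow> 'f) \<Rightarrow> ('v \<Rightarrow> 'v) \<Rightarrow> 'f fps \<Rightarrow> 'f fps" where
  "jet_model_act k \<chi> g w = fps_cutoff (Suc k) (fps_const (\<chi> g) * (w oo moebius g))"

text \<open>The unipotent radical acts on \<open>\<mm>/\<mm>\<^bsup>k+1\<^esup>\<close> and on \<open>Sym\<^bsup>k-1\<^esup> V\<close> by single Jordan blocks; the
  binomial coefficients rescale one into the other.\<close>

definition rescale :: "nat \<Rightarrow> 'f fps \<Rightarrow> 'f fps" where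
  "rescale n p = Abs_fps (\<lambda>i. if i = 0 then 0 else p $ (i - 1) / of_nat (n choose (i - 1)))"

end

section \<open>Comparison of the Moebius substitution with the symmetric power\<close>

context plane begin

lemma linear_power_nth:
  "((fps_const a + fps_const b * fps_X) ^ N) $ i = of_nat (N choose i) * b ^ i * a ^ (N - i)" for a b :: 'f
proof -
  have "(fps_const b * fps_X + fps_const a) ^ N =
    (\<Sum>j\<le>N. fps_const (of_nat (N choose j) * b ^ j * a ^ (N - j)) * fps_X ^ j)" unfolding binomial_ring by (intro sum.cong refl)
      (simp add: power_mult_distrib fps_of_nat[symmetric] mult_ac fps_const_power flip: fps_const_mult)
  then show ?thesis by (auto simp: fps_sum_nth add.commute if_distrib[of "(*) _"] binomial_eq_0 cong: if_cong)
qed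

text \<open>The power \<open>(1 - c t) ^ (- (j + 1))\<close> is a negative binomial series with
  coefficient \<open>m choose j\<close> at \<open>t ^ (m - j)\<close>. Exponent and index are
  shifted by one since only multiples of \<open>t\<close> are compared with the symmetric power,
  whose degrees start at 0.\<close>

lemma moebius_power_nth:
  "(moebius g ^ Suc j) $ Suc m =
    (if j \<le> m then char g ^ (2 * j + 2) * of_nat (m choose j) * (char g * xc (g v)) ^ (m - j) else 0)"
proof -
  have "moebius g ^ Suc j = fps_const (char g ^ (2 * j + 2)) *
      (fps_X ^ Suc j * inverse ((1 - fps_const (char g * xc (g v)) * fps_X) ^ Suc j))"
    unfolding moebius_def power_mult_distrib fps_inverse_power[symmetric] fps_const_power power_mult[symmetric] by (simp add: mult_ac)
  moreover have "inverse ((1 - fps_const c * fps_X) ^ Suc j) $ i = of_nat ((Suc j + i - 1) choose i) * c ^ i" for c :: 'f and i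
    by (subst one_minus_const_fps_X_neg_power') simp_all
  ultimately have "(moebius g ^ Suc j) $ Suc m = char g ^ (2 * j + 2) *
      (if m < j then 0 else of_nat ((Suc j + (m - j) - 1) choose (m - j)) * (char g * xc (g v)) ^ (m - j))"
    by (simp only: fps_mult_left_const_nth fps_X_power_mult_nth) simp
  then show ?thesis by (auto simp: binomial_symmetric[of j m])
qed

lemma moebius_0 [simp]: "moebius g $ 0 = 0"
  by (simp add: moebius_def mult.assoc)

lemma rescale_nth [simp]: "rescale n p $ 0 = 0" "rescale n p $ Suc j = p $ j / of_nat (n choose j)"
  by (simp_all add: rescale_def)

lemma jet_model_act_nth:
  "jet_model_act k \<chi> g w $ i = (if i \<le> k then \<chi> g * (w oo moebius g) $ i else 0)"
  by (auto simp: jet_model_act_def)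

text \<open>Coefficients at \<open>t ^ (m + 1)\<close> are compared. The substitution contributes
  \<open>m choose j\<close>, the symmetric power \<open>(n - j) choose (m - j)\<close>, and the
  ratio of the rescaling factors at \<open>j\<close> and \<open>m\<close> turns one into the other.
  What is left of the eigenvalue is \<open>char g ^ (n + 2)\<close>, independent of \<open>j\<close>
  and \<open>m\<close>. Constants are unaffected by a substitution without constant term.\<close>

lemma rescale_act:
  assumes g: "g \<in> stab" and p: "p \<in> polys_upto n"
  shows "jet_model_act (Suc n) \<chi> g (fps_const c + rescale n p) =
    fps_const (\<chi> g * c) + rescale n (fps_const (\<chi> g * char g ^ (n + 2)) * sym_act n g p)"
proof (rule fps_ext)
  fix i
  let ?a = "char g" and ?b = "xc (g v)"
  have a: "?a \<noteq> 0" using char_hom(3)[OF g] .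
  have pu: "plane_val (g u) = fps_const ?a * fps_X" using stab_coords(3)[OF g, of u] by (simp add: plane_val_def char_def)
  have pv: "plane_val (g v) = fps_const (inverse ?a) + fps_const ?b * fps_X"
    using stab_coords(3)[OF g, of v] by (simp add: plane_val_def char_def divide_inverse)
  consider "i = 0" | m where "i = Suc m" "m \<le> n" | "i > Suc n" by (cases i) force+
  then show "jet_model_act (Suc n) \<chi> g (fps_const c + rescale n p) $ i =
    (fps_const (\<chi> g * c) + rescale n (fps_const (\<chi> g * char g ^ (n + 2)) * sym_act n g p)) $ i"
  proof cases
    case 1
    then show ?thesis by (simp add: jet_model_act_nth)
  next
    case (2 m)
    have "((fps_const c + rescale n p) oo moebius g) $ Suc m
      = (\<Sum>i=0..Suc m. (fps_const c + rescale n p) $ i * (moebius g ^ i $ Suc m))" by (simp add: fps_compose_nth del: power_Suc)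
    also have "\<dots> = (\<Sum>j=0..m. (fps_const c + rescale n p) $ Suc j * (moebius g ^ Suc j $ Suc m))"
      by (subst sum.atLeast0_atMost_Suc_shift) (simp del: power_Suc)
    also have "\<dots> = (\<Sum>j=0..m. p $ j / of_nat (n choose j) * (?a ^ (2 * j + 2) * of_nat (m choose j) * (?a * ?b) ^ (m - j)))"
      by (intro sum.cong refl) (simp add: moebius_power_nth rescale_def del: power_Suc)
    finally have L: "((fps_const c + rescale n p) oo moebius g) $ Suc m = \<dots>" .
    have "sym_act n g p $ m = (\<Sum>j\<le>n. p $ j * ?a ^ j * ((fps_X ^ j * (fps_const (inverse ?a) + fps_const ?b * fps_X) ^ (n - j)) $ m))"
      unfolding sym_act_def pu pv fps_sum_nth power_mult_distrib fps_const_power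
      by (intro sum.cong refl) (simp add: mult.assoc fps_mult_left_const_nth)
    also have "\<dots> = (\<Sum>j\<le>n. if j \<le> m then p $ j * ?a ^ j * (of_nat ((n - j) choose (m - j)) * ?b ^ (m - j) * inverse ?a ^ (n - m)) else 0)"
      by (intro sum.cong refl) (auto simp: fps_X_power_mult_nth linear_power_nth)
    also have "\<dots> = (\<Sum>j=0..m. p $ j * ?a ^ j * (of_nat ((n - j) choose (m - j)) * ?b ^ (m - j) * inverse ?a ^ (n - m)))"
      by (subst sum.inter_filter[symmetric]) (use 2 in \<open>auto intro!: sum.cong\<close>)
    finally have R: "sym_act n g p $ m = \<dots>" .
    have "p $ j / of_nat (n choose j) * (?a ^ (2 * j + 2) * of_nat (m choose j) * (?a * ?b) ^ (m - j)) =
      ?a ^ (n + 2) * (p $ j * ?a ^ j * (of_nat ((n - j) choose (m - j)) * ?b ^ (m - j) * inverse ?a ^ (n - m))) / of_nat (n choose m)"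
      if j: "j \<le> m" for j
    proof -
      \<comment> \<open>Bookkeeping of the eigenvalue: here the exponent \<open>n + 2\<close> of the
        twist is forced.\<close>
      have e: "?a ^ (n + 2) * ?a ^ j * inverse ?a ^ (n - m) = ?a ^ (2 * j + 2) * ?a ^ (m - j)"
      proof -
        have h1: "?a ^ (n + 2) = ?a ^ (m + 2) * ?a ^ (n - m)" using 2 by (simp flip: power_add)
        have h2: "?a ^ (n - m) * inverse ?a ^ (n - m) = 1" using a by (simp flip: power_mult_distrib)
        have h3: "?a ^ (m + 2) * ?a ^ j = ?a ^ (2 * j + 2) * ?a ^ (m - j)" using j by (simp add: add_ac flip: power_add)
        have "?a ^ (n + 2) * ?a ^ j * inverse ?a ^ (n - m) = (?a ^ (m + 2) * ?a ^ j) * (?a ^ (n - m) * inverse ?a ^ (n - m))"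
          unfolding h1 by (simp only: mult_ac)
        then show ?thesis unfolding h2 h3 by simp
      qed
      \<comment> \<open>Choosing first \<open>m\<close> and then \<open>j\<close> of these is
        choosing first \<open>j\<close> and then the remaining \<open>m - j\<close>.\<close>
      have "(n choose m) * (m choose j) = (n choose j) * ((n - j) choose (m - j))" using j 2 by (simp add: choose_mult)
      then have b: "of_nat (n choose m) * of_nat (m choose j) = (of_nat (n choose j) * of_nat ((n - j) choose (m - j)) :: 'f)" by (metis of_nat_mult)
      \<comment> \<open>Characteristic zero enters: the binomial coefficients are invertible in the
        field.\<close>
      have nz: "of_nat (n choose m) \<noteq> (0 :: 'f)" "of_nat (n choose j) \<noteq> (0 :: 'f)" using j 2 by simp_all
      have b': "of_nat (m choose j) / of_nat (n choose j) = (of_nat ((n - j) choose (m - j)) / of_nat (n choose m) :: 'f)"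
        using b nz by (simp add: field_simps)
      have "p $ j / of_nat (n choose j) * (?a ^ (2 * j + 2) * of_nat (m choose j) * (?a * ?b) ^ (m - j)) =
        p $ j * ?b ^ (m - j) * (?a ^ (2 * j + 2) * ?a ^ (m - j)) * (of_nat (m choose j) / of_nat (n choose j))" by (simp add: power_mult_distrib)
      also have "\<dots> = p $ j * ?b ^ (m - j) * (?a ^ (n + 2) * ?a ^ j * inverse ?a ^ (n - m)) * (of_nat ((n - j) choose (m - j)) / of_nat (n choose m))"
        unfolding e b' ..
      finally show ?thesis by (simp add: mult_ac)
    qed
    then have LR: "((fps_const c + rescale n p) oo moebius g) $ Suc m = ?a ^ (n + 2) * sym_act n g p $ m / of_nat (n choose m)"
      unfolding L R sum_distrib_left sum_divide_distrib by (intro sum.cong) auto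
    show ?thesis using 2 unfolding jet_model_act_nth 2(1) LR by simp
  next
    case 3
    then show ?thesis by (cases i) (simp_all add: jet_model_act_nth binomial_eq_0)
  qed
qed

text \<open>The first summand supplies the constant term and the tensor product the multiples of
  \<open>t\<close>, so a polynomial separates uniquely. The group law for the jet operators is
  proved alongside, because \<open>rescale_act\<close> carries it over from the symmetric
  power.\<close>

lemma right_side_model:
  assumes M1: "fps_model stab (M1, a1) \<Phi>1 scalars (\<lambda>g w. fps_const (\<chi> g) * w)"
    and M2: "fps_model stab (M2, a2) \<Phi>2 scalars (\<lambda>g w. fps_const (\<chi> g * char g ^ (k + 1)) * w)"
    and \<chi>: "\<chi> id = 1" "\<And>g h. g \<in> stab \<Longrightarrow> h \<in> stab \<Longrightarrow> \<chi> (g \<circ> h) = \<chi> g * \<chi> h" and k: "k \<ge> 1"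
  shows "\<exists>\<Phi>. fps_model stab (rep_sum (M1, a1) (rep_tensor ground (M2, a2)
      (rep_sym ground (k - 1) (sub_rep scale UNIV)))) \<Phi> (polys_upto k) (jet_model_act k \<chi>)"
    and "lin_act stab (polys_upto k) (jet_model_act k \<chi>)"
proof -
  obtain n where n: "k = Suc n" using k by (cases k) auto
  let ?F = "ground :: 'f ring"
  obtain S b where S: "rep_sym ?F n (sub_rep scale UNIV) = (S, b)" by (rule prod.exhaust)
  obtain T t where T: "rep_tensor ?F (M2, a2) (S, b) = (T, t)" by (rule prod.exhaust)
  \<comment> \<open>Here \<open>n + 2\<close> equals \<open>k + 1\<close>.\<close>
  define \<chi>2 where "\<chi>2 g = \<chi> g * char g ^ (n + 2)" for g
  have \<chi>2: "\<chi>2 id = 1" "\<And>g h. g \<in> stab \<Longrightarrow> h \<in> stab \<Longrightarrow> \<chi>2 (g \<circ> h) = \<chi>2 g * \<chi>2 h"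
    using \<chi> by (auto simp: \<chi>2_def char_hom power_mult_distrib)
  have sm: "fps_model stab (S, b) (class_lift (sym_val plane_val)) (polys_upto n) (sym_act n)" using sym_plane_model[of n] S by simp
  have M2': "fps_model stab (M2, a2) \<Phi>2 scalars (\<lambda>g w. fps_const (\<chi>2 g) * w)" using M2 by (simp add: \<chi>2_def n)
  define \<Psi> where "\<Psi> = class_lift (\<lambda>(x, y). \<Phi>2 x * class_lift (sym_val plane_val) y)"
  have tm: "fps_model stab (T, t) \<Psi> (polys_upto n) (\<lambda>g w. fps_const (\<chi>2 g) * sym_act n g w)" unfolding T[symmetric] \<Psi>_def
    by (rule rep_tensor_line[OF M2' _ _ stab_group sm sym_lin_act sym_act_diff sym_act_scale]) (use \<chi>2 in auto)
  have li1: "fps_lin_iso M1 \<Phi>1 scalars" and li2: "fps_lin_iso T \<Psi> (polys_upto n)"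
    and ac1: "\<And>g x. g \<in> stab \<Longrightarrow> x \<in> carrier M1 \<Longrightarrow> a1 g x \<in> carrier M1 \<and> \<Phi>1 (a1 g x) = fps_const (\<chi> g) * \<Phi>1 x"
    and ac2: "\<And>g x. g \<in> stab \<Longrightarrow> x \<in> carrier T \<Longrightarrow> t g x \<in> carrier T \<and> \<Psi> (t g x) = fps_const (\<chi>2 g) * sym_act n g (\<Psi> x)"
    using M1 tm by (auto simp: fps_model_def)
  note D1 = fps_lin_isoD[OF li1] and D2 = fps_lin_isoD[OF li2]
  define \<Phi> where "\<Phi> = (\<lambda>(x, y). \<Phi>1 x + rescale n (\<Psi> y))"
  have resc: "rescale n (p + q) = rescale n p + rescale n q" "rescale n (fps_const c * p) = fps_const c * rescale n p"
    "rescale n 0 = 0" for p q c by (rule fps_ext, simp add: rescale_def add_divide_distrib)+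
  have c1: "\<exists>c. \<Phi>1 x = fps_const c" if "x \<in> carrier M1" for x
  proof -
    have "\<Phi>1 x \<in> \<Phi>1 ` carrier M1" using that by (rule imageI)
    then show ?thesis unfolding D1(3) by blast
  qed
  have p2: "\<Psi> y \<in> polys_upto n" if "y \<in> carrier T" for y using imageI[OF that, of \<Psi>] unfolding D2(3) .
  have split: "\<exists>c p. w = fps_const c + rescale n p \<and> p \<in> polys_upto n" if w: "w \<in> polys_upto k" for w
  proof (intro exI conjI)
    \<comment> \<open>Undoes the rescaling. For \<open>j > n\<close> the binomial coefficient is 0,
      which gives the degree bound.\<close>
    let ?p = "Abs_fps (\<lambda>j. w $ Suc j * of_nat (n choose j))"
    show "?p \<in> polys_upto n" by (simp add: polys_upto_def binomial_eq_0)
    show "w = fps_const (w $ 0) + rescale n ?p"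
      by (rule fps_ext) (use w in \<open>auto simp: rescale_def polys_upto_def n binomial_eq_0 not_le\<close>)
  qed
  have inj: "c = c' \<and> p = p'" if "fps_const c + rescale n p = fps_const c' + rescale n p'" "p \<in> polys_upto n" "p' \<in> polys_upto n" for c c' p p'
  proof
    show "c = c'" using arg_cong[OF that(1), of "\<lambda>f. f $ 0"] by simp
    have "p $ j = p' $ j" for j
    proof (cases "j \<le> n")
      case True
      then show ?thesis using arg_cong[OF that(1), of "\<lambda>f. f $ Suc j"] by simp
    qed (use that(2,3) in \<open>simp add: polys_upto_def\<close>)
    then show "p = p'" by (rule fps_ext)
  qed
  have mem: "fps_const c + rescale n p \<in> polys_upto k" if "p \<in> polys_upto n" for c p using that by (auto simp: polys_upto_def rescale_def n)
  have "inj_on \<Phi> (carrier M1 \<times> carrier T)"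
  proof (rule inj_onI)
    fix z z' assume "z \<in> carrier M1 \<times> carrier T" "z' \<in> carrier M1 \<times> carrier T" "\<Phi> z = \<Phi> z'"
    then obtain x y x' y' where z: "z = (x, y)" "z' = (x', y')" "x \<in> carrier M1" "y \<in> carrier T" "x' \<in> carrier M1" "y' \<in> carrier T"
      "\<Phi>1 x + rescale n (\<Psi> y) = \<Phi>1 x' + rescale n (\<Psi> y')" by (auto simp: \<Phi>_def)
    then have "\<Phi>1 x = \<Phi>1 x'" "\<Psi> y = \<Psi> y'" using c1[OF z(3)] c1[OF z(5)] inj p2 by metis+
    then show "z = z'" using z D1(2) D2(2) by (simp add: inj_on_def)
  qed
  moreover have "\<Phi> ` (carrier M1 \<times> carrier T) = polys_upto k"
  proof (intro equalityI subsetI)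
    fix w :: "'f fps" assume "w \<in> \<Phi> ` (carrier M1 \<times> carrier T)"
    then obtain x y where "w = \<Phi>1 x + rescale n (\<Psi> y)" "x \<in> carrier M1" "y \<in> carrier T" by (auto simp: \<Phi>_def)
    then show "w \<in> polys_upto k" using c1[of x] p2[of y] mem by auto
  next
    fix w :: "'f fps" assume "w \<in> polys_upto k"
    then obtain c p where cp: "w = fps_const c + rescale n p" "p \<in> polys_upto n" using split by blast
    have "fps_const c \<in> \<Phi>1 ` carrier M1" "p \<in> \<Psi> ` carrier T" unfolding D1(3) D2(3) using cp by auto
    then obtain x y where "x \<in> carrier M1" "\<Phi>1 x = fps_const c" "y \<in> carrier T" "\<Psi> y = p" by auto
    then show "w \<in> \<Phi> ` (carrier M1 \<times> carrier T)" using cp by (intro image_eqI[of _ _ "(x, y)"]) (simp_all add: \<Phi>_def)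
  qed
  ultimately have "fps_lin_iso (direct_sum M1 T) \<Phi> (polys_upto k)" unfolding fps_lin_iso_def bij_betw_def
    by (simp add: direct_sum_def D1 D2 \<Phi>_def resc algebra_simps)
  moreover have "map_prod (a1 g) (t g) z \<in> carrier M1 \<times> carrier T \<and> \<Phi> (map_prod (a1 g) (t g) z) = jet_model_act k \<chi> g (\<Phi> z)"
    if g: "g \<in> stab" and z: "z \<in> carrier M1 \<times> carrier T" for g z
  proof -
    obtain x y where xy: "z = (x, y)" "x \<in> carrier M1" "y \<in> carrier T" using z by blast
    obtain c where c: "\<Phi>1 x = fps_const c" using c1[OF xy(2)] by blast
    show ?thesis using ac1[OF g xy(2)] ac2[OF g xy(3)] rescale_act[OF g p2[OF xy(3)], of \<chi> c] by (simp add: xy \<Phi>_def c n \<chi>2_def)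
  qed
  moreover have "carrier (direct_sum M1 T) = carrier M1 \<times> carrier T" by (simp add: direct_sum_def)
  ultimately have "fps_model stab (rep_sum (M1, a1) (T, t)) \<Phi> (polys_upto k) (jet_model_act k \<chi>)"
    unfolding fps_model_def rep_sum_def prod.case by (intro conjI ballI) simp_all
  then show "\<exists>\<Phi>. fps_model stab (rep_sum (M1, a1) (rep_tensor ?F (M2, a2)
      (rep_sym ?F (k - 1) (sub_rep scale UNIV)))) \<Phi> (polys_upto k) (jet_model_act k \<chi>)" using S T by (auto simp: n)
  show "lin_act stab (polys_upto k) (jet_model_act k \<chi>)" unfolding lin_act_def
  proof (intro conjI ballI allI)
    fix w :: "'f fps" assume w: "w \<in> polys_upto k"
    then obtain c p where cp: "w = fps_const c + rescale n p" "p \<in> polys_upto n" using split by blast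
    have id: "id \<in> stab" using stab_group by (simp add: trans_group_def)
    have "sym_act n id p = p" using sym_lin_act[of n] cp(2) by (simp add: lin_act_def)
    then show "jet_model_act k \<chi> id w = w" using rescale_act[OF id cp(2), of \<chi> c] by (simp add: n cp \<chi> char_hom)
    fix g h assume g: "g \<in> stab" and h: "h \<in> stab"
    have co: "sym_act n (g \<circ> h) p = sym_act n g (sym_act n h p)" using sym_lin_act[of n] cp(2) g h by (simp add: lin_act_def)
    \<comment> \<open>A preimage of \<open>p\<close> in the tensor product shows that applying
      \<open>h\<close> does not leave \<open>polys_upto n\<close>, so that
      \<open>rescale_act\<close> can be used a second time.\<close>
    have "p \<in> \<Psi> ` carrier T" unfolding D2(3) by (rule cp(2))
    then obtain y where y: "y \<in> carrier T" "\<Psi> y = p" by auto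
    have "fps_const (\<chi>2 h) * sym_act n h p \<in> polys_upto n" using ac2[OF h y(1)] y(2) p2[of "t h y"] by simp
    note gq = rescale_act[OF g this, of \<chi> "\<chi> h * c", folded \<chi>2_def]
    note ghp = rescale_act[OF stab_comp[OF g h] cp(2), of \<chi> c, folded \<chi>2_def] and hp = rescale_act[OF h cp(2), of \<chi> c, folded \<chi>2_def]
    have "fps_const (\<chi>2 (g \<circ> h)) * sym_act n (g \<circ> h) p = fps_const (\<chi>2 g) * sym_act n g (fps_const (\<chi>2 h) * sym_act n h p)"
      unfolding co sym_act_scale \<chi>2(2)[OF g h] fps_const_mult[symmetric] by (simp only: mult.assoc)
    then show "jet_model_act k \<chi> (g \<circ> h) w = jet_model_act k \<chi> g (jet_model_act k \<chi> h w)"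
      unfolding n cp ghp hp gq \<chi>(2)[OF g h] by (simp only: mult.assoc)
  qed (simp_all add: jet_model_act_def fps_compose_add_distrib fps_compose_mult_distrib distrib_left fps_cutoff_add fps_eq_iff)
qed

end

section \<open>Graded rings of functions and their local rings\<close>

text \<open>Operations on classes are unions over all representatives; this states well-definedness
  in the form in which fractions and germs need it.\<close>

lemma union_pairs_const:
  assumes "(a, b) \<in> A" "(c, e) \<in> B" "\<And>a b c e. (a, b) \<in> A \<Longrightarrow> (c, e) \<in> B \<Longrightarrow> f a b c e = K"
  shows "(\<Union>(a, b)\<in>A. \<Union>(c, e)\<in>B. f a b c e) = K"
proof -
  have "(\<Union>w\<in>B. case w of (c, e) \<Rightarrow> f a b c e) = K" if "(a, b) \<in> A" for a b
  proof (rule SUP_eq_const)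
    show "B \<noteq> {}" using assms(2) by blast
    fix w assume "w \<in> B"
    then show "(case w of (c, e) \<Rightarrow> f a b c e) = K" using assms(3)[OF that] by (cases w) simp
  qed
  note * = this
  show ?thesis
  proof (rule SUP_eq_const)
    show "A \<noteq> {}" using assms(1) by blast
    fix z assume "z \<in> A"
    then show "(case z of (a, b) \<Rightarrow> \<Union>(c, e)\<in>B. f a b c e) = K" using * by (cases z) simp
  qed
qed

text \<open>Shared by the coordinate rings of the line and of its square. All operations are
  pointwise, so identities in the ring or among fractions become identities in the field at each
  point.\<close>

locale fun_graded =
  fixes R :: "('x \<Rightarrow> 'f::field, 'd::ab_group_add) graded_ring"
  assumes ops: "monoid.mult R = (\<lambda>f g x. f x * g x)" "one R = (\<lambda>_. 1)" "ring.zero R = (\<lambda>_. 0)"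
      "ring.add R = (\<lambda>f g x. f x + g x)"
    and const_closed: "\<And>c. (\<lambda>_. c) \<in> carrier R"
    and add_closed: "\<And>a b. a \<in> carrier R \<Longrightarrow> b \<in> carrier R \<Longrightarrow> (\<lambda>x. a x + b x) \<in> carrier R"
    and mult_closed: "\<And>a b. a \<in> carrier R \<Longrightarrow> b \<in> carrier R \<Longrightarrow> (\<lambda>x. a x * b x) \<in> carrier R"
    and domain: "\<And>a b. a \<in> carrier R \<Longrightarrow> b \<in> carrier R \<Longrightarrow> (\<And>x. a x * b x = 0) \<Longrightarrow> a = (\<lambda>_. 0) \<or> b = (\<lambda>_. 0)"
    and deg_closed: "\<And>m a. a \<in> degree_part R m \<Longrightarrow> a \<in> carrier R"
    and deg_const: "\<And>c. (\<lambda>_. c) \<in> degree_part R 0"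
    and deg_add: "\<And>m a b. a \<in> degree_part R m \<Longrightarrow> b \<in> degree_part R m \<Longrightarrow> (\<lambda>x. a x + b x) \<in> degree_part R m"
    and deg_mult: "\<And>m n a b. a \<in> degree_part R m \<Longrightarrow> b \<in> degree_part R n \<Longrightarrow> (\<lambda>x. a x * b x) \<in> degree_part R (m + n)"
begin

lemma cancel:
  assumes "a \<in> carrier R" "b \<in> carrier R" "c \<in> carrier R" "c \<noteq> (\<lambda>_. 0)" "\<And>x. a x * c x = b x * c x"
  shows "a = b"
proof -
  have "(\<lambda>x. (-1) * b x) \<in> carrier R" using mult_closed[OF const_closed assms(2), of "-1"] .
  then have "(\<lambda>x. a x + (-1) * b x) \<in> carrier R" by (rule add_closed[OF assms(1)])
  moreover have "(a x + (-1) * b x) * c x = 0" for x using assms(5)[of x] by (simp add: algebra_simps)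
  ultimately have "(\<lambda>x. a x + (-1) * b x) = (\<lambda>_. 0)" using domain[OF _ assms(3)] assms(4) by blast
  then show ?thesis by (metis (no_types) add.right_neutral add_right_cancel mult_minus1 right_minus ext)
qed

lemma cring_R: "cring R"
proof (rule cringI)
  show "abelian_group R"
  proof (rule abelian_groupI)
    fix a assume a: "a \<in> carrier R"
    show "\<exists>b\<in>carrier R. b \<oplus>\<^bsub>R\<^esub> a = \<zero>\<^bsub>R\<^esub>"
      by (rule bexI[of _ "\<lambda>x. (-1) * a x"]) (simp_all only: ops, simp, rule mult_closed[OF const_closed a])
  qed (simp_all add: ops add_closed const_closed[of 0] algebra_simps)
  show "comm_monoid R" by (rule comm_monoidI) (simp_all add: ops mult_closed const_closed[of 1] algebra_simps)
qed (simp_all add: ops algebra_simps)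

lemma mem_fraction: "(c, e) \<in> fraction R a b \<longleftrightarrow>
    c \<in> carrier R \<and> e \<in> carrier R \<and> e \<noteq> (\<lambda>_. 0) \<and> (\<forall>x. a x * e x = c x * b x)"
  by (auto simp: fraction_def ops fun_eq_iff)

lemma fraction_self: "a \<in> carrier R \<Longrightarrow> b \<in> carrier R \<Longrightarrow> b \<noteq> (\<lambda>_. 0) \<Longrightarrow> (a, b) \<in> fraction R a b"
  by (simp add: mem_fraction)

text \<open>Cross multiplication is a transitive relation because a nonzero denominator can be
  cancelled in a domain.\<close>

lemma fraction_eqI:
  assumes "a \<in> carrier R" "b \<in> carrier R" "b \<noteq> (\<lambda>_. 0)" "c \<in> carrier R" "e \<in> carrier R" "e \<noteq> (\<lambda>_. 0)"
    and "\<And>x. a x * e x = c x * b x"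
  shows "fraction R a b = fraction R c e"
proof -
  have *: "fraction R a b \<subseteq> fraction R c e"
    if h: "a \<in> carrier R" "b \<in> carrier R" "b \<noteq> (\<lambda>_. 0)" "c \<in> carrier R" "e \<in> carrier R" "e \<noteq> (\<lambda>_. 0)"
      "\<And>x. a x * e x = c x * b x" for a b c e
  proof
    fix z assume "z \<in> fraction R a b"
    then obtain f g where z: "z = (f, g)" "f \<in> carrier R" "g \<in> carrier R" "g \<noteq> (\<lambda>_. 0)" "\<And>x. a x * g x = f x * b x"
      by (cases z) (auto simp: mem_fraction)
    have "(\<lambda>x. c x * g x) = (\<lambda>x. f x * e x)"
    proof (rule cancel[OF _ _ h(2,3)])
      fix x
      have "c x * g x * b x = (a x * g x) * e x" using h(7)[of x] by (simp add: mult_ac)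
      then show "c x * g x * b x = f x * e x * b x" unfolding z(5) by (simp add: mult_ac)
    qed (use z h mult_closed in auto)
    then show "z \<in> fraction R c e" using z by (auto simp: mem_fraction dest: fun_cong)
  qed
  show ?thesis using *[OF assms] *[OF assms(4-6,1-3)] assms(7) by (metis subset_antisym)
qed

lemma mult_nz:
  assumes "b \<in> carrier R" "b \<noteq> (\<lambda>_. 0)" "e \<in> carrier R" "e \<noteq> (\<lambda>_. 0)"
  shows "(\<lambda>x. b x * e x) \<noteq> (\<lambda>_. 0)"
  using domain[OF assms(1,3)] assms(2,4) by (metis (no_types))

lemma fraction_add_eq:
  assumes "a \<in> carrier R" "b \<in> carrier R" "b \<noteq> (\<lambda>_. 0)" "c \<in> carrier R" "e \<in> carrier R" "e \<noteq> (\<lambda>_. 0)"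
  shows "fraction_add R (fraction R a b) (fraction R c e) = fraction R (\<lambda>x. a x * e x + c x * b x) (\<lambda>x. b x * e x)"
proof -
  have "fraction R (\<lambda>x. a' x * e' x + c' x * b' x) (\<lambda>x. b' x * e' x) = fraction R (\<lambda>x. a x * e x + c x * b x) (\<lambda>x. b x * e x)"
    if "(a', b') \<in> fraction R a b" "(c', e') \<in> fraction R c e" for a' b' c' e'
  proof -
    have *: "a' \<in> carrier R" "b' \<in> carrier R" "b' \<noteq> (\<lambda>_. 0)" "c' \<in> carrier R" "e' \<in> carrier R" "e' \<noteq> (\<lambda>_. 0)"
      and ab: "\<And>x. a x * b' x = a' x * b x" and ce: "\<And>x. c x * e' x = c' x * e x" using that unfolding mem_fraction by auto
    show ?thesis
    proof (rule fraction_eqI)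
      fix x
      have "(a' x * e' x + c' x * b' x) * (b x * e x) = (a' x * b x) * e' x * e x + (c' x * e x) * b' x * b x" by (simp add: algebra_simps)
      also have "\<dots> = (a x * b' x) * e' x * e x + (c x * e' x) * b' x * b x" unfolding ab ce ..
      finally show "(a' x * e' x + c' x * b' x) * (b x * e x) = (a x * e x + c x * b x) * (b' x * e' x)" by (simp add: algebra_simps)
    qed (simp_all add: assms * mult_closed add_closed mult_nz)
  qed
  then show ?thesis unfolding fraction_add_def ops by (rule union_pairs_const[OF fraction_self[OF assms(1-3)] fraction_self[OF assms(4-6)]])
qed

lemma fraction_mult_eq:
  assumes "a \<in> carrier R" "b \<in> carrier R" "b \<noteq> (\<lambda>_. 0)" "c \<in> carrier R" "e \<in> carrier R" "e \<noteq> (\<lambda>_. 0)"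
  shows "fraction_mult R (fraction R a b) (fraction R c e) = fraction R (\<lambda>x. a x * c x) (\<lambda>x. b x * e x)"
proof -
  have "fraction R (\<lambda>x. a' x * c' x) (\<lambda>x. b' x * e' x) = fraction R (\<lambda>x. a x * c x) (\<lambda>x. b x * e x)"
    if "(a', b') \<in> fraction R a b" "(c', e') \<in> fraction R c e" for a' b' c' e'
  proof -
    have *: "a' \<in> carrier R" "b' \<in> carrier R" "b' \<noteq> (\<lambda>_. 0)" "c' \<in> carrier R" "e' \<in> carrier R" "e' \<noteq> (\<lambda>_. 0)"
      and ab: "\<And>x. a x * b' x = a' x * b x" and ce: "\<And>x. c x * e' x = c' x * e x" using that unfolding mem_fraction by auto
    show ?thesis
    proof (rule fraction_eqI)
      fix x
      have "a' x * c' x * (b x * e x) = (a' x * b x) * (c' x * e x)" by (simp add: mult_ac)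
      also have "\<dots> = (a x * b' x) * (c x * e' x)" unfolding ab ce ..
      finally show "a' x * c' x * (b x * e x) = a x * c x * (b' x * e' x)" by (simp add: mult_ac)
    qed (simp_all add: assms * mult_closed mult_nz)
  qed
  then show ?thesis unfolding fraction_mult_def ops by (rule union_pairs_const[OF fraction_self[OF assms(1-3)] fraction_self[OF assms(4-6)]])
qed

lemma ProjD:
  assumes "p \<in> Proj R"
  shows "p \<subseteq> carrier R" "(\<lambda>_. 0) \<in> p" "(\<lambda>_. 1) \<notin> p"
    "\<And>a b. a \<in> p \<Longrightarrow> b \<in> p \<Longrightarrow> (\<lambda>x. a x + b x) \<in> p"
    "\<And>a b. a \<in> p \<Longrightarrow> b \<in> carrier R \<Longrightarrow> (\<lambda>x. b x * a x) \<in> p"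
    "\<And>a b. a \<in> carrier R \<Longrightarrow> b \<in> carrier R \<Longrightarrow> a \<notin> p \<Longrightarrow> b \<notin> p \<Longrightarrow> (\<lambda>x. a x * b x) \<notin> p"
    "p = genideal R (p \<inter> homogeneous R)" "\<And>S. S \<in> irrelevant_gens R \<Longrightarrow> \<not> S \<subseteq> p"
proof -
  have pr: "primeideal p R" using assms by (simp add: Proj_def)
  then interpret primeideal p R .
  show "p \<subseteq> carrier R" by (rule a_subset)
  show "(\<lambda>_. 0) \<in> p" using additive_subgroup.zero_closed[OF additive_subgroup_axioms] by (simp add: ops)
  show "(\<lambda>_. 1) \<notin> p" using I_notcarr one_imp_carrier by (auto simp: ops)
  show "(\<lambda>x. a x + b x) \<in> p" if "a \<in> p" "b \<in> p" for a b using additive_subgroup.a_closed[OF additive_subgroup_axioms that] by (simp add: ops)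
  show "(\<lambda>x. b x * a x) \<in> p" if "a \<in> p" "b \<in> carrier R" for a b using I_l_closed[OF that] by (simp add: ops)
  show "(\<lambda>x. a x * b x) \<notin> p" if "a \<in> carrier R" "b \<in> carrier R" "a \<notin> p" "b \<notin> p" for a b
    using I_prime[OF that(1,2)] that(3,4) by (auto simp: ops)
  show "p = genideal R (p \<inter> homogeneous R)" "\<And>S. S \<in> irrelevant_gens R \<Longrightarrow> \<not> S \<subseteq> p"
    using assms by (auto simp: Proj_def)
qed

text \<open>Homogeneity of \<open>p\<close> is asked for in the form in which it will be verified:
  each ideal containing the homogeneous elements of \<open>p\<close> contains
  \<open>p\<close>.\<close>

lemma ProjI:
  assumes "p \<subseteq> carrier R" "(\<lambda>_. 1) \<notin> p" "(\<lambda>_. 0) \<in> p"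
    and add: "\<And>a b. a \<in> p \<Longrightarrow> b \<in> p \<Longrightarrow> (\<lambda>x. a x + b x) \<in> p"
    and mult: "\<And>a b. a \<in> p \<Longrightarrow> b \<in> carrier R \<Longrightarrow> (\<lambda>x. b x * a x) \<in> p"
    and prime: "\<And>a b. a \<in> carrier R \<Longrightarrow> b \<in> carrier R \<Longrightarrow> (\<lambda>x. a x * b x) \<in> p \<Longrightarrow> a \<in> p \<or> b \<in> p"
    and hom: "\<And>a J. a \<in> p \<Longrightarrow> ideal J R \<Longrightarrow> p \<inter> homogeneous R \<subseteq> J \<Longrightarrow> a \<in> J"
    and irr: "\<And>S. S \<in> irrelevant_gens R \<Longrightarrow> \<not> S \<subseteq> p"
  shows "p \<in> Proj R"
proof -
  interpret cring R by (rule cring_R)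
  have neg: "\<ominus>\<^bsub>R\<^esub> a = (\<lambda>x. (-1) * a x)" if "a \<in> carrier R" for a
    using that mult_closed[OF const_closed that, of "-1"] by (intro minus_equality) (simp_all add: ops)
  have sub: "subgroup p (add_monoid R)"
  proof
    fix a assume a: "a \<in> p"
    then have "inv\<^bsub>add_monoid R\<^esub> a = (\<lambda>x. (-1) * a x)" using neg[of a] assms(1) by (auto simp: a_inv_def)
    then show "inv\<^bsub>add_monoid R\<^esub> a \<in> p" using mult[OF a const_closed[of "-1"]] by simp
  qed (use assms in \<open>auto simp: ops\<close>)
  have id: "ideal p R" by (rule idealI[OF ring_axioms sub]) (use mult assms(1) in \<open>auto simp: ops mult.commute\<close>)
  have "primeideal p R" by (rule primeidealI[OF id cring_R]) (use assms(1,2) one_closed prime in \<open>auto simp: ops\<close>)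
  moreover have "p = genideal R (p \<inter> homogeneous R)"
  proof
    show "p \<subseteq> genideal R (p \<inter> homogeneous R)" using hom by (auto simp: genideal_def)
    show "genideal R (p \<inter> homogeneous R) \<subseteq> p" by (rule genideal_minimal[OF id]) simp
  qed
  ultimately show ?thesis using irr by (simp add: Proj_def)
qed

lemma deg_scale: "a \<in> degree_part R m \<Longrightarrow> (\<lambda>x. c * a x) \<in> degree_part R m"
  using deg_mult[OF deg_const, of a m c] by simp

lemma deg_diff: "a \<in> degree_part R m \<Longrightarrow> b \<in> degree_part R m \<Longrightarrow> (\<lambda>x. a x - b x) \<in> degree_part R m"
  using deg_add[OF _ deg_scale, of a m b "-1"] by simp

lemma twist_ops:
  "\<And>r s. r \<otimes>\<^bsub>twist_stalk R d p\<^esub> s = fraction_mult R r s" "\<And>r s. r \<odot>\<^bsub>twist_stalk R d p\<^esub> s = fraction_mult R r s"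
  "\<And>r s. r \<oplus>\<^bsub>twist_stalk R d p\<^esub> s = fraction_add R r s" "\<zero>\<^bsub>twist_stalk R d p\<^esub> = fraction R (\<lambda>_. 0) (\<lambda>_. 1)"
  "\<one>\<^bsub>twist_stalk R d p\<^esub> = fraction R (\<lambda>_. 1) (\<lambda>_. 1)"
  by (simp_all add: twist_stalk_def ops)

lemma twist_memI:
  "a \<in> degree_part R m \<Longrightarrow> b \<in> degree_part R n \<Longrightarrow> m - n = d \<Longrightarrow> b \<notin> p \<Longrightarrow> fraction R a b \<in> carrier (twist_stalk R d p)"
  by (auto simp: twist_stalk_def)

lemma twist_memE:
  assumes "F \<in> carrier (twist_stalk R d p)"
  obtains a b m n where "F = fraction R a b" "a \<in> degree_part R m" "b \<in> degree_part R n" "m - n = d" "b \<notin> p"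
  using assms by (auto simp: twist_stalk_def)

lemma notin_nz: "p \<in> Proj R \<Longrightarrow> b \<notin> p \<Longrightarrow> b \<noteq> (\<lambda>_. 0)"
  using ProjD(2) by blast

lemma twist_closed:
  assumes p: "p \<in> Proj R" and F: "F \<in> carrier (twist_stalk R d p)" and G: "G \<in> carrier (twist_stalk R d p)"
    and r: "r \<in> carrier (twist_stalk R 0 p)"
  shows "fraction_add R F G \<in> carrier (twist_stalk R d p)" "fraction_mult R r F \<in> carrier (twist_stalk R d p)"
proof -
  obtain a b m n where F': "F = fraction R a b" "a \<in> degree_part R m" "b \<in> degree_part R n" "m - n = d" "b \<notin> p"
    by (rule twist_memE[OF F])
  obtain c e m' n' where G': "G = fraction R c e" "c \<in> degree_part R m'" "e \<in> degree_part R n'" "m' - n' = d" "e \<notin> p"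
    by (rule twist_memE[OF G])
  obtain s t l l' where r': "r = fraction R s t" "s \<in> degree_part R l" "t \<in> degree_part R l'" "l - l' = 0" "t \<notin> p"
    by (rule twist_memE[OF r])
  note nz = notin_nz[OF p] and cl = deg_closed
  have "m + n' = m' + n" using F'(4) G'(4) by (simp add: algebra_simps)
  then have "(\<lambda>x. a x * e x + c x * b x) \<in> degree_part R (m + n')"
    using deg_mult[OF F'(2) G'(3)] deg_mult[OF G'(2) F'(3)] by (intro deg_add) simp_all
  moreover have "m + n' - (n + n') = d" using F'(4) by simp
  ultimately show "fraction_add R F G \<in> carrier (twist_stalk R d p)"
    unfolding F'(1) G'(1) fraction_add_eq[OF cl[OF F'(2)] cl[OF F'(3)] nz[OF F'(5)] cl[OF G'(2)] cl[OF G'(3)] nz[OF G'(5)]]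
    using twist_memI[OF _ deg_mult[OF F'(3) G'(3)] _ ProjD(6)[OF p cl[OF F'(3)] cl[OF G'(3)] F'(5) G'(5)]] by blast
  have "l + m - (l' + n) = d" using F'(4) r'(4) by (simp add: algebra_simps)
  then show "fraction_mult R r F \<in> carrier (twist_stalk R d p)"
    unfolding F'(1) r'(1) fraction_mult_eq[OF cl[OF r'(2)] cl[OF r'(3)] nz[OF r'(5)] cl[OF F'(2)] cl[OF F'(3)] nz[OF F'(5)]]
    using twist_memI[OF deg_mult[OF r'(2) F'(2)] deg_mult[OF r'(3) F'(3)] _ ProjD(6)[OF p cl[OF r'(3)] cl[OF F'(3)] r'(5) F'(5)]] by blast
qed

definition is_frac :: "('x \<Rightarrow> 'f) \<Rightarrow> ('x \<Rightarrow> 'f) \<Rightarrow> bool" where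
  "is_frac a b \<longleftrightarrow> a \<in> carrier R \<and> b \<in> carrier R \<and> b \<noteq> (\<lambda>_. 0)"

lemma twist_frac:
  assumes p: "p \<in> Proj R" and "F \<in> carrier (twist_stalk R d p)"
  shows "\<exists>a b. F = fraction R a b \<and> is_frac a b"
proof -
  obtain a b m n where "F = fraction R a b" "a \<in> degree_part R m" "b \<in> degree_part R n" "m - n = d" "b \<notin> p"
    by (rule twist_memE[OF assms(2)])
  then show ?thesis using notin_nz[OF p] deg_closed unfolding is_frac_def by blast
qed

lemma frac_add: "is_frac a b \<Longrightarrow> is_frac c e \<Longrightarrow>
    fraction_add R (fraction R a b) (fraction R c e) = fraction R (\<lambda>x. a x * e x + c x * b x) (\<lambda>x. b x * e x)"
  unfolding is_frac_def by (intro fraction_add_eq) auto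

lemma frac_mult: "is_frac a b \<Longrightarrow> is_frac c e \<Longrightarrow>
    fraction_mult R (fraction R a b) (fraction R c e) = fraction R (\<lambda>x. a x * c x) (\<lambda>x. b x * e x)"
  unfolding is_frac_def by (intro fraction_mult_eq) auto

lemma is_frac_add: "is_frac a b \<Longrightarrow> is_frac c e \<Longrightarrow> is_frac (\<lambda>x. a x * e x + c x * b x) (\<lambda>x. b x * e x)"
  unfolding is_frac_def by (intro conjI add_closed mult_closed mult_nz) auto

lemma is_frac_mult: "is_frac a b \<Longrightarrow> is_frac c e \<Longrightarrow> is_frac (\<lambda>x. a x * c x) (\<lambda>x. b x * e x)"
  unfolding is_frac_def by (intro conjI mult_closed mult_nz) auto

lemma is_frac_const: "c \<noteq> 0 \<Longrightarrow> a \<in> carrier R \<Longrightarrow> is_frac a (\<lambda>_. c)"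
  using const_closed[of c] by (auto simp: is_frac_def fun_eq_iff)

lemma frac_eqI: "is_frac a b \<Longrightarrow> is_frac c e \<Longrightarrow> (\<And>x. a x * e x = c x * b x) \<Longrightarrow> fraction R a b = fraction R c e"
  unfolding is_frac_def by (intro fraction_eqI) auto

lemma fraction_distrib:
  assumes "p \<in> Proj R" "F \<in> carrier (twist_stalk R d p)" "G \<in> carrier (twist_stalk R d p)" "H \<in> carrier (twist_stalk R d' p)"
  shows "fraction_mult R H (fraction_add R F G) = fraction_add R (fraction_mult R H F) (fraction_mult R H G)"
    "fraction_mult R (fraction_add R F G) H = fraction_add R (fraction_mult R F H) (fraction_mult R G H)"
proof -
  obtain a b c e f g where *: "F = fraction R a b" "is_frac a b" "G = fraction R c e" "is_frac c e" "H = fraction R f g" "is_frac f g"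
    using twist_frac[OF assms(1)] assms(2-4) by meson
  note i = *(2,4,6) and fr = frac_add frac_mult
  note s = is_frac_add[OF i(1,2)] and m = is_frac_mult[OF i(3,1)] is_frac_mult[OF i(3,2)] is_frac_mult[OF i(1,3)] is_frac_mult[OF i(2,3)]
  show "fraction_mult R H (fraction_add R F G) = fraction_add R (fraction_mult R H F) (fraction_mult R H G)"
    unfolding *(1,3,5) frac_add[OF i(1,2)] frac_mult[OF i(3) s] frac_mult[OF i(3,1)] frac_mult[OF i(3,2)] frac_add[OF m(1,2)]
    by (rule frac_eqI[OF is_frac_mult[OF i(3) s] is_frac_add[OF m(1,2)]]) (simp add: algebra_simps)
  show "fraction_mult R (fraction_add R F G) H = fraction_add R (fraction_mult R F H) (fraction_mult R G H)"
    unfolding *(1,3,5) frac_add[OF i(1,2)] frac_mult[OF s i(3)] frac_mult[OF i(1,3)] frac_mult[OF i(2,3)] frac_add[OF m(3,4)]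
    by (rule frac_eqI[OF is_frac_mult[OF s i(3)] is_frac_add[OF m(3,4)]]) (simp add: algebra_simps)
qed

lemma fraction_comm_assoc:
  assumes "p \<in> Proj R" "F \<in> carrier (twist_stalk R d p)" "G \<in> carrier (twist_stalk R d' p)" "H \<in> carrier (twist_stalk R d'' p)"
  shows "fraction_mult R F G = fraction_mult R G F"
    "fraction_mult R (fraction_mult R F G) H = fraction_mult R F (fraction_mult R G H)"
proof -
  obtain a b c e f g where *: "F = fraction R a b" "is_frac a b" "G = fraction R c e" "is_frac c e" "H = fraction R f g" "is_frac f g"
    using twist_frac[OF assms(1)] assms(2-4) by meson
  show "fraction_mult R F G = fraction_mult R G F"
    "fraction_mult R (fraction_mult R F G) H = fraction_mult R F (fraction_mult R G H)" by (simp_all add: * frac_mult is_frac_mult mult_ac)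
qed

lemma fraction_one_mult:
  assumes "p \<in> Proj R" "F \<in> carrier (twist_stalk R d p)"
  shows "fraction_mult R (fraction R (\<lambda>_. 1) (\<lambda>_. 1)) F = F"
proof -
  obtain a b where *: "F = fraction R a b" "is_frac a b" using twist_frac[OF assms] by blast
  show ?thesis using * is_frac_const[OF one_neq_zero const_closed[of 1]] by (simp add: frac_mult)
qed

lemma twist_abelian_group_axioms:
  assumes p: "p \<in> Proj R" and F: "F \<in> carrier (twist_stalk R d p)" and G: "G \<in> carrier (twist_stalk R d p)"
    and H: "H \<in> carrier (twist_stalk R d p)"
  shows "fraction_add R (fraction_add R F G) H = fraction_add R F (fraction_add R G H)"
    "fraction_add R F G = fraction_add R G F"
    "fraction_add R (fraction R (\<lambda>_. 0) (\<lambda>_. 1)) F = F"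
    "fraction_add R (fraction_mult R (fraction R (\<lambda>_. - 1) (\<lambda>_. 1)) F) F = fraction R (\<lambda>_. 0) (\<lambda>_. 1)"
proof -
  obtain a b c e f g where *: "F = fraction R a b" "is_frac a b" "G = fraction R c e" "is_frac c e" "H = fraction R f g" "is_frac f g"
    using twist_frac[OF p] F G H by meson
  have cf: "is_frac (\<lambda>_. k) (\<lambda>_. 1)" for k by (rule is_frac_const[OF one_neq_zero const_closed])
  note i = *(2,4,6)
  show "fraction_add R (fraction_add R F G) H = fraction_add R F (fraction_add R G H)"
    unfolding *(1,3,5) frac_add[OF i(1,2)] frac_add[OF i(2,3)] frac_add[OF is_frac_add[OF i(1,2)] i(3)] frac_add[OF i(1) is_frac_add[OF i(2,3)]]
    by (rule frac_eqI[OF is_frac_add[OF is_frac_add[OF i(1,2)] i(3)] is_frac_add[OF i(1) is_frac_add[OF i(2,3)]]]) (simp add: algebra_simps)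
  show "fraction_add R F G = fraction_add R G F" unfolding *(1,3) frac_add[OF i(1,2)] frac_add[OF i(2,1)]
    by (rule frac_eqI[OF is_frac_add[OF i(1,2)] is_frac_add[OF i(2,1)]]) (simp add: algebra_simps)
  show "fraction_add R (fraction R (\<lambda>_. 0) (\<lambda>_. 1)) F = F" using frac_add[OF cf *(2), of 0] by (simp add: *)
  have "is_frac (\<lambda>x. - 1 * a x) (\<lambda>x. 1 * b x)" by (rule is_frac_mult[OF cf *(2)])
  from frac_add[OF this *(2)] is_frac_add[OF this *(2)]
  show "fraction_add R (fraction_mult R (fraction R (\<lambda>_. - 1) (\<lambda>_. 1)) F) F = fraction R (\<lambda>_. 0) (\<lambda>_. 1)"
    unfolding * frac_mult[OF cf *(2)] by (simp only:) (rule frac_eqI, simp_all add: cf)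
qed

lemma const_mem: "p \<in> Proj R \<Longrightarrow> fraction R (\<lambda>_. c) (\<lambda>_. 1) \<in> carrier (twist_stalk R 0 p)"
  by (rule twist_memI[OF deg_const deg_const]) (use ProjD(3) in auto)

lemma local_cring: assumes p: "p \<in> Proj R" shows "cring (twist_stalk R 0 p)"
proof (rule cringI)
  let ?O = "twist_stalk R 0 p"
  note cl = twist_closed[OF p, of _ 0] and ax = twist_abelian_group_axioms[OF p, of _ 0]
  show "abelian_group ?O"
  proof (rule abelian_groupI)
    fix x assume x: "x \<in> carrier ?O"
    show "\<exists>y\<in>carrier ?O. y \<oplus>\<^bsub>?O\<^esub> x = \<zero>\<^bsub>?O\<^esub>"
      by (rule bexI[of _ "fraction_mult R (fraction R (\<lambda>_. - 1) (\<lambda>_. 1)) x"])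
        (simp_all only: twist_ops ax(4)[OF x x x] cl(2)[OF x x const_mem[OF p]])
  next
    fix x y z assume x: "x \<in> carrier ?O" and y: "y \<in> carrier ?O" and z: "z \<in> carrier ?O"
    show "x \<oplus>\<^bsub>?O\<^esub> y \<oplus>\<^bsub>?O\<^esub> z = x \<oplus>\<^bsub>?O\<^esub> (y \<oplus>\<^bsub>?O\<^esub> z)" unfolding twist_ops by (rule ax(1)[OF x y z])
  next
    fix x y assume x: "x \<in> carrier ?O" and y: "y \<in> carrier ?O"
    show "x \<oplus>\<^bsub>?O\<^esub> y = y \<oplus>\<^bsub>?O\<^esub> x" unfolding twist_ops by (rule ax(2)[OF x y x])
    show "x \<oplus>\<^bsub>?O\<^esub> y \<in> carrier ?O" unfolding twist_ops by (rule cl(1)[OF x y x])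
  next
    fix x assume x: "x \<in> carrier ?O"
    show "\<zero>\<^bsub>?O\<^esub> \<oplus>\<^bsub>?O\<^esub> x = x" unfolding twist_ops by (rule ax(3)[OF x x x])
  qed (simp_all only: twist_ops const_mem[OF p])
  show "comm_monoid ?O"
  proof (rule comm_monoidI)
    fix x y z assume x: "x \<in> carrier ?O" and y: "y \<in> carrier ?O" and z: "z \<in> carrier ?O"
    show "x \<otimes>\<^bsub>?O\<^esub> y \<otimes>\<^bsub>?O\<^esub> z = x \<otimes>\<^bsub>?O\<^esub> (y \<otimes>\<^bsub>?O\<^esub> z)" unfolding twist_ops by (rule fraction_comm_assoc(2)[OF p x y z])
  next
    fix x y assume x: "x \<in> carrier ?O" and y: "y \<in> carrier ?O"
    show "x \<otimes>\<^bsub>?O\<^esub> y = y \<otimes>\<^bsub>?O\<^esub> x" unfolding twist_ops by (rule fraction_comm_assoc(1)[OF p x y x])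
    show "x \<otimes>\<^bsub>?O\<^esub> y \<in> carrier ?O" unfolding twist_ops by (rule cl(2)[OF y y x])
  next
    fix x assume x: "x \<in> carrier ?O"
    show "\<one>\<^bsub>?O\<^esub> \<otimes>\<^bsub>?O\<^esub> x = x" unfolding twist_ops by (rule fraction_one_mult[OF p x])
  qed (simp_all only: twist_ops const_mem[OF p])
  fix x y z assume x: "x \<in> carrier ?O" and y: "y \<in> carrier ?O" and z: "z \<in> carrier ?O"
  show "(x \<oplus>\<^bsub>?O\<^esub> y) \<otimes>\<^bsub>?O\<^esub> z = x \<otimes>\<^bsub>?O\<^esub> z \<oplus>\<^bsub>?O\<^esub> y \<otimes>\<^bsub>?O\<^esub> z" unfolding twist_ops by (rule fraction_distrib(2)[OF p x y z])
qed

lemma zariski_open_basic: "b \<in> degree_part R m \<Longrightarrow> zariski_open R {p \<in> Proj R. b \<notin> p}"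
  unfolding zariski_open_def homogeneous_def by (intro exI[of _ "{b}"]) auto

lemma zariski_open_basis:
  assumes "zariski_open R U" "p \<in> U"
  obtains b m where "b \<in> degree_part R m" "b \<notin> p" "{q \<in> Proj R. b \<notin> q} \<subseteq> U"
proof -
  obtain T where T: "T \<subseteq> homogeneous R" "U = {p \<in> Proj R. \<not> T \<subseteq> p}" using assms(1) by (auto simp: zariski_open_def)
  then obtain b where "b \<in> T" "b \<notin> p" using assms(2) by blast
  then show ?thesis using that T unfolding homogeneous_def by blast
qed

text \<open>For primes, avoiding some \<open>a\<close> and some \<open>b\<close> is the same as
  avoiding the product, so products of the defining functions cut out the intersection.\<close>

lemma zariski_open_Int:
  assumes "zariski_open R U" "zariski_open R U'" shows "zariski_open R (U \<inter> U')"
proof -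
  obtain T T' where T: "T \<subseteq> homogeneous R" "U = {p \<in> Proj R. \<not> T \<subseteq> p}"
    and T': "T' \<subseteq> homogeneous R" "U' = {p \<in> Proj R. \<not> T' \<subseteq> p}" using assms by (auto simp: zariski_open_def)
  have hc: "homogeneous R \<subseteq> carrier R" using deg_closed by (auto simp: homogeneous_def)
  let ?S = "{(\<lambda>x. a x * b x) | a b. a \<in> T \<and> b \<in> T'}"
  have "?S \<subseteq> homogeneous R"
  proof
    fix s assume "s \<in> ?S"
    then obtain a b where s: "s = (\<lambda>x. a x * b x)" "a \<in> T" "b \<in> T'" by blast
    obtain m where m: "a \<in> degree_part R m" using subsetD[OF T(1) s(2)] unfolding homogeneous_def by (rule UN_E)
    obtain n where n: "b \<in> degree_part R n" using subsetD[OF T'(1) s(3)] unfolding homogeneous_def by (rule UN_E)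
    show "s \<in> homogeneous R" unfolding s(1) homogeneous_def by (rule UN_I[OF UNIV_I]) (rule deg_mult[OF m n])
  qed
  moreover have "U \<inter> U' = {p \<in> Proj R. \<not> ?S \<subseteq> p}"
  proof (intro equalityI subsetI)
    fix p assume "p \<in> U \<inter> U'"
    then obtain a b where "p \<in> Proj R" "a \<in> T" "a \<notin> p" "b \<in> T'" "b \<notin> p" unfolding T T' by blast
    moreover then have "(\<lambda>x. a x * b x) \<notin> p" using T(1) T'(1) hc by (intro ProjD(6)) blast+
    ultimately have "(\<lambda>x. a x * b x) \<in> ?S" "(\<lambda>x. a x * b x) \<notin> p" "p \<in> Proj R" by (auto simp only: mem_Collect_eq)
    then show "p \<in> {p \<in> Proj R. \<not> ?S \<subseteq> p}" by (metis (mono_tags, lifting) mem_Collect_eq subsetD)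
  next
    fix p assume "p \<in> {p \<in> Proj R. \<not> ?S \<subseteq> p}"
    then have "p \<in> Proj R" "\<not> ?S \<subseteq> p" by simp_all
    then obtain s where "s \<in> ?S" "s \<notin> p" by (meson subsetI)
    then obtain a b where p: "p \<in> Proj R" "a \<in> T" "b \<in> T'" "(\<lambda>x. a x * b x) \<notin> p"
      using \<open>p \<in> Proj R\<close> by (auto simp only: mem_Collect_eq)
    have "a \<notin> p" using ProjD(5)[OF p(1), of a b] p T'(1) hc by (auto simp: mult.commute)
    moreover have "b \<notin> p" using ProjD(5)[OF p(1), of b a] p T(1) hc by auto
    ultimately show "p \<in> U \<inter> U'" unfolding T T' using p by blast
  qed
  ultimately show ?thesis unfolding zariski_open_def by blast
qed

lemma zariski_open_Proj: "zariski_open R (Proj R)"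
proof -
  have "Proj R = {p \<in> Proj R. (\<lambda>_. 1) \<notin> p}" using ProjD(3) by blast
  then show ?thesis using zariski_open_basic[OF deg_const[of 1]] by simp
qed

lemma nbhd_Int: "nbhd R p U \<Longrightarrow> nbhd R p U' \<Longrightarrow> nbhd R p (U \<inter> U')"
  by (auto simp: nbhd_def zariski_open_Int)

end

section \<open>Polynomial functions on the plane and its square\<close>

context fun_graded begin

lemma idealD:
  assumes "ideal J R"
  shows "(\<lambda>_. 0) \<in> J" "\<And>a b. a \<in> J \<Longrightarrow> b \<in> J \<Longrightarrow> (\<lambda>x. a x + b x) \<in> J"
    "\<And>a b. a \<in> J \<Longrightarrow> b \<in> carrier R \<Longrightarrow> (\<lambda>x. b x * a x) \<in> J" "J \<subseteq> carrier R"
proof -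
  interpret ideal J R by fact
  show "(\<lambda>_. 0) \<in> J" using additive_subgroup.zero_closed[OF additive_subgroup_axioms] by (simp add: ops)
  show "(\<lambda>x. a x + b x) \<in> J" if "a \<in> J" "b \<in> J" for a b
    using additive_subgroup.a_closed[OF additive_subgroup_axioms that] by (simp add: ops)
  show "(\<lambda>x. b x * a x) \<in> J" if "a \<in> J" "b \<in> carrier R" for a b using I_l_closed[OF that] by (simp add: ops)
  show "J \<subseteq> carrier R" by (rule a_subset)
qed

lemma idealI':
  assumes "J \<subseteq> carrier R" "(\<lambda>_. 0) \<in> J"
    and add: "\<And>a b. a \<in> J \<Longrightarrow> b \<in> J \<Longrightarrow> (\<lambda>x. a x + b x) \<in> J"
    and mult: "\<And>a b. a \<in> J \<Longrightarrow> b \<in> carrier R \<Longrightarrow> (\<lambda>x. b x * a x) \<in> J"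
  shows "ideal J R"
proof -
  interpret cring R by (rule cring_R)
  have neg: "\<ominus>\<^bsub>R\<^esub> a = (\<lambda>x. (-1) * a x)" if "a \<in> carrier R" for a
    using that mult_closed[OF const_closed that, of "-1"] by (intro minus_equality) (simp_all add: ops)
  have sub: "subgroup J (add_monoid R)"
  proof
    fix a assume a: "a \<in> J"
    then have "inv\<^bsub>add_monoid R\<^esub> a = (\<lambda>x. (-1) * a x)" using neg[of a] assms(1) by (auto simp: a_inv_def)
    then show "inv\<^bsub>add_monoid R\<^esub> a \<in> J" using mult[OF a const_closed[of "-1"]] by simp
  qed (use assms in \<open>auto simp: ops\<close>)
  show ?thesis by (rule idealI[OF ring_axioms sub]) (use mult assms(1) in \<open>auto simp: ops mult.commute\<close>)
qed

lemma Proj_minimal: "p \<in> Proj R \<Longrightarrow> ideal J R \<Longrightarrow> p \<inter> homogeneous R \<subseteq> J \<Longrightarrow> p \<subseteq> J"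
  using ProjD(7) ring.genideal_minimal[OF cring.axioms(1)[OF cring_R]] by metis

lemma deg_sum: "(\<And>i. i \<in> A \<Longrightarrow> f i \<in> degree_part R m) \<Longrightarrow> (\<lambda>_. 0) \<in> degree_part R m \<Longrightarrow>
    (\<lambda>x. \<Sum>i\<in>A. f i x) \<in> degree_part R m"
  by (induction A rule: infinite_finite_induct) (auto intro: deg_add)

lemma Proj_sum: "p \<in> Proj R \<Longrightarrow> (\<And>i. i \<in> A \<Longrightarrow> f i \<in> p) \<Longrightarrow> (\<lambda>x. \<Sum>i\<in>A. f i x) \<in> p"
  by (induction A rule: infinite_finite_induct) (auto intro: ProjD)

lemma Proj_scale: "p \<in> Proj R \<Longrightarrow> f \<in> p \<Longrightarrow> (\<lambda>x. c * f x) \<in> p"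
  using ProjD(5)[of p f "\<lambda>_. c"] const_closed by blast

end

context plane begin

abbreviation "SR \<equiv> square_ring scale"
abbreviation "LR \<equiv> line_ring scale"
abbreviation "fmul \<equiv> fraction_mult SR"
abbreviation "fadd \<equiv> fraction_add SR"
abbreviation "lmul \<equiv> fraction_mult LR"
abbreviation "lfrac \<equiv> fraction LR"
abbreviation "pr2 \<equiv> proj2 scale"
abbreviation "Zp \<equiv> proj2_preimage scale"

abbreviation "x1 \<equiv> \<lambda>z :: 'v \<times> 'v. xc (fst z)"
abbreviation "y1 \<equiv> \<lambda>z :: 'v \<times> 'v. yc (fst z)"
abbreviation "x2 \<equiv> \<lambda>z :: 'v \<times> 'v. xc (snd z)"
abbreviation "y2 \<equiv> \<lambda>z :: 'v \<times> 'v. yc (snd z)"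
abbreviation "poly1 \<equiv> poly_functions scale"
abbreviation "poly2 \<equiv> poly_functions (pair_scale scale)"

lemma pair_scale_simps [simp]: "fst (pair_scale scale c z) = scale c (fst z)" "snd (pair_scale scale c z) = scale c (snd z)"
  by (simp_all add: pair_scale_def)

lemma vector_space_pair: "vector_space (pair_scale scale)"
  by unfold_locales (auto simp: prod_eq_iff scale_right_distrib scale_left_distrib)

lemma linear_pairI:
  assumes "\<And>x y. l (x + y) = l x + l y" "\<And>c x. l (pair_scale scale c x) = c * l x"
  shows "Vector_Spaces.linear (pair_scale scale) times l"
proof -
  interpret p: vector_space "pair_scale scale" by (rule vector_space_pair)
  have "vector_space (times :: 'f \<Rightarrow> 'f \<Rightarrow> 'f)" by unfold_locales (auto simp: algebra_simps)
  moreover have "Modules.module (times :: 'f \<Rightarrow> 'f \<Rightarrow> 'f)" by unfold_locales (auto simp: algebra_simps)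
  ultimately show ?thesis using assms p.vector_space_axioms p.module_axioms
    by (simp add: Vector_Spaces.linear_def Modules.module_hom_def module_hom_axioms_def)
qed

lemma xc_linear: "linfun xc" "linfun yc"
  by (rule linear_funcI; simp)+

lemma poly1_basic: "xc \<in> poly1" "yc \<in> poly1"
  by (rule poly_functions.linear, rule xc_linear)+

lemma poly2_basic: "x1 \<in> poly2" "y1 \<in> poly2" "x2 \<in> poly2" "y2 \<in> poly2"
  by (rule poly_functions.linear, rule linear_pairI; simp)+

text \<open>Linear functions are combinations of the two coordinates, so the inductive clause for
  all linear functions may be replaced by one for each coordinate.\<close>

lemma poly1_induct [consumes 1, case_names const x y add mult]:
  assumes "f \<in> poly1" and c: "\<And>c. P (\<lambda>_. c)" and x: "P xc" and y: "P yc"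
    and a: "\<And>f g. f \<in> poly1 \<Longrightarrow> P f \<Longrightarrow> g \<in> poly1 \<Longrightarrow> P g \<Longrightarrow> P (\<lambda>x. f x + g x)"
    and m: "\<And>f g. f \<in> poly1 \<Longrightarrow> P f \<Longrightarrow> g \<in> poly1 \<Longrightarrow> P g \<Longrightarrow> P (\<lambda>x. f x * g x)"
  shows "P f"
  using assms(1)
proof (induction rule: poly_functions.induct)
  case (linear l)
  note pc = poly_functions.const[where scale = scale]
  have "l = (\<lambda>w. l u * xc w + l v * yc w)"
  proof
    fix w show "l w = l u * xc w + l v * yc w" using func_coords[OF linear, of w] by (simp only: mult.commute)
  qed
  moreover have "P (\<lambda>w. l u * xc w + l v * yc w)"
  proof (rule a)
    show "(\<lambda>w. l u * xc w) \<in> poly1" "(\<lambda>w. l v * yc w) \<in> poly1"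
      by (rule poly_functions.mult[OF pc poly1_basic(1)], rule poly_functions.mult[OF pc poly1_basic(2)])
    show "P (\<lambda>w. l u * xc w)" by (rule m[OF pc c poly1_basic(1) x])
    show "P (\<lambda>w. l v * yc w)" by (rule m[OF pc c poly1_basic(2) y])
  qed
  ultimately show ?case by simp
qed (use c a m in auto)

lemma poly2_induct [consumes 1, case_names const x1 y1 x2 y2 add mult]:
  assumes "f \<in> poly2" and c: "\<And>c. P (\<lambda>_. c)" and x: "P x1" "P y1" "P x2" "P y2"
    and a: "\<And>f g. f \<in> poly2 \<Longrightarrow> P f \<Longrightarrow> g \<in> poly2 \<Longrightarrow> P g \<Longrightarrow> P (\<lambda>x. f x + g x)"
    and m: "\<And>f g. f \<in> poly2 \<Longrightarrow> P f \<Longrightarrow> g \<in> poly2 \<Longrightarrow> P g \<Longrightarrow> P (\<lambda>x. f x * g x)"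
  shows "P f"
  using assms(1)
proof (induction rule: poly_functions.induct)
  case (linear l)
  interpret l: Vector_Spaces.linear "pair_scale scale" times l by (rule linear)
  note pc = poly_functions.const[where scale = "pair_scale scale"]
  have "l z = l (u, 0) * x1 z + l (v, 0) * y1 z + (l (0, u) * x2 z + l (0, v) * y2 z)" for z
  proof -
    have "z = pair_scale scale (x1 z) (u, 0) + pair_scale scale (y1 z) (v, 0) +
        (pair_scale scale (x2 z) (0, u) + pair_scale scale (y2 z) (0, v))" using coords[of "fst z"] coords[of "snd z"] by (simp add: prod_eq_iff)
    then have "l z = l (pair_scale scale (x1 z) (u, 0) + pair_scale scale (y1 z) (v, 0) +
        (pair_scale scale (x2 z) (0, u) + pair_scale scale (y2 z) (0, v)))" by (rule arg_cong)
    also have "\<dots> = x1 z * l (u, 0) + y1 z * l (v, 0) + (x2 z * l (0, u) + y2 z * l (0, v))" by (simp only: l.add l.scale)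
    finally show ?thesis by (simp only: mult.commute)
  qed
  then have "l = (\<lambda>z. l (u, 0) * x1 z + l (v, 0) * y1 z + (l (0, u) * x2 z + l (0, v) * y2 z))" by (rule ext)
  moreover have "P (\<lambda>z. l (u, 0) * x1 z + l (v, 0) * y1 z + (l (0, u) * x2 z + l (0, v) * y2 z))"
  proof -
    note p = poly_functions.mult[OF pc poly2_basic(1)] poly_functions.mult[OF pc poly2_basic(2)]
      poly_functions.mult[OF pc poly2_basic(3)] poly_functions.mult[OF pc poly2_basic(4)]
    note q = m[OF pc c poly2_basic(1) x(1)] m[OF pc c poly2_basic(2) x(2)]
      m[OF pc c poly2_basic(3) x(3)] m[OF pc c poly2_basic(4) x(4)]
    show ?thesis by (rule a[OF poly_functions.add[OF p(1,2)] a[OF p(1) q(1) p(2) q(2)] poly_functions.add[OF p(3,4)] a[OF p(3) q(3) p(4) q(4)]])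
  qed
  ultimately show ?case by simp
qed (use c a m in auto)

lemma poly1_comp_snd: "f \<in> poly1 \<Longrightarrow> (\<lambda>z. f (snd z)) \<in> poly2"
  by (induction rule: poly1_induct) (auto intro: poly2_basic poly_functions.intros)

lemma poly1_comp_fst: "f \<in> poly1 \<Longrightarrow> (\<lambda>z. f (fst z)) \<in> poly2"
  by (induction rule: poly1_induct) (auto intro: poly2_basic poly_functions.intros)

lemma poly2_diag: "f \<in> poly2 \<Longrightarrow> (\<lambda>w. f (w, w)) \<in> poly1"
  by (induction rule: poly2_induct) (auto intro: poly1_basic poly_functions.intros)

text \<open>Restriction to a parametrized affine line gives a polynomial in one variable;
  nonvanishing arguments are thereby moved to \<open>poly\<close>.\<close>

lemma poly2_curve:
  assumes "f \<in> poly2"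
  shows "\<exists>p. \<forall>t. poly p t = f (w1 + scale t z1, w2 + scale t z2)"
  using assms
proof (induction rule: poly2_induct)
  case (const c) show ?case by (rule exI[of _ "[:c:]"]) simp
next
  case x1 show ?case by (rule exI[of _ "[:xc w1, xc z1:]"]) simp
next
  case y1 show ?case by (rule exI[of _ "[:yc w1, yc z1:]"]) simp
next
  case x2 show ?case by (rule exI[of _ "[:xc w2, xc z2:]"]) simp
next
  case y2 show ?case by (rule exI[of _ "[:yc w2, yc z2:]"]) simp
next
  case (add f g) then show ?case by (metis poly_add)
next
  case (mult f g) then show ?case by (metis poly_mult)
qed

text \<open>Join a point where \<open>a\<close> is nonzero to one where \<open>b\<close> is nonzero.
  Along the joining line both restrict to nonzero polynomials, whose product does not vanish
  identically over an infinite field.\<close>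

lemma poly2_domain:
  assumes "a \<in> poly2" "b \<in> poly2" "\<And>z. a z * b z = 0"
  shows "a = (\<lambda>_. 0) \<or> b = (\<lambda>_. 0)"
proof (rule ccontr)
  assume "\<not> ?thesis"
  then obtain z w where zw: "a z \<noteq> 0" "b w \<noteq> 0" by (auto simp: fun_eq_iff)
  let ?\<gamma> = "\<lambda>t. (fst z + scale t (fst w - fst z), snd z + scale t (snd w - snd z))"
  obtain p where p: "\<And>t. poly p t = a (?\<gamma> t)" using poly2_curve[OF assms(1)] by blast
  obtain q where q: "\<And>t. poly q t = b (?\<gamma> t)" using poly2_curve[OF assms(2)] by blast
  have "poly (p * q) t = 0" for t using assms(3) by (simp add: p q)
  then have "p * q = 0" using poly_all_0_iff_0 by blast
  then have "p = 0 \<or> q = 0" by simp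
  moreover have "poly p 0 \<noteq> 0" "poly q 1 \<noteq> 0" using zw by (simp_all add: p q)
  ultimately show False by auto
qed

sublocale S: fun_graded SR
proof
  show "monoid.mult SR = (\<lambda>f g x. f x * g x)" "one SR = (\<lambda>_. 1)"
    "ring.zero SR = (\<lambda>_. 0)" "ring.add SR = (\<lambda>f g x. f x + g x)" by (simp_all add: square_ring_def)
  fix a b assume "a \<in> carrier SR" "b \<in> carrier SR" "\<And>x. a x * b x = 0"
  then show "a = (\<lambda>_. 0) \<or> b = (\<lambda>_. 0)" by (intro poly2_domain) (auto simp: square_ring_def)
next
  fix m n :: "int \<times> int" and a b
  assume "a \<in> degree_part SR m" "b \<in> degree_part SR n"
  then obtain i j i' j' where "m = (int i, int j)" "n = (int i', int j')" "a \<in> poly2" "b \<in> poly2"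
    "\<And>c x y. a (scale c x, y) = c ^ i * a (x, y)" "\<And>c x y. a (x, scale c y) = c ^ j * a (x, y)"
    "\<And>c x y. b (scale c x, y) = c ^ i' * b (x, y)" "\<And>c x y. b (x, scale c y) = c ^ j' * b (x, y)" unfolding square_ring_def by auto
  then show "(\<lambda>x. a x * b x) \<in> degree_part SR (m + n)" unfolding square_ring_def graded_ring.simps
    by (intro CollectI conjI poly_functions.mult exI[of _ "i + i'"] exI[of _ "j + j'"]) (simp_all add: power_add)
next
  fix m :: "int \<times> int" and a b
  assume "a \<in> degree_part SR m" "b \<in> degree_part SR m"
  then obtain i j where "m = (int i, int j)" "a \<in> poly2" "b \<in> poly2"
    "\<And>c x y. a (scale c x, y) = c ^ i * a (x, y)" "\<And>c x y. a (x, scale c y) = c ^ j * a (x, y)"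
    "\<And>c x y. b (scale c x, y) = c ^ i * b (x, y)" "\<And>c x y. b (x, scale c y) = c ^ j * b (x, y)" unfolding square_ring_def by auto
  then show "(\<lambda>x. a x + b x) \<in> degree_part SR m" unfolding square_ring_def graded_ring.simps
    by (intro CollectI conjI poly_functions.add exI[of _ i] exI[of _ j]) (simp_all add: distrib_left)
next
  fix c show "(\<lambda>_. c) \<in> degree_part SR 0" unfolding square_ring_def graded_ring.simps
    by (intro CollectI conjI poly_functions.const exI[of _ 0]) (simp_all add: zero_prod_def)
qed (auto simp: square_ring_def intro: poly_functions.intros)

sublocale L: fun_graded LR
proof
  show "monoid.mult LR = (\<lambda>f g x. f x * g x)" "one LR = (\<lambda>_. 1)"
    "ring.zero LR = (\<lambda>_. 0)" "ring.add LR = (\<lambda>f g x. f x + g x)" by (simp_all add: line_ring_def)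
  fix a b assume "a \<in> carrier LR" "b \<in> carrier LR" "\<And>x. a x * b x = 0"
  \<comment> \<open>The domain property is inherited from the square by viewing functions as
    independent of the first variable.\<close>
  then have "(\<lambda>z. a (snd z)) = (\<lambda>_ :: 'v \<times> 'v. 0) \<or> (\<lambda>z. b (snd z)) = (\<lambda>_ :: 'v \<times> 'v. 0)"
    by (intro poly2_domain poly1_comp_snd) (auto simp: line_ring_def)
  then show "a = (\<lambda>_. 0) \<or> b = (\<lambda>_. 0)" by (auto simp: fun_eq_iff)
next
  fix m n :: int and a b
  assume "a \<in> degree_part LR m" "b \<in> degree_part LR n"
  then obtain i j where "m = int i" "n = int j" "a \<in> poly1" "b \<in> poly1"
    "\<And>c x. a (scale c x) = c ^ i * a x" "\<And>c x. b (scale c x) = c ^ j * b x" unfolding line_ring_def by auto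
  then show "(\<lambda>x. a x * b x) \<in> degree_part LR (m + n)" unfolding line_ring_def graded_ring.simps
    by (intro CollectI conjI poly_functions.mult exI[of _ "i + j"]) (simp_all add: power_add)
next
  fix m :: int and a b
  assume "a \<in> degree_part LR m" "b \<in> degree_part LR m"
  then obtain i where "m = int i" "a \<in> poly1" "b \<in> poly1"
    "\<And>c x. a (scale c x) = c ^ i * a x" "\<And>c x. b (scale c x) = c ^ i * b x" unfolding line_ring_def by auto
  then show "(\<lambda>x. a x + b x) \<in> degree_part LR m" unfolding line_ring_def graded_ring.simps
    by (intro CollectI conjI poly_functions.add exI[of _ i]) (simp_all add: distrib_left)
next
  fix c show "(\<lambda>_. c) \<in> degree_part LR 0" unfolding line_ring_def graded_ring.simps
    by (intro CollectI conjI poly_functions.const exI[of _ 0]) simp_all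
qed (auto simp: line_ring_def intro: poly_functions.intros)

lemma carriers: "carrier SR = poly2" "carrier LR = poly1"
  by (simp_all add: square_ring_def line_ring_def)

abbreviation "deg1 \<equiv> degree_part LR"
abbreviation "deg2 \<equiv> degree_part SR"

lemma deg1I: "f \<in> poly1 \<Longrightarrow> (\<And>c x. f (scale c x) = c ^ n * f x) \<Longrightarrow> f \<in> deg1 (int n)"
  by (auto simp: line_ring_def)

lemma deg2I: "f \<in> poly2 \<Longrightarrow> (\<And>c x y. f (scale c x, y) = c ^ m * f (x, y)) \<Longrightarrow>
   (\<And>c x y. f (x, scale c y) = c ^ n * f (x, y)) \<Longrightarrow> f \<in> deg2 (int m, int n)"
  by (auto simp: square_ring_def)

lemma deg1E:
  assumes "f \<in> deg1 d"
  obtains n where "d = int n" "f \<in> poly1" "\<And>c x. f (scale c x) = c ^ n * f x"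
  using assms by (auto simp: line_ring_def)

lemma deg2E:
  assumes "f \<in> deg2 d"
  obtains m n where "d = (int m, int n)" "f \<in> poly2" "\<And>c x y. f (scale c x, y) = c ^ m * f (x, y)"
    "\<And>c x y. f (x, scale c y) = c ^ n * f (x, y)"
  using assms by (auto simp: square_ring_def)

lemma deg2D:
  assumes "f \<in> deg2 (int m, int n)"
  shows "f \<in> poly2" "f (scale c x, y) = c ^ m * f (x, y)" "f (x, scale c y) = c ^ n * f (x, y)"
    "f (scale c x, scale c' y) = c ^ m * c' ^ n * f (x, y)"
  using assms by (auto simp: square_ring_def)

lemma deg1D:
  assumes "f \<in> deg1 (int n)"
  shows "f \<in> poly1" "f (scale c x) = c ^ n * f x"
  using assms by (auto simp: line_ring_def)

lemma poly_powers: "a \<in> poly_functions s \<Longrightarrow> (\<lambda>x. a x ^ n) \<in> poly_functions s"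
  by (induction n) (auto intro: poly_functions.intros)

lemma deg1_linear: assumes "linfun l" shows "(\<lambda>w. l w ^ n) \<in> deg1 (int n)"
proof (rule deg1I)
  interpret l: Vector_Spaces.linear scale times l by fact
  show "l (scale c x) ^ n = c ^ n * l x ^ n" for c x by (simp add: l.scale power_mult_distrib)
qed (rule poly_powers, rule poly_functions.linear[OF assms])

lemma deg2_basic:
  "(\<lambda>z. x1 z ^ n) \<in> deg2 (int n, int 0)" "(\<lambda>z. y1 z ^ n) \<in> deg2 (int n, int 0)"
  "(\<lambda>z. x2 z ^ n) \<in> deg2 (int 0, int n)" "(\<lambda>z. y2 z ^ n) \<in> deg2 (int 0, int n)"
  by (rule deg2I; auto intro: poly_powers poly2_basic simp: power_mult_distrib)+

lemma deg2_snd: "f \<in> deg1 (int n) \<Longrightarrow> (\<lambda>z. f (snd z)) \<in> deg2 (int 0, int n)"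
  by (rule deg2I) (auto simp: deg1D intro: poly1_comp_snd)

lemma deg2_mult: "a \<in> deg2 (int m, int n) \<Longrightarrow> b \<in> deg2 (int m', int n') \<Longrightarrow>
    (\<lambda>z. a z * b z) \<in> deg2 (int (m + m'), int (n + n'))"
  using S.deg_mult[of a "(int m, int n)" b "(int m', int n')"] by simp

lemma deg2_diag: "b \<in> deg2 (int m, int n) \<Longrightarrow> (\<lambda>w. b (w, w)) \<in> deg1 (int (m + n))"
  by (rule deg1I) (auto simp: deg2D power_add intro: poly2_diag)

subsection \<open>Dehomogenization\<close>

text \<open>The outer variable is \<open>t\<close>, the coordinate of the second factor, and the
  inner one \<open>s\<close>. Thus the coefficient of \<open>P\<close> at degree 0 is the
  restriction to the fiber \<open>t = 0\<close> of the second projection.\<close>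

lemma dehomogenize:
  assumes "f \<in> poly2"
  shows "\<exists>P. \<forall>s t. f (u + scale s v, u + scale t v) = poly (poly P [:t:]) s"
  using assms
proof (induction rule: poly2_induct)
  case (const c) show ?case by (rule exI[of _ "[:[:c:]:]"]) simp
next
  case x1 show ?case by (rule exI[of _ 1]) simp
next
  case y1 show ?case by (rule exI[of _ "[:[:0, 1:]:]"]) simp
next
  case x2 show ?case by (rule exI[of _ 1]) simp
next
  case y2 show ?case by (rule exI[of _ "[:0, 1:]"]) simp
next
  case (add f g)
  then obtain P Q where "\<forall>s t. f (u + scale s v, u + scale t v) = poly (poly P [:t:]) s"
    "\<forall>s t. g (u + scale s v, u + scale t v) = poly (poly Q [:t:]) s" by blast
  then show ?case by (intro exI[of _ "P + Q"]) simp
next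
  case (mult f g)
  then obtain P Q where "\<forall>s t. f (u + scale s v, u + scale t v) = poly (poly P [:t:]) s"
    "\<forall>s t. g (u + scale s v, u + scale t v) = poly (poly Q [:t:]) s" by blast
  then show ?case by (intro exI[of _ "P * Q"]) simp
qed

lemma deg2_dehomogenize:
  assumes "a \<in> deg2 (int m, int n)" "x1 z \<noteq> 0" "x2 z \<noteq> 0"
  shows "a z = x1 z ^ m * x2 z ^ n * a (u + scale (y1 z / x1 z) v, u + scale (y2 z / x2 z) v)"
proof -
  have "z = (scale (x1 z) (u + scale (y1 z / x1 z) v), scale (x2 z) (u + scale (y2 z / x2 z) v))"
    using assms(2,3) by (intro prod_eqI coords_eqI) simp_all
  then have "a z = a (scale (x1 z) (u + scale (y1 z / x1 z) v), scale (x2 z) (u + scale (y2 z / x2 z) v))" by simp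
  also have "\<dots> = x1 z ^ m * x2 z ^ n * a (u + scale (y1 z / x1 z) v, u + scale (y2 z / x2 z) v)" by (rule deg2D(4)[OF assms(1)])
  finally show ?thesis .
qed

text \<open>All sufficiently large degrees are provided, so that several polynomials can be
  homogenized to one common bidegree.\<close>

lemma homogenize1:
  "\<exists>N0. \<forall>N\<ge>N0. \<forall>M. \<exists>a\<in>deg2 (int N, int M). \<forall>z. x1 z \<noteq> 0 \<longrightarrow> a z = x1 z ^ N * x2 z ^ M * poly p (y1 z / x1 z)"
proof (induction p rule: pCons_induct)
  case 0
  have "\<exists>a\<in>deg2 (int N, int M). \<forall>z. x1 z \<noteq> 0 \<longrightarrow> a z = x1 z ^ N * x2 z ^ M * poly 0 (y1 z / x1 z)" for N M
    by (rule bexI[of _ "\<lambda>_. 0"]) (simp, rule deg2I, auto intro: poly_functions.const)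
  then show ?case by blast
next
  case (pCons c p)
  then obtain N0 where N0: "\<forall>N\<ge>N0. \<forall>M. \<exists>a\<in>deg2 (int N, int M). \<forall>z. x1 z \<noteq> 0 \<longrightarrow> a z = x1 z ^ N * x2 z ^ M * poly p (y1 z / x1 z)"
    by blast
  have "\<exists>a\<in>deg2 (int N, int M). \<forall>z. x1 z \<noteq> 0 \<longrightarrow> a z = x1 z ^ N * x2 z ^ M * poly (pCons c p) (y1 z / x1 z)"
    if N: "N \<ge> Suc N0" for N M
  proof -
    obtain n where n: "N = Suc n" "n \<ge> N0" using N by (cases N) auto
    then obtain a where a: "a \<in> deg2 (int n, int M)" "\<And>z. x1 z \<noteq> 0 \<Longrightarrow> a z = x1 z ^ n * x2 z ^ M * poly p (y1 z / x1 z)"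
      using N0 by meson
    have "(\<lambda>z. c * (x1 z ^ N * x2 z ^ M) + y1 z ^ 1 * a z) \<in> deg2 (int N, int M)"
      using deg2_mult[OF deg2_basic(1)[of N] deg2_basic(3)[of M]] deg2_mult[OF deg2_basic(2)[of 1] a(1)] n by (intro S.deg_add S.deg_scale) simp_all
    then show ?thesis by (rule bexI[rotated]) (auto simp: a(2) n algebra_simps)
  qed
  then show ?case by blast
qed

lemma homogenize:
  "\<exists>N0. \<forall>N\<ge>N0. \<exists>a\<in>deg2 (int N, int N). \<forall>z. x1 z \<noteq> 0 \<longrightarrow> x2 z \<noteq> 0 \<longrightarrow>
     a z = x1 z ^ N * x2 z ^ N * poly (poly P [:y2 z / x2 z:]) (y1 z / x1 z)"
proof (induction P rule: pCons_induct)
  case 0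
  have "\<exists>a\<in>deg2 (int N, int N). \<forall>z. x1 z \<noteq> 0 \<longrightarrow> x2 z \<noteq> 0 \<longrightarrow>
     a z = x1 z ^ N * x2 z ^ N * poly (poly 0 [:y2 z / x2 z:]) (y1 z / x1 z)" for N
    by (rule bexI[of _ "\<lambda>_. 0"]) (simp, rule deg2I, auto intro: poly_functions.const)
  then show ?case by blast
next
  case (pCons p P)
  then obtain N0 where N0: "\<forall>N\<ge>N0. \<exists>a\<in>deg2 (int N, int N). \<forall>z. x1 z \<noteq> 0 \<longrightarrow> x2 z \<noteq> 0 \<longrightarrow>
     a z = x1 z ^ N * x2 z ^ N * poly (poly P [:y2 z / x2 z:]) (y1 z / x1 z)" by blast
  obtain N1 where N1: "\<forall>N\<ge>N1. \<forall>M. \<exists>a\<in>deg2 (int N, int M). \<forall>z. x1 z \<noteq> 0 \<longrightarrow> a z = x1 z ^ N * x2 z ^ M * poly p (y1 z / x1 z)"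
    using homogenize1 by blast
  have "\<exists>a\<in>deg2 (int N, int N). \<forall>z. x1 z \<noteq> 0 \<longrightarrow> x2 z \<noteq> 0 \<longrightarrow>
     a z = x1 z ^ N * x2 z ^ N * poly (poly (pCons p P) [:y2 z / x2 z:]) (y1 z / x1 z)"
    if N: "N \<ge> Suc (max N0 N1)" for N
  proof -
    obtain n where n: "N = Suc n" "n \<ge> N0" "N \<ge> N1" using N by (cases N) auto
    obtain a where a: "a \<in> deg2 (int n, int n)" "\<And>z. x1 z \<noteq> 0 \<Longrightarrow> x2 z \<noteq> 0 \<Longrightarrow>
        a z = x1 z ^ n * x2 z ^ n * poly (poly P [:y2 z / x2 z:]) (y1 z / x1 z)" using N0 n by meson
    obtain b where b: "b \<in> deg2 (int N, int N)" "\<And>z. x1 z \<noteq> 0 \<Longrightarrow> b z = x1 z ^ N * x2 z ^ N * poly p (y1 z / x1 z)"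
      using N1 n by meson
    have "(\<lambda>z. b z + x1 z ^ 1 * (y2 z ^ 1 * a z)) \<in> deg2 (int N, int N)"
      using deg2_mult[OF deg2_basic(1)[of 1] deg2_mult[OF deg2_basic(4)[of 1] a(1)]] n b(1) by (intro S.deg_add) simp_all
    then show ?thesis by (rule bexI[rotated]) (auto simp: a(2) b(2) n(1) algebra_simps)
  qed
  then show ?case by blast
qed

text \<open>Both sides may be multiplied by the nonzero function \<open>x1 x2\<close> and this
  factor cancelled, so an identity needs checking on the affine chart only.\<close>

lemma poly2_eqI:
  assumes "a \<in> poly2" "b \<in> poly2" "\<And>z. x1 z \<noteq> 0 \<Longrightarrow> x2 z \<noteq> 0 \<Longrightarrow> a z = b z"
  shows "a = b"
proof (rule S.cancel[unfolded carriers, OF assms(1,2)])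
  show "(\<lambda>z. x1 z * x2 z) \<in> poly2" by (intro poly_functions.mult poly2_basic)
  have "x1 (u, u) * x2 (u, u) \<noteq> 0" by simp
  then show "(\<lambda>z. x1 z * x2 z) \<noteq> (\<lambda>_. 0)" by metis
  show "a z * (x1 z * x2 z) = b z * (x1 z * x2 z)" for z using assms(3)[of z] by (cases "x1 z = 0 \<or> x2 z = 0") auto
qed

end

section \<open>Points of the square and the ideal of the diagonal\<close>

lemma (in cring) comm_idealI:
  assumes "J \<subseteq> carrier R" "\<zero> \<in> J" "\<And>a b. a \<in> J \<Longrightarrow> b \<in> J \<Longrightarrow> a \<oplus> b \<in> J"
    and mult: "\<And>a r. a \<in> J \<Longrightarrow> r \<in> carrier R \<Longrightarrow> r \<otimes> a \<in> J"
  shows "ideal J R"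
proof (rule idealI[OF ring_axioms])
  show "subgroup J (add_monoid R)"
  proof
    fix a assume a: "a \<in> J"
    then have "inv\<^bsub>add_monoid R\<^esub> a = (\<ominus> \<one>) \<otimes> a" using assms(1) by (auto simp: a_inv_def[symmetric] l_minus)
    then show "inv\<^bsub>add_monoid R\<^esub> a \<in> J" using mult[OF a, of "\<ominus> \<one>"] by simp
  qed (use assms in auto)
  show "x \<otimes> a \<in> J" "a \<otimes> x \<in> J" if "a \<in> J" "x \<in> carrier R" for a x
    using mult[OF that] assms(1) that m_comm[of a x] by auto
qed

context plane begin

abbreviation "quo \<equiv> fraction (square_ring scale)"
abbreviation "sqO \<equiv> twist_stalk SR 0"
abbreviation "sqC Q \<equiv> carrier (sqO Q)"
abbreviation "cst c \<equiv> quo (\<lambda>_. c) (\<lambda>_. 1)"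
abbreviation "lnO \<equiv> twist_stalk LR"
abbreviation "lnC d Q \<equiv> carrier (lnO d (pr2 Q))"
abbreviation "SP \<equiv> Proj SR"
abbreviation "LP \<equiv> Proj LR"

text \<open>The point \<open>(e, e)\<close> of the diagonal over the fixed point
  \<open>e\<close>.\<close>

definition base_pt :: "('v \<times> 'v \<Rightarrow> 'f) set" where
  "base_pt = {f \<in> poly2. \<forall>x\<in>line. \<forall>y\<in>line. f (x, y) = 0}"

lemma line_iff: "x \<in> line \<longleftrightarrow> (\<exists>c. x = scale c u)"
  using coords[of x] by (auto simp: line_def)

lemma base_pt_iff:
  assumes "b \<in> deg2 m" shows "b \<in> base_pt \<longleftrightarrow> b (u, u) = 0"
proof -
  obtain i j where b: "m = (int i, int j)" "b \<in> poly2" by (rule deg2E[OF assms])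
  have "u \<in> line" by (simp add: line_def)
  moreover have "b (scale c u, scale c' u) = c ^ i * c' ^ j * b (u, u)" for c c' using deg2D(4)[of b i j] assms b(1) by simp
  ultimately show ?thesis using b(2) unfolding base_pt_def by (intro iffI CollectI conjI ballI) (blast, blast, metis line_iff mult_zero_right)
qed

lemma base_pt_Proj: "base_pt \<in> SP"
proof (rule S.ProjI)
  show "base_pt \<subseteq> carrier SR" by (auto simp: base_pt_def carriers)
  have uL: "u \<in> line" by (simp add: line_def)
  then show "(\<lambda>_. 1) \<notin> base_pt" by (auto simp: base_pt_def)
  show "(\<lambda>_. 0) \<in> base_pt" by (auto simp: base_pt_def poly_functions.const)
  show "(\<lambda>x. a x + b x) \<in> base_pt" if "a \<in> base_pt" "b \<in> base_pt" for a b using that by (simp add: base_pt_def poly_functions.add)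
  show "(\<lambda>x. b x * a x) \<in> base_pt" if "a \<in> base_pt" "b \<in> carrier SR" for a b
    using that by (simp add: base_pt_def poly_functions.mult carriers)
next
  fix a b assume ab: "a \<in> carrier SR" "b \<in> carrier SR" "(\<lambda>x. a x * b x) \<in> base_pt"
  show "a \<in> base_pt \<or> b \<in> base_pt"
  proof (rule ccontr)
    assume "\<not> ?thesis"
    then obtain z w where zw: "fst z \<in> line" "snd z \<in> line" "fst w \<in> line" "snd w \<in> line" "a z \<noteq> 0" "b w \<noteq> 0"
      using ab(1,2) by (auto simp: base_pt_def carriers)
    \<comment> \<open>The line through the two points stays among the pairs of vectors of
      \<open>line\<close>, where the product vanishes.\<close>
    let ?\<gamma> = "\<lambda>t. (fst z + scale t (fst w - fst z), snd z + scale t (snd w - snd z))"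
    obtain p where p: "\<And>t. poly p t = a (?\<gamma> t)" using poly2_curve ab(1) unfolding carriers by blast
    obtain q where q: "\<And>t. poly q t = b (?\<gamma> t)" using poly2_curve ab(2) unfolding carriers by blast
    have "poly (p * q) t = 0" for t using ab(3) zw(1-4) by (simp add: p q base_pt_def line_def)
    then have "p * q = 0" using poly_all_0_iff_0 by blast
    then have "p = 0 \<or> q = 0" by simp
    moreover have "poly p 0 \<noteq> 0" "poly q 1 \<noteq> 0" using zw by (simp_all add: p q)
    ultimately show False by auto
  qed
next
  fix S assume "S \<in> irrelevant_gens SR"
  then consider "S = (\<lambda>l. l \<circ> fst) ` {l. linfun l}"
    | "S = (\<lambda>l. l \<circ> snd) ` {l. linfun l}" by (auto simp: square_ring_def)
  then have "x1 \<in> S \<or> x2 \<in> S" using xc_linear(1) by cases (auto simp: comp_def)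
  moreover have uL: "u \<in> line" by (simp add: line_def)
  have "x1 \<notin> base_pt" "x2 \<notin> base_pt" using basis(1) uL by (auto simp: base_pt_def intro!: bexI[of _ u])
  ultimately show "\<not> S \<subseteq> base_pt" by blast
next
  fix f J assume f: "f \<in> base_pt" and J: "ideal J SR"
    and sub: "base_pt \<inter> homogeneous SR \<subseteq> J"
  note J' = S.idealD[OF J]
  \<comment> \<open>A retraction onto the pairs of vectors of \<open>line\<close>. Modulo
    \<open>y1\<close> and \<open>y2\<close>, which are homogeneous elements of the point, every
    function agrees with its composite with the retraction, and for \<open>f\<close> in the point
    that composite is 0.\<close>
  let ?\<pi> = "\<lambda>z. (scale (x1 z) u, scale (x2 z) u)"
  have yJ: "y1 \<in> J" "y2 \<in> J" using deg2_basic(2)[of 1] deg2_basic(4)[of 1] poly2_basic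
    by (intro subsetD[OF sub] IntI; force simp: homogeneous_def base_pt_def line_def)+
  have pi: "(\<lambda>z. g (?\<pi> z)) \<in> poly2" if "g \<in> poly2" for g
    using that by (induction rule: poly2_induct) (simp_all add: poly_functions.intros poly2_basic)
  have "(\<lambda>z. g z - g (?\<pi> z)) \<in> J" if "g \<in> poly2" for g using that
  proof (induction rule: poly2_induct)
    case (add g h)
    then show ?case using J'(2)[OF add(3,4)] by (simp add: algebra_simps)
  next
    case (mult g h)
    have "(\<lambda>z. h z * (g z - g (?\<pi> z)) + g (?\<pi> z) * (h z - h (?\<pi> z))) \<in> J"
      using mult pi[OF mult(1)] by (intro J'(2,3)) (simp_all add: carriers)
    then show ?case by (simp add: algebra_simps)
  qed (use J'(1) yJ in simp_all)
  from this[of f] show "f \<in> J" using f by (simp add: base_pt_def line_def)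
qed

subsection \<open>The second projection\<close>

lemma proj2_iff: "f \<in> pr2 Q \<longleftrightarrow> f \<in> poly1 \<and> (\<lambda>z. f (snd z)) \<in> Q"
  by (simp add: proj2_def comp_def)

lemma deg1_zero: "(\<lambda>_. 0) \<in> deg1 (int i)"
  by (rule deg1I) (auto intro: poly_functions.const)

text \<open>The value \<open>f w\<close> is written as the value at 1 of a polynomial
  \<open>P w\<close> in an auxiliary grading variable; its coefficients, as functions of
  \<open>w\<close>, are the homogeneous components.\<close>

lemma line_components:
  assumes "f \<in> poly1"
  shows "\<exists>F N. (\<forall>i. F i \<in> deg1 (int i)) \<and> f = (\<lambda>w. \<Sum>i\<le>N. F i w)"
proof -
  have "\<exists>P N. (\<forall>w. poly (P w) 1 = f w) \<and> (\<forall>w. degree (P w) \<le> N) \<and> (\<forall>i. (\<lambda>w. coeff (P w) i) \<in> deg1 (int i))"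
    using assms
  proof (induction rule: poly1_induct)
    case (const c)
    have "(\<lambda>w. coeff [:c:] i) \<in> deg1 (int i)" for i by (rule deg1I) (auto simp: coeff_pCons poly_functions.const split: nat.split)
    then show ?case by (intro exI[of _ "\<lambda>_. [:c:]"] exI[of _ 0]) simp
  next
    case x
    have "(\<lambda>w. coeff [:0, xc w:] i) \<in> deg1 (int i)" for i
    proof -
      have "(\<lambda>w. coeff [:0, xc w:] i) = (if i = 1 then xc else (\<lambda>_. 0))" by (auto simp: coeff_pCons fun_eq_iff split: nat.split)
      then show ?thesis using deg1_linear[OF xc_linear(1), of 1] by (auto intro: deg1_zero)
    qed
    then show ?case by (intro exI[of _ "\<lambda>w. [:0, xc w:]"] exI[of _ 1]) simp
  next
    case y
    have "(\<lambda>w. coeff [:0, yc w:] i) \<in> deg1 (int i)" for i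
    proof -
      have "(\<lambda>w. coeff [:0, yc w:] i) = (if i = 1 then yc else (\<lambda>_. 0))" by (auto simp: coeff_pCons fun_eq_iff split: nat.split)
      then show ?thesis using deg1_linear[OF xc_linear(2), of 1] by (auto intro: deg1_zero)
    qed
    then show ?case by (intro exI[of _ "\<lambda>w. [:0, yc w:]"] exI[of _ 1]) simp
  next
    case (add f g)
    then obtain P N Q M where "\<forall>w. poly (P w) 1 = f w" "\<forall>w. degree (P w) \<le> N" "\<forall>i. (\<lambda>w. coeff (P w) i) \<in> deg1 (int i)"
      "\<forall>w. poly (Q w) 1 = g w" "\<forall>w. degree (Q w) \<le> M" "\<forall>i. (\<lambda>w. coeff (Q w) i) \<in> deg1 (int i)" by blast
    moreover then have "degree (P w + Q w) \<le> max N M" for w by (meson degree_add_le max.coboundedI1 max.coboundedI2)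
    ultimately show ?case by (intro exI[of _ "\<lambda>w. P w + Q w"] exI[of _ "max N M"]) (simp add: L.deg_add)
  next
    case (mult f g)
    then obtain P N Q M where *: "\<forall>w. poly (P w) 1 = f w" "\<forall>w. degree (P w) \<le> N" "\<forall>i. (\<lambda>w. coeff (P w) i) \<in> deg1 (int i)"
      "\<forall>w. poly (Q w) 1 = g w" "\<forall>w. degree (Q w) \<le> M" "\<forall>i. (\<lambda>w. coeff (Q w) i) \<in> deg1 (int i)" by blast
    have "degree (P w * Q w) \<le> N + M" for w using *(2,5) degree_mult_le[of "P w" "Q w"] by (meson add_mono order_trans)
    moreover have "(\<lambda>w. coeff (P w * Q w) i) \<in> deg1 (int i)" for i unfolding coeff_mult
    proof (rule L.deg_sum)
      show "(\<lambda>w. coeff (P w) j * coeff (Q w) (i - j)) \<in> deg1 (int i)" if "j \<in> {..i}" for j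
      proof -
        have "(\<lambda>w. coeff (P w) j * coeff (Q w) (i - j)) \<in> deg1 (int j + int (i - j))" by (rule L.deg_mult) (use *(3,6) in blast)+
        moreover have "int j + int (i - j) = int i" using that by simp
        ultimately show ?thesis by (simp only:)
      qed
      show "(\<lambda>_. 0) \<in> deg1 (int i)" by (rule deg1I) (auto intro: poly_functions.const)
    qed
    ultimately show ?case using * by (intro exI[of _ "\<lambda>w. P w * Q w"] exI[of _ "N + M"]) simp
  qed
  then obtain P N where P: "\<And>w. poly (P w) 1 = f w" "\<And>w. degree (P w) \<le> N" "\<And>i. (\<lambda>w. coeff (P w) i) \<in> deg1 (int i)"
    by blast
  have "f w = (\<Sum>i\<le>N. coeff (P w) i)" for w unfolding P(1)[symmetric] poly_altdef
    using P(2)[of w] by (simp, intro sum.mono_neutral_left) (auto simp: coeff_eq_0)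
  then show ?thesis using P(3) by (intro exI[of _ "\<lambda>i w. coeff (P w) i"] exI[of _ N]) (simp add: fun_eq_iff)
qed

text \<open>The functions that stay in \<open>Q\<close> after scaling the second variable form an
  ideal, and it contains the bihomogeneous elements of \<open>Q\<close>, on which scaling is
  multiplication by a constant.\<close>

lemma Proj_scale_snd:
  assumes Q: "Q \<in> SP" and f: "f \<in> Q"
  shows "(\<lambda>z. f (fst z, scale c (snd z))) \<in> Q"
proof -
  let ?J = "{f \<in> poly2. (\<lambda>z. f (fst z, scale c (snd z))) \<in> Q}"
  have comp: "(\<lambda>z. f (fst z, scale c (snd z))) \<in> poly2" if "f \<in> poly2" for f
    using that by (induction rule: poly2_induct) (simp_all add: poly_functions.intros poly2_basic)
  have "ideal ?J SR"
  proof (rule S.idealI')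
    show "(\<lambda>x. b x * a x) \<in> ?J" if "a \<in> ?J" "b \<in> carrier SR" for a b
      using that S.ProjD(5)[OF Q, of "\<lambda>z. a (fst z, scale c (snd z))" "\<lambda>z. b (fst z, scale c (snd z))"] comp[of b]
      by (simp add: carriers poly_functions.mult)
    show "(\<lambda>x. a x + b x) \<in> ?J" if "a \<in> ?J" "b \<in> ?J" for a b
      using that S.ProjD(4)[OF Q, of "\<lambda>z. a (fst z, scale c (snd z))" "\<lambda>z. b (fst z, scale c (snd z))"]
      by (simp add: poly_functions.add)
  qed (use S.ProjD(2)[OF Q] poly_functions.const in \<open>auto simp: carriers\<close>)
  moreover have "Q \<inter> homogeneous SR \<subseteq> ?J"
  proof
    fix a assume "a \<in> Q \<inter> homogeneous SR"
    then obtain m where a: "a \<in> Q" "a \<in> deg2 m" by (auto simp: homogeneous_def)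
    obtain i j where ij: "a \<in> poly2" "\<And>c x y. a (x, scale c y) = c ^ j * a (x, y)" using deg2E[OF a(2)] by metis
    have "(\<lambda>z. a (fst z, scale c (snd z))) = (\<lambda>z. c ^ j * a z)" using ij(2) by auto
    then show "a \<in> ?J" using S.Proj_scale[OF Q a(1)] ij(1) by simp
  qed
  ultimately show ?thesis using S.Proj_minimal[OF Q] f by blast
qed

text \<open>Scaling by 2 and subtracting \<open>2 ^ Suc N\<close> times the sum removes the top
  component and multiplies each lower one by \<open>2 ^ i - 2 ^ Suc N\<close>, which is nonzero in
  characteristic zero. This is what makes the second projection of a bihomogeneous prime
  homogeneous.\<close>

lemma proj2_components:
  assumes Q: "Q \<in> SP"
  shows "(\<forall>i. F i \<in> deg1 (int i)) \<Longrightarrow> (\<lambda>z. \<Sum>i\<le>N. F i (snd z)) \<in> Q \<Longrightarrow> i \<le> N \<Longrightarrow> (\<lambda>z. F i (snd z)) \<in> Q"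
proof (induction N arbitrary: F i)
  case 0
  then show ?case by simp
next
  case (Suc N)
  let ?c = "\<lambda>i. (2 :: 'f) ^ i - 2 ^ Suc N"
  let ?h = "\<lambda>z. \<Sum>i\<le>Suc N. F i (snd z)"
  have F: "F i (scale c w) = c ^ i * F i w" for i c w using Suc.prems(1) deg1D(2) by blast
  have "(\<lambda>z. (\<Sum>i\<le>Suc N. F i (snd (fst z, scale 2 (snd z)))) + (- (2 ^ Suc N)) * ?h z) \<in> Q"
    by (rule S.ProjD(4)[OF Q Proj_scale_snd[OF Q Suc.prems(2)] S.Proj_scale[OF Q Suc.prems(2)]])
  moreover have "(\<lambda>z. (\<Sum>i\<le>Suc N. F i (snd (fst z, scale 2 (snd z)))) + (- (2 ^ Suc N)) * ?h z) = (\<lambda>z. \<Sum>i\<le>N. ?c i * F i (snd z))"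
    by (simp add: F sum_distrib_left left_diff_distrib sum_subtractf sum_negf distrib_left)
  ultimately have h: "(\<lambda>z. \<Sum>i\<le>N. ?c i * F i (snd z)) \<in> Q" by (rule back_subst[where P = "\<lambda>f. f \<in> Q"])
  have IH: "(\<lambda>z. F i (snd z)) \<in> Q" if i: "i \<le> N" for i
  proof -
    have nz: "?c i \<noteq> 0"
    proof -
      have "(2::nat) ^ i \<noteq> 2 ^ Suc N" using i by (simp del: power_Suc)
      then have "of_nat (2 ^ i) \<noteq> (of_nat (2 ^ Suc N) :: 'f)" unfolding of_nat_eq_iff .
      then show ?thesis by (simp del: power_Suc)
    qed
    have "(\<lambda>z. ?c i * F i (snd z)) \<in> Q"
      by (rule Suc.IH[of "\<lambda>i w. ?c i * F i w", OF _ h i]) (use Suc.prems(1) L.deg_scale in blast)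
    from S.Proj_scale[OF Q this, of "inverse (?c i)"] show ?thesis using nz by (simp add: mult.assoc[symmetric])
  qed
  show ?case
  proof (cases "i \<le> N")
    case False
    then have i: "i = Suc N" using Suc.prems(3) by simp
    have "(\<lambda>z. ?h z + (-1) * (\<Sum>i\<le>N. F i (snd z))) \<in> Q"
      using IH by (intro S.ProjD(4)[OF Q Suc.prems(2) S.Proj_scale[OF Q S.Proj_sum[OF Q]]]) simp
    then show ?thesis by (simp add: i)
  qed (rule IH)
qed

lemma proj2_Proj:
  assumes Q: "Q \<in> SP" shows "pr2 Q \<in> LP"
proof (rule L.ProjI)
  show "pr2 Q \<subseteq> carrier LR" by (auto simp: proj2_iff carriers)
  show "(\<lambda>_. 1) \<notin> pr2 Q" "(\<lambda>_. 0) \<in> pr2 Q" using S.ProjD(2,3)[OF Q] by (auto simp: proj2_iff poly_functions.const)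
  show "(\<lambda>x. a x + b x) \<in> pr2 Q" if "a \<in> pr2 Q" "b \<in> pr2 Q" for a b
    using that S.ProjD(4)[OF Q] by (simp add: proj2_iff poly_functions.add)
  show "(\<lambda>x. b x * a x) \<in> pr2 Q" if "a \<in> pr2 Q" "b \<in> carrier LR" for a b
    using that S.ProjD(5)[OF Q, of "\<lambda>z. a (snd z)" "\<lambda>z. b (snd z)"] poly1_comp_snd[of b]
    by (simp add: proj2_iff poly_functions.mult carriers)
  show "a \<in> pr2 Q \<or> b \<in> pr2 Q"
    if "a \<in> carrier LR" "b \<in> carrier LR" "(\<lambda>x. a x * b x) \<in> pr2 Q" for a b
    using that S.ProjD(6)[OF Q, of "\<lambda>z. a (snd z)" "\<lambda>z. b (snd z)"] poly1_comp_snd[of a] poly1_comp_snd[of b]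
    by (auto simp: proj2_iff carriers)
  show "\<not> S \<subseteq> pr2 Q" if "S \<in> irrelevant_gens LR" for S
  proof
    assume s: "S \<subseteq> pr2 Q"
    have "S = {l. linfun l}" using that by (simp add: line_ring_def)
    then have "(\<lambda>l. l \<circ> snd) ` {l. linfun l} \<subseteq> Q" using s by (auto simp: proj2_def)
    then show False using S.ProjD(8)[OF Q] by (simp add: square_ring_def)
  qed
next
  fix f J assume f: "f \<in> pr2 Q" and J: "ideal J LR"
    and sub: "pr2 Q \<inter> homogeneous LR \<subseteq> J"
  obtain F N where F: "\<forall>i. F i \<in> deg1 (int i)" "f = (\<lambda>w. \<Sum>i\<le>N. F i w)"
    using line_components[of f] f unfolding proj2_iff by blast
  have FJ: "F i \<in> J" if "i \<le> N" for i
  proof -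
    have "(\<lambda>z. F i (snd z)) \<in> Q" by (rule proj2_components[OF Q F(1) _ that]) (use f F(2) in \<open>simp add: proj2_iff\<close>)
    then show ?thesis using F(1) deg1D(1)[of "F i" i] by (intro subsetD[OF sub] IntI) (auto simp: proj2_iff homogeneous_def)
  qed
  have "(\<lambda>w. \<Sum>i\<in>A. F i w) \<in> J" if "A \<subseteq> {..N}" for A
    using that by (induction A rule: infinite_finite_induct) (auto intro: L.idealD[OF J] FJ)
  then show "f \<in> J" by (simp add: F(2))
qed

lemma line_point_eq: "line_point scale line = pr2 base_pt"
proof -
  have "u \<in> line" by (simp add: line_def)
  then show ?thesis by (auto simp: line_point_def proj2_iff base_pt_def intro: poly1_comp_snd)
qed

abbreviation "pt \<equiv> line_point scale line"

lemma pt_Proj: "pt \<in> LP"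
  unfolding line_point_eq by (rule proj2_Proj[OF base_pt_Proj])

lemma pt_iff: assumes "f \<in> deg1 d" shows "f \<in> pt \<longleftrightarrow> f u = 0"
proof -
  obtain n where n: "f \<in> poly1" "\<And>c x. f (scale c x) = c ^ n * f x" using deg1E[OF assms] by metis
  have "u \<in> line" by (simp add: line_def)
  then show ?thesis using n(1) unfolding line_point_def by (intro iffI CollectI conjI ballI) (blast, blast, metis line_iff n(2) mult_zero_right)
qed

lemma preimage_iff: "Q \<in> Zp U \<longleftrightarrow> Q \<in> SP \<and> pr2 Q \<in> U"
  by (simp add: proj2_preimage_def)

lemma preimage_open:
  assumes "zariski_open LR U" shows "zariski_open SR (Zp U)"
proof -
  obtain T where T: "T \<subseteq> homogeneous LR" "U = {p \<in> LP. \<not> T \<subseteq> p}" using assms by (auto simp: zariski_open_def)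
  let ?T = "(\<lambda>f (z :: 'v \<times> 'v). f (snd z)) ` T"
  have "?T \<subseteq> homogeneous SR"
  proof
    fix f assume "f \<in> ?T"
    then obtain g where g: "f = (\<lambda>z. g (snd z))" "g \<in> T" by blast
    then obtain d where d: "g \<in> deg1 d" using T(1) by (auto simp: homogeneous_def)
    obtain n where "d = int n" by (rule deg1E[OF d])
    then show "f \<in> homogeneous SR" unfolding g(1) homogeneous_def using deg2_snd d by blast
  qed
  moreover have "T \<subseteq> poly1" using T(1) L.deg_closed carriers(2) unfolding homogeneous_def by blast
  then have *: "T \<subseteq> pr2 Q \<longleftrightarrow> ?T \<subseteq> Q" for Q by (auto simp: proj2_iff image_subset_iff subset_iff)
  have "Zp U = {Q \<in> SP. \<not> ?T \<subseteq> Q}"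
    unfolding proj2_preimage_def T(2) mem_Collect_eq * using proj2_Proj by (intro Collect_cong) blast
  ultimately show ?thesis unfolding zariski_open_def by blast
qed

subsection \<open>Powers of the ideal of the diagonal\<close>

abbreviation "Ipow j Q \<equiv> diagonal_power scale j Q"

lemma Ipow_0: "Ipow 0 Q = sqC Q"
  and Ipow_Suc: "Ipow (Suc j) Q = ideal_prod (sqO Q) (diagonal_stalk scale Q) (Ipow j Q)"
  by (simp_all add: diagonal_power_def)

lemma diagonal_stalkI:
  "a \<in> deg2 m \<Longrightarrow> b \<in> deg2 m \<Longrightarrow> b \<notin> Q \<Longrightarrow> (\<And>x. a (x, x) = 0) \<Longrightarrow> quo a b \<in> diagonal_stalk scale Q"
  unfolding diagonal_stalk_def by blast

lemma sq_frac: "Q \<in> SP \<Longrightarrow> a \<in> deg2 m \<Longrightarrow> b \<in> deg2 n \<Longrightarrow> b \<notin> Q \<Longrightarrow> S.is_frac a b"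
  unfolding S.is_frac_def using S.deg_closed S.notin_nz by blast

lemma sqO_mem: "a \<in> deg2 m \<Longrightarrow> b \<in> deg2 m \<Longrightarrow> b \<notin> Q \<Longrightarrow> quo a b \<in> sqC Q"
  by (rule S.twist_memI) simp_all

lemma sqO_memE:
  assumes "F \<in> sqC Q"
  obtains a b m where "F = quo a b" "a \<in> deg2 m" "b \<in> deg2 m" "b \<notin> Q"
  using S.twist_memE[OF assms] by (metis eq_iff_diff_eq_0)

lemma sq_notin_mult: "Q \<in> SP \<Longrightarrow> a \<in> deg2 m \<Longrightarrow> b \<in> deg2 n \<Longrightarrow> a \<notin> Q \<Longrightarrow> b \<notin> Q \<Longrightarrow> (\<lambda>z. a z * b z) \<notin> Q"
  using S.ProjD(6) S.deg_closed by blast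

lemma diagonal_stalk_ideal:
  assumes Q: "Q \<in> SP" shows "ideal (diagonal_stalk scale Q) (sqO Q)"
proof -
  show ?thesis
  proof (rule cring.comm_idealI[OF S.local_cring[OF Q]])
    show "diagonal_stalk scale Q \<subseteq> sqC Q" by (auto simp: diagonal_stalk_def intro: sqO_mem)
    show "\<zero>\<^bsub>sqO Q\<^esub> \<in> diagonal_stalk scale Q"
      unfolding S.twist_ops by (rule diagonal_stalkI[OF S.deg_const S.deg_const]) (use S.ProjD(3)[OF Q] in auto)
  next
    fix F G assume "F \<in> diagonal_stalk scale Q" "G \<in> diagonal_stalk scale Q"
    then obtain a b m c e n where *: "F = quo a b" "a \<in> deg2 m" "b \<in> deg2 m" "b \<notin> Q" "\<And>x. a (x, x) = 0"
      "G = quo c e" "c \<in> deg2 n" "e \<in> deg2 n" "e \<notin> Q" "\<And>x. c (x, x) = 0" unfolding diagonal_stalk_def by blast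
    have "(\<lambda>z. a z * e z + c z * b z) \<in> deg2 (m + n)"
      using S.deg_mult[OF *(2,8)] S.deg_mult[OF *(7,3)] by (intro S.deg_add) (simp_all add: add.commute)
    then show "F \<oplus>\<^bsub>sqO Q\<^esub> G \<in> diagonal_stalk scale Q"
      unfolding S.twist_ops *(1,6) S.frac_add[OF sq_frac[OF Q *(2-4)] sq_frac[OF Q *(7-9)]]
      by (rule diagonal_stalkI[OF _ S.deg_mult[OF *(3,8)] sq_notin_mult[OF Q *(3,8,4,9)]]) (simp add: *)
  next
    fix F G assume "F \<in> diagonal_stalk scale Q" and G: "G \<in> sqC Q"
    then obtain a b m where *: "F = quo a b" "a \<in> deg2 m" "b \<in> deg2 m" "b \<notin> Q" "\<And>x. a (x, x) = 0"
      unfolding diagonal_stalk_def by blast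
    obtain c e n where **: "G = quo c e" "c \<in> deg2 n" "e \<in> deg2 n" "e \<notin> Q" by (rule sqO_memE[OF G])
    show "G \<otimes>\<^bsub>sqO Q\<^esub> F \<in> diagonal_stalk scale Q"
      unfolding S.twist_ops *(1) **(1) S.frac_mult[OF sq_frac[OF Q **(2-4)] sq_frac[OF Q *(2-4)]]
      by (rule diagonal_stalkI[OF S.deg_mult[OF **(2) *(2)] S.deg_mult[OF **(3) *(3)] sq_notin_mult[OF Q **(3) *(3) **(4) *(4)]])
        (simp add: *)
  qed
qed

lemma Ipow_ideal: assumes Q: "Q \<in> SP" shows "ideal (Ipow j Q) (sqO Q)"
proof (induction j)
  case 0
  show ?case unfolding Ipow_0 by (rule ring.oneideal[OF cring.axioms(1)[OF S.local_cring[OF Q]]])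
next
  case (Suc j)
  show ?case unfolding Ipow_Suc by (rule ring.ideal_prod_is_ideal[OF cring.axioms(1)[OF S.local_cring[OF Q]] diagonal_stalk_ideal[OF Q] Suc])
qed

text \<open>If \<open>a\<close> vanishes on the diagonal and is invertible at \<open>Q\<close>, the
  fraction \<open>a / a\<close> puts 1 into the ideal of the diagonal at \<open>Q\<close>.\<close>

lemma Ipow_trivial:
  assumes Q: "Q \<in> SP" and a: "a \<in> deg2 m" "a \<notin> Q" "\<And>x. a (x, x) = 0"
  shows "Ipow j Q = sqC Q"
proof (induction j)
  case (Suc j)
  have "quo a a = \<one>\<^bsub>sqO Q\<^esub>"
    unfolding S.twist_ops by (rule S.frac_eqI[OF sq_frac[OF Q a(1,1,2)] sq_frac[OF Q S.deg_const S.deg_const]])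
      (use S.ProjD(3)[OF Q] in auto)
  then have "\<one>\<^bsub>sqO Q\<^esub> \<in> diagonal_stalk scale Q" using diagonal_stalkI[OF a(1,1,2,3)] by simp
  then have "F \<in> Ipow (Suc j) Q" if "F \<in> sqC Q" for F
    using ideal_prod.prod[of "\<one>\<^bsub>sqO Q\<^esub>" "diagonal_stalk scale Q" F "Ipow j Q" "sqO Q"] that
      S.fraction_one_mult[OF Q that] unfolding Ipow_Suc Suc S.twist_ops by simp
  moreover have "Ipow (Suc j) Q \<subseteq> sqC Q" using ideal.Icarr[OF Ipow_ideal[OF Q]] by blast
  ultimately show ?case by blast
qed (rule Ipow_0)

text \<open>If \<open>Q\<close> contained all bihomogeneous functions that vanish on the diagonal,
  \<open>b\<close> would be interchangeable with its restriction to the diagonal. An explicit such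
  function then forces every linear form in the first variable into \<open>Q\<close>, which a point
  of the square excludes.\<close>

lemma off_diagonal:
  assumes Q: "Q \<in> SP" and b: "b \<in> deg2 (int m, int n)" "b \<in> Q" "(\<lambda>w. b (w, w)) \<notin> pr2 Q"
  shows "\<exists>a d. a \<in> deg2 d \<and> a \<notin> Q \<and> (\<forall>x. a (x, x) = 0)"
proof (rule ccontr)
  assume no: "\<not> ?thesis"
  let ?c = "\<lambda>z :: 'v \<times> 'v. b (snd z, snd z)"
  have bd: "(\<lambda>w. b (w, w)) \<in> deg1 (int (m + n))" by (rule deg2_diag[OF b(1)])
  have c: "?c \<in> deg2 (int 0, int (m + n))" using deg2_snd[OF bd] .
  have cQ: "?c \<notin> Q" using b(3) deg1D(1)[OF bd] by (simp add: proj2_iff)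
  have key: "(\<lambda>z. l (fst z)) \<in> Q" if l: "linfun l" for l
  proof -
    interpret l: Vector_Spaces.linear scale times l by (rule l)
    have l1: "(\<lambda>z. l (fst z)) \<in> poly2" by (rule poly1_comp_fst[OF poly_functions.linear[OF l]])
    have p1: "(\<lambda>z. l (fst z) ^ m) \<in> deg2 (int m, int 0)" by (rule deg2I) (auto simp: l.scale power_mult_distrib intro: poly_powers[OF l1])
    have p2: "(\<lambda>z. l (snd z) ^ m) \<in> deg2 (int 0, int m)" by (rule deg2_snd[OF deg1_linear[OF l]])
    \<comment> \<open>In variables \<open>x\<close>, \<open>y\<close> this is
      \<open>l(y) ^ m b(x, y) - l(x) ^ m b(y, y)\<close>. The powers of \<open>l\<close> equalize
      the bidegrees, and the difference vanishes for \<open>x = y\<close>. Its first term lies in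
      \<open>Q\<close>, and \<open>b(y, y)\<close> does not.\<close>
    let ?a = "\<lambda>z. l (snd z) ^ m * b z - l (fst z) ^ m * ?c z"
    have "?a \<in> deg2 (int m, int (m + n))" using deg2_mult[OF p2 b(1)] deg2_mult[OF p1 c] by (intro S.deg_diff) simp_all
    moreover have "\<forall>x. ?a (x, x) = 0" by simp
    ultimately have "?a \<in> Q" using no by blast
    moreover have "(\<lambda>z. l (snd z) ^ m * b z) \<in> Q" by (rule S.ProjD(5)[OF Q b(2)]) (use p2 S.deg_closed in blast)
    ultimately have "(\<lambda>z. l (snd z) ^ m * b z + (-1) * ?a z) \<in> Q" by (intro S.ProjD(4)[OF Q] S.Proj_scale[OF Q])
    then have "(\<lambda>z. l (fst z) ^ m * ?c z) \<in> Q" by simp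
    then have pm: "(\<lambda>z. l (fst z) ^ m) \<in> Q" using sq_notin_mult[OF Q p1 c _ cQ] by blast
    have "(\<lambda>z. l (fst z) ^ j) \<in> Q \<Longrightarrow> (\<lambda>z. l (fst z)) \<in> Q" for j
    proof (induction j)
      case 0 then show ?case using S.ProjD(3)[OF Q] by simp
    next
      case (Suc j)
      then show ?case using S.ProjD(6)[OF Q, of "\<lambda>z. l (fst z)" "\<lambda>z. l (fst z) ^ j"] poly_powers[OF l1] l1 by (auto simp: carriers)
    qed
    then show ?thesis using pm by blast
  qed
  then have "(\<lambda>l. l \<circ> fst) ` {l. linfun l} \<subseteq> Q" by (auto simp: comp_def)
  then show False using S.ProjD(8)[OF Q] by (simp add: square_ring_def)
qed

end

section \<open>Expansion along the first factor\<close>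

context plane begin

text \<open>Restriction to the fiber of the second projection over the fixed point, in the affine
  coordinate \<open>t\<close> of the first factor.\<close>

definition curve_poly :: "('v \<times> 'v \<Rightarrow> 'f) \<Rightarrow> 'f poly" where
  "curve_poly f = (SOME p. \<forall>t. poly p t = f (u + scale t v, u))"

lemma curve_poly: assumes "f \<in> poly2" shows "poly (curve_poly f) t = f (u + scale t v, u)"
proof -
  have "\<exists>p. \<forall>t. poly p t = f (u + scale t v, u)" using poly2_curve[OF assms, of u v u 0] by simp
  then have "\<forall>t. poly (curve_poly f) t = f (u + scale t v, u)" unfolding curve_poly_def by (rule someI_ex)
  then show ?thesis by blast
qed

lemma poly_fun_eqI: "(\<And>t. poly p t = poly q t) \<Longrightarrow> p = q" for p q :: "'f poly"
  using poly_eq_poly_eq_iff by blast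

lemma curve_poly_unique: "f \<in> poly2 \<Longrightarrow> (\<And>t. poly p t = f (u + scale t v, u)) \<Longrightarrow> curve_poly f = p"
  by (rule poly_fun_eqI) (simp add: curve_poly)

definition expand :: "('v \<times> 'v \<Rightarrow> 'f) \<Rightarrow> 'f fps" where "expand f = fps_of_poly (curve_poly f)"

lemma expand_add: "f \<in> poly2 \<Longrightarrow> g \<in> poly2 \<Longrightarrow> expand (\<lambda>z. f z + g z) = expand f + expand g"
  unfolding expand_def fps_of_poly_add[symmetric]
  by (rule arg_cong[of _ _ fps_of_poly], rule curve_poly_unique) (simp_all add: poly_functions.add curve_poly)

lemma expand_mult: "f \<in> poly2 \<Longrightarrow> g \<in> poly2 \<Longrightarrow> expand (\<lambda>z. f z * g z) = expand f * expand g"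
  unfolding expand_def fps_of_poly_mult[symmetric]
  by (rule arg_cong[of _ _ fps_of_poly], rule curve_poly_unique) (simp_all add: poly_functions.mult curve_poly)

lemma expand_const: "expand (\<lambda>_. c) = fps_const c"
  unfolding expand_def fps_of_poly_const[symmetric]
  by (rule arg_cong[of _ _ fps_of_poly], rule curve_poly_unique) (simp_all add: poly_functions.const)

lemma expand_0: "f \<in> poly2 \<Longrightarrow> expand f $ 0 = f (u, u)"
  using curve_poly[of f 0] by (simp add: expand_def poly_0_coeff_0)

lemma expand_snd: "f \<in> poly1 \<Longrightarrow> expand (\<lambda>z. f (snd z)) = fps_const (f u)"
  unfolding expand_def fps_of_poly_const[symmetric]
  by (rule arg_cong[of _ _ fps_of_poly], rule curve_poly_unique) (simp_all add: poly1_comp_snd)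

lemma expand_unit: "f \<in> poly2 \<Longrightarrow> f (u, u) \<noteq> 0 \<Longrightarrow> expand f * inverse (expand f) = 1"
  by (rule inverse_mult_eq_1') (simp add: expand_0)

text \<open>A fraction is the class of all its representatives, including ones whose denominator
  vanishes at \<open>(u, u)\<close> and so has no inverse series; the choice therefore insists on a
  nonzero value there.\<close>

definition germ_series :: "('f, 'v) sqfrac \<Rightarrow> 'f fps" where
  "germ_series F = (let (a, b) = (SOME (a, b). (a, b) \<in> F \<and> b (u, u) \<noteq> 0) in expand a * inverse (expand b))"

lemma germ_series_quo:
  assumes "a \<in> poly2" "b \<in> poly2" "b (u, u) \<noteq> 0"
  shows "germ_series (quo a b) = expand a * inverse (expand b)"
proof -
  have bn: "b \<noteq> (\<lambda>_. 0)" using assms(3) by auto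
  define ce where "ce = (SOME (a', b'). (a', b') \<in> quo a b \<and> b' (u, u) \<noteq> 0)"
  have "\<exists>ce. case ce of (a', b') \<Rightarrow> (a', b') \<in> quo a b \<and> b' (u, u) \<noteq> 0"
    using S.fraction_self[of a b] assms bn by (intro exI[of _ "(a, b)"]) (simp add: carriers)
  then have "case ce of (a', b') \<Rightarrow> (a', b') \<in> quo a b \<and> b' (u, u) \<noteq> 0" unfolding ce_def by (rule someI_ex)
  then obtain c e where ce: "ce = (c, e)" "(c, e) \<in> quo a b" "e (u, u) \<noteq> 0" by (cases ce) auto
  have m: "c \<in> poly2" "e \<in> poly2" "\<And>x. a x * e x = c x * b x" using ce(2) unfolding S.mem_fraction carriers by auto
  have "(\<lambda>x. a x * e x) = (\<lambda>x. c x * b x)" using m(3) by blast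
  then have "expand a * expand e = expand c * expand b" using expand_mult assms(1,2) m(1,2) by metis
  then have "expand a * expand e * (inverse (expand e) * inverse (expand b)) =
      expand c * expand b * (inverse (expand e) * inverse (expand b))" by simp
  then have "expand a * (expand e * inverse (expand e)) * inverse (expand b) =
      expand c * (expand b * inverse (expand b)) * inverse (expand e)" by (simp only: mult_ac)
  then have "expand a * inverse (expand b) = expand c * inverse (expand e)" unfolding expand_unit[OF m(2) ce(3)] expand_unit[OF assms(2,3)] by simp
  then show ?thesis unfolding germ_series_def Let_def ce_def[symmetric] ce(1) by simp
qed

text \<open>Unlike membership in \<open>sqC base_pt\<close> this puts no condition on degrees, so it
  applies also to pulled back sections of a twisting sheaf.\<close>

definition unit_den :: "('v \<times> 'v \<Rightarrow> 'f) \<Rightarrow> ('v \<times> 'v \<Rightarrow> 'f) \<Rightarrow> bool" where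
  "unit_den a b \<longleftrightarrow> a \<in> poly2 \<and> b \<in> poly2 \<and> b (u, u) \<noteq> 0"

lemma base_mem_unit_den:
  assumes "F \<in> sqC base_pt"
  shows "\<exists>a b. F = quo a b \<and> unit_den a b"
proof -
  obtain a b m where *: "F = quo a b" "a \<in> deg2 m" "b \<in> deg2 m" "b \<notin> base_pt" by (rule sqO_memE[OF assms])
  then show ?thesis using base_pt_iff[OF *(3)] S.deg_closed unfolding unit_den_def carriers by blast
qed

lemma unit_den_frac: "unit_den a b \<Longrightarrow> S.is_frac a b"
  unfolding unit_den_def S.is_frac_def carriers by auto

lemma germ_series_unit_ops:
  assumes F': "F = quo a b" "unit_den a b" and G': "G = quo c e" "unit_den c e"
  shows "germ_series (fadd F G) = germ_series F + germ_series G"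
    "germ_series (fmul F G) = germ_series F * germ_series G"
proof -
  have m: "a \<in> poly2" "b \<in> poly2" "b (u, u) \<noteq> 0" "c \<in> poly2" "e \<in> poly2" "e (u, u) \<noteq> 0"
    using F'(2) G'(2) by (auto simp: unit_den_def)
  note U = expand_unit[OF m(2,3)] expand_unit[OF m(5,6)]
  have i: "inverse (expand b * expand e) = inverse (expand b) * inverse (expand e)" by (rule fps_inverse_mult)
  have pm: "(\<lambda>z. a z * e z) \<in> poly2" "(\<lambda>z. c z * b z) \<in> poly2" "(\<lambda>z. b z * e z) \<in> poly2" "(\<lambda>z. a z * c z) \<in> poly2"
    using m poly_functions.mult by blast+
  have "germ_series (fmul F G) = expand a * expand c * (inverse (expand b) * inverse (expand e))"
    unfolding F'(1) G'(1) S.frac_mult[OF unit_den_frac[OF F'(2)] unit_den_frac[OF G'(2)]]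
    using germ_series_quo[OF pm(4,3)] m by (simp add: expand_mult i)
  then show "germ_series (fmul F G) = germ_series F * germ_series G"
    unfolding F'(1) G'(1) germ_series_quo[OF m(1-3)] germ_series_quo[OF m(4-6)] by (simp only: mult_ac)
  have "germ_series (fadd F G) =
      (expand a * expand e + expand c * expand b) * (inverse (expand b) * inverse (expand e))"
    unfolding F'(1) G'(1) S.frac_add[OF unit_den_frac[OF F'(2)] unit_den_frac[OF G'(2)]]
    using germ_series_quo[OF poly_functions.add[OF pm(1,2)] pm(3)] m pm by (simp add: expand_mult expand_add i)
  also have "\<dots> = expand a * inverse (expand b) * (expand e * inverse (expand e)) +
      expand c * inverse (expand e) * (expand b * inverse (expand b))" by (simp only: distrib_right distrib_left mult_ac add_ac)
  finally show "germ_series (fadd F G) = germ_series F + germ_series G"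
    unfolding F'(1) G'(1) germ_series_quo[OF m(1-3)] germ_series_quo[OF m(4-6)] U by simp
qed

lemma germ_series_ops:
  assumes F: "F \<in> sqC base_pt" and G: "G \<in> sqC base_pt"
  shows "germ_series (fadd F G) = germ_series F + germ_series G"
    "germ_series (fmul F G) = germ_series F * germ_series G"
proof -
  obtain a b where F': "F = quo a b" "unit_den a b" using base_mem_unit_den[OF F] by metis
  obtain c e where G': "G = quo c e" "unit_den c e" using base_mem_unit_den[OF G] by metis
  show "germ_series (fadd F G) = germ_series F + germ_series G"
    "germ_series (fmul F G) = germ_series F * germ_series G" by (rule germ_series_unit_ops[OF F' G'])+
qed

lemma germ_series_const: "germ_series (cst c) = fps_const c"
  by (subst germ_series_quo) (simp_all add: poly_functions.const expand_const)

text \<open>A function vanishing on the diagonal vanishes at \<open>(u, u)\<close>, so its expansion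
  is divisible by \<open>fps_X\<close>; each further factor from the ideal contributes one more
  \<open>fps_X\<close>.\<close>

lemma germ_series_Ipow: "F \<in> Ipow j base_pt \<Longrightarrow> F \<in> sqC base_pt \<and> (\<exists>h. germ_series F = fps_X ^ j * h)"
proof (induction j arbitrary: F)
  case 0 then show ?case by (auto simp: Ipow_0)
next
  case (Suc j)
  have Ic: "F \<in> sqC base_pt" if "F \<in> Ipow i base_pt" for i F using ideal.Icarr[OF Ipow_ideal[OF base_pt_Proj] that] .
  have "\<exists>h. germ_series F = fps_X ^ Suc j * h" using Suc.prems unfolding Ipow_Suc
  proof (induction rule: ideal_prod.induct)
    case (prod i g)
    obtain a b m where *: "i = quo a b" "a \<in> deg2 m" "b \<in> deg2 m" "b \<notin> base_pt" "\<And>x. a (x, x) = 0"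
      using prod(1) unfolding diagonal_stalk_def by blast
    have i: "i \<in> sqC base_pt" unfolding *(1) by (rule sqO_mem[OF *(2-4)])
    have p2: "a \<in> poly2" "b \<in> poly2" "b (u, u) \<noteq> 0" using *(2-4) base_pt_iff[OF *(3)] S.deg_closed unfolding carriers by blast+
    have "germ_series i $ 0 = 0" unfolding *(1) germ_series_quo[OF p2] by (simp add: fps_mult_nth_0 expand_0[OF p2(1)] *(5))
    then have "\<exists>h. germ_series i = fps_X * h" by (intro exI[of _ "fps_shift 1 (germ_series i)"]) (simp add: fps_eq_iff)
    then obtain h where h: "germ_series i = fps_X * h" by blast
    obtain h' where h': "g \<in> sqC base_pt" "germ_series g = fps_X ^ j * h'" using Suc.IH[OF prod(2)] by blast
    have "germ_series (i \<otimes>\<^bsub>sqO base_pt\<^esub> g) = fps_X ^ Suc j * (h * h')"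
      unfolding S.twist_ops germ_series_ops(2)[OF i h'(1)] h h'(2) by (simp add: mult_ac)
    then show ?case by blast
  next
    case (sum s t)
    have "s \<in> sqC base_pt" "t \<in> sqC base_pt" using sum(1,2) Ic[of _ "Suc j"] unfolding Ipow_Suc by blast+
    moreover obtain h h' where "germ_series s = fps_X ^ Suc j * h" "germ_series t = fps_X ^ Suc j * h'" using sum by blast
    ultimately have "germ_series (s \<oplus>\<^bsub>sqO base_pt\<^esub> t) = fps_X ^ Suc j * (h + h')"
      unfolding S.twist_ops by (simp only: germ_series_ops distrib_left)
    then show ?case by blast
  qed
  then show ?case using Ic[OF Suc.prems] by blast
qed

lemma germ_series_Ipow_cutoff: "F \<in> Ipow j base_pt \<Longrightarrow> fps_cutoff j (germ_series F) = 0"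
  using germ_series_Ipow[of F j] by (auto simp: fps_eq_iff fps_X_power_mult_nth)

text \<open>An element whose expansion vanishes to order \<open>j\<close> lies in \<open>I\<^sup>j + \<mm>\<O>\<close>, with \<open>\<mm>\<close> the maximal ideal of
  the second factor; in the affine coordinates \<open>s, t\<close> this is \<open>s\<^sup>j \<equiv> (s - t)\<^sup>j\<close> modulo \<open>t\<close>.\<close>

definition delta :: "'v \<times> 'v \<Rightarrow> 'f" where "delta z = y1 z * x2 z - x1 z * y2 z"

definition xx :: "'v \<times> 'v \<Rightarrow> 'f" where "xx z = x1 z * x2 z"

lemma delta_scale: "delta (scale c x, y) = c * delta (x, y)" "delta (x, scale c y) = c * delta (x, y)"
  "xx (scale c x, y) = c * xx (x, y)" "xx (x, scale c y) = c * xx (x, y)"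
  by (simp_all add: delta_def xx_def algebra_simps)

lemma delta_poly: "delta \<in> poly2" "xx \<in> poly2"
proof -
  have "(\<lambda>z. y1 z * x2 z + (-1) * (x1 z * y2 z)) \<in> poly2" by (rule poly_functions.add[OF poly_functions.mult[OF poly2_basic(2,3)]
        poly_functions.mult[OF poly_functions.const[of "-1"] poly_functions.mult[OF poly2_basic(1,4)]]])
  moreover have "(\<lambda>z. y1 z * x2 z + (-1) * (x1 z * y2 z)) = delta" by (rule ext) (simp add: delta_def)
  ultimately show "delta \<in> poly2" by (simp only:)
  show "xx \<in> poly2" unfolding xx_def[abs_def] by (rule poly_functions.mult[OF poly2_basic(1,3)])
qed

lemma deg2_delta: "(\<lambda>z. delta z ^ j) \<in> deg2 (int j, int j)" "(\<lambda>z. xx z ^ j) \<in> deg2 (int j, int j)"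
  by (rule deg2I[OF poly_powers[OF delta_poly(1)]], simp_all only: delta_scale power_mult_distrib)
    (rule deg2I[OF poly_powers[OF delta_poly(2)]], simp_all only: delta_scale power_mult_distrib)

lemma power_notin:
  assumes "Q \<in> SP" "f \<in> deg2 d" "f \<notin> Q" shows "(\<lambda>z. f z ^ n) \<notin> Q"
proof (induction n)
  case 0 then show ?case using S.ProjD(3)[OF assms(1)] by simp
next
  case (Suc n)
  have "f \<in> carrier SR" by (rule S.deg_closed[OF assms(2)])
  then show ?case using S.ProjD(6)[OF assms(1), of f "\<lambda>z. f z ^ n"] assms(3) Suc poly_powers[of f _ n] by (auto simp: carriers)
qed

lemma xx_notin: assumes "Q \<in> SP" "x1 \<notin> Q" "x2 \<notin> Q" shows "(\<lambda>z. xx z ^ n) \<notin> Q"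
proof -
  have "xx \<notin> Q" unfolding xx_def using S.ProjD(6)[OF assms(1), of x1 x2] assms(2,3) poly2_basic by (auto simp: carriers)
  then show ?thesis using power_notin[OF assms(1), of xx] deg2_delta(2)[of 1] by simp
qed

text \<open>The fraction \<open>delta / xx\<close> is the affine function \<open>s - t\<close>,
  which vanishes on the diagonal.\<close>

lemma delta_power_Ipow:
  assumes Q: "Q \<in> SP" "x1 \<notin> Q" "x2 \<notin> Q" and F: "F \<in> sqC Q"
  shows "fmul (quo (\<lambda>z. delta z ^ j) (\<lambda>z. xx z ^ j)) F \<in> Ipow j Q"
proof (induction j)
  case 0
  show ?case using S.fraction_one_mult[OF Q(1) F] F by (simp add: Ipow_0)
next
  case (Suc j)
  let ?q = "\<lambda>j. quo (\<lambda>z. delta z ^ j) (\<lambda>z. xx z ^ j)"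
  have fr: "S.is_frac (\<lambda>z. delta z ^ j) (\<lambda>z. xx z ^ j)" for j by (rule sq_frac[OF Q(1) deg2_delta xx_notin[OF Q]])
  have q: "?q j \<in> sqC Q" for j by (rule sqO_mem[OF deg2_delta xx_notin[OF Q]])
  have "?q 1 \<in> diagonal_stalk scale Q" by (rule diagonal_stalkI[OF deg2_delta xx_notin[OF Q]]) (simp add: delta_def)
  then have "fmul (?q 1) (fmul (?q j) F) \<in> Ipow (Suc j) Q"
    using ideal_prod.prod[OF _ Suc, of "?q 1" "diagonal_stalk scale Q" "sqO Q"] unfolding Ipow_Suc S.twist_ops by blast
  moreover have "fmul (?q 1) (?q j) = ?q (Suc j)" unfolding S.frac_mult[OF fr fr] by simp
  ultimately show ?case using S.fraction_comm_assoc(2)[OF Q(1) q q F, of 1 j] by simp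
qed

text \<open>The factor \<open>y2 / x2\<close> is a parameter of the second factor vanishing at the
  fixed point, precisely what passage to the fiber divides out. The decomposition comes from an
  identity of functions, so \<open>c\<close> and \<open>e\<close> serve for all nearby points at
  once, as an equality of sections requires; only \<open>H\<close> depends on
  \<open>Q\<close>.\<close>

lemma series_kernel:
  assumes a: "a \<in> deg2 (int m, int n)" and b: "b \<in> deg2 (int m, int n)" "b \<notin> base_pt"
    and z: "fps_cutoff j (germ_series (quo a b)) = 0"
  shows "\<exists>c e d. c \<in> deg2 d \<and> e \<in> deg2 d \<and> e \<notin> base_pt \<and>
    (\<forall>Q\<in>SP. b \<notin> Q \<longrightarrow> x1 \<notin> Q \<longrightarrow> x2 \<notin> Q \<longrightarrow> e \<notin> Q \<and>
      (\<exists>H\<in>Ipow j Q. quo a b = fadd (fmul (quo y2 x2) (quo c e)) H))"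
proof -
  have ap: "a \<in> poly2" and bp: "b \<in> poly2" "b (u, u) \<noteq> 0" using a b S.deg_closed base_pt_iff[OF b(1)] unfolding carriers by blast+
  define sh where "sh = fps_shift j (germ_series (quo a b))"
  have "expand a = germ_series (quo a b) * expand b" unfolding germ_series_quo[OF ap bp] using expand_unit[OF bp] by (simp add: mult_ac)
  moreover have "germ_series (quo a b) = fps_X ^ j * sh" using fps_shift_cutoff'[of j "germ_series (quo a b)"] z by (simp add: sh_def)
  ultimately have "expand a = fps_X ^ j * (sh * expand b)" by (simp only: mult.assoc)
  then have co: "coeff (curve_poly a) i = 0" if "i < j" for i using that unfolding expand_def by (metis fps_of_poly_nth fps_X_power_mult_nth)
  \<comment> \<open>The denominator is invertible, so the numerator itself vanishes to order
    \<open>j\<close> along the fiber \<open>t = 0\<close>; \<open>q\<close> is the cofactor of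
    \<open>s ^ j\<close>.\<close>
  define q where "q = poly_shift j (curve_poly a)"
  have q: "curve_poly a = monom 1 j * q" by (rule poly_eqI) (auto simp: q_def coeff_poly_shift coeff_monom_mult co)
  obtain P where P: "\<And>s t. a (u + scale s v, u + scale t v) = poly (poly P [:t:]) s" using dehomogenize[OF ap] by blast
  obtain p P' where pP: "P = pCons p P'" by (rule pCons_cases)
  \<comment> \<open>Putting \<open>t = 0\<close> leaves the coefficient of \<open>P\<close> at
    degree 0.\<close>
  have "p = curve_poly a" by (rule poly_fun_eqI) (use P[of _ 0] in \<open>simp add: curve_poly[OF ap] pP\<close>)
  \<comment> \<open>The coordinates \<open>s\<close> and \<open>t\<close> as polynomials. A
    difference of \<open>j\<close>th powers is divisible by the difference of the bases, here by
    \<open>s - (s - t) = t\<close>.\<close>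
  define Z1 Z2 where "Z1 = [:[:0, 1 :: 'f:]:]" and "Z2 = [:0, 1 :: 'f poly:]"
  have "(Z1 - (Z1 - Z2)) dvd (Z1 ^ j - (Z1 - Z2) ^ j)" unfolding power_diff_sumr2[of Z1 j "Z1 - Z2"] by (rule dvd_triv_left)
  then obtain E where E: "Z1 ^ j - (Z1 - Z2) ^ j = Z2 * E" unfolding dvd_def by auto
  \<comment> \<open>Collects all multiples of \<open>t\<close> once \<open>s ^ j\<close> has been
    traded for \<open>(s - t) ^ j\<close>.\<close>
  define P1 where "P1 = P' + E * [:q:]"
  have ev: "poly (poly Z1 [:t:]) s = s" "poly (poly Z2 [:t:]) s = t" for s t by (simp_all add: Z1_def Z2_def)
  have key: "a (u + scale s v, u + scale t v) = (s - t) ^ j * poly q s + t * poly (poly P1 [:t:]) s" for s t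
  proof -
    have "poly (poly (Z1 ^ j - (Z1 - Z2) ^ j) [:t:]) s = poly (poly (Z2 * E) [:t:]) s" unfolding E ..
    then have e: "s ^ j - (s - t) ^ j = t * poly (poly E [:t:]) s" by (simp add: ev)
    have "a (u + scale s v, u + scale t v) = s ^ j * poly q s + t * poly (poly P' [:t:]) s"
      unfolding P pP \<open>p = curve_poly a\<close> by (simp add: q poly_monom)
    also have "\<dots> = (s - t) ^ j * poly q s + t * (poly (poly P' [:t:]) s + poly (poly E [:t:]) s * poly q s)"
    proof -
      have "s ^ j = t * poly (poly E [:t:]) s + (s - t) ^ j" using e unfolding diff_eq_eq .
      then show ?thesis by (simp only: distrib_left distrib_right mult.assoc add_ac)
    qed
    finally show ?thesis by (simp add: P1_def)
  qed
  obtain N0 where N0: "\<forall>N\<ge>N0. \<exists>a\<in>deg2 (int N, int N). \<forall>z. x1 z \<noteq> 0 \<longrightarrow> x2 z \<noteq> 0 \<longrightarrow>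
     a z = x1 z ^ N * x2 z ^ N * poly (poly P1 [:y2 z / x2 z:]) (y1 z / x1 z)" using homogenize by blast
  obtain N1 where N1: "\<forall>N\<ge>N1. \<forall>M. \<exists>a\<in>deg2 (int N, int M). \<forall>z. x1 z \<noteq> 0 \<longrightarrow> a z = x1 z ^ N * x2 z ^ M * poly q (y1 z / x1 z)"
    using homogenize1 by blast
  define N where "N = max N0 N1"
  obtain a1 where a1: "a1 \<in> deg2 (int N, int N)" "\<And>z. x1 z \<noteq> 0 \<Longrightarrow> x2 z \<noteq> 0 \<Longrightarrow>
     a1 z = x1 z ^ N * x2 z ^ N * poly (poly P1 [:y2 z / x2 z:]) (y1 z / x1 z)" using N0[rule_format, of N] unfolding N_def by auto
  obtain a2 where a2: "a2 \<in> deg2 (int N, int N)" "\<And>z. x1 z \<noteq> 0 \<Longrightarrow> a2 z = x1 z ^ N * x2 z ^ N * poly q (y1 z / x1 z)"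
    using N1[rule_format, of N N] unfolding N_def by auto
  \<comment> \<open>The monomial that turns a dehomogenized expression back into one of the bidegree
    of \<open>a\<close>.\<close>
  define xmn where "xmn z = x1 z ^ m * x2 z ^ n" for z
  have xmn: "xmn \<in> deg2 (int m, int n)" using deg2_mult[OF deg2_basic(1)[of m] deg2_basic(3)[of n]] by (simp add: xmn_def[abs_def])
  let ?e = "\<lambda>z. b z * xx z ^ N"
  have e: "?e \<in> deg2 (int (m + N), int (n + N))" by (rule deg2_mult[OF b(1) deg2_delta(2)])
  have c1: "(\<lambda>z. xmn z * a1 z) \<in> deg2 (int (m + N), int (n + N))" "(\<lambda>z. xmn z * a2 z) \<in> deg2 (int (m + N), int (n + N))"
    by (rule deg2_mult[OF xmn a1(1)], rule deg2_mult[OF xmn a2(1)])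
  have eb: "?e \<notin> base_pt" using base_pt_iff[OF e] bp(2) by (simp add: xx_def)
  \<comment> \<open>The desired equality of fractions with all denominators cleared; it can be
    verified on the chart where \<open>x1\<close> and \<open>x2\<close> are nonzero.\<close>
  have main: "(\<lambda>z. a z * (x2 z * (b z * xx z ^ N) * (xx z ^ j * (b z * xx z ^ N)))) =
      (\<lambda>z. (y2 z * (xmn z * a1 z) * (xx z ^ j * (b z * xx z ^ N)) + delta z ^ j * (xmn z * a2 z) * (x2 z * (b z * xx z ^ N))) * b z)"
  proof (rule poly2_eqI)
    have p: "(\<lambda>z. xx z ^ i) \<in> poly2" "(\<lambda>z. delta z ^ i) \<in> poly2" "xmn \<in> poly2" "a1 \<in> poly2" "a2 \<in> poly2" for i
      using deg2_delta xmn a1(1) a2(1) S.deg_closed unfolding carriers by blast+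
    show "(\<lambda>z. a z * (x2 z * (b z * xx z ^ N) * (xx z ^ j * (b z * xx z ^ N)))) \<in> poly2"
      by (intro poly_functions.mult p ap bp poly2_basic)
    show "(\<lambda>z. (y2 z * (xmn z * a1 z) * (xx z ^ j * (b z * xx z ^ N)) + delta z ^ j * (xmn z * a2 z) * (x2 z * (b z * xx z ^ N))) * b z) \<in> poly2"
      by (intro poly_functions.mult poly_functions.add p ap bp poly2_basic)
    fix z assume x: "x1 z \<noteq> 0" "x2 z \<noteq> 0"
    let ?s = "y1 z / x1 z" and ?t = "y2 z / x2 z"
    let ?A = "poly (poly P1 [:?t:]) ?s" and ?B = "poly q ?s"
    have "delta z = xx z * (?s - ?t)" using x by (simp add: delta_def xx_def field_simps)
    then have d: "delta z ^ j = xx z ^ j * (?s - ?t) ^ j" by (simp only: power_mult_distrib)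
    have y: "y2 z = x2 z * ?t" using x by simp
    have az: "a z = xmn z * ((?s - ?t) ^ j * ?B + ?t * ?A)" using deg2_dehomogenize[OF a x] unfolding key xmn_def .
    have xn: "x1 z ^ N * x2 z ^ N = xx z ^ N" by (simp add: xx_def power_mult_distrib)
    show "a z * (x2 z * (b z * xx z ^ N) * (xx z ^ j * (b z * xx z ^ N))) =
      (y2 z * (xmn z * a1 z) * (xx z ^ j * (b z * xx z ^ N)) + delta z ^ j * (xmn z * a2 z) * (x2 z * (b z * xx z ^ N))) * b z"
      unfolding az d a1(2)[OF x] a2(2)[OF x(1)] xn by (subst (3) y) (simp only: distrib_left distrib_right mult_ac add_ac)
  qed
  have "?e \<notin> Q \<and> (\<exists>H\<in>Ipow j Q. quo a b =
      fadd (fmul (quo y2 x2) (quo (\<lambda>z. xmn z * a1 z) ?e)) H)"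
    if Q: "Q \<in> SP" "b \<notin> Q" "x1 \<notin> Q" "x2 \<notin> Q" for Q
  proof -
    have eQ: "?e \<notin> Q" by (rule sq_notin_mult[OF Q(1) b(1) deg2_delta(2) Q(2) xx_notin[OF Q(1,3,4)]])
    define H where "H = fmul (quo (\<lambda>z. delta z ^ j) (\<lambda>z. xx z ^ j)) (quo (\<lambda>z. xmn z * a2 z) ?e)"
    have H: "H \<in> Ipow j Q" unfolding H_def by (rule delta_power_Ipow[OF Q(1,3,4) sqO_mem[OF c1(2) e eQ]])
    have f1: "S.is_frac y2 x2" using sq_frac[OF Q(1), of y2 "(int 0, int 1)" x2 "(int 0, int 1)"] deg2_basic(3)[of 1] deg2_basic(4)[of 1] Q(4) by simp
    note f2 = sq_frac[OF Q(1) c1(1) e eQ] and f3 = sq_frac[OF Q(1) c1(2) e eQ]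
      and f4 = sq_frac[OF Q(1) deg2_delta(1) deg2_delta(2) xx_notin[OF Q(1,3,4)]]
    have "quo a b = fadd (fmul (quo y2 x2) (quo (\<lambda>z. xmn z * a1 z) ?e)) H"
      unfolding H_def S.frac_mult[OF f1 f2] S.frac_mult[OF f4 f3] S.frac_add[OF S.is_frac_mult[OF f1 f2] S.is_frac_mult[OF f4 f3]]
      by (rule S.frac_eqI[OF sq_frac[OF Q(1) a b(1) Q(2)] S.is_frac_add[OF S.is_frac_mult[OF f1 f2] S.is_frac_mult[OF f4 f3]]])
        (rule fun_cong[OF main])
    then show ?thesis using eQ H by blast
  qed
  then show ?thesis using c1(1) e eb by blast
qed

text \<open>A truncated series is a polynomial in \<open>y1 / x1\<close>, and \<open>x1 ^ j\<close>
  is a common denominator.\<close>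

lemma series_surj:
  assumes "w \<in> polys_upto j"
  shows "\<exists>a. a \<in> deg2 (int j, int 0) \<and> germ_series (quo a (\<lambda>z. x1 z ^ j)) = w"
proof -
  let ?a = "\<lambda>z. \<Sum>i\<le>j. w $ i * (x1 z ^ (j - i) * y1 z ^ i)"
  have "?a \<in> deg2 (int j, int 0)"
  proof (rule S.deg_sum)
    show "(\<lambda>_. 0) \<in> deg2 (int j, int 0)" by (rule deg2I) (auto intro: poly_functions.const)
    show "(\<lambda>z. w $ i * (x1 z ^ (j - i) * y1 z ^ i)) \<in> deg2 (int j, int 0)" if "i \<in> {..j}" for i
      using deg2_mult[OF deg2_basic(1)[of "j - i"] deg2_basic(2)[of i]] that by (intro S.deg_scale) simp
  qed
  moreover have "germ_series (quo ?a (\<lambda>z. x1 z ^ j)) = w"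
  proof -
    have p: "?a \<in> poly2" "(\<lambda>z. x1 z ^ j) \<in> poly2"
      using \<open>?a \<in> deg2 _\<close> deg2_basic(1)[of j] S.deg_closed unfolding carriers by blast+
    have "expand (\<lambda>z. x1 z ^ j) = 1" unfolding expand_def fps_of_poly_1[symmetric]
      by (rule arg_cong[of _ _ fps_of_poly], rule curve_poly_unique[OF p(2)]) simp
    moreover have "expand ?a = fps_of_poly (\<Sum>i\<le>j. monom (w $ i) i)" unfolding expand_def
      by (rule arg_cong[of _ _ fps_of_poly], rule curve_poly_unique[OF p(1)]) (simp add: poly_sum poly_monom)
    moreover have "fps_of_poly (\<Sum>i\<le>j. monom (w $ i) i) = w" using polys_upto_sum[OF assms] by (simp add: fps_of_poly_sum fps_of_poly_monom)
    ultimately show ?thesis using germ_series_quo[OF p] by simp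
  qed
  ultimately show ?thesis by blast
qed

end

section \<open>Stalks of the sheaf of jets\<close>

text \<open>Closure makes every relation a combination of generators. This light interface is shared
  by the pullback stalk, a base change, and the jet stalk, a tensor product over one ring.\<close>

locale tensor_data =
  fixes R :: "('r, 'y) ring_scheme" and M :: "('r, 'm, 'z) module_scheme" and N :: "('r, 'n, 'w) module_scheme"
  assumes M_closed: "\<And>x y. x \<in> carrier M \<Longrightarrow> y \<in> carrier M \<Longrightarrow> x \<oplus>\<^bsub>M\<^esub> y \<in> carrier M"
      "\<And>r x. r \<in> carrier R \<Longrightarrow> x \<in> carrier M \<Longrightarrow> r \<odot>\<^bsub>M\<^esub> x \<in> carrier M"
    and N_closed: "\<And>x y. x \<in> carrier N \<Longrightarrow> y \<in> carrier N \<Longrightarrow> x \<oplus>\<^bsub>N\<^esub> y \<in> carrier N"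
      "\<And>r x. r \<in> carrier R \<Longrightarrow> x \<in> carrier N \<Longrightarrow> r \<odot>\<^bsub>N\<^esub> x \<in> carrier N"
begin

sublocale presentation "carrier M \<times> carrier N" "tensor_relations R M N"
  by (rule tensor_presentation) (auto simp: M_closed N_closed)

abbreviation "gens \<equiv> carrier M \<times> carrier N"
abbreviation "rels \<equiv> tensor_relations R M N"

abbreviation "act_module act \<equiv> presented_module gens rels (\<lambda>s (x, y). (act s x, y))"

lemma pure_class: "pure (presented_module gens rels act) x y = rel_class gens rels (frag_of (x, y))"
  unfolding pure_def presented_zero by (simp add: rel_class_def image_image)

lemma pure_mem: "x \<in> carrier M \<Longrightarrow> y \<in> carrier N \<Longrightarrow> pure (presented_module gens rels act) x y \<in> carrier (presented_module gens rels act)"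
  unfolding pure_class presented_carrier by (intro imageI) (simp add: keys_frag_of)

lemma pure_add_left: "x \<in> carrier M \<Longrightarrow> x' \<in> carrier M \<Longrightarrow> y \<in> carrier N \<Longrightarrow>
   pure (presented_module gens rels act) (x \<oplus>\<^bsub>M\<^esub> x') y =
   pure (presented_module gens rels act) x y \<oplus>\<^bsub>presented_module gens rels act\<^esub> pure (presented_module gens rels act) x' y"
  unfolding pure_class presented_add class_eq_iff
  using span_incl[OF tensor_relationsI(1)[of x M x' y N R]] by (simp add: diff_diff_eq)

lemma pure_balanced: "r \<in> carrier R \<Longrightarrow> x \<in> carrier M \<Longrightarrow> y \<in> carrier N \<Longrightarrow>
   pure (presented_module gens rels act) (r \<odot>\<^bsub>M\<^esub> x) y = pure (presented_module gens rels act) x (r \<odot>\<^bsub>N\<^esub> y)"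
  unfolding pure_class class_eq_iff by (rule span_incl[OF tensor_relationsI(3)])

lemma smult_rel:
  assumes "\<And>x y. x \<in> carrier M \<Longrightarrow> y \<in> carrier M \<Longrightarrow> f (x \<oplus>\<^bsub>M\<^esub> y) = f x \<oplus>\<^bsub>M\<^esub> f y"
    and "\<And>x. x \<in> carrier M \<Longrightarrow> f x \<in> carrier M"
    and "\<And>r x. r \<in> carrier R \<Longrightarrow> x \<in> carrier M \<Longrightarrow> f (r \<odot>\<^bsub>M\<^esub> x) = r \<odot>\<^bsub>M\<^esub> f x"
    and e: "e \<in> rels"
  shows "gen_map (\<lambda>(x, y). (f x, y)) e \<in> span_rel gens rels"
proof -
  have "gen_map (map_prod f id) e \<in> rels" by (rule tensor_relations_map[where \<rho> = id, OF e]) (simp_all add: assms)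
  moreover have "map_prod f id = (\<lambda>(x, y). (f x, y))" by (auto simp: fun_eq_iff)
  ultimately show ?thesis by (metis span_incl)
qed

lemma smult_pure:
  assumes "\<And>x y. x \<in> carrier M \<Longrightarrow> y \<in> carrier M \<Longrightarrow> act s (x \<oplus>\<^bsub>M\<^esub> y) = act s x \<oplus>\<^bsub>M\<^esub> act s y"
    and "\<And>x. x \<in> carrier M \<Longrightarrow> act s x \<in> carrier M"
    and "\<And>r x. r \<in> carrier R \<Longrightarrow> x \<in> carrier M \<Longrightarrow> act s (r \<odot>\<^bsub>M\<^esub> x) = r \<odot>\<^bsub>M\<^esub> act s x"
  shows "s \<odot>\<^bsub>act_module act\<^esub> pure (act_module act) x y =
    pure (act_module act) (act s x) y"
proof -
  have "s \<odot>\<^bsub>act_module act\<^esub> rel_class gens rels c =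
      rel_class gens rels (gen_map (\<lambda>(x, y). (act s x, y)) c)" for c by (rule presented_smult) (rule smult_rel, use assms in auto)
  then show ?thesis unfolding pure_class by simp
qed

lemma smult_closed:
  assumes "\<And>x y. x \<in> carrier M \<Longrightarrow> y \<in> carrier M \<Longrightarrow> act s (x \<oplus>\<^bsub>M\<^esub> y) = act s x \<oplus>\<^bsub>M\<^esub> act s y"
    and cl: "\<And>x. x \<in> carrier M \<Longrightarrow> act s x \<in> carrier M"
    and "\<And>r x. r \<in> carrier R \<Longrightarrow> x \<in> carrier M \<Longrightarrow> act s (r \<odot>\<^bsub>M\<^esub> x) = r \<odot>\<^bsub>M\<^esub> act s x"
    and A: "A \<in> carrier (act_module act)"
  shows "s \<odot>\<^bsub>act_module act\<^esub> A \<in> carrier (act_module act)"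
proof -
  obtain c where c: "A = rel_class gens rels c" "supp c \<subseteq> gens" using A by (auto simp: presented_carrier)
  have "s \<odot>\<^bsub>act_module act\<^esub> rel_class gens rels c =
      rel_class gens rels (gen_map (\<lambda>(x, y). (act s x, y)) c)" for c by (rule presented_smult) (rule smult_rel, use assms in auto)
  then show ?thesis unfolding c presented_carrier
    using keys_frag_extend_of[OF c(2), of "\<lambda>(x, y). (act s x, y)" gens] cl by (auto intro!: imageI)
qed

end

lemma tensor_presentation_of: "tensor_data R M N \<Longrightarrow> presentation (carrier M \<times> carrier N) (tensor_relations R M N)"
  by (rule tensor_presentation) (auto simp: tensor_data_def)

lemma quot_ideal:
  fixes M :: "('m, 'm, 'z) module_scheme"
  assumes ring: "ring M" and J: "ideal J M" and sm: "module.smult M = monoid.mult M"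
  shows "carrier (quot_module M J) = (\<lambda>x. J +>\<^bsub>M\<^esub> x) ` carrier M"
    and "\<zero>\<^bsub>quot_module M J\<^esub> = J +>\<^bsub>M\<^esub> \<zero>\<^bsub>M\<^esub>"
    and "\<And>x y. x \<in> carrier M \<Longrightarrow> y \<in> carrier M \<Longrightarrow> (J +>\<^bsub>M\<^esub> x) \<oplus>\<^bsub>quot_module M J\<^esub> (J +>\<^bsub>M\<^esub> y) = J +>\<^bsub>M\<^esub> (x \<oplus>\<^bsub>M\<^esub> y)"
    and "\<And>r x. r \<in> carrier M \<Longrightarrow> x \<in> carrier M \<Longrightarrow> r \<odot>\<^bsub>quot_module M J\<^esub> (J +>\<^bsub>M\<^esub> x) = J +>\<^bsub>M\<^esub> (r \<otimes>\<^bsub>M\<^esub> x)"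
    and "\<And>x. x \<in> J \<Longrightarrow> J +>\<^bsub>M\<^esub> x = J"
    and "\<And>x y. x \<in> carrier M \<Longrightarrow> y \<in> J +>\<^bsub>M\<^esub> x \<Longrightarrow> \<exists>j\<in>J. y = j \<oplus>\<^bsub>M\<^esub> x"
    and "\<And>x. x \<in> carrier M \<Longrightarrow> x \<in> J +>\<^bsub>M\<^esub> x"
proof -
  interpret I: ideal J M by (rule J)
  have as: "abelian_subgroup J M" by (rule abelian_subgroupI3[OF I.additive_subgroup_axioms ring.is_abelian_group[OF ring]])
  show "carrier (quot_module M J) = (\<lambda>x. J +>\<^bsub>M\<^esub> x) ` carrier M"
    by (auto simp: quot_module_def A_RCOSETS_def RCOSETS_def a_r_coset_def)
  show z: "J +>\<^bsub>M\<^esub> x = J" if "x \<in> J" for x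
    by (rule abelian_group.a_coset_join2[OF ring.is_abelian_group[OF ring] I.Icarr[OF that] additive_subgroup.a_subgroup[OF I.additive_subgroup_axioms] that])
  then show "\<zero>\<^bsub>quot_module M J\<^esub> = J +>\<^bsub>M\<^esub> \<zero>\<^bsub>M\<^esub>"
    using additive_subgroup.zero_closed[OF I.additive_subgroup_axioms] by (simp add: quot_module_def)
  show "(J +>\<^bsub>M\<^esub> x) \<oplus>\<^bsub>quot_module M J\<^esub> (J +>\<^bsub>M\<^esub> y) = J +>\<^bsub>M\<^esub> (x \<oplus>\<^bsub>M\<^esub> y)"
    if "x \<in> carrier M" "y \<in> carrier M" for x y using abelian_subgroup.a_rcos_sum[OF as that] by (simp add: quot_module_def)
  show ex: "\<exists>j\<in>J. y = j \<oplus>\<^bsub>M\<^esub> x" if "x \<in> carrier M" "y \<in> J +>\<^bsub>M\<^esub> x" for x y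
    using that by (auto simp: a_r_coset_def')
  show self: "x \<in> J +>\<^bsub>M\<^esub> x" if "x \<in> carrier M" for x using that abelian_subgroup.a_rcos_self[OF as] by blast
  show "r \<odot>\<^bsub>quot_module M J\<^esub> (J +>\<^bsub>M\<^esub> x) = J +>\<^bsub>M\<^esub> (r \<otimes>\<^bsub>M\<^esub> x)" if r: "r \<in> carrier M" and x: "x \<in> carrier M" for r x
  proof -
    have "J +>\<^bsub>M\<^esub> (r \<otimes>\<^bsub>M\<^esub> y) = J +>\<^bsub>M\<^esub> (r \<otimes>\<^bsub>M\<^esub> x)" if yx: "y \<in> J +>\<^bsub>M\<^esub> x" for y
    proof -
      obtain j where j: "j \<in> J" "y = j \<oplus>\<^bsub>M\<^esub> x" using ex[OF x yx] by blast
      have "r \<otimes>\<^bsub>M\<^esub> y = r \<otimes>\<^bsub>M\<^esub> j \<oplus>\<^bsub>M\<^esub> r \<otimes>\<^bsub>M\<^esub> x" using j r x I.Icarr by (simp add: ring.ring_simprules(13)[OF ring] I.r_distr)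
      then have "r \<otimes>\<^bsub>M\<^esub> y \<in> J +>\<^bsub>M\<^esub> (r \<otimes>\<^bsub>M\<^esub> x)" using I.I_l_closed[OF j(1) r] by (auto simp: a_r_coset_def')
      then show ?thesis using abelian_subgroup.a_repr_independence'[OF as, of "r \<otimes>\<^bsub>M\<^esub> y" "r \<otimes>\<^bsub>M\<^esub> x"] r x I.m_closed by auto
    qed
    moreover have "J +>\<^bsub>M\<^esub> x \<noteq> {}" using self[OF x] by blast
    ultimately have "(\<Union>y\<in>J +>\<^bsub>M\<^esub> x. J +>\<^bsub>M\<^esub> (r \<otimes>\<^bsub>M\<^esub> y)) = J +>\<^bsub>M\<^esub> (r \<otimes>\<^bsub>M\<^esub> x)" by (intro SUP_eq_const) auto
    then show ?thesis by (simp add: quot_module_def sm)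
  qed
qed

context plane begin

abbreviation "TS \<equiv> thick_stalk scale"
abbreviation "Jcos k Q F \<equiv> Ipow (k + 1) Q +>\<^bsub>sqO Q\<^esub> F"

lemma thick_stalk:
  assumes Q: "Q \<in> SP"
  shows "carrier (TS k Q) = (\<lambda>F. Jcos k Q F) ` sqC Q"
    and "\<And>F G. F \<in> sqC Q \<Longrightarrow> G \<in> sqC Q \<Longrightarrow>
      Jcos k Q F \<oplus>\<^bsub>TS k Q\<^esub> Jcos k Q G = Jcos k Q (fadd F G)"
    and "\<And>F G. F \<in> sqC Q \<Longrightarrow> G \<in> sqC Q \<Longrightarrow>
      F \<odot>\<^bsub>TS k Q\<^esub> Jcos k Q G = Jcos k Q (fmul F G)"
    and "\<And>F. F \<in> Ipow (k + 1) Q \<Longrightarrow> Jcos k Q F = Jcos k Q (cst 0)"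
    and "\<And>F G. F \<in> sqC Q \<Longrightarrow> G \<in> Jcos k Q F \<Longrightarrow> \<exists>H\<in>Ipow (k + 1) Q. G = fadd H F"
    and "\<And>F. F \<in> sqC Q \<Longrightarrow> F \<in> Jcos k Q F"
proof -
  have "module.smult (sqO Q) = monoid.mult (sqO Q)" by (simp add: twist_stalk_def)
  note q = quot_ideal[OF cring.axioms(1)[OF S.local_cring[OF Q]] Ipow_ideal[OF Q, of "k + 1"] this]
  show "carrier (TS k Q) = (\<lambda>F. Jcos k Q F) ` sqC Q" unfolding thick_stalk_def by (rule q(1))
  show "Jcos k Q F \<oplus>\<^bsub>TS k Q\<^esub> Jcos k Q G = Jcos k Q (fadd F G)"
    "F \<odot>\<^bsub>TS k Q\<^esub> Jcos k Q G = Jcos k Q (fmul F G)"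
    if "F \<in> sqC Q" "G \<in> sqC Q" for F G using q(3,4)[OF that] unfolding thick_stalk_def S.twist_ops by simp_all
  show "Jcos k Q F = Jcos k Q (cst 0)" if "F \<in> Ipow (k + 1) Q" for F using q(5)[OF that] q(2) unfolding S.twist_ops by (simp add: quot_module_def)
  show "\<exists>H\<in>Ipow (k + 1) Q. G = fadd H F" if "F \<in> sqC Q" "G \<in> Jcos k Q F" for F G using q(6)[OF that] unfolding S.twist_ops .
  show "F \<in> Jcos k Q F" if "F \<in> sqC Q" for F by (rule q(7)[OF that])
qed

text \<open>A nonzero function on the line stays nonzero when read in the second variable, so pulled
  back denominators are legitimate.\<close>

lemma pullback_frac:
  assumes "L.is_frac a b"
  shows "proj2_pullback scale (lfrac a b) = quo (\<lambda>z. a (snd z)) (\<lambda>z. b (snd z))"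
    "S.is_frac (\<lambda>z. a (snd z)) (\<lambda>z. b (snd z))"
proof -
  have nz: "(\<lambda>z. f (snd z)) \<noteq> (\<lambda>_ :: 'v \<times> 'v. 0)" if "f \<noteq> (\<lambda>_. 0)" for f :: "'v \<Rightarrow> 'f"
  proof
    assume z: "(\<lambda>z. f (snd z)) = (\<lambda>_ :: 'v \<times> 'v. 0)"
    have "f w = 0" for w using fun_cong[OF z, of "(w, w)"] by simp
    then show False using that by (simp add: fun_eq_iff)
  qed
  have fr: "S.is_frac (\<lambda>z. a (snd z)) (\<lambda>z. b (snd z))" if "L.is_frac a b" for a b
    using that nz poly1_comp_snd unfolding L.is_frac_def S.is_frac_def carriers by blast
  show "S.is_frac (\<lambda>z. a (snd z)) (\<lambda>z. b (snd z))" by (rule fr[OF assms])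
  have "quo (c \<circ> snd) (e \<circ> snd) = quo (\<lambda>z. a (snd z)) (\<lambda>z. b (snd z))" if "(c, e) \<in> lfrac a b" for c e
  proof -
    have ce: "L.is_frac c e" "\<And>x. a x * e x = c x * b x" using that unfolding L.mem_fraction L.is_frac_def by auto
    show ?thesis unfolding comp_def by (rule S.frac_eqI[OF fr[OF ce(1)] fr[OF assms]]) (simp add: ce(2))
  qed
  moreover have "lfrac a b \<noteq> {}" using L.fraction_self[of a b] assms unfolding L.is_frac_def by blast
  ultimately show "proj2_pullback scale (lfrac a b) = quo (\<lambda>z. a (snd z)) (\<lambda>z. b (snd z))"
    unfolding proj2_pullback_def by (intro SUP_eq_const) auto
qed

abbreviation "pb \<equiv> proj2_pullback scale"

lemma ln_frac: "p \<in> LP \<Longrightarrow> a \<in> deg1 m \<Longrightarrow> b \<in> deg1 n \<Longrightarrow> b \<notin> p \<Longrightarrow> L.is_frac a b"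
  unfolding L.is_frac_def using L.deg_closed L.notin_nz by blast

lemma snd_notin: "b \<in> deg1 n \<Longrightarrow> b \<notin> pr2 Q \<Longrightarrow> (\<lambda>z. b (snd z)) \<notin> Q"
  using L.deg_closed by (auto simp: proj2_iff carriers)

lemma pullback_local:
  assumes Q: "Q \<in> SP" and r: "r \<in> lnC 0 Q" shows "pb r \<in> sqC Q"
proof -
  obtain a b m n where *: "r = lfrac a b" "a \<in> deg1 m" "b \<in> deg1 n" "m - n = 0" "b \<notin> pr2 Q" by (rule L.twist_memE[OF r])
  obtain i where i: "m = int i" using deg1E[OF *(2)] by metis
  have "(\<lambda>z. a (snd z)) \<in> deg2 (int 0, int i)" "(\<lambda>z. b (snd z)) \<in> deg2 (int 0, int i)"
    using deg2_snd[of a i] deg2_snd[of b i] *(2-4) i by auto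
  then show ?thesis unfolding *(1) pullback_frac(1)[OF ln_frac[OF proj2_Proj[OF Q] *(2,3,5)]] by (rule sqO_mem) (rule snd_notin[OF *(3,5)])
qed

lemma pullback_ops:
  assumes p: "p \<in> LP" and r: "r \<in> carrier (lnO d p)" and s: "s \<in> carrier (lnO d' p)"
  shows "pb (lmul r s) = fmul (pb r) (pb s)"
    "pb (fraction_add LR r s) = fadd (pb r) (pb s)"
proof -
  obtain a b c e where *: "r = lfrac a b" "L.is_frac a b" "s = lfrac c e" "L.is_frac c e" using L.twist_frac[OF p r] L.twist_frac[OF p s] by blast
  show "pb (lmul r s) = fmul (pb r) (pb s)"
    "pb (fraction_add LR r s) = fadd (pb r) (pb s)"
    unfolding *(1,3) L.frac_mult[OF *(2,4)] L.frac_add[OF *(2,4)] pullback_frac(1)[OF *(2)] pullback_frac(1)[OF *(4)]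
      pullback_frac(1)[OF L.is_frac_mult[OF *(2,4)]] pullback_frac(1)[OF L.is_frac_add[OF *(2,4)]]
      S.frac_mult[OF pullback_frac(2)[OF *(2)] pullback_frac(2)[OF *(4)]] S.frac_add[OF pullback_frac(2)[OF *(2)] pullback_frac(2)[OF *(4)]]
    by (rule refl)+
qed

abbreviation "bcM Q \<equiv> \<lparr>carrier = sqC Q, monoid.mult = monoid.mult (sqO Q), one = \<one>\<^bsub>sqO Q\<^esub>,
    ring.zero = \<zero>\<^bsub>sqO Q\<^esub>, ring.add = ring.add (sqO Q), module.smult = (\<lambda>r s. pb r \<otimes>\<^bsub>sqO Q\<^esub> s)\<rparr>"

lemma pullback_data:
  assumes Q: "Q \<in> SP" shows "tensor_data (lnO 0 (pr2 Q)) (bcM Q) (lnO d (pr2 Q))"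
proof
  note p = proj2_Proj[OF Q]
  fix x y r assume x: "x \<in> carrier (bcM Q)"
  show "x \<oplus>\<^bsub>bcM Q\<^esub> y \<in> carrier (bcM Q)" if "y \<in> carrier (bcM Q)"
    using S.twist_closed(1)[OF Q, of x 0 y x] x that by (simp add: S.twist_ops)
  show "r \<odot>\<^bsub>bcM Q\<^esub> x \<in> carrier (bcM Q)" if "r \<in> lnC 0 Q"
    using S.twist_closed(2)[OF Q, of x 0 x "pb r"] pullback_local[OF Q that] x by (simp add: S.twist_ops)
next
  note p = proj2_Proj[OF Q]
  fix x y r assume x: "x \<in> lnC d Q"
  show "x \<oplus>\<^bsub>lnO d (pr2 Q)\<^esub> y \<in> lnC d Q" if "y \<in> lnC d Q"
    using L.twist_closed(1)[OF p x that L.const_mem[OF p]] by (simp add: L.twist_ops)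
  show "r \<odot>\<^bsub>lnO d (pr2 Q)\<^esub> x \<in> lnC d Q" if "r \<in> lnC 0 Q" using L.twist_closed(2)[OF p x x that] by (simp add: L.twist_ops)
qed

lemma bc_action:
  assumes Q: "Q \<in> SP"
  shows "\<And>g x y. g \<in> sqC Q \<Longrightarrow> x \<in> carrier (bcM Q) \<Longrightarrow> y \<in> carrier (bcM Q) \<Longrightarrow>
      g \<otimes>\<^bsub>sqO Q\<^esub> (x \<oplus>\<^bsub>bcM Q\<^esub> y) = g \<otimes>\<^bsub>sqO Q\<^esub> x \<oplus>\<^bsub>bcM Q\<^esub> g \<otimes>\<^bsub>sqO Q\<^esub> y"
    and "\<And>g x. g \<in> sqC Q \<Longrightarrow> x \<in> carrier (bcM Q) \<Longrightarrow> g \<otimes>\<^bsub>sqO Q\<^esub> x \<in> carrier (bcM Q)"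
    and "\<And>g r x. g \<in> sqC Q \<Longrightarrow> r \<in> lnC 0 Q \<Longrightarrow> x \<in> carrier (bcM Q) \<Longrightarrow>
      g \<otimes>\<^bsub>sqO Q\<^esub> (r \<odot>\<^bsub>bcM Q\<^esub> x) = r \<odot>\<^bsub>bcM Q\<^esub> (g \<otimes>\<^bsub>sqO Q\<^esub> x)"
proof -
  show "g \<otimes>\<^bsub>sqO Q\<^esub> (x \<oplus>\<^bsub>bcM Q\<^esub> y) = g \<otimes>\<^bsub>sqO Q\<^esub> x \<oplus>\<^bsub>bcM Q\<^esub> g \<otimes>\<^bsub>sqO Q\<^esub> y"
    if "g \<in> sqC Q" "x \<in> carrier (bcM Q)" "y \<in> carrier (bcM Q)" for g x y
    using S.fraction_distrib(1)[OF Q, of x 0 y g 0] that by (simp add: S.twist_ops)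
  show "g \<otimes>\<^bsub>sqO Q\<^esub> x \<in> carrier (bcM Q)" if "g \<in> sqC Q" "x \<in> carrier (bcM Q)" for g x
    using S.twist_closed(2)[OF Q, of x 0 x g] that by (simp add: S.twist_ops)
  show "g \<otimes>\<^bsub>sqO Q\<^esub> (r \<odot>\<^bsub>bcM Q\<^esub> x) = r \<odot>\<^bsub>bcM Q\<^esub> (g \<otimes>\<^bsub>sqO Q\<^esub> x)"
    if "g \<in> sqC Q" "r \<in> lnC 0 Q" "x \<in> carrier (bcM Q)" for g r x
  proof -
    have x: "x \<in> sqC Q" using that by simp
    note r = pullback_local[OF Q that(2)]
    show ?thesis
      using S.fraction_comm_assoc(2)[OF Q that(1) r x] S.fraction_comm_assoc(2)[OF Q r that(1) x] S.fraction_comm_assoc(1)[OF Q r that(1) x]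
      by (simp add: S.twist_ops)
  qed
qed

abbreviation "PB d Q \<equiv> pullback_stalk scale d Q"
abbreviation "JT k d Q \<equiv> jet_stalk scale k d Q"

lemma PB_eq: "PB d Q = presented_module (carrier (bcM Q) \<times> lnC d Q)
    (tensor_relations (lnO 0 (pr2 Q)) (bcM Q) (lnO d (pr2 Q))) (\<lambda>s (x, y). (s \<otimes>\<^bsub>sqO Q\<^esub> x, y))"
  by (simp add: pullback_stalk_def base_change_def)

lemma PB_facts:
  assumes Q: "Q \<in> SP"
  shows "\<And>h s. h \<in> sqC Q \<Longrightarrow> s \<in> lnC d Q \<Longrightarrow> pure (PB d Q) h s \<in> carrier (PB d Q)"
    and "\<And>h s r. h \<in> sqC Q \<Longrightarrow> s \<in> lnC d Q \<Longrightarrow> r \<in> lnC 0 Q \<Longrightarrow>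
      pure (PB d Q) h (lmul r s) = pure (PB d Q) (fmul (pb r) h) s"
    and "\<And>h s g. g \<in> sqC Q \<Longrightarrow> g \<odot>\<^bsub>PB d Q\<^esub> pure (PB d Q) h s = pure (PB d Q) (fmul g h) s"
    and "\<And>A B. A \<in> carrier (PB d Q) \<Longrightarrow> B \<in> carrier (PB d Q) \<Longrightarrow> A \<oplus>\<^bsub>PB d Q\<^esub> B \<in> carrier (PB d Q)"
    and "\<And>g A. g \<in> sqC Q \<Longrightarrow> A \<in> carrier (PB d Q) \<Longrightarrow> g \<odot>\<^bsub>PB d Q\<^esub> A \<in> carrier (PB d Q)"
proof -
  note td = pullback_data[OF Q, of d] and p = proj2_Proj[OF Q]
  show "pure (PB d Q) h s \<in> carrier (PB d Q)" if "h \<in> sqC Q" "s \<in> lnC d Q" for h s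
    unfolding PB_eq by (rule tensor_data.pure_mem[OF td]) (use that in simp_all)
  show "pure (PB d Q) h (lmul r s) = pure (PB d Q) (fmul (pb r) h) s"
    if "h \<in> sqC Q" "s \<in> lnC d Q" "r \<in> lnC 0 Q" for h s r
  proof -
    have e: "r \<odot>\<^bsub>bcM Q\<^esub> h = fmul (pb r) h"
      "r \<odot>\<^bsub>lnO d (pr2 Q)\<^esub> s = lmul r s" by (simp_all add: S.twist_ops L.twist_ops)
    have "pure (PB d Q) (r \<odot>\<^bsub>bcM Q\<^esub> h) s = pure (PB d Q) h (r \<odot>\<^bsub>lnO d (pr2 Q)\<^esub> s)"
      unfolding PB_eq by (rule tensor_data.pure_balanced[OF td that(3) _ that(2)]) (simp add: that(1))
    then show ?thesis unfolding e by (rule sym)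
  qed
  note a = bc_action(1)[OF Q] and b = bc_action(2)[OF Q] and c = bc_action(3)[OF Q]
  show "g \<odot>\<^bsub>PB d Q\<^esub> pure (PB d Q) h s = pure (PB d Q) (fmul g h) s" if g: "g \<in> sqC Q" for h s g
  proof -
    have e: "fmul g h = g \<otimes>\<^bsub>sqO Q\<^esub> h" by (simp add: S.twist_ops)
    show ?thesis unfolding PB_eq e by (rule tensor_data.smult_pure[OF td, of "\<lambda>s x. s \<otimes>\<^bsub>sqO Q\<^esub> x"])
        (rule a[OF g] b[OF g] c[OF g]; assumption)+
  qed
  show "A \<oplus>\<^bsub>PB d Q\<^esub> B \<in> carrier (PB d Q)" if "A \<in> carrier (PB d Q)" "B \<in> carrier (PB d Q)" for A B
    using that unfolding PB_eq
    by (rule abelian_monoid.a_closed[OF abelian_group.axioms(1)[OF presentation.presented_abelian_group[OF tensor_presentation_of[OF td]]]])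
  show "g \<odot>\<^bsub>PB d Q\<^esub> A \<in> carrier (PB d Q)" if g: "g \<in> sqC Q" and A: "A \<in> carrier (PB d Q)" for g A
    using A unfolding PB_eq by (intro tensor_data.smult_closed[OF td, of "\<lambda>s x. s \<otimes>\<^bsub>sqO Q\<^esub> x"])
      (rule a[OF g] b[OF g] c[OF g]; assumption)+
qed

lemma jet_data:
  assumes Q: "Q \<in> SP" shows "tensor_data (sqO Q) (TS k Q) (PB d Q)"
proof
  fix A B r assume A: "A \<in> carrier (TS k Q)"
  then obtain F where F: "A = Jcos k Q F" "F \<in> sqC Q" unfolding thick_stalk(1)[OF Q] by (rule imageE)
  show "A \<oplus>\<^bsub>TS k Q\<^esub> B \<in> carrier (TS k Q)" if B: "B \<in> carrier (TS k Q)"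
  proof -
    obtain G where G: "B = Jcos k Q G" "G \<in> sqC Q" using B unfolding thick_stalk(1)[OF Q] by (rule imageE)
    show ?thesis unfolding F(1) G(1) thick_stalk(2)[OF Q F(2) G(2)] thick_stalk(1)[OF Q]
      by (rule imageI) (rule S.twist_closed(1)[OF Q F(2) G(2) F(2)])
  qed
  show "r \<odot>\<^bsub>TS k Q\<^esub> A \<in> carrier (TS k Q)" if r: "r \<in> sqC Q"
    unfolding F(1) thick_stalk(3)[OF Q r F(2)] thick_stalk(1)[OF Q] by (rule imageI) (rule S.twist_closed(2)[OF Q F(2) F(2) r])
qed (rule PB_facts(4)[OF Q] PB_facts(5)[OF Q]; assumption)+

lemma JT_eq: "JT k d Q = presented_module (carrier (TS k Q) \<times> carrier (PB d Q))
   (tensor_relations (sqO Q) (TS k Q) (PB d Q)) (\<lambda>r (x, y). (r \<odot>\<^bsub>TS k Q\<^esub> x, y))"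
  by (simp add: jet_stalk_def tensor_def)

lemma JT_group: assumes "Q \<in> SP" shows "abelian_group (JT k d Q)"
  unfolding JT_eq by (rule presentation.presented_abelian_group[OF tensor_presentation_of[OF jet_data[OF assms]]])

text \<open>The power of \<open>l\<close> with an integer exponent of either sign: at most one of
  the two natural exponents is nonzero.\<close>

definition xpow :: "('v \<Rightarrow> 'f) \<Rightarrow> int \<Rightarrow> (('v \<Rightarrow> 'f) \<times> ('v \<Rightarrow> 'f)) set" where
  "xpow l d = lfrac (\<lambda>w. l w ^ nat d) (\<lambda>w. l w ^ nat (- d))"

text \<open>A form not vanishing at the second projection of \<open>Q\<close>; its powers generate
  the stalks of the twisting sheaves there.\<close>

definition good_lin :: "('v \<Rightarrow> 'f) \<Rightarrow> ('v \<times> 'v \<Rightarrow> 'f) set \<Rightarrow> bool" where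
  "good_lin l Q \<longleftrightarrow> Q \<in> SP \<and> linfun l \<and> l \<notin> pr2 Q"

lemma good_lin_power:
  assumes "good_lin l Q" shows "(\<lambda>w. l w ^ n) \<notin> pr2 Q"
proof (induction n)
  case 0
  then show ?case using L.ProjD(3)[OF proj2_Proj] assms by (simp add: good_lin_def)
next
  case (Suc n)
  have l: "l \<in> poly1" using assms poly_functions.linear by (auto simp: good_lin_def)
  show ?case using L.ProjD(6)[OF proj2_Proj, of Q l "\<lambda>w. l w ^ n"] Suc assms l poly_powers[OF l] by (simp add: good_lin_def carriers)
qed

lemma xpow_mem:
  assumes "good_lin l Q" shows "xpow l d \<in> lnC d Q"
  unfolding xpow_def
  by (rule L.twist_memI[OF deg1_linear deg1_linear]) (use assms good_lin_power[OF assms] in \<open>auto simp: good_lin_def\<close>)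

lemma xpow_frac: assumes "good_lin l Q" shows "L.is_frac (\<lambda>w. l w ^ i) (\<lambda>w. l w ^ j)"
proof -
  have l: "linfun l" "Q \<in> SP" using assms by (auto simp: good_lin_def)
  show ?thesis by (rule ln_frac[OF proj2_Proj[OF l(2)] deg1_linear[OF l(1)] deg1_linear[OF l(1)] good_lin_power[OF assms]])
qed

text \<open>A trivialization of the jet stalk. As \<open>l ^ d\<close> generates the stalk of the
  twisting sheaf, all pure tensors take this form, and the nested tensor products are replaced by
  single elements \<open>G\<close> of the local ring.\<close>

definition tau :: "nat \<Rightarrow> int \<Rightarrow> ('v \<Rightarrow> 'f) \<Rightarrow> ('v \<times> 'v \<Rightarrow> 'f) set \<Rightarrow> ('f, 'v) sqfrac \<Rightarrow> ('f, 'v) jet_germ" where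
  "tau k d l Q G = pure (JT k d Q) (Jcos k Q G) (pure (PB d Q) (cst 1) (xpow l d))"

lemma tau_base_mem:
  assumes "good_lin l Q" shows "pure (PB d Q) (cst 1) (xpow l d) \<in> carrier (PB d Q)"
proof -
  have Q: "Q \<in> SP" using assms by (simp add: good_lin_def)
  show ?thesis by (rule PB_facts(1)[OF Q S.const_mem[OF Q] xpow_mem[OF assms]])
qed

text \<open>The last claim is the trivialization proper: \<open>s\<close> is a multiple of
  \<open>l ^ d\<close> by an element of degree 0, and that element and \<open>h\<close> are moved
  across the two tensor signs to the thickened structure sheaf.\<close>

lemma tau_facts:
  assumes g: "good_lin l Q"
  shows "\<And>G. G \<in> sqC Q \<Longrightarrow> tau k d l Q G \<in> carrier (JT k d Q)"
    and "\<And>F G. F \<in> sqC Q \<Longrightarrow> G \<in> sqC Q \<Longrightarrow>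
      tau k d l Q (fadd F G) = tau k d l Q F \<oplus>\<^bsub>JT k d Q\<^esub> tau k d l Q G"
    and "\<And>F G. F \<in> sqC Q \<Longrightarrow> G \<in> sqC Q \<Longrightarrow>
      F \<odot>\<^bsub>JT k d Q\<^esub> tau k d l Q G = tau k d l Q (fmul F G)"
    and "\<And>F. F \<in> Ipow (k + 1) Q \<Longrightarrow> tau k d l Q F = \<zero>\<^bsub>JT k d Q\<^esub>"
    and "tau k d l Q (cst 0) = \<zero>\<^bsub>JT k d Q\<^esub>"
    and "\<And>f h s. f \<in> sqC Q \<Longrightarrow> h \<in> sqC Q \<Longrightarrow> s \<in> lnC d Q \<Longrightarrow>
      pure (JT k d Q) (Jcos k Q f) (pure (PB d Q) h s) =
      tau k d l Q (fmul (fmul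
        (pb (lmul s (xpow l (- d)))) h) f)"
proof -
  have Q: "Q \<in> SP" using g by (simp add: good_lin_def)
  note td = jet_data[OF Q, of k d] and bm = tau_base_mem[OF g, of d] and p = proj2_Proj[OF Q]
  let ?e = "pure (PB d Q) (cst 1) (xpow l d)"
  have Jm: "Jcos k Q F \<in> carrier (TS k Q)" if "F \<in> sqC Q" for F unfolding thick_stalk(1)[OF Q] using that by (rule imageI)
  show mem: "tau k d l Q G \<in> carrier (JT k d Q)" if "G \<in> sqC Q" for G
    unfolding tau_def JT_eq by (rule tensor_data.pure_mem[OF td Jm[OF that] bm])
  show add: "tau k d l Q (fadd F G) = tau k d l Q F \<oplus>\<^bsub>JT k d Q\<^esub> tau k d l Q G"
    if "F \<in> sqC Q" "G \<in> sqC Q" for F G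
    unfolding tau_def thick_stalk(2)[OF Q that, symmetric] unfolding JT_eq by (rule tensor_data.pure_add_left[OF td Jm Jm bm]) fact+
  show "F \<odot>\<^bsub>JT k d Q\<^esub> tau k d l Q G = tau k d l Q (fmul F G)"
    if F: "F \<in> sqC Q" and G: "G \<in> sqC Q" for F G unfolding tau_def thick_stalk(3)[OF Q F G, symmetric] unfolding JT_eq
  proof (rule tensor_data.smult_pure[OF td])
    fix A assume "A \<in> carrier (TS k Q)"
    then show "F \<odot>\<^bsub>TS k Q\<^esub> A \<in> carrier (TS k Q)" by (rule tensor_data.M_closed(2)[OF td F])
  next
    fix A B assume "A \<in> carrier (TS k Q)" "B \<in> carrier (TS k Q)"
    then obtain a b where a: "A = Jcos k Q a" "a \<in> sqC Q" and b: "B = Jcos k Q b" "b \<in> sqC Q" unfolding thick_stalk(1)[OF Q] by (elim imageE)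
    note cl = S.twist_closed(1)[OF Q a(2) b(2) F] S.twist_closed(2)[OF Q a(2) a(2) F] S.twist_closed(2)[OF Q b(2) b(2) F]
    show "F \<odot>\<^bsub>TS k Q\<^esub> (A \<oplus>\<^bsub>TS k Q\<^esub> B) =
      F \<odot>\<^bsub>TS k Q\<^esub> A \<oplus>\<^bsub>TS k Q\<^esub> F \<odot>\<^bsub>TS k Q\<^esub> B"
      unfolding a(1) b(1) thick_stalk(2)[OF Q a(2) b(2)] thick_stalk(3)[OF Q F a(2)] thick_stalk(3)[OF Q F b(2)]
        thick_stalk(3)[OF Q F cl(1)] thick_stalk(2)[OF Q cl(2,3)] S.fraction_distrib(1)[OF Q a(2) b(2) F] ..
  next
    fix r A assume r: "r \<in> sqC Q" and "A \<in> carrier (TS k Q)"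
    then obtain a where a: "A = Jcos k Q a" "a \<in> sqC Q" unfolding thick_stalk(1)[OF Q] by (elim imageE)
    have "fmul F (fmul r a) = fmul r (fmul F a)"
      using S.fraction_comm_assoc(2)[OF Q F r a(2)] S.fraction_comm_assoc(2)[OF Q r F a(2)] S.fraction_comm_assoc(1)[OF Q F r a(2)] by simp
    then show "F \<odot>\<^bsub>TS k Q\<^esub> (r \<odot>\<^bsub>TS k Q\<^esub> A) = r \<odot>\<^bsub>TS k Q\<^esub> (F \<odot>\<^bsub>TS k Q\<^esub> A)"
      unfolding a(1) thick_stalk(3)[OF Q r a(2)] thick_stalk(3)[OF Q F a(2)]
        thick_stalk(3)[OF Q F S.twist_closed(2)[OF Q a(2) a(2) r]] thick_stalk(3)[OF Q r S.twist_closed(2)[OF Q a(2) a(2) F]] by simp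
  qed
  show z: "tau k d l Q (cst 0) = \<zero>\<^bsub>JT k d Q\<^esub>"
  proof -
    let ?z = "tau k d l Q (cst 0)"
    note c0 = S.const_mem[OF Q, of 0]
    \<comment> \<open>Additivity gives \<open>z + z = z\<close>, which forces \<open>z\<close> to be
      zero in a group.\<close>
    have "?z \<oplus>\<^bsub>JT k d Q\<^esub> ?z = ?z" using add[OF c0 c0] S.twist_abelian_group_axioms(3)[OF Q c0 c0 c0] by simp
    then show ?thesis using abelian_group.r_neg1[OF JT_group[OF Q] mem[OF c0] mem[OF c0]]
      abelian_group.l_neg[OF JT_group[OF Q, of k d] mem[OF c0]] by simp
  qed
  show "tau k d l Q F = \<zero>\<^bsub>JT k d Q\<^esub>" if "F \<in> Ipow (k + 1) Q" for F using z unfolding tau_def thick_stalk(4)[OF Q that] .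
  show "pure (JT k d Q) (Jcos k Q f) (pure (PB d Q) h s) =
      tau k d l Q (fmul (fmul (pb (lmul s (xpow l (- d)))) h) f)"
    if f: "f \<in> sqC Q" and h: "h \<in> sqC Q" and s: "s \<in> lnC d Q" for f h s
  proof -
    \<comment> \<open>The coordinate of \<open>s\<close> with respect to the generator
      \<open>l ^ d\<close>.\<close>
    let ?r = "lmul s (xpow l (- d))"
    obtain a b m n where ab: "s = lfrac a b" "a \<in> deg1 m" "b \<in> deg1 n" "m - n = d" "b \<notin> pr2 Q" by (rule L.twist_memE[OF s])
    have ll: "linfun l" using g by (simp add: good_lin_def)
    note sf = ln_frac[OF p ab(2,3,5)] and lp = good_lin_power[OF g]
    have r: "?r \<in> lnC 0 Q" unfolding ab(1) xpow_def L.frac_mult[OF sf xpow_frac[OF g]]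
    proof (rule L.twist_memI[OF L.deg_mult[OF ab(2) deg1_linear[OF ll]] L.deg_mult[OF ab(3) deg1_linear[OF ll]]])
      show "(\<lambda>x. b x * l x ^ nat (- (- d))) \<notin> pr2 Q"
        by (rule L.ProjD(6)[OF p L.deg_closed[OF ab(3)] L.deg_closed[OF deg1_linear[OF ll]] ab(5) lp])
      show "m + int (nat (- d)) - (n + int (nat (- (- d)))) = 0" using ab(4) by simp
    qed
    have sr: "s = lmul ?r (xpow l d)"
      unfolding ab(1) xpow_def L.frac_mult[OF sf xpow_frac[OF g]] L.frac_mult[OF L.is_frac_mult[OF sf xpow_frac[OF g]] xpow_frac[OF g]]
      by (rule L.frac_eqI[OF sf L.is_frac_mult[OF L.is_frac_mult[OF sf xpow_frac[OF g]] xpow_frac[OF g]]]) (simp add: mult_ac)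
    let ?g = "fmul (pb ?r) h"
    have gm: "?g \<in> sqC Q" by (rule S.twist_closed(2)[OF Q h h pullback_local[OF Q r]])
    have "pure (PB d Q) h s = pure (PB d Q) ?g (xpow l d)" by (subst sr) (rule PB_facts(2)[OF Q h xpow_mem[OF g] r])
    also have "\<dots> = ?g \<odot>\<^bsub>PB d Q\<^esub> ?e"
      unfolding PB_facts(3)[OF Q gm] using S.fraction_one_mult[OF Q gm] S.fraction_comm_assoc(1)[OF Q gm S.const_mem[OF Q] gm, of 1] by simp
    finally have "pure (JT k d Q) (Jcos k Q f) (pure (PB d Q) h s) = pure (JT k d Q) (?g \<odot>\<^bsub>TS k Q\<^esub> Jcos k Q f) ?e"
      unfolding JT_eq using tensor_data.pure_balanced[OF td gm Jm[OF f] bm, symmetric] by simp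
    then show ?thesis unfolding tau_def thick_stalk(3)[OF Q gm f] .
  qed
qed

end

section \<open>Sections of the sheaf of jets\<close>

lemma (in fun_graded) twist_sections_mem:
  "s \<in> twist_sections R d U \<Longrightarrow> p \<in> U \<Longrightarrow> s p \<in> carrier (twist_stalk R d p)"
  unfolding twist_sections_def nbhd_def by (fastforce intro: twist_memI)

lemma (in presentation) class_lift_add:
  assumes "\<And>e. e \<in> E \<Longrightarrow> zlift f e = 0"
    and "A \<in> carrier (presented_module S E act)" "B \<in> carrier (presented_module S E act)"
  shows "class_lift f (A \<oplus>\<^bsub>presented_module S E act\<^esub> B) = class_lift f A + class_lift f B"
proof -
  obtain c d where c: "A = rel_class S E c" "B = rel_class S E d" using assms(2,3) by (auto simp: presented_carrier)
  have "class_lift f (rel_class S E c) = zlift f c" for c by (rule class_lift_class) (rule assms(1))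
  then show ?thesis unfolding c presented_add by simp
qed

lemma (in tensor_data) class_lift_smult:
  assumes kill: "\<And>e. e \<in> rels \<Longrightarrow> zlift f e = 0"
    and act: "\<And>x y. x \<in> carrier M \<Longrightarrow> y \<in> carrier M \<Longrightarrow> act s (x \<oplus>\<^bsub>M\<^esub> y) = act s x \<oplus>\<^bsub>M\<^esub> act s y"
      "\<And>x. x \<in> carrier M \<Longrightarrow> act s x \<in> carrier M"
      "\<And>r x. r \<in> carrier R \<Longrightarrow> x \<in> carrier M \<Longrightarrow> act s (r \<odot>\<^bsub>M\<^esub> x) = r \<odot>\<^bsub>M\<^esub> act s x"
    and f: "\<And>x y. x \<in> carrier M \<Longrightarrow> y \<in> carrier N \<Longrightarrow> f (act s x, y) = w * f (x, y)"
    and A: "A \<in> carrier (act_module act)"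
  shows "class_lift f (s \<odot>\<^bsub>act_module act\<^esub> A) = w * class_lift f A"
proof -
  obtain c where c: "A = rel_class gens rels c" "supp c \<subseteq> gens" using A by (auto simp: presented_carrier)
  have sm: "s \<odot>\<^bsub>act_module act\<^esub> rel_class gens rels c =
      rel_class gens rels (gen_map (\<lambda>(x, y). (act s x, y)) c)" by (rule presented_smult) (rule smult_rel, use act in auto)
  have cl: "class_lift f (rel_class gens rels c) = zlift f c" for c by (rule class_lift_class) (rule kill)
  have "zlift f (gen_map (\<lambda>(x, y). (act s x, y)) c) = w * zlift f c"
    by (rule frag_induction[OF c(2)]) (auto simp: frag_extend_diff f right_diff_distrib)
  then show ?thesis unfolding c(1) sm cl .
qed

context plane begin

lemma ln_unit:
  assumes s: "s \<in> carrier (lnO d (pr2 base_pt))"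
  shows "\<exists>a b. pb s = quo a b \<and> unit_den a b"
proof -
  obtain a b m n where ab: "s = lfrac a b" "a \<in> deg1 m" "b \<in> deg1 n" "m - n = d" "b \<notin> pr2 base_pt" by (rule L.twist_memE[OF s])
  have "b u \<noteq> 0" using pt_iff[OF ab(3)] ab(5) unfolding line_point_eq by simp
  moreover have "a \<in> poly1" "b \<in> poly1" using ab(2,3) L.deg_closed unfolding carriers by blast+
  ultimately show ?thesis unfolding ab(1) pullback_frac(1)[OF ln_frac[OF pt_Proj[unfolded line_point_eq] ab(2,3,5)]] unit_den_def
    using poly1_comp_snd by (intro exI conjI) (rule refl, auto)
qed

text \<open>Sections of a twisting sheaf are not functions; expanding their homogeneous fractions
  evaluates them at the vector \<open>u\<close>, that is, uses \<open>u\<close> as a basis of the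
  line. This choice is the origin of the character \<open>jet_char d\<close>.\<close>

definition pull_series :: "((('f, 'v) sqfrac \<times> (('v \<Rightarrow> 'f) \<times> ('v \<Rightarrow> 'f)) set) \<Rightarrow>\<^sub>0 int) set \<Rightarrow> 'f fps" where
  "pull_series = class_lift (\<lambda>(h, s). germ_series h * germ_series (pb s))"

lemma pull_series:
  shows "\<And>h s. pull_series (pure (PB d base_pt) h s) = germ_series h * germ_series (pb s)"
    and "\<And>A B. A \<in> carrier (PB d base_pt) \<Longrightarrow> B \<in> carrier (PB d base_pt) \<Longrightarrow>
      pull_series (A \<oplus>\<^bsub>PB d base_pt\<^esub> B) = pull_series A + pull_series B"
    and "\<And>g A. g \<in> sqC base_pt \<Longrightarrow> A \<in> carrier (PB d base_pt) \<Longrightarrow>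
      pull_series (g \<odot>\<^bsub>PB d base_pt\<^esub> A) = germ_series g * pull_series A"
proof -
  note Q = base_pt_Proj and p = proj2_Proj[OF base_pt_Proj]
  note td = pullback_data[OF Q, of d] and tp = tensor_presentation_of[OF pullback_data[OF Q, of d]]
  let ?f = "\<lambda>(h, s). germ_series h * germ_series (pb s)"
  have kill: "zlift ?f e = 0" if "e \<in> tensor_relations (lnO 0 (pr2 base_pt)) (bcM base_pt) (lnO d (pr2 base_pt))" for e
  proof (rule tensor_val_kill[OF that, where \<rho> = "\<lambda>r. germ_series (pb r)"])
    fix x y assume "x \<in> carrier (bcM base_pt)" "y \<in> carrier (bcM base_pt)"
    then show "germ_series (x \<oplus>\<^bsub>bcM base_pt\<^esub> y) = germ_series x + germ_series y" by (simp add: S.twist_ops germ_series_ops)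
  next
    fix r x assume "r \<in> carrier (lnO 0 (pr2 base_pt))" "x \<in> carrier (bcM base_pt)"
    then show "germ_series (r \<odot>\<^bsub>bcM base_pt\<^esub> x) = germ_series (pb r) * germ_series x"
      using pullback_local[OF Q] by (simp add: S.twist_ops germ_series_ops)
  next
    fix x y assume x: "x \<in> carrier (lnO d (pr2 base_pt))" and y: "y \<in> carrier (lnO d (pr2 base_pt))"
    show "germ_series (pb (x \<oplus>\<^bsub>lnO d (pr2 base_pt)\<^esub> y)) = germ_series (pb x) + germ_series (pb y)"
      unfolding L.twist_ops pullback_ops(2)[OF p x y] using ln_unit[OF x] ln_unit[OF y] germ_series_unit_ops(1) by blast
  next
    fix r x assume r: "r \<in> carrier (lnO 0 (pr2 base_pt))" and x: "x \<in> carrier (lnO d (pr2 base_pt))"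
    show "germ_series (pb (r \<odot>\<^bsub>lnO d (pr2 base_pt)\<^esub> x)) = germ_series (pb r) * germ_series (pb x)"
      unfolding L.twist_ops pullback_ops(1)[OF p r x] using ln_unit[OF r] ln_unit[OF x] germ_series_unit_ops(2) by blast
  qed
  show "pull_series (pure (PB d base_pt) h s) = germ_series h * germ_series (pb s)" for h s
    unfolding pull_series_def PB_eq tensor_data.pure_class[OF td] by (subst presentation.class_lift_class[OF tp kill]) simp_all
  show "pull_series (A \<oplus>\<^bsub>PB d base_pt\<^esub> B) = pull_series A + pull_series B"
    if "A \<in> carrier (PB d base_pt)" "B \<in> carrier (PB d base_pt)" for A B
    unfolding pull_series_def PB_eq by (rule presentation.class_lift_add[OF tp kill that[unfolded PB_eq]])
  show "pull_series (g \<odot>\<^bsub>PB d base_pt\<^esub> A) = germ_series g * pull_series A"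
    if g: "g \<in> sqC base_pt" and A: "A \<in> carrier (PB d base_pt)" for g A unfolding pull_series_def PB_eq
  proof (rule tensor_data.class_lift_smult[OF td kill _ _ _ _ A[unfolded PB_eq]])
    fix x y assume x: "x \<in> carrier (bcM base_pt)"
    then have x': "x \<in> sqC base_pt" by simp
    show "g \<otimes>\<^bsub>sqO base_pt\<^esub> x \<in> carrier (bcM base_pt)" using S.twist_closed(2)[OF Q x' x' g] by (simp add: S.twist_ops)
    show "g \<otimes>\<^bsub>sqO base_pt\<^esub> (x \<oplus>\<^bsub>bcM base_pt\<^esub> y) = g \<otimes>\<^bsub>sqO base_pt\<^esub> x \<oplus>\<^bsub>bcM base_pt\<^esub> g \<otimes>\<^bsub>sqO base_pt\<^esub> y"
      if "y \<in> carrier (bcM base_pt)" using S.fraction_distrib(1)[OF Q x' _ g, of y] that by (simp add: S.twist_ops)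
    show "g \<otimes>\<^bsub>sqO base_pt\<^esub> (r \<odot>\<^bsub>bcM base_pt\<^esub> x) = r \<odot>\<^bsub>bcM base_pt\<^esub> (g \<otimes>\<^bsub>sqO base_pt\<^esub> x)"
      if "r \<in> carrier (lnO 0 (pr2 base_pt))" for r
      using S.fraction_comm_assoc(2)[OF Q g pullback_local[OF Q that] x'] S.fraction_comm_assoc(2)[OF Q pullback_local[OF Q that] g x']
        S.fraction_comm_assoc(1)[OF Q pullback_local[OF Q that] g x'] by (simp add: S.twist_ops)
    show "(case (g \<otimes>\<^bsub>sqO base_pt\<^esub> x, y) of (h, s) \<Rightarrow> germ_series h * germ_series (pb s)) =
      germ_series g * (case (x, y) of (h, s) \<Rightarrow> germ_series h * germ_series (pb s))" for y :: "(('v \<Rightarrow> 'f) \<times> ('v \<Rightarrow> 'f)) set"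
      using germ_series_ops(2)[OF g x'] by (simp add: S.twist_ops mult.assoc)
  qed assumption
qed

lemma cutoff_mult [simp]: "fps_cutoff n (fps_cutoff n f * g) = fps_cutoff n (f * g)" "fps_cutoff n (f * fps_cutoff n g) = fps_cutoff n (f * g)"
  for f g :: "'f fps"
  by (rule fps_ext, simp add: fps_cutoff_left_mult_nth fps_cutoff_right_mult_nth)+

text \<open>The order of truncation makes the choice of a representative immaterial: elements of the
  ideal power expand into multiples of \<open>fps_X ^ (k + 1)\<close>.\<close>

definition thick_series :: "nat \<Rightarrow> ('f, 'v) sqfrac set \<Rightarrow> 'f fps" where
  "thick_series k A = fps_cutoff (k + 1) (germ_series (SOME F. F \<in> A))"

lemma thick_series:
  assumes F: "F \<in> sqC base_pt"
  shows "thick_series k (Jcos k base_pt F) = fps_cutoff (k + 1) (germ_series F)"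
proof -
  have "(SOME G. G \<in> Jcos k base_pt F) \<in> Jcos k base_pt F" by (rule someI) (rule thick_stalk(6)[OF base_pt_Proj F])
  from thick_stalk(5)[OF base_pt_Proj F this] obtain H where
    H: "H \<in> Ipow (k + 1) base_pt" "(SOME G. G \<in> Jcos k base_pt F) = fadd H F" by blast
  have Hm: "H \<in> sqC base_pt" using germ_series_Ipow[OF H(1)] by blast
  then show ?thesis unfolding thick_series_def H(2) germ_series_ops(1)[OF Hm F] fps_cutoff_add germ_series_Ipow_cutoff[OF H(1)] by simp
qed

text \<open>The Taylor polynomial of a jet germ at \<open>(e, e)\<close>. Truncating once more after
  multiplication makes the value balanced over the local ring, whose elements act by full
  series.\<close>

definition theta :: "nat \<Rightarrow> ('f, 'v) jet_germ \<Rightarrow> 'f fps" where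
  "theta k = class_lift (\<lambda>(A, B). fps_cutoff (k + 1) (thick_series k A * pull_series B))"

text \<open>The constant in the second claim is the value of \<open>l ^ d\<close> at
  \<open>u\<close>. It is 1 for \<open>l = xc\<close>; for a form moved by \<open>g\<close> it
  produces the character.\<close>

lemma theta:
  shows "\<And>A B. A \<in> carrier (JT k d base_pt) \<Longrightarrow> B \<in> carrier (JT k d base_pt) \<Longrightarrow>
      theta k (A \<oplus>\<^bsub>JT k d base_pt\<^esub> B) = theta k A + theta k B"
    and "\<And>l G. good_lin l base_pt \<Longrightarrow> G \<in> sqC base_pt \<Longrightarrow>
      theta k (tau k d l base_pt G) = fps_cutoff (k + 1) (germ_series G * fps_const (l u ^ nat d * inverse (l u ^ nat (- d))))"
proof -
  note Q = base_pt_Proj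
  note td = jet_data[OF Q, of k d] and tp = tensor_presentation_of[OF jet_data[OF Q, of k d]]
  let ?f = "\<lambda>(A, B). fps_cutoff (k + 1) (thick_series k A * pull_series B)"
  have ex: "\<exists>F. A = Jcos k base_pt F \<and> F \<in> sqC base_pt" if "A \<in> carrier (TS k base_pt)" for A
    using that unfolding thick_stalk(1)[OF Q] by blast
  have kill: "zlift ?f e = 0" if "e \<in> tensor_relations (sqO base_pt) (TS k base_pt) (PB d base_pt)" for e using that
  proof (cases rule: tensor_relations_cases)
    case (left A A' B)
    obtain F F' where F: "A = Jcos k base_pt F" "F \<in> sqC base_pt" "A' = Jcos k base_pt F'" "F' \<in> sqC base_pt"
      using ex[OF left(1)] ex[OF left(2)] by blast
    have "thick_series k (A \<oplus>\<^bsub>TS k base_pt\<^esub> A') = thick_series k A + thick_series k A'"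
      unfolding F(1,3) thick_stalk(2)[OF Q F(2,4)] thick_series[OF S.twist_closed(1)[OF Q F(2,4,2)]] thick_series[OF F(2)]
        thick_series[OF F(4)] germ_series_ops(1)[OF F(2,4)] fps_cutoff_add ..
    then show ?thesis by (simp add: left(4) distrib_right fps_cutoff_add)
  next
    case (right A B B')
    then show ?thesis by (simp add: pull_series(2) distrib_left fps_cutoff_add)
  next
    case (bal r A B)
    obtain F where F: "A = Jcos k base_pt F" "F \<in> sqC base_pt" using ex[OF bal(2)] by blast
    have "thick_series k (r \<odot>\<^bsub>TS k base_pt\<^esub> A) = fps_cutoff (k + 1) (germ_series r * thick_series k A)"
      unfolding F(1) thick_stalk(3)[OF Q bal(1) F(2)] thick_series[OF S.twist_closed(2)[OF Q F(2,2) bal(1)]] thick_series[OF F(2)]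
        germ_series_ops(2)[OF bal(1) F(2)] by simp
    then show ?thesis using bal by (simp add: pull_series(3) mult_ac)
  qed
  show "theta k (A \<oplus>\<^bsub>JT k d base_pt\<^esub> B) = theta k A + theta k B"
    if "A \<in> carrier (JT k d base_pt)" "B \<in> carrier (JT k d base_pt)" for A B
    unfolding theta_def JT_eq by (rule presentation.class_lift_add[OF tp kill that[unfolded JT_eq]])
  show "theta k (tau k d l base_pt G) = fps_cutoff (k + 1) (germ_series G * fps_const (l u ^ nat d * inverse (l u ^ nat (- d))))"
    if l: "good_lin l base_pt" and G: "G \<in> sqC base_pt" for l G
  proof -
    have ll: "linfun l" and lp: "l \<in> poly1" using l poly_functions.linear by (auto simp: good_lin_def)
    have lu: "l u \<noteq> 0" using l pt_iff[of l 1] deg1_linear[OF ll, of 1] unfolding good_lin_def line_point_eq by auto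
    have pp: "(\<lambda>z. l (snd z) ^ i) \<in> poly2" for i by (rule poly1_comp_snd[OF poly_powers[OF lp]])
    have "germ_series (pb (xpow l d)) = expand (\<lambda>z. l (snd z) ^ nat d) * inverse (expand (\<lambda>z. l (snd z) ^ nat (- d)))"
      unfolding xpow_def pullback_frac(1)[OF xpow_frac[OF l]] by (rule germ_series_quo[OF pp pp]) (simp add: lu)
    also have "\<dots> = fps_const (l u ^ nat d * inverse (l u ^ nat (- d)))" using expand_snd[OF poly_powers[OF lp]] by (simp add: fps_const_inverse)
    finally have xp: "germ_series (pb (xpow l d)) = \<dots>" .
    show ?thesis unfolding theta_def tau_def JT_eq tensor_data.pure_class[OF td] by (subst presentation.class_lift_class[OF tp kill])
        (simp_all add: thick_series[OF G, simplified] pull_series(1) xp germ_series_const)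
  qed
qed

section \<open>The local form of sections of the jets\<close>

definition locfrac :: "('v \<times> 'v \<Rightarrow> 'f) set set \<Rightarrow> (('v \<times> 'v \<Rightarrow> 'f) set \<Rightarrow> ('f, 'v) sqfrac) \<Rightarrow> bool" where
  "locfrac W F \<longleftrightarrow> W \<subseteq> SP \<and> (\<exists>a b m. a \<in> deg2 m \<and> b \<in> deg2 m \<and> (\<forall>Q\<in>W. b \<notin> Q \<and> F Q = quo a b))"

lemma locfracI: "W \<subseteq> SP \<Longrightarrow> a \<in> deg2 m \<Longrightarrow> b \<in> deg2 m \<Longrightarrow> (\<And>Q. Q \<in> W \<Longrightarrow> b \<notin> Q) \<Longrightarrow>
    (\<And>Q. Q \<in> W \<Longrightarrow> F Q = quo a b) \<Longrightarrow> locfrac W F"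
  unfolding locfrac_def by (intro conjI exI[of _ a] exI[of _ b] exI[of _ m] ballI)

lemma locfracE:
  assumes "locfrac W F"
  obtains a m b where "W \<subseteq> SP" "a \<in> deg2 m" "b \<in> deg2 m" "\<And>Q. Q \<in> W \<Longrightarrow> b \<notin> Q" "\<And>Q. Q \<in> W \<Longrightarrow> F Q = quo a b"
proof -
  obtain a b m where "W \<subseteq> SP" "a \<in> deg2 m" "b \<in> deg2 m" and *: "\<forall>Q\<in>W. b \<notin> Q \<and> F Q = quo a b"
    using assms unfolding locfrac_def by (elim conjE exE)
  then show ?thesis using that by simp
qed

lemma locfrac_sub: assumes "locfrac W F" "W' \<subseteq> W" shows "locfrac W' F"
proof -
  obtain a b m where "W \<subseteq> SP" "a \<in> deg2 m" "b \<in> deg2 m" "\<And>Q. Q \<in> W \<Longrightarrow> b \<notin> Q" "\<And>Q. Q \<in> W \<Longrightarrow> F Q = quo a b"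
    using assms(1) by (rule locfracE) (rule that)
  then show ?thesis using assms(2) by (intro locfracI[of W' a m b]) auto
qed

lemma locfrac_mem: "locfrac W F \<Longrightarrow> Q \<in> W \<Longrightarrow> F Q \<in> sqC Q"
  by (erule locfracE) (simp add: sqO_mem)

lemma locfrac_ops:
  assumes "locfrac W F" "locfrac W G"
  shows "locfrac W (\<lambda>Q. fmul (F Q) (G Q))" "locfrac W (\<lambda>Q. fadd (F Q) (G Q))"
proof -
  obtain a b m where a: "W \<subseteq> SP" "a \<in> deg2 m" "b \<in> deg2 m" "\<And>Q. Q \<in> W \<Longrightarrow> b \<notin> Q" "\<And>Q. Q \<in> W \<Longrightarrow> F Q = quo a b"
    using assms(1) by (rule locfracE) (rule that)
  obtain c e n where c: "W \<subseteq> SP" "c \<in> deg2 n" "e \<in> deg2 n" "\<And>Q. Q \<in> W \<Longrightarrow> e \<notin> Q" "\<And>Q. Q \<in> W \<Longrightarrow> G Q = quo c e"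
    using assms(2) by (rule locfracE) (rule that)
  note * = a c(2-5)
  have nb: "(\<lambda>x. b x * e x) \<notin> Q" if "Q \<in> W" for Q
    using sq_notin_mult[OF subsetD[OF *(1) that] *(3,7) *(4)[OF that] *(8)[OF that]] .
  have fr: "S.is_frac a b" "S.is_frac c e" if "Q \<in> W" for Q
    using sq_frac[OF subsetD[OF *(1) that] *(2,3) *(4)[OF that]] sq_frac[OF subsetD[OF *(1) that] *(6,7) *(8)[OF that]] .
  show "locfrac W (\<lambda>Q. fmul (F Q) (G Q))"
    by (rule locfracI[OF *(1) S.deg_mult[OF *(2,6)] S.deg_mult[OF *(3,7)] nb]) (simp_all add: *(5,9) S.frac_mult[OF fr])
  have "(\<lambda>x. a x * e x + c x * b x) \<in> deg2 (m + n)"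
    using S.deg_mult[OF *(2,7)] S.deg_mult[OF *(6,3)] by (intro S.deg_add) (simp_all add: add.commute)
  then show "locfrac W (\<lambda>Q. fadd (F Q) (G Q))" by (rule locfracI[OF *(1) _ S.deg_mult[OF *(3,7)] nb]) (simp_all add: *(5,9) S.frac_add[OF fr])
qed

lemma locfrac_const: "W \<subseteq> SP \<Longrightarrow> locfrac W (\<lambda>Q. cst c)"
  by (rule locfracI[of W "\<lambda>_. c" 0 "\<lambda>_. 1"]) (auto intro: S.deg_const dest: S.ProjD(3))

lemma open_sub: "zariski_open SR W \<Longrightarrow> W \<subseteq> SP"
  by (auto simp: zariski_open_def)

lemma section_locfrac:
  assumes "f \<in> twist_sections SR 0 W" "P \<in> W"
  shows "\<exists>V. nbhd SR P V \<and> V \<subseteq> W \<and> locfrac V f"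
proof -
  obtain V a b m n where *: "nbhd SR P V" "V \<subseteq> W" "a \<in> deg2 m" "b \<in> deg2 n" "m - n = 0"
    "\<forall>r\<in>V. b \<notin> r \<and> f r = quo a b" using assms unfolding twist_sections_def by blast
  have "m = n" using *(5) by simp
  moreover have "V \<subseteq> SP" using *(1) open_sub unfolding nbhd_def by blast
  ultimately have "locfrac V f" using *(3,4,6) by (intro locfracI[of V a m b]) auto
  then show ?thesis using * by blast
qed

lemma section_line_locfrac:
  assumes s: "s \<in> twist_sections LR d U" and P: "P \<in> Zp U" and l: "good_lin l P"
  shows "\<exists>V. nbhd SR P V \<and> locfrac V (\<lambda>Q. pb (lmul (s (pr2 Q)) (xpow l (- d))))"
proof -
  have "pr2 P \<in> U" using P by (simp add: preimage_iff)
  then obtain V a b m n where *: "nbhd LR (pr2 P) V" "V \<subseteq> U" "a \<in> deg1 m" "b \<in> deg1 n" "m - n = d"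
    "\<forall>r\<in>V. b \<notin> r \<and> s r = lfrac a b" using s unfolding twist_sections_def by blast
  obtain i j where ij: "m = int i" "n = int j" using deg1E[OF *(3)] deg1E[OF *(4)] by metis
  have ll: "linfun l" and PS: "P \<in> SP" using l by (auto simp: good_lin_def)
  have l1: "l \<in> deg1 (int 1)" using deg1_linear[OF ll, of 1] by simp
  let ?V = "Zp V \<inter> {Q \<in> SP. (\<lambda>z. l (snd z)) \<notin> Q}"
  have gl: "good_lin l Q" if "Q \<in> ?V" for Q using that ll poly_functions.linear[OF ll] by (auto simp: good_lin_def proj2_iff)
  have op: "nbhd SR P ?V" using S.zariski_open_Int[OF preimage_open S.zariski_open_basic[OF deg2_snd[OF l1]], of V] *(1) PS l
      poly_functions.linear[OF ll] by (auto simp: nbhd_def preimage_iff good_lin_def proj2_iff)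
  let ?n = "nat (- d)" and ?m = "nat (- (- d))"
  let ?c = "\<lambda>z :: 'v \<times> 'v. a (snd z) * l (snd z) ^ ?n" and ?e = "\<lambda>z :: 'v \<times> 'v. b (snd z) * l (snd z) ^ ?m"
  have cd: "?c \<in> deg2 (int 0, int (i + ?n))" "?e \<in> deg2 (int 0, int (j + ?m))"
    using deg2_snd[OF L.deg_mult[OF *(3)[unfolded ij] deg1_linear[OF ll, of ?n], folded of_nat_add]]
      deg2_snd[OF L.deg_mult[OF *(4)[unfolded ij] deg1_linear[OF ll, of ?m], folded of_nat_add]] by simp_all
  have "int (i + ?n) = int (j + ?m)" using *(5) ij by simp
  moreover have "?e \<notin> Q \<and> pb (lmul (s (pr2 Q)) (xpow l (- d))) = quo ?c ?e" if Q: "Q \<in> ?V" for Q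
  proof
    have QS: "Q \<in> SP" and b: "b \<notin> pr2 Q" "s (pr2 Q) = lfrac a b" using Q *(6) by (auto simp: preimage_iff)
    note p = proj2_Proj[OF QS]
    note sf = ln_frac[OF p *(3,4) b(1)] and xf = xpow_frac[OF gl[OF Q]]
    have "(\<lambda>w. b w * l w ^ ?m) \<notin> pr2 Q"
      by (rule L.ProjD(6)[OF p L.deg_closed[OF *(4)] L.deg_closed[OF deg1_linear[OF ll]] b(1) good_lin_power[OF gl[OF Q]]])
    from snd_notin[OF L.deg_mult[OF *(4) deg1_linear[OF ll]] this] show "?e \<notin> Q" .
    show "pb (lmul (s (pr2 Q)) (xpow l (- d))) = quo ?c ?e"
      unfolding b(2) xpow_def L.frac_mult[OF sf xf] pullback_frac(1)[OF L.is_frac_mult[OF sf xf]] ..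
  qed
  ultimately have "locfrac ?V (\<lambda>Q. pb (lmul (s (pr2 Q)) (xpow l (- d))))"
    using cd by (intro locfracI[of ?V ?c "(int 0, int (i + ?n))" ?e]) (auto simp del: of_nat_add simp: preimage_iff)
  then show ?thesis using op by blast
qed

text \<open>Near \<open>P\<close> the section is the class of one fraction times one power of
  \<open>l\<close>. Sums of tensors do not occur in this description, and it characterizes
  sections.\<close>

definition loc_tau :: "nat \<Rightarrow> int \<Rightarrow> ('v \<times> 'v \<Rightarrow> 'f) set set \<Rightarrow> (('v \<times> 'v \<Rightarrow> 'f) set \<Rightarrow> ('f, 'v) jet_germ) \<Rightarrow> ('v \<Rightarrow> 'f) \<Rightarrow> ('v \<times> 'v \<Rightarrow> 'f) set \<Rightarrow> bool" where
  "loc_tau k d Z \<sigma> l P \<longleftrightarrow> (\<exists>W F. nbhd SR P W \<and> W \<subseteq> Z \<and> locfrac W F \<and>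
     (\<forall>Q\<in>W. good_lin l Q \<and> \<sigma> Q = tau k d l Q (F Q)))"

lemma good_lin_open:
  assumes l: "good_lin l P" shows "\<exists>W. nbhd SR P W \<and> (\<forall>Q\<in>W. good_lin l Q)"
proof -
  have ll: "linfun l" and PS: "P \<in> SP" using l by (auto simp: good_lin_def)
  have l1: "l \<in> deg1 (int 1)" using deg1_linear[OF ll, of 1] by simp
  show ?thesis using S.zariski_open_basic[OF deg2_snd[OF l1]] l ll poly_functions.linear[OF ll]
    by (intro exI[of _ "{Q \<in> SP. (\<lambda>z. l (snd z)) \<notin> Q}"]) (auto simp: nbhd_def good_lin_def proj2_iff)
qed

text \<open>Each pure tensor becomes a \<open>tau\<close> of one local fraction, and a sum of such
  is the \<open>tau\<close> of the sum; only finitely many neighbourhoods have to be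
  intersected.\<close>

lemma sections_loc_tau:
  assumes \<sigma>: "\<sigma> \<in> jet_sections scale k d Z" and P: "P \<in> Z" and l: "good_lin l P"
  shows "loc_tau k d Z \<sigma> l P"
proof -
  obtain W U n f h s where sec: "nbhd SR P W" "W \<subseteq> Z" "W \<subseteq> Zp U"
    "\<And>i. i < n \<Longrightarrow> f i \<in> twist_sections SR 0 W"
    "\<And>i. i < n \<Longrightarrow> h i \<in> twist_sections SR 0 W"
    "\<And>i. i < n \<Longrightarrow> s i \<in> twist_sections LR d U"
    and \<sigma>W: "\<And>Q. Q \<in> W \<Longrightarrow> \<sigma> Q = (\<Oplus>\<^bsub>JT k d Q\<^esub>i\<in>{..<n::nat}. pure (JT k d Q) (Jcos k Q (f i Q)) (pure (PB d Q) (h i Q) (s i (pr2 Q))))"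
  proof -
    have "\<exists>W U (n::nat) f h s. nbhd SR P W \<and> W \<subseteq> Z \<and> zariski_open LR U \<and> W \<subseteq> Zp U \<and>
        (\<forall>i<n. f i \<in> twist_sections SR 0 W \<and> h i \<in> twist_sections SR 0 W \<and> s i \<in> twist_sections LR d U) \<and>
        (\<forall>Q\<in>W. \<sigma> Q = (\<Oplus>\<^bsub>JT k d Q\<^esub>i\<in>{..<n}. pure (JT k d Q) (Jcos k Q (f i Q)) (pure (PB d Q) (h i Q) (s i (pr2 Q)))))"
      using \<sigma> P unfolding jet_sections_def by simp
    then obtain W U n f h s where "nbhd SR P W" "W \<subseteq> Z" "zariski_open LR U" "W \<subseteq> Zp U"
      "\<forall>i<n. f i \<in> twist_sections SR 0 W \<and> h i \<in> twist_sections SR 0 W \<and> s i \<in> twist_sections LR d U"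
      "\<forall>Q\<in>W. \<sigma> Q = (\<Oplus>\<^bsub>JT k d Q\<^esub>i\<in>{..<n::nat}. pure (JT k d Q) (Jcos k Q (f i Q)) (pure (PB d Q) (h i Q) (s i (pr2 Q))))"
      by (elim exE conjE)
    then show ?thesis using that[of W U n f h s] by simp
  qed
  note * = sec
  have PW: "P \<in> W" using *(1) by (simp add: nbhd_def)
  let ?t = "\<lambda>Q i. pure (JT k d Q) (Jcos k Q (f i Q)) (pure (PB d Q) (h i Q) (s i (pr2 Q)))"
  obtain Wl where Wl: "nbhd SR P Wl" "\<And>Q. Q \<in> Wl \<Longrightarrow> good_lin l Q" using good_lin_open[OF l] by blast
  \<comment> \<open>Induction on the number \<open>j\<close> of summands treated, shrinking the
    neighbourhood at each step; the empty sum is the class of the fraction 0.\<close>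
  have "\<exists>V F. nbhd SR P V \<and> V \<subseteq> W \<and> V \<subseteq> Wl \<and> locfrac V F \<and>
      (\<forall>Q\<in>V. finsum (JT k d Q) (?t Q) {..<j} = tau k d l Q (F Q))" if "j \<le> n" for j using that
  proof (induction j)
    case 0
    let ?V = "W \<inter> Wl"
    have "nbhd SR P ?V" by (rule S.nbhd_Int[OF *(1) Wl(1)])
    moreover have "?V \<subseteq> SP" using calculation open_sub by (simp add: nbhd_def)
    moreover have "finsum (JT k d Q) (?t Q) {..<0} = tau k d l Q (cst 0)" if "Q \<in> ?V" for Q
    proof -
      have "Q \<in> SP" "good_lin l Q" using that \<open>?V \<subseteq> SP\<close> Wl(2) by auto
      then show ?thesis using tau_facts(5)[of l Q k d] abelian_monoid.finsum_empty[OF abelian_group.axioms(1)[OF JT_group[of Q k d]]] by simp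
    qed
    ultimately show ?case using locfrac_const[of ?V 0] by (intro exI[of _ ?V] exI[of _ "\<lambda>Q. cst 0"]) auto
  next
    case (Suc j)
    then obtain V F where V: "nbhd SR P V" "V \<subseteq> W" "V \<subseteq> Wl" "locfrac V F"
      "\<And>Q. Q \<in> V \<Longrightarrow> finsum (JT k d Q) (?t Q) {..<j} = tau k d l Q (F Q)" by auto
    have j: "j < n" using Suc.prems by simp
    obtain Vf where Vf: "nbhd SR P Vf" "locfrac Vf (f j)" using section_locfrac[OF *(4)[OF j] PW] by blast
    obtain Vh where Vh: "nbhd SR P Vh" "locfrac Vh (h j)" using section_locfrac[OF *(5)[OF j] PW] by blast
    have PU: "P \<in> Zp U" using *(3) PW by blast
    let ?S = "\<lambda>Q. pb (lmul (s j (pr2 Q)) (xpow l (- d)))"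
    obtain Vs where Vs: "nbhd SR P Vs" "locfrac Vs ?S" using section_line_locfrac[OF *(6)[OF j] PU l] by blast
    let ?V = "V \<inter> (Vf \<inter> (Vh \<inter> Vs))"
    let ?G = "\<lambda>Q. fmul (fmul (?S Q) (h j Q)) (f j Q)"
    have nb: "nbhd SR P ?V" by (intro S.nbhd_Int V Vf Vh Vs)
    have lf: "locfrac ?V (f j)" "locfrac ?V (h j)" "locfrac ?V ?S" "locfrac ?V F"
      by (rule locfrac_sub[OF Vf(2)], blast, rule locfrac_sub[OF Vh(2)], blast, rule locfrac_sub[OF Vs(2)], blast, rule locfrac_sub[OF V(4)], blast)
    have G: "locfrac ?V ?G" by (rule locfrac_ops(1)[OF locfrac_ops(1)[OF lf(3,2)] lf(1)])
    have "finsum (JT k d Q) (?t Q) {..<Suc j} = tau k d l Q (fadd (?G Q) (F Q))" if Q: "Q \<in> ?V" for Q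
    proof -
      have QW: "Q \<in> W" "good_lin l Q" "Q \<in> V" using Q V(2,3) Wl(2) by auto
      have QU: "pr2 Q \<in> U" using QW(1) *(3) by (auto simp: preimage_iff)
      interpret am: abelian_monoid "JT k d Q" using JT_group[of Q k d] QW(2) by (simp add: good_lin_def abelian_group_def)
      have t: "?t Q i = tau k d l Q (fmul (fmul
          (pb (lmul (s i (pr2 Q)) (xpow l (- d)))) (h i Q)) (f i Q))" "?t Q i \<in> carrier (JT k d Q)" if i: "i < n" for i
      proof -
        have m: "f i Q \<in> sqC Q" "h i Q \<in> sqC Q" "s i (pr2 Q) \<in> lnC d Q"
          using S.twist_sections_mem[OF *(4)[OF i] QW(1)] S.twist_sections_mem[OF *(5)[OF i] QW(1)] L.twist_sections_mem[OF *(6)[OF i] QU] by auto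
        show "?t Q i = tau k d l Q (fmul (fmul
          (pb (lmul (s i (pr2 Q)) (xpow l (- d)))) (h i Q)) (f i Q))" by (rule tau_facts(6)[OF QW(2) m])
        have QS: "Q \<in> SP" using QW(2) by (simp add: good_lin_def)
        show "?t Q i \<in> carrier (JT k d Q)" unfolding JT_eq
        proof (rule tensor_data.pure_mem[OF jet_data[OF QS]])
          show "Jcos k Q (f i Q) \<in> carrier (TS k Q)" unfolding thick_stalk(1)[OF QS] by (rule imageI[OF m(1)])
          show "pure (PB d Q) (h i Q) (s i (pr2 Q)) \<in> carrier (PB d Q)" by (rule PB_facts(1)[OF QS m(2,3)])
        qed
      qed
      have "finsum (JT k d Q) (?t Q) {..<Suc j} = ?t Q j \<oplus>\<^bsub>JT k d Q\<^esub> finsum (JT k d Q) (?t Q) {..<j}"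
        unfolding lessThan_Suc by (rule am.finsum_insert) (use t(2) j in auto)
      also have "\<dots> = tau k d l Q (?G Q) \<oplus>\<^bsub>JT k d Q\<^esub> tau k d l Q (F Q)" unfolding V(5)[OF QW(3)] t(1)[OF j] ..
      also have "\<dots> = tau k d l Q (fadd (?G Q) (F Q))" by (rule tau_facts(2)[OF QW(2) locfrac_mem[OF G Q] locfrac_mem[OF lf(4) Q], symmetric])
      finally show ?thesis .
    qed
    then show ?case using nb locfrac_ops(2)[OF G lf(4)] V(2,3) by (intro exI[of _ ?V] exI[of _ "\<lambda>Q. fadd (?G Q) (F Q)"]) blast
  qed
  from this[OF order_refl] show ?thesis unfolding loc_tau_def using *(2) Wl(2) \<sigma>W by (metis (no_types, lifting) subset_iff)
qed

lemma ex_good_lin: assumes "P \<in> SP" shows "\<exists>l. good_lin l P"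
proof -
  have "\<not> (\<lambda>l. l \<circ> snd) ` {l. linfun l} \<subseteq> P" by (rule S.ProjD(8)[OF assms]) (simp add: square_ring_def)
  then show ?thesis using assms by (auto simp: good_lin_def proj2_iff comp_def)
qed

text \<open>Conversely one summand is enough, with \<open>h\<close> the constant 1 and
  \<open>s\<close> the section \<open>l ^ d\<close> over the open set where \<open>l\<close> does
  not vanish.\<close>

lemma sectionsI:
  assumes ext: "\<sigma> \<in> extensional Z" and loc: "\<And>P. P \<in> Z \<Longrightarrow> \<exists>l. loc_tau k d Z \<sigma> l P"
  shows "\<sigma> \<in> jet_sections scale k d Z"
  unfolding jet_sections_def
proof (intro CollectI conjI ext ballI)
  fix P assume "P \<in> Z"
  then obtain l W F where W: "nbhd SR P W" "W \<subseteq> Z" "locfrac W F"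
    "\<And>Q. Q \<in> W \<Longrightarrow> good_lin l Q" "\<And>Q. Q \<in> W \<Longrightarrow> \<sigma> Q = tau k d l Q (F Q)"
    using loc unfolding loc_tau_def by blast
  obtain a b m where ab': "W \<subseteq> SP" "a \<in> deg2 m" "b \<in> deg2 m" "\<And>Q. Q \<in> W \<Longrightarrow> b \<notin> Q" "\<And>Q. Q \<in> W \<Longrightarrow> F Q = quo a b"
    using W(3) by (rule locfracE) (rule that)
  note ab = ab'(2-5) ab'(1)
  have PW: "P \<in> W" using W(1) by (simp add: nbhd_def)
  have ll: "linfun l" using W(4)[OF PW] by (simp add: good_lin_def)
  have l1: "l \<in> deg1 (int 1)" using deg1_linear[OF ll, of 1] by simp
  let ?U = "{p \<in> LP. l \<notin> p}"
  let ?f = "\<lambda>Q\<in>W. quo a b" and ?h = "\<lambda>Q\<in>W. cst 1" and ?s = "\<lambda>p\<in>?U. xpow l d"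
  have U: "zariski_open LR ?U" by (rule L.zariski_open_basic[OF l1])
  have WU: "W \<subseteq> Zp ?U" using W(4) proj2_Proj by (auto simp: preimage_iff good_lin_def)
  have Wn: "nbhd SR Q W" if "Q \<in> W" for Q using W(1) that by (simp add: nbhd_def)
  have f: "?f \<in> twist_sections SR 0 W"
    unfolding twist_sections_def using Wn ab by (intro CollectI conjI ballI exI[of _ W] exI[of _ a] exI[of _ b] exI[of _ m]) auto
  have h: "?h \<in> twist_sections SR 0 W" unfolding twist_sections_def using Wn S.ProjD(3) ab(5)
    by (intro CollectI conjI ballI exI[of _ W] exI[of _ "\<lambda>_. 1"] exI[of _ "\<lambda>_. 1"] exI[of _ 0] S.deg_const) auto
  have lp: "(\<lambda>w. l w ^ i) \<notin> p" if "p \<in> ?U" for p i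
  proof (induction i)
    case (Suc i)
    then show ?case using that L.ProjD(6)[of p l "\<lambda>w. l w ^ i"] poly_functions.linear[OF ll] poly_powers[OF poly_functions.linear[OF ll]]
      by (auto simp: carriers)
  qed (use that L.ProjD(3) in auto)
  have s: "?s \<in> twist_sections LR d ?U" unfolding twist_sections_def
    by (intro CollectI conjI ballI exI[of _ ?U] exI[of _ "\<lambda>w. l w ^ nat d"] exI[of _ "\<lambda>w. l w ^ nat (- d)"]
        exI[of _ "int (nat d)"] exI[of _ "int (nat (- d))"] deg1_linear[OF ll]) (use U lp in \<open>auto simp: nbhd_def xpow_def\<close>)
  have "\<sigma> Q = (\<Oplus>\<^bsub>JT k d Q\<^esub>i\<in>{..<1::nat}. pure (JT k d Q) (Jcos k Q (?f Q)) (pure (PB d Q) (?h Q) (?s (pr2 Q))))" if Q: "Q \<in> W" for Q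
  proof -
    have QS: "Q \<in> SP" using Q ab(5) by blast
    have "pr2 Q \<in> ?U" using WU Q by (auto simp: preimage_iff)
    then have e: "pure (JT k d Q) (Jcos k Q (?f Q)) (pure (PB d Q) (?h Q) (?s (pr2 Q))) = \<sigma> Q" using Q by (simp add: W(5) ab(4) tau_def)
    have m: "\<sigma> Q \<in> carrier (JT k d Q)" unfolding W(5)[OF Q] by (rule tau_facts(1)[OF W(4)[OF Q] locfrac_mem[OF W(3) Q]])
    interpret am: abelian_monoid "JT k d Q" using JT_group[OF QS] by (simp add: abelian_group_def)
    have "(\<Oplus>\<^bsub>JT k d Q\<^esub>i\<in>insert (0::nat) {}. \<sigma> Q) = \<sigma> Q \<oplus>\<^bsub>JT k d Q\<^esub> (\<Oplus>\<^bsub>JT k d Q\<^esub>i\<in>{}. \<sigma> Q)"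
      using am.finsum_insert[of "{}::nat set" 0 "\<lambda>_. \<sigma> Q"] m by simp
    then show ?thesis unfolding e using m by (simp add: lessThan_Suc)
  qed
  then show "\<exists>W U (n::nat) f h s. nbhd SR P W \<and> W \<subseteq> Z \<and> zariski_open LR U \<and> W \<subseteq> Zp U \<and>
        (\<forall>i<n. f i \<in> twist_sections SR 0 W \<and> h i \<in> twist_sections SR 0 W \<and> s i \<in> twist_sections LR d U) \<and>
        (\<forall>Q\<in>W. \<sigma> Q = (\<Oplus>\<^bsub>JT k d Q\<^esub>i\<in>{..<n}. pure (JT k d Q) (Jcos k Q (f i Q)) (pure (PB d Q) (h i Q) (s i (pr2 Q)))))"
    using W(1,2) U WU f h s
    by (intro exI[of _ W] exI[of _ ?U] exI[of _ "1::nat"] exI[of _ "\<lambda>_. ?f"] exI[of _ "\<lambda>_. ?h"] exI[of _ "\<lambda>_. ?s"]) blast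
qed

text \<open>Off the diagonal the ideal and its powers are the whole local ring, so the thickened
  structure sheaf and all jets vanish there.\<close>

lemma trivial_tau:
  assumes "good_lin l Q" "a \<in> deg2 m" "a \<notin> Q" "\<And>x. a (x, x) = 0" "G \<in> sqC Q"
  shows "tau k d l Q G = \<zero>\<^bsub>JT k d Q\<^esub>"
proof -
  have Q: "Q \<in> SP" using assms(1) by (simp add: good_lin_def)
  show ?thesis using tau_facts(4)[OF assms(1)] Ipow_trivial[OF Q assms(2-4)] assms(5) by blast
qed

lemma section_value:
  assumes "\<sigma> \<in> jet_sections scale k d Z" "P \<in> Z" "good_lin l P"
  shows "\<exists>F. F \<in> sqC P \<and> \<sigma> P = tau k d l P F"
  using sections_loc_tau[OF assms] locfrac_mem unfolding loc_tau_def nbhd_def by blast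

lemma section_mem: "\<sigma> \<in> jet_sections scale k d Z \<Longrightarrow> P \<in> Z \<Longrightarrow> P \<in> SP \<Longrightarrow> \<sigma> P \<in> carrier (JT k d P)"
  using section_value ex_good_lin tau_facts(1) by metis

text \<open>Over the preimage of this neighbourhood of the base point, \<open>b\<close> vanishes only off the diagonal.\<close>

definition unit_nbhd :: "('v \<times> 'v \<Rightarrow> 'f) \<Rightarrow> ('v \<Rightarrow> 'f) set set" where
  "unit_nbhd b = {p \<in> LP. (\<lambda>w. b (w, w) * xc w) \<notin> p}"

text \<open>Each factor of the defining function has its task: \<open>b (w, w)\<close> makes
  \<open>off_diagonal\<close> applicable at zeros of \<open>b\<close>, and \<open>xc w\<close> lets
  the single form \<open>xc\<close> trivialize the twist over the whole neighbourhood.\<close>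

lemma unit_nbhd:
  assumes b: "b \<in> deg2 m" "b \<notin> base_pt"
  shows "nbhd LR pt (unit_nbhd b)"
    and "\<And>Q. Q \<in> Zp (unit_nbhd b) \<Longrightarrow> good_lin xc Q"
    and "\<And>Q. Q \<in> Zp (unit_nbhd b) \<Longrightarrow> b \<in> Q \<Longrightarrow> \<exists>a d. a \<in> deg2 d \<and> a \<notin> Q \<and> (\<forall>x. a (x, x) = 0)"
proof -
  obtain i j where ij: "m = (int i, int j)" using deg2E[OF b(1)] by metis
  have bd: "(\<lambda>w. b (w, w)) \<in> deg1 (int (i + j))" using deg2_diag b(1) ij by blast
  have xd: "xc \<in> deg1 (int 1)" using deg1_linear[OF xc_linear(1), of 1] by simp
  note d = L.deg_mult[OF bd xd]
  show "nbhd LR pt (unit_nbhd b)"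
    unfolding nbhd_def unit_nbhd_def using L.zariski_open_basic[OF d] pt_Proj pt_iff[OF d] base_pt_iff[OF b(1)] b(2) by simp
  fix Q assume Q: "Q \<in> Zp (unit_nbhd b)"
  then have QS: "Q \<in> SP" and n: "(\<lambda>w. b (w, w) * xc w) \<notin> pr2 Q" by (auto simp: preimage_iff unit_nbhd_def)
  note p = proj2_Proj[OF QS]
  have "xc \<notin> pr2 Q" using n L.ProjD(5)[OF p _ L.deg_closed[OF bd], of xc] by blast
  then show "good_lin xc Q" using QS xc_linear by (simp add: good_lin_def)
  have bn: "(\<lambda>w. b (w, w)) \<notin> pr2 Q"
    using n L.ProjD(5)[OF p _ L.deg_closed[OF xd], of "\<lambda>w. b (w, w)"] by (auto simp: mult.commute)
  show "\<exists>a d. a \<in> deg2 d \<and> a \<notin> Q \<and> (\<forall>x. a (x, x) = 0)" if "b \<in> Q"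
    by (rule off_diagonal[OF QS b(1)[unfolded ij] that bn])
qed

text \<open>Extends the germ of \<open>a / b\<close> at the base point to the full preimage, by zero
  where the denominator vanishes.\<close>

definition glued :: "nat \<Rightarrow> int \<Rightarrow> ('v \<times> 'v \<Rightarrow> 'f) \<Rightarrow> ('v \<times> 'v \<Rightarrow> 'f) \<Rightarrow> ('v \<times> 'v \<Rightarrow> 'f) set set \<Rightarrow> ('v \<times> 'v \<Rightarrow> 'f) set \<Rightarrow> ('f, 'v) jet_germ" where
  "glued k d a b Z = (\<lambda>Q\<in>Z. if b \<in> Q then \<zero>\<^bsub>JT k d Q\<^esub> else tau k d xc Q (quo a b))"

text \<open>A zero of \<open>b\<close> has a neighbourhood on which some function vanishing on the
  diagonal is invertible. All jets are zero on it, so both branches of the definition agree there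
  and the zero fraction describes the section.\<close>

lemma glued_section:
  assumes ab: "a \<in> deg2 m" "b \<in> deg2 m" "b \<notin> base_pt" and U: "zariski_open LR U" "U \<subseteq> unit_nbhd b"
  shows "glued k d a b (Zp U) \<in> jet_sections scale k d (Zp U)"
proof (rule sectionsI)
  let ?Z = "Zp U"
  show "glued k d a b ?Z \<in> extensional ?Z" by (simp add: glued_def)
  fix P assume P: "P \<in> ?Z"
  have Zs: "Q \<in> Zp (unit_nbhd b)" if "Q \<in> ?Z" for Q using that U(2) by (auto simp: preimage_iff)
  note gl = unit_nbhd(2)[OF ab(2,3) Zs] and Zo = preimage_open[OF U(1)]
  have ZS: "?Z \<subseteq> SP" by (rule open_sub[OF Zo])
  show "\<exists>l. loc_tau k d ?Z (glued k d a b ?Z) l P"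
  proof (cases "b \<in> P")
    case False
    let ?W = "?Z \<inter> {Q \<in> SP. b \<notin> Q}"
    have "nbhd SR P ?W" using S.zariski_open_Int[OF Zo S.zariski_open_basic[OF ab(2)]] P False ZS by (auto simp: nbhd_def)
    moreover have "locfrac ?W (\<lambda>Q. quo a b)" using ab by (intro locfracI[of _ a m b]) auto
    ultimately show ?thesis unfolding loc_tau_def using gl by (intro exI[of _ xc] exI[of _ ?W] exI[of _ "\<lambda>Q. quo a b"]) (auto simp: glued_def)
  next
    case True
    then obtain c e where c: "c \<in> deg2 e" "c \<notin> P" "\<And>x. c (x, x) = 0" using unit_nbhd(3)[OF ab(2,3) Zs[OF P]] by blast
    let ?W = "?Z \<inter> {Q \<in> SP. c \<notin> Q}"
    have "nbhd SR P ?W" using S.zariski_open_Int[OF Zo S.zariski_open_basic[OF c(1)]] P c(2) ZS by (auto simp: nbhd_def)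
    moreover have "locfrac ?W (\<lambda>Q. cst 0)" using locfrac_const[of ?W] ZS by blast
    moreover have "glued k d a b ?Z Q = tau k d xc Q (cst 0)" if Q: "Q \<in> ?W" for Q
      using Q trivial_tau[OF gl c(1) _ c(3) sqO_mem[OF ab(1,2)], of Q] tau_facts(5)[OF gl] by (auto simp: glued_def)
    ultimately show ?thesis unfolding loc_tau_def using gl by (intro exI[of _ xc] exI[of _ ?W] exI[of _ "\<lambda>Q. cst 0"]) auto
  qed
qed

text \<open>A neighbourhood of \<open>(e, e)\<close> need not contain the preimage of any
  neighbourhood of \<open>e\<close>. Over a suitable neighbourhood, however, the points of the
  preimage left out lie off the diagonal, where all sections are zero.\<close>

lemma sections_agree:
  assumes s: "\<sigma> \<in> jet_sections scale k d (Zp U)" "\<sigma>' \<in> jet_sections scale k d (Zp U')"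
    and U: "nbhd LR pt U" "nbhd LR pt U'"
    and W: "nbhd SR base_pt W"
    and eq: "\<And>Q. Q \<in> W \<Longrightarrow> Q \<in> Zp U \<Longrightarrow> Q \<in> Zp U' \<Longrightarrow> \<sigma> Q = \<sigma>' Q"
  shows "\<exists>V. nbhd LR pt V \<and> V \<subseteq> U \<inter> U' \<and> (\<forall>Q\<in>Zp V. \<sigma> Q = \<sigma>' Q)"
proof -
  obtain b m where b: "b \<in> deg2 m" "b \<notin> base_pt" "{Q \<in> SP. b \<notin> Q} \<subseteq> W"
    using S.zariski_open_basis[of W base_pt] W unfolding nbhd_def by blast
  let ?V = "(U \<inter> U') \<inter> unit_nbhd b"
  have "nbhd LR pt ?V" by (intro L.nbhd_Int U unit_nbhd(1)[OF b(1,2)])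
  moreover have "\<sigma> Q = \<sigma>' Q" if Q: "Q \<in> Zp ?V" for Q
  proof -
    have QS: "Q \<in> SP" and QU: "Q \<in> Zp U" "Q \<in> Zp U'"
      "Q \<in> Zp (unit_nbhd b)" using Q by (auto simp: preimage_iff)
    note gl = unit_nbhd(2)[OF b(1,2) QU(3)]
    show ?thesis
    proof (cases "b \<in> Q")
      case True
      then obtain c e where c: "c \<in> deg2 e" "c \<notin> Q" "\<And>x. c (x, x) = 0" using unit_nbhd(3)[OF b(1,2) QU(3)] by blast
      show ?thesis using section_value[OF s(1) QU(1) gl] section_value[OF s(2) QU(2) gl] trivial_tau[OF gl c] by metis
    next
      case False
      then show ?thesis using eq[OF _ QU(1,2)] b(3) QS by blast
    qed
  qed
  ultimately show ?thesis by blast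
qed

end

section \<open>The stalk and the fiber of the sheaf of jets\<close>

context plane begin

abbreviation "JS k d U \<equiv> jet_sections scale k d (Zp U)"
abbreviation "nb \<equiv> nbhd LR pt"
abbreviation "gm k d \<equiv> germ LR (right_jets scale k d) (right_jets_res scale) pt"
abbreviation "Stk k d \<equiv> sheaf_stalk LR (\<lambda>c _. c) (right_jets scale k d) (right_jets_res scale) pt"
abbreviation "StkC k d \<equiv> carrier (Stk k d)"

lemma locfrac_cong: assumes "locfrac W F" "\<And>Q. Q \<in> W \<Longrightarrow> G Q = F Q" shows "locfrac W G"
proof -
  obtain a b m where *: "W \<subseteq> SP" "a \<in> deg2 m" "b \<in> deg2 m" "\<And>Q. Q \<in> W \<Longrightarrow> b \<notin> Q" "\<And>Q. Q \<in> W \<Longrightarrow> F Q = quo a b"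
    using assms(1) by (rule locfracE) (rule that)
  show ?thesis by (rule locfracI[OF *(1-4)]) (simp_all add: assms(2) *(5))
qed

lemma section_tau:
  assumes "\<sigma> \<in> jet_sections scale k d Z" "P \<in> Z" "good_lin l P"
  obtains W F where "nbhd SR P W" "W \<subseteq> Z" "locfrac W F" "\<And>Q. Q \<in> W \<Longrightarrow> good_lin l Q"
    "\<And>Q. Q \<in> W \<Longrightarrow> \<sigma> Q = tau k d l Q (F Q)"
proof -
  obtain W F where *: "nbhd SR P W" "W \<subseteq> Z" "locfrac W F" "\<forall>Q\<in>W. good_lin l Q \<and> \<sigma> Q = tau k d l Q (F Q)"
    using sections_loc_tau[OF assms] unfolding loc_tau_def by (elim exE conjE)
  show ?thesis using that[OF *(1-3)] *(4) by simp
qed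

lemma loc_tauI: "nbhd SR P W \<Longrightarrow> W \<subseteq> Z \<Longrightarrow> locfrac W F \<Longrightarrow> (\<And>Q. Q \<in> W \<Longrightarrow> good_lin l Q) \<Longrightarrow>
   (\<And>Q. Q \<in> W \<Longrightarrow> \<sigma> Q = tau k d l Q (F Q)) \<Longrightarrow> \<exists>l. loc_tau k d Z \<sigma> l P"
  unfolding loc_tau_def by (intro exI[of _ l] exI[of _ W] exI[of _ F]) simp

lemma section_add:
  assumes "\<sigma> \<in> jet_sections scale k d Z" "\<sigma>' \<in> jet_sections scale k d Z" "Z \<subseteq> SP"
  shows "(\<lambda>P\<in>Z. \<sigma> P \<oplus>\<^bsub>JT k d P\<^esub> \<sigma>' P) \<in> jet_sections scale k d Z"
proof (rule sectionsI)
  fix P assume P: "P \<in> Z"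
  obtain l where l: "good_lin l P" using ex_good_lin P assms(3) by blast
  obtain W F where W: "nbhd SR P W" "W \<subseteq> Z" "locfrac W F" "\<And>Q. Q \<in> W \<Longrightarrow> good_lin l Q"
    "\<And>Q. Q \<in> W \<Longrightarrow> \<sigma> Q = tau k d l Q (F Q)" using assms(1) P l by (rule section_tau) (rule that)
  obtain W' F' where W': "nbhd SR P W'" "W' \<subseteq> Z" "locfrac W' F'" "\<And>Q. Q \<in> W' \<Longrightarrow> good_lin l Q"
    "\<And>Q. Q \<in> W' \<Longrightarrow> \<sigma>' Q = tau k d l Q (F' Q)" using assms(2) P l by (rule section_tau) (rule that)
  let ?W = "W \<inter> W'"
  have lf: "locfrac ?W F" "locfrac ?W F'" by (rule locfrac_sub[OF W(3)], simp, rule locfrac_sub[OF W'(3)], simp)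
  show "\<exists>l. loc_tau k d Z (\<lambda>P\<in>Z. \<sigma> P \<oplus>\<^bsub>JT k d P\<^esub> \<sigma>' P) l P"
  proof (rule loc_tauI[OF S.nbhd_Int[OF W(1) W'(1)] _ locfrac_ops(2)[OF lf]])
    show "?W \<subseteq> Z" using W(2) by blast
    fix Q assume Q: "Q \<in> ?W"
    show "good_lin l Q" using W(4) Q by simp
    show "(\<lambda>P\<in>Z. \<sigma> P \<oplus>\<^bsub>JT k d P\<^esub> \<sigma>' P) Q = tau k d l Q (fadd (F Q) (F' Q))"
      using Q W(2) W(5)[of Q] W'(5)[of Q] tau_facts(2)[OF W(4) locfrac_mem[OF lf(1) Q] locfrac_mem[OF lf(2) Q]] by auto
  qed
qed simp

lemma section_smult:
  assumes "\<sigma> \<in> jet_sections scale k d Z" "Z \<subseteq> SP"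
    and g: "\<And>P. P \<in> Z \<Longrightarrow> \<exists>V. nbhd SR P V \<and> locfrac V g"
  shows "(\<lambda>P\<in>Z. g P \<odot>\<^bsub>JT k d P\<^esub> \<sigma> P) \<in> jet_sections scale k d Z"
proof (rule sectionsI)
  fix P assume P: "P \<in> Z"
  obtain l where l: "good_lin l P" using ex_good_lin P assms(2) by blast
  obtain W F where W: "nbhd SR P W" "W \<subseteq> Z" "locfrac W F" "\<And>Q. Q \<in> W \<Longrightarrow> good_lin l Q"
    "\<And>Q. Q \<in> W \<Longrightarrow> \<sigma> Q = tau k d l Q (F Q)" using assms(1) P l by (rule section_tau) (rule that)
  obtain V where V: "nbhd SR P V" "locfrac V g" using g[OF P] by (elim exE conjE)
  let ?W = "W \<inter> V"
  have lf: "locfrac ?W F" "locfrac ?W g" by (rule locfrac_sub[OF W(3)], simp, rule locfrac_sub[OF V(2)], simp)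
  show "\<exists>l. loc_tau k d Z (\<lambda>P\<in>Z. g P \<odot>\<^bsub>JT k d P\<^esub> \<sigma> P) l P"
  proof (rule loc_tauI[OF S.nbhd_Int[OF W(1) V(1)] _ locfrac_ops(1)[OF lf(2,1)]])
    show "?W \<subseteq> Z" using W(2) by blast
    fix Q assume Q: "Q \<in> ?W"
    show "good_lin l Q" using W(4) Q by simp
    show "(\<lambda>P\<in>Z. g P \<odot>\<^bsub>JT k d P\<^esub> \<sigma> P) Q = tau k d l Q (fmul (g Q) (F Q))"
      using Q W(2) W(5)[of Q] tau_facts(3)[OF W(4) locfrac_mem[OF lf(2) Q] locfrac_mem[OF lf(1) Q]] by auto
  qed
qed simp

lemma section_restrict:
  assumes "\<sigma> \<in> jet_sections scale k d Z" "zariski_open SR Z'" "Z' \<subseteq> Z"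
  shows "restrict \<sigma> Z' \<in> jet_sections scale k d Z'"
proof (rule sectionsI)
  fix P assume P: "P \<in> Z'"
  obtain l where l: "good_lin l P" using ex_good_lin P open_sub[OF assms(2)] by blast
  obtain W F where W: "nbhd SR P W" "W \<subseteq> Z" "locfrac W F" "\<And>Q. Q \<in> W \<Longrightarrow> good_lin l Q"
    "\<And>Q. Q \<in> W \<Longrightarrow> \<sigma> Q = tau k d l Q (F Q)" using assms(1) subsetD[OF assms(3) P] l by (rule section_tau) (rule that)
  have nZ: "nbhd SR P Z'" using assms(2) P by (simp add: nbhd_def)
  show "\<exists>l. loc_tau k d Z' (restrict \<sigma> Z') l P"
    by (rule loc_tauI[OF S.nbhd_Int[OF W(1) nZ] _ locfrac_sub[OF W(3)]]) (auto simp: W(4,5))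
qed simp

lemma section_zero:
  assumes "zariski_open SR Z"
  shows "(\<lambda>P\<in>Z. \<zero>\<^bsub>JT k d P\<^esub>) \<in> jet_sections scale k d Z"
proof (rule sectionsI)
  fix P assume P: "P \<in> Z"
  note ZS = open_sub[OF assms]
  obtain l where "good_lin l P" using ex_good_lin P ZS by blast
  then obtain W where W: "nbhd SR P W" "\<forall>Q\<in>W. good_lin l Q" using good_lin_open by metis
  have nZ: "nbhd SR P Z" using assms P by (simp add: nbhd_def)
  have "locfrac (W \<inter> Z) (\<lambda>Q. cst 0)" by (rule locfrac_const) (use ZS in auto)
  then show "\<exists>l. loc_tau k d Z (\<lambda>P\<in>Z. \<zero>\<^bsub>JT k d P\<^esub>) l P"
    by (rule loc_tauI[OF S.nbhd_Int[OF W(1) nZ] _, rotated]) (use W(2) tau_facts(5) in auto)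
qed simp

lemma Zp_open: "nb U \<Longrightarrow> zariski_open SR (Zp U)"
  by (rule preimage_open) (simp add: nbhd_def)

lemma Zp_sub: "nb U \<Longrightarrow> Zp U \<subseteq> SP"
  by (rule open_sub[OF Zp_open])

lemma base_pt_Zp: "nb U \<Longrightarrow> base_pt \<in> Zp U"
  unfolding preimage_iff using base_pt_Proj line_point_eq by (simp add: nbhd_def)

lemma Zp_Int: "Zp (U \<inter> U') = Zp U \<inter> Zp U'"
  by (auto simp: preimage_iff)

lemma Zp_mono: "U \<subseteq> U' \<Longrightarrow> Zp U \<subseteq> Zp U'"
  by (auto simp: preimage_iff)

lemma section_pull_smult:
  assumes "\<sigma> \<in> JS k d U" "nb U" and t: "t \<in> twist_sections LR 0 U"
  shows "(\<lambda>P\<in>Zp U. pb (t (pr2 P)) \<odot>\<^bsub>JT k d P\<^esub> \<sigma> P) \<in> JS k d U"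
proof (rule section_smult[OF assms(1) Zp_sub[OF assms(2)]])
  fix P assume P: "P \<in> Zp U"
  obtain l where l: "good_lin l P" using ex_good_lin P Zp_sub[OF assms(2)] by blast
  from section_line_locfrac[OF t P l] obtain V where V: "nbhd SR P V"
    "locfrac V (\<lambda>Q. pb (lmul (t (pr2 Q)) (xpow l (- 0))))" by (elim exE conjE)
  have "locfrac (V \<inter> Zp U) (\<lambda>Q. pb (t (pr2 Q)))"
  proof (rule locfrac_cong[OF locfrac_sub[OF V(2)]])
    fix Q assume Q: "Q \<in> V \<inter> Zp U"
    then have p: "pr2 Q \<in> LP" "pr2 Q \<in> U" using proj2_Proj by (auto simp: preimage_iff)
    have tm: "t (pr2 Q) \<in> lnC 0 Q" by (rule L.twist_sections_mem[OF t p(2)])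
    \<comment> \<open>For degree 0 the trivializing power of \<open>l\<close> is 1.\<close>
    have "lmul (t (pr2 Q)) (xpow l (- 0)) = t (pr2 Q)"
      using L.fraction_one_mult[OF p(1) tm] L.fraction_comm_assoc(1)[OF p(1) tm L.const_mem[OF p(1)] tm, of 1] by (simp add: xpow_def)
    then show "pb (t (pr2 Q)) = pb (lmul (t (pr2 Q)) (xpow l (- 0)))" by simp
  qed simp
  moreover have "nbhd SR P (Zp U)" using P Zp_open[OF assms(2)] by (simp add: nbhd_def)
  ultimately show "\<exists>V. nbhd SR P V \<and> locfrac V (\<lambda>P. pb (t (pr2 P)))" using S.nbhd_Int[OF V(1)] by blast
qed

lemma section_const_smult:
  assumes "\<sigma> \<in> JS k d U" "nb U"
  shows "(\<lambda>P\<in>Zp U. cst c \<odot>\<^bsub>JT k d P\<^esub> \<sigma> P) \<in> JS k d U"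
proof (rule section_smult[OF assms(1) Zp_sub[OF assms(2)]])
  fix P assume P: "P \<in> Zp U"
  show "\<exists>V. nbhd SR P V \<and> locfrac V (\<lambda>P. cst c)"
    using P Zp_open[OF assms(2)] Zp_sub[OF assms(2)] by (intro exI[of _ "Zp U"] conjI locfrac_const) (simp_all add: nbhd_def)
qed

lemma germ_mem:
  "(U', s') \<in> gm k d U s \<longleftrightarrow> nb U' \<and> s' \<in> JS k d U' \<and> (\<exists>V. nb V \<and> V \<subseteq> U \<inter> U' \<and> (\<forall>Q\<in>Zp V. s Q = s' Q))"
proof -
  have "restrict f Z = restrict g Z \<longleftrightarrow> (\<forall>Q\<in>Z. f Q = g Q)" for f g :: "('v \<times> 'v \<Rightarrow> 'f) set \<Rightarrow> ('f, 'v) jet_germ" and Z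
    by (metis restrict_apply' restrict_ext)
  then show ?thesis by (simp add: germ_def right_jets_def right_jets_res_def)
qed

lemma germ_self: "nb U \<Longrightarrow> s \<in> JS k d U \<Longrightarrow> (U, s) \<in> gm k d U s"
  unfolding germ_mem by auto

lemma germ_eqI:
  assumes V: "nb V" "V \<subseteq> U \<inter> U'" "\<And>Q. Q \<in> Zp V \<Longrightarrow> s Q = s' Q"
  shows "gm k d U s = gm k d U' s'"
proof -
  have *: "(U1, s1) \<in> gm k d U2 s2" if m: "(U1, s1) \<in> gm k d U3 s3" and sub: "V \<subseteq> U2" and eq: "\<And>Q. Q \<in> Zp V \<Longrightarrow> s2 Q = s3 Q" for U1 s1 U2 s2 U3 s3
  proof -
    obtain V' where V': "nb U1" "s1 \<in> JS k d U1" "nb V'" "V' \<subseteq> U3 \<inter> U1" "\<forall>Q\<in>Zp V'. s3 Q = s1 Q" using m unfolding germ_mem by blast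
    show ?thesis unfolding germ_mem
    proof (intro conjI V' exI[of _ "V \<inter> V'"] L.nbhd_Int V(1) ballI)
      show "V \<inter> V' \<subseteq> U2 \<inter> U1" using V'(4) sub by blast
      show "s2 Q = s1 Q" if "Q \<in> Zp (V \<inter> V')" for Q using that eq V'(5) by (simp add: Zp_Int)
    qed
  qed
  show ?thesis
  proof (rule Set.set_eqI)
    fix x show "x \<in> gm k d U s \<longleftrightarrow> x \<in> gm k d U' s'"
      using *[of "fst x" "snd x" U' s' U s] *[of "fst x" "snd x" U s U' s'] V by auto
  qed
qed

lemma stalk_carrier: "StkC k d = {gm k d U s | U s. nb U \<and> s \<in> JS k d U}"
  by (simp add: sheaf_stalk_def right_jets_def)

lemma stalk_zero: "\<zero>\<^bsub>Stk k d\<^esub> = gm k d LP (\<lambda>P\<in>Zp LP. \<zero>\<^bsub>JT k d P\<^esub>)"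
  by (simp add: sheaf_stalk_def right_jets_def)

lemma nb_LP: "nb LP"
  using L.zariski_open_Proj pt_Proj by (simp add: nbhd_def)

lemma stalk_add:
  assumes "nb U" "s \<in> JS k d U" "nb U'" "s' \<in> JS k d U'"
  shows "gm k d U s \<oplus>\<^bsub>Stk k d\<^esub> gm k d U' s' = gm k d (U \<inter> U') (\<lambda>P\<in>Zp (U \<inter> U'). s P \<oplus>\<^bsub>JT k d P\<^esub> s' P)"
proof -
  have "(\<Union>(U1, s1)\<in>gm k d U s. \<Union>(U2, s2)\<in>gm k d U' s'. gm k d (U1 \<inter> U2)
      (right_jets_res scale (U1 \<inter> U2) s1 \<oplus>\<^bsub>right_jets scale k d (U1 \<inter> U2)\<^esub> right_jets_res scale (U1 \<inter> U2) s2)) =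
    gm k d (U \<inter> U') (\<lambda>P\<in>Zp (U \<inter> U'). s P \<oplus>\<^bsub>JT k d P\<^esub> s' P)"
  proof (rule union_pairs_const[OF germ_self[OF assms(1,2)] germ_self[OF assms(3,4)]])
    fix U1 s1 U2 s2 assume "(U1, s1) \<in> gm k d U s" "(U2, s2) \<in> gm k d U' s'"
    then obtain V V' where V: "nb V" "V \<subseteq> U \<inter> U1" "\<forall>Q\<in>Zp V. s Q = s1 Q" and V': "nb V'" "V' \<subseteq> U' \<inter> U2" "\<forall>Q\<in>Zp V'. s' Q = s2 Q"
      unfolding germ_mem by blast
    show "gm k d (U1 \<inter> U2) (right_jets_res scale (U1 \<inter> U2) s1 \<oplus>\<^bsub>right_jets scale k d (U1 \<inter> U2)\<^esub> right_jets_res scale (U1 \<inter> U2) s2) =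
      gm k d (U \<inter> U') (\<lambda>P\<in>Zp (U \<inter> U'). s P \<oplus>\<^bsub>JT k d P\<^esub> s' P)"
    proof (rule germ_eqI[OF L.nbhd_Int[OF V(1) V'(1)]])
      show "V \<inter> V' \<subseteq> (U1 \<inter> U2) \<inter> (U \<inter> U')" using V(2) V'(2) by blast
      fix Q assume Q: "Q \<in> Zp (V \<inter> V')"
      then have "Q \<in> Zp (U1 \<inter> U2)" "Q \<in> Zp (U \<inter> U')" "s Q = s1 Q" "s' Q = s2 Q"
        using V(2,3) V'(2,3) by (auto simp: Zp_Int preimage_iff)
      then show "(right_jets_res scale (U1 \<inter> U2) s1 \<oplus>\<^bsub>right_jets scale k d (U1 \<inter> U2)\<^esub> right_jets_res scale (U1 \<inter> U2) s2) Q =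
        (\<lambda>P\<in>Zp (U \<inter> U'). s P \<oplus>\<^bsub>JT k d P\<^esub> s' P) Q" by (simp add: right_jets_def right_jets_res_def)
    qed
  qed
  then show ?thesis by (simp add: sheaf_stalk_def)
qed

lemma stalk_smult:
  assumes "nb U" "s \<in> JS k d U"
  shows "c \<odot>\<^bsub>Stk k d\<^esub> gm k d U s = gm k d U (\<lambda>P\<in>Zp U. cst c \<odot>\<^bsub>JT k d P\<^esub> s P)"
proof -
  have "(\<Union>x\<in>gm k d U s. case x of (U1, s1) \<Rightarrow> gm k d U1 (const_section LR (\<lambda>c _. c) U1 c \<odot>\<^bsub>right_jets scale k d U1\<^esub> s1)) =
      gm k d U (\<lambda>P\<in>Zp U. cst c \<odot>\<^bsub>JT k d P\<^esub> s P)"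
  proof (rule SUP_eq_const)
    show "gm k d U s \<noteq> {}" using germ_self assms by blast
    fix x assume x: "x \<in> gm k d U s"
    obtain U1 s1 where [simp]: "x = (U1, s1)" by (cases x)
    obtain V where V: "nb V" "V \<subseteq> U \<inter> U1" "\<forall>Q\<in>Zp V. s Q = s1 Q" using x unfolding \<open>x = _\<close> germ_mem by blast
    have "gm k d U1 (const_section LR (\<lambda>c _. c) U1 c \<odot>\<^bsub>right_jets scale k d U1\<^esub> s1) =
      gm k d U (\<lambda>P\<in>Zp U. cst c \<odot>\<^bsub>JT k d P\<^esub> s P)"
    proof (rule germ_eqI[OF V(1)])
      show "V \<subseteq> U1 \<inter> U" using V(2) by blast
      fix Q assume Q: "Q \<in> Zp V"
      then have Q': "Q \<in> Zp U1" "Q \<in> Zp U" "s Q = s1 Q" "Q \<in> SP" "pr2 Q \<in> U1" using V(2,3) by (auto simp: preimage_iff)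
      have "L.is_frac (\<lambda>_. c) (\<lambda>_. 1)" by (rule ln_frac[OF proj2_Proj[OF Q'(4)] L.deg_const L.deg_const]) (rule L.ProjD(3)[OF proj2_Proj[OF Q'(4)]])
      then have "pb (lfrac (\<lambda>_. c) (\<lambda>_. 1)) = cst c" by (rule pullback_frac(1))
      moreover have "\<one>\<^bsub>LR\<^esub> = (\<lambda>_. 1)" by (simp add: line_ring_def)
      ultimately show "(const_section LR (\<lambda>c _. c) U1 c \<odot>\<^bsub>right_jets scale k d U1\<^esub> s1) Q =
        (\<lambda>P\<in>Zp U. cst c \<odot>\<^bsub>JT k d P\<^esub> s P) Q" using Q' by (simp add: right_jets_def const_section_def)
    qed
    then show "(case x of (U1, s1) \<Rightarrow> gm k d U1 (const_section LR (\<lambda>c _. c) U1 c \<odot>\<^bsub>right_jets scale k d U1\<^esub> s1)) =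
      gm k d U (\<lambda>P\<in>Zp U. cst c \<odot>\<^bsub>JT k d P\<^esub> s P)" by simp
  qed
  then show ?thesis by (simp add: sheaf_stalk_def)
qed

lemma section_sum:
  assumes "nb U" "s \<in> JS k d U" "nb U'" "s' \<in> JS k d U'"
  shows "(\<lambda>P\<in>Zp (U \<inter> U'). s P \<oplus>\<^bsub>JT k d P\<^esub> s' P) \<in> JS k d (U \<inter> U')"
proof -
  note n = L.nbhd_Int[OF assms(1,3)]
  have "restrict s (Zp (U \<inter> U')) \<in> JS k d (U \<inter> U')" "restrict s' (Zp (U \<inter> U')) \<in> JS k d (U \<inter> U')"
    by (rule section_restrict[OF _ Zp_open[OF n]], fact, simp add: Zp_Int)+
  from section_add[OF this Zp_sub[OF n]] show ?thesis by (simp cong: restrict_cong)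
qed

text \<open>Provides negatives in the stalk: the constant section -1 acts as negation on every jet
  germ.\<close>

lemma quo_minus_one:
  assumes Q: "Q \<in> SP" and A: "A = tau k d l Q F" "good_lin l Q" "F \<in> sqC Q"
  shows "cst (- 1) \<odot>\<^bsub>JT k d Q\<^esub> A \<oplus>\<^bsub>JT k d Q\<^esub> A = \<zero>\<^bsub>JT k d Q\<^esub>"
proof -
  obtain a b m where ab: "F = quo a b" "a \<in> deg2 m" "b \<in> deg2 m" "b \<notin> Q" using sqO_memE[OF A(3)] by metis
  note c = S.const_mem[OF Q]
  have m: "fmul (cst (- 1)) F \<in> sqC Q" by (rule S.twist_closed(2)[OF Q A(3) A(3) c])
  have f1: "S.is_frac a b" "S.is_frac (\<lambda>_. - 1) (\<lambda>_. 1)" "S.is_frac (\<lambda>_. 0) (\<lambda>_. 1)"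
    by (rule sq_frac[OF Q ab(2-4)], (rule sq_frac[OF Q S.deg_const S.deg_const S.ProjD(3)[OF Q]])+)
  have "fadd (fmul (cst (- 1)) F) F = cst 0" unfolding ab(1) S.frac_mult[OF f1(2,1)] S.frac_add[OF S.is_frac_mult[OF f1(2,1)] f1(1)]
    by (rule S.frac_eqI[OF S.is_frac_add[OF S.is_frac_mult[OF f1(2,1)] f1(1)] f1(3)]) simp
  then show ?thesis unfolding A(1) tau_facts(3)[OF A(2) c A(3)] tau_facts(2)[OF A(2) m A(3), symmetric] by (simp add: tau_facts(5)[OF A(2)])
qed

lemma JS_mem: "nb U \<Longrightarrow> s \<in> JS k d U \<Longrightarrow> Q \<in> Zp U \<Longrightarrow> s Q \<in> carrier (JT k d Q)"
  using section_mem Zp_sub by blast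

text \<open>The axioms hold because they hold in the jet stalk at each point of the preimage of a
  common neighbourhood.\<close>

lemma stalk_group: "abelian_group (Stk k d)"
proof -
  have add: "\<exists>U s. nb U \<and> s \<in> JS k d U \<and> x = gm k d U s" if "x \<in> StkC k d" for x using that unfolding stalk_carrier by blast
  have am: "abelian_monoid (JT k d Q)" if "Q \<in> SP" for Q using JT_group[OF that] by (simp add: abelian_group_def)
  have zS: "(\<lambda>P\<in>Zp LP. \<zero>\<^bsub>JT k d P\<^esub>) \<in> JS k d LP" by (rule section_zero[OF Zp_open[OF nb_LP]])
  show ?thesis
  proof (rule abelian_groupI)
    fix x y z assume x: "x \<in> StkC k d" and y: "y \<in> StkC k d"
    obtain U s where U: "nb U" "s \<in> JS k d U" "x = gm k d U s" using add[OF x] by blast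
    obtain U' s' where U': "nb U'" "s' \<in> JS k d U'" "y = gm k d U' s'" using add[OF y] by blast
    note xy = stalk_add[OF U(1,2) U'(1,2), folded U(3) U'(3)]
    note nU = L.nbhd_Int[OF U(1) U'(1)] and sU = section_sum[OF U(1,2) U'(1,2)]
    show "x \<oplus>\<^bsub>Stk k d\<^esub> y \<in> StkC k d" unfolding xy stalk_carrier using nU sU by blast
    show "x \<oplus>\<^bsub>Stk k d\<^esub> y = y \<oplus>\<^bsub>Stk k d\<^esub> x" unfolding xy stalk_add[OF U'(1,2) U(1,2), folded U(3) U'(3)]
    proof (rule germ_eqI[OF nU])
      fix Q assume Q: "Q \<in> Zp (U \<inter> U')"
      then have "Q \<in> SP" "Q \<in> Zp U" "Q \<in> Zp U'" "Q \<in> Zp (U' \<inter> U)" by (auto simp: preimage_iff)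
      then show "(\<lambda>P\<in>Zp (U \<inter> U'). s P \<oplus>\<^bsub>JT k d P\<^esub> s' P) Q = (\<lambda>P\<in>Zp (U' \<inter> U). s' P \<oplus>\<^bsub>JT k d P\<^esub> s P) Q"
        using abelian_monoid.a_comm[OF am JS_mem[OF U(1,2)] JS_mem[OF U'(1,2)], of Q] Q by simp
    qed auto
    show "x \<oplus>\<^bsub>Stk k d\<^esub> y \<oplus>\<^bsub>Stk k d\<^esub> z = x \<oplus>\<^bsub>Stk k d\<^esub> (y \<oplus>\<^bsub>Stk k d\<^esub> z)" if z: "z \<in> StkC k d"
    proof -
      obtain T t where T: "nb T" "t \<in> JS k d T" "z = gm k d T t" using add[OF z] by blast
      show ?thesis unfolding xy stalk_add[OF U'(1,2) T(1,2), folded U'(3) T(3)] stalk_add[OF nU sU T(1,2), folded T(3)]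
          stalk_add[OF U(1,2) L.nbhd_Int[OF U'(1) T(1)] section_sum[OF U'(1,2) T(1,2)], folded U(3)]
      proof (rule germ_eqI[OF L.nbhd_Int[OF nU T(1)]])
        fix Q assume Q: "Q \<in> Zp (U \<inter> U' \<inter> T)"
        then have Q': "Q \<in> SP" "Q \<in> Zp U" "Q \<in> Zp U'" "Q \<in> Zp T" "Q \<in> Zp (U \<inter> U')" "Q \<in> Zp (U' \<inter> T)" "Q \<in> Zp (U \<inter> (U' \<inter> T))"
          by (auto simp: preimage_iff)
        show "(\<lambda>P\<in>Zp (U \<inter> U' \<inter> T). (\<lambda>P\<in>Zp (U \<inter> U'). s P \<oplus>\<^bsub>JT k d P\<^esub> s' P) P \<oplus>\<^bsub>JT k d P\<^esub> t P) Q =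
          (\<lambda>P\<in>Zp (U \<inter> (U' \<inter> T)). s P \<oplus>\<^bsub>JT k d P\<^esub> (\<lambda>P\<in>Zp (U' \<inter> T). s' P \<oplus>\<^bsub>JT k d P\<^esub> t P) P) Q"
          using abelian_monoid.a_assoc[OF am JS_mem[OF U(1,2)] JS_mem[OF U'(1,2)] JS_mem[OF T(1,2)], of Q] Q Q' by simp
      qed auto
    qed
    show "\<zero>\<^bsub>Stk k d\<^esub> \<oplus>\<^bsub>Stk k d\<^esub> x = x" unfolding stalk_zero U(3) stalk_add[OF nb_LP zS U(1,2)]
    proof (rule germ_eqI[OF L.nbhd_Int[OF nb_LP U(1)]])
      fix Q assume Q: "Q \<in> Zp (LP \<inter> U)"
      then have "Q \<in> SP" "Q \<in> Zp U" "Q \<in> Zp LP" by (auto simp: preimage_iff)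
      then show "(\<lambda>P\<in>Zp (LP \<inter> U). (\<lambda>P\<in>Zp LP. \<zero>\<^bsub>JT k d P\<^esub>) P \<oplus>\<^bsub>JT k d P\<^esub> s P) Q = s Q"
        using abelian_monoid.l_zero[OF am JS_mem[OF U(1,2)], of Q] Q by simp
    qed auto
    show "\<exists>y\<in>StkC k d. y \<oplus>\<^bsub>Stk k d\<^esub> x = \<zero>\<^bsub>Stk k d\<^esub>"
    proof
      let ?m = "\<lambda>P\<in>Zp U. cst (- 1) \<odot>\<^bsub>JT k d P\<^esub> s P"
      have m: "?m \<in> JS k d U" by (rule section_const_smult[OF U(2,1)])
      show "gm k d U ?m \<in> StkC k d" unfolding stalk_carrier using m U(1) by blast
      show "gm k d U ?m \<oplus>\<^bsub>Stk k d\<^esub> x = \<zero>\<^bsub>Stk k d\<^esub>" unfolding U(3) stalk_zero stalk_add[OF U(1) m U(1,2)]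
      proof (rule germ_eqI[OF L.nbhd_Int[OF nb_LP U(1)]])
        fix Q assume "Q \<in> Zp (LP \<inter> U)"
        then have Q: "Q \<in> SP" "Q \<in> Zp U" "Q \<in> Zp LP" by (auto simp: preimage_iff)
        obtain l where l: "good_lin l Q" using ex_good_lin[OF Q(1)] by blast
        obtain F where F: "F \<in> sqC Q" "s Q = tau k d l Q F" using section_value[OF U(2) Q(2) l] by blast
        show "(\<lambda>P\<in>Zp (U \<inter> U). ?m P \<oplus>\<^bsub>JT k d P\<^esub> s P) Q = (\<lambda>P\<in>Zp LP. \<zero>\<^bsub>JT k d P\<^esub>) Q"
          using quo_minus_one[OF Q(1) F(2) l F(1)] Q by simp
      qed auto
    qed
  next
    show "\<zero>\<^bsub>Stk k d\<^esub> \<in> StkC k d" unfolding stalk_zero stalk_carrier using zS nb_LP by blast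
  qed
qed

section \<open>Values of germs at the base point, and the fiber\<close>

lemma good_lin_xc: "good_lin xc base_pt"
  using base_pt_Proj xc_linear pt_iff[OF deg1_linear[OF xc_linear(1), of 1]] unfolding good_lin_def line_point_eq by simp

lemma theta_tau:
  assumes "G \<in> sqC base_pt"
  shows "theta k (tau k d xc base_pt G) = fps_cutoff (k + 1) (germ_series G)"
  using theta(2)[OF good_lin_xc assms, of k d] by simp

lemma theta_smult:
  assumes s: "nb U" "s \<in> JS k d U" and g: "g \<in> sqC base_pt"
  shows "theta k (g \<odot>\<^bsub>JT k d base_pt\<^esub> s base_pt) = fps_cutoff (k + 1) (germ_series g * theta k (s base_pt))"
proof -
  obtain F where F: "F \<in> sqC base_pt" "s base_pt = tau k d xc base_pt F" using section_value[OF s(2) base_pt_Zp[OF s(1)] good_lin_xc] by blast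
  show ?thesis unfolding F(2) tau_facts(3)[OF good_lin_xc g F(1)] theta_tau[OF F(1)] theta_tau[OF S.twist_closed(2)[OF base_pt_Proj F(1) F(1) g]]
      germ_series_ops(2)[OF g F(1)] by simp
qed

text \<open>Every representative of a germ at \<open>e\<close> is defined at \<open>(e, e)\<close>,
  and any two agree there, so the chosen one is as good as any other.\<close>

definition germ_value :: "nat \<Rightarrow> (('v \<Rightarrow> 'f) set set \<times> (('v \<times> 'v \<Rightarrow> 'f) set \<Rightarrow> ('f, 'v) jet_germ)) set \<Rightarrow> 'f fps" where
  "germ_value k A = theta k (snd (SOME x. x \<in> A) base_pt)"

lemma germ_value:
  assumes "nb U" "s \<in> JS k d U" shows "germ_value k (gm k d U s) = theta k (s base_pt)"
proof -
  have "(SOME x. x \<in> gm k d U s) \<in> gm k d U s" using germ_self[OF assms] by (rule someI)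
  then obtain V where "nb V" "\<forall>Q\<in>Zp V. s Q = snd (SOME x. x \<in> gm k d U s) Q"
    using germ_mem[of "fst (SOME x. x \<in> gm k d U s)" "snd (SOME x. x \<in> gm k d U s)" k d U s] by auto
  then show ?thesis unfolding germ_value_def using base_pt_Zp by simp
qed

lemma germ_value_add:
  assumes "x \<in> StkC k d" "y \<in> StkC k d"
  shows "germ_value k (x \<oplus>\<^bsub>Stk k d\<^esub> y) = germ_value k x + germ_value k y"
proof -
  obtain U s U' s' where U: "nb U" "s \<in> JS k d U" "x = gm k d U s" and U': "nb U'" "s' \<in> JS k d U'" "y = gm k d U' s'"
    using assms unfolding stalk_carrier by blast
  note n = L.nbhd_Int[OF U(1) U'(1)]
  show ?thesis
    unfolding U(3) U'(3) stalk_add[OF U(1,2) U'(1,2)] germ_value[OF n section_sum[OF U(1,2) U'(1,2)]] germ_value[OF U(1,2)] germ_value[OF U'(1,2)]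
    using theta(1)[OF JS_mem[OF U(1,2) base_pt_Zp[OF U(1)]] JS_mem[OF U'(1,2) base_pt_Zp[OF U'(1)]]] base_pt_Zp[OF n] by simp
qed

lemma theta_section_cutoff:
  assumes "nb U" "s \<in> JS k d U" shows "fps_cutoff (k + 1) (theta k (s base_pt)) = theta k (s base_pt)"
proof -
  obtain F where F: "F \<in> sqC base_pt" "s base_pt = tau k d xc base_pt F"
    using section_value[OF assms(2) base_pt_Zp[OF assms(1)] good_lin_xc] by blast
  show ?thesis unfolding F(2) theta_tau[OF F(1)] by (simp add: fps_eq_iff)
qed

lemma germ_value_smult:
  assumes "x \<in> StkC k d"
  shows "c \<odot>\<^bsub>Stk k d\<^esub> x \<in> StkC k d" "germ_value k (c \<odot>\<^bsub>Stk k d\<^esub> x) = fps_const c * germ_value k x"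
proof -
  obtain U s where U: "nb U" "s \<in> JS k d U" "x = gm k d U s" using assms unfolding stalk_carrier by blast
  note m = section_const_smult[OF U(2,1), of c]
  show "c \<odot>\<^bsub>Stk k d\<^esub> x \<in> StkC k d" unfolding U(3) stalk_smult[OF U(1,2)] stalk_carrier using m U(1) by blast
  have "fps_cutoff (k + 1) (fps_const c * theta k (s base_pt)) = fps_const c * fps_cutoff (k + 1) (theta k (s base_pt))" by (simp add: fps_eq_iff)
  then show "germ_value k (c \<odot>\<^bsub>Stk k d\<^esub> x) = fps_const c * germ_value k x"
    unfolding U(3) stalk_smult[OF U(1,2)] germ_value[OF U(1) m] germ_value[OF U(1,2)]
    using theta_smult[OF U(1,2) S.const_mem[OF base_pt_Proj, of c]] base_pt_Zp[OF U(1)] theta_section_cutoff[OF U(1,2)]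
    by (simp add: germ_series_const)
qed

text \<open>The bound on degrees comes from the truncation in \<open>theta\<close>. Surjectivity
  needs a section over a full preimage with prescribed Taylor polynomial, which gluing
  provides.\<close>

lemma germ_value_image: "germ_value k ` StkC k d = polys_upto k"
proof (intro equalityI subsetI)
  fix w assume "w \<in> germ_value k ` StkC k d"
  then obtain x where "x \<in> StkC k d" "w = germ_value k x" by (rule imageE)
  then obtain U s where U: "nb U" "s \<in> JS k d U" "w = germ_value k (gm k d U s)" unfolding stalk_carrier by blast
  have "w $ i = 0" if "i > k" for i unfolding U(3) germ_value[OF U(1,2)] using that by (subst theta_section_cutoff[OF U(1,2), symmetric]) simp
  then show "w \<in> polys_upto k" by (simp add: polys_upto_def)
next
  fix w :: "'f fps" assume w: "w \<in> polys_upto k"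
  \<comment> \<open>This denominator has zeros on every fiber of the second projection, so the
    fraction does not by itself define a section over a preimage and has to be glued.\<close>
  let ?b = "\<lambda>z. x1 z ^ k"
  obtain a where a: "a \<in> deg2 (int k, int 0)" "germ_series (quo a ?b) = w" using series_surj[OF w] by blast
  have b: "?b \<in> deg2 (int k, int 0)" by (rule deg2_basic(1))
  have b': "?b \<notin> base_pt" unfolding base_pt_iff[OF b] by simp
  let ?U = "unit_nbhd ?b"
  note nU = unit_nbhd(1)[OF b b']
  have g: "glued k d a ?b (Zp ?U) \<in> JS k d ?U" by (rule glued_section[OF a(1) b b']) (use nU in \<open>auto simp: nbhd_def\<close>)
  have "germ_value k (gm k d ?U (glued k d a ?b (Zp ?U))) = fps_cutoff (k + 1) w"
    unfolding germ_value[OF nU g] using theta_tau[OF sqO_mem[OF a(1) b b'], of k d] base_pt_Zp[OF nU] b' a(2) by (simp add: glued_def)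
  also have "\<dots> = w" using w by (auto simp: fps_eq_iff polys_upto_def)
  finally show "w \<in> germ_value k ` StkC k d"
    unfolding stalk_carrier using g nU by (intro image_eqI[where x = "gm k d ?U (glued k d a ?b (Zp ?U))"]) auto
qed

abbreviation "fiber_gens k d \<equiv> {gm k d U (t \<odot>\<^bsub>right_jets scale k d U\<^esub> s) | U t s.
   nb U \<and> t \<in> twist_sections LR 0 U \<and> t pt \<in> local_max LR pt \<and> s \<in> carrier (right_jets scale k d U)}"

text \<open>An element of the maximal ideal at the fixed point is pulled back to a function of the
  second variable alone that vanishes at \<open>u\<close>; its expansion along the first factor is
  0.\<close>

lemma fiber_gens_kernel:
  assumes "x \<in> fiber_gens k d" shows "x \<in> StkC k d" "germ_value k x = 0"
proof -
  obtain U t s where U: "nb U" "t \<in> twist_sections LR 0 U" "t pt \<in> local_max LR pt" "s \<in> JS k d U"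
    and x: "x = gm k d U (\<lambda>P\<in>Zp U. pb (t (pr2 P)) \<odot>\<^bsub>JT k d P\<^esub> s P)" using assms by (auto simp: right_jets_def)
  note m = section_pull_smult[OF U(4,1,2)]
  show "x \<in> StkC k d" unfolding x stalk_carrier using m U(1) by blast
  obtain a b i where ab: "t pt = lfrac a b" "a \<in> deg1 i" "b \<in> deg1 i" "a \<in> pt" "b \<notin> pt" using U(3) unfolding local_max_def by blast
  have au: "a u = 0" "b u \<noteq> 0" using ab(4,5) pt_iff[OF ab(2)] pt_iff[OF ab(3)] by auto
  have p: "a \<in> poly1" "b \<in> poly1" using ab(2,3) L.deg_closed unfolding carriers by blast+
  have pbt: "pb (t pt) = quo (\<lambda>z. a (snd z)) (\<lambda>z. b (snd z))"
    unfolding ab(1) by (rule pullback_frac(1)[OF ln_frac[OF pt_Proj ab(2,3,5)]])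
  have "germ_series (pb (t pt)) = 0"
    unfolding pbt using germ_series_quo[OF poly1_comp_snd[OF p(1)] poly1_comp_snd[OF p(2)]] au expand_snd[OF p(1)] by simp
  moreover have "pb (t (pr2 base_pt)) \<in> sqC base_pt"
    by (rule pullback_local[OF base_pt_Proj]) (rule L.twist_sections_mem[OF U(2)], use U(1) line_point_eq in \<open>simp add: nbhd_def\<close>)
  ultimately show "germ_value k x = 0" unfolding x germ_value[OF U(1) m] using base_pt_Zp[OF U(1)] theta_smult[OF U(1,4)] line_point_eq by simp
qed

text \<open>By \<open>series_kernel\<close> the fraction of the germ is \<open>y2 / x2\<close> times
  \<open>c / e\<close> up to an element of the ideal power, which is zero as a jet. A kernel element
  is thus a single generator: the local parameter times the glued section of
  \<open>c / e\<close>.\<close>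

lemma kernel_fiber_gens:
  assumes x: "x \<in> StkC k d" "germ_value k x = 0" shows "x \<in> fiber_gens k d"
proof -
  obtain U s where U: "nb U" "s \<in> JS k d U" "x = gm k d U s" using x(1) unfolding stalk_carrier by blast
  obtain W F where W: "nbhd SR base_pt W" "W \<subseteq> Zp U" "locfrac W F" "\<And>Q. Q \<in> W \<Longrightarrow> good_lin xc Q"
    "\<And>Q. Q \<in> W \<Longrightarrow> s Q = tau k d xc Q (F Q)" using U(2) base_pt_Zp[OF U(1)] good_lin_xc by (rule section_tau) (rule that)
  obtain a b m where ab: "W \<subseteq> SP" "a \<in> deg2 m" "b \<in> deg2 m" "\<And>Q. Q \<in> W \<Longrightarrow> b \<notin> Q" "\<And>Q. Q \<in> W \<Longrightarrow> F Q = quo a b"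
    using W(3) by (rule locfracE) (rule that)
  have bW: "base_pt \<in> W" using W(1) by (simp add: nbhd_def)
  obtain i j where m: "m = (int i, int j)" by (rule deg2E[OF ab(2)])
  have "fps_cutoff (k + 1) (germ_series (quo a b)) = 0"
    using x(2) theta_tau[OF sqO_mem[OF ab(2,3) ab(4)[OF bW]], of k d] unfolding U(3) germ_value[OF U(1,2)] W(5)[OF bW] ab(5)[OF bW] by simp
  from series_kernel[OF ab(2)[unfolded m] ab(3)[unfolded m] ab(4)[OF bW] this] obtain c e n where
    ce: "c \<in> deg2 n" "e \<in> deg2 n" "e \<notin> base_pt" and K: "\<forall>Q\<in>SP. b \<notin> Q \<longrightarrow> x1 \<notin> Q \<longrightarrow> x2 \<notin> Q \<longrightarrow> e \<notin> Q \<and>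
      (\<exists>H\<in>Ipow (k + 1) Q. quo a b = fadd (fmul (quo y2 x2) (quo c e)) H)" by (elim exE conjE)
  have xd: "xc \<in> deg1 (int 1)" and yd: "yc \<in> deg1 (int 1)"
    using deg1_linear[OF xc_linear(1), of 1] deg1_linear[OF xc_linear(2), of 1] by simp_all
  let ?U = "unit_nbhd e \<inter> {p \<in> LP. xc \<notin> p}"
  have nX: "nb {p \<in> LP. xc \<notin> p}" using L.zariski_open_basic[OF xd] pt_Proj pt_iff[OF xd] by (simp add: nbhd_def)
  have nU: "nb ?U" by (rule L.nbhd_Int[OF unit_nbhd(1)[OF ce(2,3)] nX])
  \<comment> \<open>The local parameter \<open>yc / xc\<close> at the fixed point, whose pullback is
    \<open>y2 / x2\<close>.\<close>
  let ?t = "\<lambda>p\<in>?U. lfrac yc xc" and ?s = "glued k d c e (Zp ?U)"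
  have t: "?t \<in> twist_sections LR 0 ?U" unfolding twist_sections_def using nU xd yd
    by (intro CollectI conjI ballI exI[of _ ?U] exI[of _ yc] exI[of _ xc] exI[of _ "int 1"]) (auto simp: nbhd_def)
  have tpt: "?t pt \<in> local_max LR pt" using nU xd yd pt_iff[OF xd] pt_iff[OF yd] unfolding local_max_def
    by (intro CollectI exI[of _ yc] exI[of _ xc] exI[of _ "int 1"]) (auto simp: nbhd_def)
  have s: "?s \<in> JS k d ?U" by (rule glued_section[OF ce(1-3)]) (use nU in \<open>auto simp: nbhd_def\<close>)
  note ts = section_pull_smult[OF s nU t]
  let ?ts = "\<lambda>P\<in>Zp ?U. pb (?t (pr2 P)) \<odot>\<^bsub>JT k d P\<^esub> ?s P"
  have xb: "x1 \<in> deg2 (int 1, int 0)" "x2 \<in> deg2 (int 0, int 1)" using deg2_basic(1)[of 1] deg2_basic(3)[of 1] by simp_all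
  let ?W = "W \<inter> ({Q \<in> SP. x1 \<notin> Q} \<inter> {Q \<in> SP. x2 \<notin> Q})"
  have nW: "nbhd SR base_pt ?W"
    using S.zariski_open_basic[OF xb(1)] S.zariski_open_basic[OF xb(2)] base_pt_Proj base_pt_iff[OF xb(1)] base_pt_iff[OF xb(2)]
    by (intro S.nbhd_Int W(1)) (simp_all add: nbhd_def)
  \<comment> \<open>The fractions are compared close to the base point only;
    \<open>sections_agree\<close> takes care of the rest of the preimage.\<close>
  have "\<exists>V. nb V \<and> V \<subseteq> U \<inter> ?U \<and> (\<forall>Q\<in>Zp V. s Q = ?ts Q)"
  proof (rule sections_agree[OF U(2) ts U(1) nU nW])
    fix Q assume Q: "Q \<in> ?W" and QU: "Q \<in> Zp ?U"
    then have QS: "Q \<in> SP" "pr2 Q \<in> ?U" "Q \<in> W" "x2 \<notin> Q" by (auto simp: preimage_iff)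
    obtain H where H: "e \<notin> Q" "H \<in> Ipow (k + 1) Q"
      "quo a b = fadd (fmul (quo y2 x2) (quo c e)) H" using K QS(1) ab(4)[OF QS(3)] Q by blast
    note g = W(4)[OF QS(3)]
    have yx: "quo y2 x2 \<in> sqC Q" using sqO_mem[OF _ xb(2) QS(4), of y2] deg2_basic(4)[of 1] by simp
    have cem: "quo c e \<in> sqC Q" by (rule sqO_mem[OF ce(1,2) H(1)])
    have Hm: "H \<in> sqC Q" using ideal.Icarr[OF Ipow_ideal[OF QS(1)] H(2)] .
    note mm = S.twist_closed(2)[OF QS(1) cem cem yx]
    have "s Q = tau k d xc Q (fadd (fmul (quo y2 x2) (quo c e)) H)" unfolding W(5)[OF QS(3)] ab(5)[OF QS(3)] H(3) ..
    also have "\<dots> = tau k d xc Q (fmul (quo y2 x2) (quo c e))" unfolding tau_facts(2)[OF g mm Hm] tau_facts(4)[OF g H(2)]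
      by (rule abelian_monoid.r_zero) (use JT_group[OF QS(1)] tau_facts(1)[OF g mm] in \<open>simp_all add: abelian_group_def\<close>)
    also have "\<dots> = quo y2 x2 \<odot>\<^bsub>JT k d Q\<^esub> tau k d xc Q (quo c e)" by (rule tau_facts(3)[OF g yx cem, symmetric])
    also have "\<dots> = ?ts Q"
    proof -
      have "xc \<notin> pr2 Q" using QS(2) by simp
      then have "pb (lfrac yc xc) = quo y2 x2" by (rule pullback_frac(1)[OF ln_frac[OF proj2_Proj[OF QS(1)] yd xd]])
      then show ?thesis using QU QS(2) H(1) by (simp add: glued_def)
    qed
    finally show "s Q = ?ts Q" .
  qed
  then obtain V where V: "nb V" "V \<subseteq> U \<inter> ?U" "\<forall>Q\<in>Zp V. s Q = ?ts Q" by (elim exE conjE)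
  have xe: "x = gm k d ?U ?ts" unfolding U(3) by (rule germ_eqI[OF V(1,2)]) (use V(3) in simp)
  have "?t \<odot>\<^bsub>right_jets scale k d ?U\<^esub> ?s = ?ts" "?s \<in> carrier (right_jets scale k d ?U)"
    using s by (simp_all add: right_jets_def)
  then show ?thesis using nU t tpt xe by (intro CollectI exI[of _ ?U] exI[of _ ?t] exI[of _ ?s]) simp
qed

text \<open>The kernel is a subgroup and consists of generators already, so generating a subgroup
  adds nothing.\<close>

lemma fiber_kernel: "generate (add_monoid (Stk k d)) (fiber_gens k d) = {x \<in> StkC k d. germ_value k x = 0}"
proof -
  interpret G: abelian_group "Stk k d" by (rule stalk_group)
  let ?K = "{x \<in> StkC k d. germ_value k x = 0}"
  have z: "germ_value k \<zero>\<^bsub>Stk k d\<^esub> = 0" using germ_value_add[of "\<zero>\<^bsub>Stk k d\<^esub>" k d "\<zero>\<^bsub>Stk k d\<^esub>"] by simp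
  have "subgroup ?K (add_monoid (Stk k d))"
  proof (rule group.subgroupI[OF G.a_group])
    show "?K \<subseteq> carrier (add_monoid (Stk k d))" "?K \<noteq> {}" using z by auto
    fix x assume x: "x \<in> ?K"
    then have "germ_value k (\<ominus>\<^bsub>Stk k d\<^esub> x) = 0" using germ_value_add[of "\<ominus>\<^bsub>Stk k d\<^esub> x" k d x] z by (simp add: G.l_neg)
    then show "inv\<^bsub>add_monoid (Stk k d)\<^esub> x \<in> ?K" using x by (simp add: a_inv_def[symmetric])
    show "x \<otimes>\<^bsub>add_monoid (Stk k d)\<^esub> y \<in> ?K" if "y \<in> ?K" for y using x that by (simp add: germ_value_add)
  qed
  then have "generate (add_monoid (Stk k d)) (fiber_gens k d) \<subseteq> ?K"
    by (rule group.generate_subgroup_incl[OF G.a_group, rotated]) (use fiber_gens_kernel in blast)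
  moreover have "?K \<subseteq> generate (add_monoid (Stk k d)) (fiber_gens k d)" using kernel_fiber_gens by (blast intro: generate.incl)
  ultimately show ?thesis by blast
qed

abbreviation "Fib k d \<equiv> sheaf_fiber LR (\<lambda>c _. c) (right_jets scale k d) (right_jets_res scale) pt"

lemma fiber_model:
  defines "\<Phi> \<equiv> \<lambda>k A. germ_value k (SOME x. x \<in> A)"
  shows "fps_lin_iso (Fib k d) (\<Phi> k) (polys_upto k)"
    and "carrier (Fib k d) = (\<lambda>x. {y \<in> StkC k d. germ_value k y = germ_value k x}) ` StkC k d"
    and "\<And>x. x \<in> StkC k d \<Longrightarrow> \<Phi> k {y \<in> StkC k d. germ_value k y = germ_value k x} = germ_value k x"
proof -
  have "Fib k d = quot_module (Stk k d) {x \<in> StkC k d. germ_value k x = 0}" unfolding fiber_kernel[symmetric] by (simp add: sheaf_fiber_def)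
  note * = this and q = fps_lin_iso_quot[OF stalk_group germ_value_add germ_value_image refl germ_value_smult]
  show "fps_lin_iso (Fib k d) (\<Phi> k) (polys_upto k)" unfolding * \<Phi>_def by (rule q(1))
  show "carrier (Fib k d) = (\<lambda>x. {y \<in> StkC k d. germ_value k y = germ_value k x}) ` StkC k d" unfolding * by (rule q(2))
  show "\<Phi> k {y \<in> StkC k d. germ_value k y = germ_value k x} = germ_value k x" if "x \<in> StkC k d" for x
    unfolding \<Phi>_def by (rule q(3)[OF _ _ _ _ that])
qed

end

section \<open>Transport of structure\<close>

text \<open>The inverse \<open>h\<close> is carried along as a parameter, so that every fact about
  \<open>g\<close> becomes one about \<open>h\<close> through \<open>swap\<close>.\<close>

locale fun_graded_aut = fun_graded R
  for R :: "('x \<Rightarrow> 'f::field, 'd::ab_group_add) graded_ring" +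
  fixes g h :: "'x \<Rightarrow> 'x"
  assumes inverse: "\<And>x. g (h x) = x" "\<And>x. h (g x) = x"
    and car: "\<And>f. f \<in> carrier R \<Longrightarrow> (\<lambda>x. f (g x)) \<in> carrier R" "\<And>f. f \<in> carrier R \<Longrightarrow> (\<lambda>x. f (h x)) \<in> carrier R"
    and deg: "\<And>f m. f \<in> degree_part R m \<Longrightarrow> (\<lambda>x. f (g x)) \<in> degree_part R m"
      "\<And>f m. f \<in> degree_part R m \<Longrightarrow> (\<lambda>x. f (h x)) \<in> degree_part R m"
    and irr: "\<And>S f. S \<in> irrelevant_gens R \<Longrightarrow> f \<in> S \<Longrightarrow> (\<lambda>x. f (g x)) \<in> S"
      "\<And>S f. S \<in> irrelevant_gens R \<Longrightarrow> f \<in> S \<Longrightarrow> (\<lambda>x. f (h x)) \<in> S"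
begin

lemma swap: "fun_graded_aut R h g"
  by (rule fun_graded_aut.intro[OF fun_graded_axioms]) (unfold_locales, simp_all add: inverse car deg irr)

lemma translate: "translate g f = (\<lambda>x. f (h x))"
proof -
  have "inv_into UNIV g = h" using inverse by (intro inv_equality) auto
  then show ?thesis by (auto simp: translate_def)
qed

lemma point_act_iff: "f \<in> point_act g p \<longleftrightarrow> (\<lambda>x. f (g x)) \<in> p"
proof
  assume "f \<in> point_act g p"
  then show "(\<lambda>x. f (g x)) \<in> p" unfolding point_act_def by (auto simp: translate inverse)
next
  assume "(\<lambda>x. f (g x)) \<in> p"
  moreover have "f = translate g (\<lambda>x. f (g x))" by (simp add: translate inverse)
  ultimately show "f \<in> point_act g p" unfolding point_act_def by blast
qed

lemma point_act_inverse: "point_act h (point_act g p) = p"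
  by (rule Set.set_eqI) (simp add: fun_graded_aut.point_act_iff[OF swap] point_act_iff inverse)

lemma carrier_iff: "(\<lambda>x. f (g x)) \<in> carrier R \<longleftrightarrow> f \<in> carrier R"
  using car(1)[of f] car(2)[of "\<lambda>x. f (g x)"] by (auto simp: inverse)

lemma point_act_Proj: assumes p: "p \<in> Proj R" shows "point_act g p \<in> Proj R"
proof (rule ProjI)
  show "point_act g p \<subseteq> carrier R" using ProjD(1)[OF p] carrier_iff by (auto simp: point_act_iff)
  show "(\<lambda>_. 1) \<notin> point_act g p" "(\<lambda>_. 0) \<in> point_act g p" using ProjD(2,3)[OF p] by (simp_all add: point_act_iff)
  show "(\<lambda>x. a x + b x) \<in> point_act g p" if "a \<in> point_act g p" "b \<in> point_act g p" for a b
    using ProjD(4)[OF p] that by (simp add: point_act_iff)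
  show "(\<lambda>x. b x * a x) \<in> point_act g p" if "a \<in> point_act g p" "b \<in> carrier R" for a b
    using ProjD(5)[OF p _ car(1)[OF that(2)]] that(1) by (simp add: point_act_iff)
  show "a \<in> point_act g p \<or> b \<in> point_act g p" if "a \<in> carrier R" "b \<in> carrier R" "(\<lambda>x. a x * b x) \<in> point_act g p" for a b
    using ProjD(6)[OF p car(1)[OF that(1)] car(1)[OF that(2)]] that(3) by (auto simp: point_act_iff)
  show "\<not> S \<subseteq> point_act g p" if "S \<in> irrelevant_gens R" for S
  proof
    assume s: "S \<subseteq> point_act g p"
    have "f \<in> p" if f: "f \<in> S" for f
    proof -
      have "(\<lambda>x. f (h x)) \<in> point_act g p" using s irr(2)[OF \<open>S \<in> _\<close> f] by blast
      then show ?thesis by (simp add: point_act_iff inverse)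
    qed
    then show False using ProjD(8)[OF p that] by blast
  qed
  fix a J assume a: "a \<in> point_act g p" and J: "ideal J R" and sub: "point_act g p \<inter> homogeneous R \<subseteq> J"
  note J' = idealD[OF J]
  let ?J = "{f. (\<lambda>x. f (h x)) \<in> J}"
  have "ideal ?J R"
  proof (rule idealI')
    show "?J \<subseteq> carrier R"
    proof
      fix f assume "f \<in> ?J"
      then have "(\<lambda>x. f (h x)) \<in> carrier R" using J'(4) by blast
      from car(1)[OF this] show "f \<in> carrier R" by (simp add: inverse)
    qed
    show "(\<lambda>_. 0) \<in> ?J" using J'(1) by simp
    show "(\<lambda>x. c x + b x) \<in> ?J" if "c \<in> ?J" "b \<in> ?J" for c b
      using J'(2)[of "\<lambda>x. c (h x)" "\<lambda>x. b (h x)"] that by simp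
    show "(\<lambda>x. b x * c x) \<in> ?J" if "c \<in> ?J" "b \<in> carrier R" for c b
      using J'(3)[of "\<lambda>x. c (h x)" "\<lambda>x. b (h x)"] that car(2) by simp
  qed
  moreover have "p \<inter> homogeneous R \<subseteq> ?J"
  proof
    fix f assume f: "f \<in> p \<inter> homogeneous R"
    then obtain m where "f \<in> degree_part R m" by (auto simp: homogeneous_def)
    then have "(\<lambda>x. f (h x)) \<in> homogeneous R" using deg(2) by (auto simp: homogeneous_def)
    moreover have "(\<lambda>x. f (h x)) \<in> point_act g p" using f by (simp add: point_act_iff inverse)
    ultimately show "f \<in> ?J" using sub by blast
  qed
  ultimately have "p \<subseteq> ?J" by (rule Proj_minimal[OF p])
  then have "(\<lambda>x. a (g x)) \<in> ?J" using a by (auto simp: point_act_iff)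
  then show "a \<in> J" by (simp add: inverse)
qed

lemma point_act_open: assumes "zariski_open R U" shows "zariski_open R (point_act g ` U)"
proof -
  obtain T where T: "T \<subseteq> homogeneous R" "U = {p \<in> Proj R. \<not> T \<subseteq> p}" using assms by (auto simp: zariski_open_def)
  have "q \<in> point_act g ` U \<longleftrightarrow> q \<in> {p \<in> Proj R. \<not> translate g ` T \<subseteq> p}" for q
  proof -
    have q: "point_act g (point_act h q) = q" by (rule fun_graded_aut.point_act_inverse[OF swap])
    have "q \<in> point_act g ` U \<longleftrightarrow> point_act h q \<in> U" using q point_act_inverse by (metis imageI image_iff)
    also have "\<dots> \<longleftrightarrow> q \<in> Proj R \<and> \<not> T \<subseteq> point_act h q"
      unfolding T(2) using q point_act_Proj[of "point_act h q"] fun_graded_aut.point_act_Proj[OF swap, of q] by auto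
    also have "T \<subseteq> point_act h q \<longleftrightarrow> translate g ` T \<subseteq> q"
      by (auto simp: fun_graded_aut.point_act_iff[OF swap] translate)
    finally show ?thesis by simp
  qed
  then have "point_act g ` U = {p \<in> Proj R. \<not> translate g ` T \<subseteq> p}" by blast
  moreover have "translate g ` T \<subseteq> homogeneous R" using T(1) deg(2) by (fastforce simp: homogeneous_def translate)
  ultimately show ?thesis unfolding zariski_open_def by blast
qed

lemma point_act_image_iff: "q \<in> point_act g ` U \<longleftrightarrow> point_act h q \<in> U"
  using fun_graded_aut.point_act_inverse[OF swap] point_act_inverse by (metis imageI image_iff)

lemma fraction_act_fraction: "fraction_act g (fraction R a b) = fraction R (\<lambda>x. a (h x)) (\<lambda>x. b (h x))"
proof (rule Set.set_eqI)
  fix z :: "('x \<Rightarrow> 'f) \<times> ('x \<Rightarrow> 'f)"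
  obtain c e where z: "z = (c, e)" by (cases z)
  have "z \<in> fraction_act g (fraction R a b) \<longleftrightarrow> ((\<lambda>x. c (g x)), (\<lambda>x. e (g x))) \<in> fraction R a b"
  proof
    assume "z \<in> fraction_act g (fraction R a b)"
    then show "((\<lambda>x. c (g x)), (\<lambda>x. e (g x))) \<in> fraction R a b" unfolding fraction_act_def z by (auto simp: translate inverse)
  next
    assume "((\<lambda>x. c (g x)), (\<lambda>x. e (g x))) \<in> fraction R a b"
    moreover have "z = map_prod (translate g) (translate g) ((\<lambda>x. c (g x)), (\<lambda>x. e (g x)))" by (simp add: z translate inverse)
    ultimately show "z \<in> fraction_act g (fraction R a b)" unfolding fraction_act_def by blast
  qed
  also have "\<dots> \<longleftrightarrow> z \<in> fraction R (\<lambda>x. a (h x)) (\<lambda>x. b (h x))"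
  proof -
    have "(\<lambda>x. e (g x)) = (\<lambda>_. 0) \<longleftrightarrow> e = (\<lambda>_. 0)" by (metis inverse(1))
    moreover have "(\<forall>x. a x * e (g x) = c (g x) * b x) \<longleftrightarrow> (\<forall>x. a (h x) * e x = c x * b (h x))" by (metis inverse)
    ultimately show ?thesis unfolding z mem_fraction carrier_iff by simp
  qed
  finally show "z \<in> fraction_act g (fraction R a b) \<longleftrightarrow> z \<in> fraction R (\<lambda>x. a (h x)) (\<lambda>x. b (h x))" .
qed

lemma fraction_act_inverse: "fraction_act h (fraction_act g A) = A" for A :: "(('x \<Rightarrow> 'f) \<times> ('x \<Rightarrow> 'f)) set"
proof -
  have "map_prod (translate h) (translate h) (map_prod (translate g) (translate g) z) = z" for z :: "('x \<Rightarrow> 'f) \<times> ('x \<Rightarrow> 'f)"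
    by (cases z) (simp add: translate fun_graded_aut.translate[OF swap] inverse)
  then show ?thesis by (simp add: fraction_act_def image_image)
qed

lemma is_frac_act: "is_frac a b \<Longrightarrow> is_frac (\<lambda>x. a (h x)) (\<lambda>x. b (h x))"
  unfolding is_frac_def using car(2) by (metis inverse(2))

lemma fraction_act_mem: assumes "A \<in> carrier (twist_stalk R d p)" shows "fraction_act g A \<in> carrier (twist_stalk R d (point_act g p))"
proof -
  obtain a b m n where *: "A = fraction R a b" "a \<in> degree_part R m" "b \<in> degree_part R n" "m - n = d" "b \<notin> p"
    by (rule twist_memE[OF assms])
  show ?thesis unfolding *(1) fraction_act_fraction
    by (rule twist_memI[OF deg(2)[OF *(2)] deg(2)[OF *(3)] *(4)]) (simp add: point_act_iff inverse *(5))
qed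

lemma fraction_act_ops:
  assumes p: "p \<in> Proj R" and A: "A \<in> carrier (twist_stalk R d p)" and B: "B \<in> carrier (twist_stalk R d' p)"
  shows "fraction_act g (fraction_mult R A B) = fraction_mult R (fraction_act g A) (fraction_act g B)"
    "fraction_act g (fraction_add R A B) = fraction_add R (fraction_act g A) (fraction_act g B)"
proof -
  obtain a b c e where *: "A = fraction R a b" "is_frac a b" "B = fraction R c e" "is_frac c e" using twist_frac[OF p A] twist_frac[OF p B] by metis
  note i = *(2,4) is_frac_act[OF *(2)] is_frac_act[OF *(4)]
  show "fraction_act g (fraction_mult R A B) = fraction_mult R (fraction_act g A) (fraction_act g B)"
    "fraction_act g (fraction_add R A B) = fraction_add R (fraction_act g A) (fraction_act g B)"
    unfolding *(1,3) frac_mult[OF i(1,2)] frac_add[OF i(1,2)] fraction_act_fraction frac_mult[OF i(3,4)] frac_add[OF i(3,4)] by (rule refl)+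
qed

end

text \<open>An automorphism moves points, so the maps it induces on stalks connect modules over
  different local rings; \<open>\<rho>\<close> is the accompanying map of rings.\<close>

definition semilinear_on :: "('r, 'y) ring_scheme \<Rightarrow> ('r \<Rightarrow> 's) \<Rightarrow> ('r, 'm, 'z) module_scheme \<Rightarrow> ('s, 'n, 'w) module_scheme \<Rightarrow> ('m \<Rightarrow> 'n) \<Rightarrow> bool" where
  "semilinear_on R \<rho> M M' \<phi> \<longleftrightarrow> (\<forall>x\<in>carrier M. \<phi> x \<in> carrier M') \<and>
     (\<forall>x\<in>carrier M. \<forall>y\<in>carrier M. \<phi> (x \<oplus>\<^bsub>M\<^esub> y) = \<phi> x \<oplus>\<^bsub>M'\<^esub> \<phi> y) \<and>
     (\<forall>r\<in>carrier R. \<forall>x\<in>carrier M. \<phi> (r \<odot>\<^bsub>M\<^esub> x) = \<rho> r \<odot>\<^bsub>M'\<^esub> \<phi> x)"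

text \<open>Maps in both directions are demanded because the action on classes takes images of sets,
  and the image of a coset is a whole coset only with preimages at hand.\<close>

locale tensor_transport = A: tensor_data R M N + B: tensor_data R' M' N'
  for R :: "('r, 'y) ring_scheme" and M :: "('r, 'm, 'z) module_scheme" and N :: "('r, 'n, 'w) module_scheme"
    and R' :: "('r, 'y) ring_scheme" and M' :: "('r, 'm, 'z) module_scheme" and N' :: "('r, 'n, 'w) module_scheme" +
  fixes \<rho> \<rho>' \<phi> \<phi>' \<psi> \<psi>'
  assumes ring_map: "\<And>r. r \<in> carrier R \<Longrightarrow> \<rho> r \<in> carrier R'" "\<And>r. r \<in> carrier R' \<Longrightarrow> \<rho>' r \<in> carrier R"
    and map: "semilinear_on R \<rho> M M' \<phi>" "semilinear_on R \<rho> N N' \<psi>"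
    and map': "semilinear_on R' \<rho>' M' M \<phi>'" "semilinear_on R' \<rho>' N' N \<psi>'"
    and inv: "\<And>x. x \<in> carrier M' \<Longrightarrow> \<phi> (\<phi>' x) = x" "\<And>x. x \<in> carrier N' \<Longrightarrow> \<psi> (\<psi>' x) = x"
begin

lemma class_image:
  "tensor_map \<phi> \<psi> (rel_class A.gens A.rels c) = rel_class B.gens B.rels (gen_map (map_prod \<phi> \<psi>) c)"
  unfolding tensor_map_def
proof (rule image_rel_class[OF A.presentation_axioms B.presentation_axioms, where m' = "map_prod \<phi>' \<psi>'"])
  show "gen_map (map_prod \<phi> \<psi>) e \<in> span_rel B.gens B.rels" if "e \<in> A.rels" for e
    by (rule B.span_incl, rule tensor_relations_map[where \<rho> = \<rho>, OF that]) (use ring_map map in \<open>auto simp: semilinear_on_def\<close>)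
  show "gen_map (map_prod \<phi>' \<psi>') e \<in> span_rel A.gens A.rels" if "e \<in> B.rels" for e
    by (rule A.span_incl, rule tensor_relations_map[where \<rho> = \<rho>', OF that]) (use ring_map map' in \<open>auto simp: semilinear_on_def\<close>)
qed (use map map' inv in \<open>auto simp: semilinear_on_def\<close>)

lemma pure_image:
  "tensor_map \<phi> \<psi> (pure (presented_module A.gens A.rels act) x y) = pure (presented_module B.gens B.rels act') (\<phi> x) (\<psi> y)"
  unfolding A.pure_class B.pure_class class_image by simp

text \<open>The ring \<open>T\<close> is the one whose scalars act on the result. For a base change
  it differs from the ring \<open>R\<close> over which the tensor product is formed.\<close>

lemma semilinear_image:
  assumes act: "\<And>s c. s \<in> carrier T \<Longrightarrow> s \<odot>\<^bsub>A.act_module act\<^esub> rel_class A.gens A.rels c =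
      rel_class A.gens A.rels (gen_map (\<lambda>(x, y). (act s x, y)) c)"
    and act': "\<And>s c. s \<in> carrier T \<Longrightarrow> \<sigma> s \<odot>\<^bsub>B.act_module act'\<^esub> rel_class B.gens B.rels c =
      rel_class B.gens B.rels (gen_map (\<lambda>(x, y). (act' (\<sigma> s) x, y)) c)"
    and comm: "\<And>s x. s \<in> carrier T \<Longrightarrow> x \<in> carrier M \<Longrightarrow> \<phi> (act s x) = act' (\<sigma> s) (\<phi> x)"
  shows "semilinear_on T \<sigma> (A.act_module act)
    (B.act_module act') (tensor_map \<phi> \<psi>)"
  unfolding semilinear_on_def A.presented_carrier B.presented_carrier
proof (intro conjI ballI; elim imageE; simp only: class_image A.presented_add B.presented_add frag_extend_add)
  fix c :: "'m \<times> 'n \<Rightarrow>\<^sub>0 int" assume c: "c \<in> {c. supp c \<subseteq> A.gens}"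
  then have c': "supp c \<subseteq> A.gens" by simp
  show "rel_class B.gens B.rels (gen_map (map_prod \<phi> \<psi>) c) \<in> rel_class B.gens B.rels ` {c. supp c \<subseteq> B.gens}"
    using keys_frag_extend_of[OF c', of "map_prod \<phi> \<psi>" B.gens] map by (auto simp: semilinear_on_def intro!: imageI)
  fix s assume s: "s \<in> carrier T"
  have "gen_map (map_prod \<phi> \<psi>) (gen_map (\<lambda>(x, y). (act s x, y)) c) =
    gen_map (\<lambda>(x, y). (act' (\<sigma> s) x, y)) (gen_map (map_prod \<phi> \<psi>) c)"
    by (rule frag_induction[OF c']) (auto simp: frag_extend_diff comm[OF s])
  then show "tensor_map \<phi> \<psi> (s \<odot>\<^bsub>A.act_module act\<^esub> rel_class A.gens A.rels c) =
    \<sigma> s \<odot>\<^bsub>B.act_module act'\<^esub> rel_class B.gens B.rels (gen_map (map_prod \<phi> \<psi>) c)"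
    unfolding act[OF s] act'[OF s] class_image by simp
qed

lemma inverse_image:
  assumes "A \<in> carrier (presented_module B.gens B.rels act)"
    and "\<And>c. tensor_map \<phi>' \<psi>' (rel_class B.gens B.rels c) = rel_class A.gens A.rels (gen_map (map_prod \<phi>' \<psi>') c)"
  shows "tensor_map \<phi> \<psi> (tensor_map \<phi>' \<psi>' A) = A"
proof -
  obtain c where c: "A = rel_class B.gens B.rels c" "supp c \<subseteq> B.gens" using assms(1) by (auto simp: B.presented_carrier)
  have "gen_map (map_prod \<phi> \<psi>) (gen_map (map_prod \<phi>' \<psi>') c) = c"
    by (rule frag_induction[OF c(2)]) (auto simp: frag_extend_diff inv)
  then show ?thesis unfolding c(1) assms(2) class_image by simp
qed

end

section \<open>Transport of the jet stalks by the stabilizer\<close>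

context plane begin

abbreviation "iv \<equiv> inv_into (UNIV :: 'v set)"
abbreviation "dbl \<equiv> \<lambda>g :: 'v \<Rightarrow> 'v. map_prod g g"

lemma aut_linear:
  assumes "g \<in> stab" "linfun l" shows "linfun (\<lambda>w. l (g w))"
proof -
  interpret l: Vector_Spaces.linear scale times l by (rule assms(2))
  show ?thesis by (rule linear_funcI) (simp_all add: stab_coords(4,5)[OF assms(1)] l.add l.scale)
qed

lemma aut_poly:
  assumes g: "g \<in> stab"
  shows "f \<in> poly1 \<Longrightarrow> (\<lambda>w. f (g w)) \<in> poly1" "f' \<in> poly2 \<Longrightarrow> (\<lambda>z. f' (dbl g z)) \<in> poly2"
proof -
  note x = poly_functions.linear[OF aut_linear[OF g xc_linear(1)]] poly_functions.linear[OF aut_linear[OF g xc_linear(2)]]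
  show "f \<in> poly1 \<Longrightarrow> (\<lambda>w. f (g w)) \<in> poly1" by (induction rule: poly1_induct) (auto intro: x poly_functions.intros)
  show "f' \<in> poly2 \<Longrightarrow> (\<lambda>z. f' (dbl g z)) \<in> poly2"
    by (induction rule: poly2_induct) (auto intro: poly1_comp_fst[OF x(1)] poly1_comp_fst[OF x(2)] poly1_comp_snd[OF x(1)]
        poly1_comp_snd[OF x(2)] poly_functions.intros)
qed

lemma aut_deg:
  assumes g: "g \<in> stab"
  shows "f \<in> deg1 m \<Longrightarrow> (\<lambda>w. f (g w)) \<in> deg1 m" "f' \<in> deg2 n \<Longrightarrow> (\<lambda>z. f' (dbl g z)) \<in> deg2 n"
proof -
  note sc = stab_coords(5)[OF g]
  show "(\<lambda>w. f (g w)) \<in> deg1 m" if f: "f \<in> deg1 m"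
  proof -
    obtain i where "m = int i" "f \<in> poly1" "\<And>c x. f (scale c x) = c ^ i * f x" by (rule deg1E[OF f]) (rule that)
    then show ?thesis using aut_poly(1)[OF g] by (auto intro!: deg1I simp: sc)
  qed
  show "(\<lambda>z. f' (dbl g z)) \<in> deg2 n" if f: "f' \<in> deg2 n"
  proof -
    obtain i j where "n = (int i, int j)" "f' \<in> poly2" "\<And>c x y. f' (scale c x, y) = c ^ i * f' (x, y)"
      "\<And>c x y. f' (x, scale c y) = c ^ j * f' (x, y)" by (rule deg2E[OF f]) (rule that)
    then show ?thesis using aut_poly(2)[OF g] by (auto intro!: deg2I simp: sc)
  qed
qed

lemma stab_aut:
  assumes g: "g \<in> stab"
  shows "fun_graded_aut SR (dbl g) (dbl (iv g))" "fun_graded_aut LR g (iv g)"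
proof -
  note h = stab_inv(1)[OF g] and i = stab_inv(3,4)[OF g]
  have irr2: "(\<lambda>x. f (dbl h x)) \<in> T" if "T \<in> irrelevant_gens SR" "f \<in> T" "h \<in> stab" for T f h
    using that aut_linear[OF that(3)] by (fastforce simp: square_ring_def comp_def image_iff)
  have irr1: "(\<lambda>x. f (h x)) \<in> T" if "T \<in> irrelevant_gens LR" "f \<in> T" "h \<in> stab" for T f h
    using that aut_linear[OF that(3)] by (auto simp: line_ring_def)
  show "fun_graded_aut SR (dbl g) (dbl (iv g))" by (rule fun_graded_aut.intro[OF S.fun_graded_axioms], unfold_locales)
      (simp_all add: i carriers aut_poly[OF g] aut_poly[OF h] aut_deg[OF g] aut_deg[OF h] irr2 g h prod_eq_iff)
  show "fun_graded_aut LR g (iv g)" by (rule fun_graded_aut.intro[OF L.fun_graded_axioms], unfold_locales)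
      (simp_all add: i carriers aut_poly[OF g] aut_poly[OF h] aut_deg[OF g] aut_deg[OF h] irr1 g h)
qed

lemma iv_iv: "g \<in> stab \<Longrightarrow> iv (iv g) = g"
  using stab_inv(2) inv_inv_eq by blast

lemma proj2_act: assumes g: "g \<in> stab" shows "pr2 (point_act (dbl g) Q) = point_act g (pr2 Q)"
proof (rule Set.set_eqI)
  interpret A2: fun_graded_aut SR "dbl g" "dbl (iv g)" by (rule stab_aut(1)[OF g])
  interpret A1: fun_graded_aut LR g "iv g" by (rule stab_aut(2)[OF g])
  fix f show "f \<in> pr2 (point_act (dbl g) Q) \<longleftrightarrow> f \<in> point_act g (pr2 Q)"
    unfolding A1.point_act_iff proj2_iff A2.point_act_iff using A1.carrier_iff[of f] by (simp add: carriers)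
qed

lemma base_pt_act: assumes g: "g \<in> stab" shows "point_act (dbl g) base_pt = base_pt"
proof (rule Set.set_eqI)
  interpret A2: fun_graded_aut SR "dbl g" "dbl (iv g)" by (rule stab_aut(1)[OF g])
  have ln: "g w \<in> line \<longleftrightarrow> w \<in> line" "iv g w \<in> line \<longleftrightarrow> w \<in> line" for w
    using stab_coords(1)[OF g] stab_coords(3)[OF g, of w] stab_coords(1)[OF stab_inv(1)[OF g]] stab_coords(3)[OF stab_inv(1)[OF g], of w]
    by (auto simp: line_def)
  fix f :: "'v \<times> 'v \<Rightarrow> 'f"
  have "(\<forall>x\<in>line. \<forall>y\<in>line. f (g x, g y) = 0) \<longleftrightarrow> (\<forall>x\<in>line. \<forall>y\<in>line. f (x, y) = 0)"
    using ln stab_inv(3)[OF g] by metis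
  then show "f \<in> point_act (dbl g) base_pt \<longleftrightarrow> f \<in> base_pt"
    unfolding A2.point_act_iff base_pt_def using A2.carrier_iff[of f] by (simp add: carriers)
qed

lemma pt_act: assumes g: "g \<in> stab" shows "point_act g pt = pt"
  unfolding line_point_eq proj2_act[OF g, symmetric] base_pt_act[OF g] ..

lemma pb_act:
  assumes g: "g \<in> stab" and p: "p \<in> LP" and r: "r \<in> carrier (lnO d p)"
  shows "pb (fraction_act g r) = fraction_act (dbl g) (pb r)"
proof -
  interpret A2: fun_graded_aut SR "dbl g" "dbl (iv g)" by (rule stab_aut(1)[OF g])
  interpret A1: fun_graded_aut LR g "iv g" by (rule stab_aut(2)[OF g])
  obtain a b where *: "r = lfrac a b" "L.is_frac a b" using L.twist_frac[OF p r] by metis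
  show ?thesis unfolding *(1) A1.fraction_act_fraction pullback_frac(1)[OF *(2)] pullback_frac(1)[OF A1.is_frac_act[OF *(2)]] A2.fraction_act_fraction
    by simp
qed

text \<open>The diagonal is stable under the diagonal action, so generators of the ideal go to
  generators, and products and sums follow.\<close>

lemma Ipow_act:
  assumes g: "g \<in> stab" and Q: "Q \<in> SP" and F: "F \<in> Ipow j Q"
  shows "fraction_act (dbl g) F \<in> Ipow j (point_act (dbl g) Q)"
proof -
  interpret A2: fun_graded_aut SR "dbl g" "dbl (iv g)" by (rule stab_aut(1)[OF g])
  have Ic: "F \<in> sqC Q" if "F \<in> Ipow i Q" for i F using ideal.Icarr[OF Ipow_ideal[OF Q] that] .
  show ?thesis using F
  proof (induction j arbitrary: F)
    case 0
    then show ?case unfolding Ipow_0 by (rule A2.fraction_act_mem)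
  next
    case (Suc j)
    from Suc.prems show ?case unfolding Ipow_Suc
    proof (induction rule: ideal_prod.induct)
      case (prod i f)
      obtain a b m where *: "i = quo a b" "a \<in> deg2 m" "b \<in> deg2 m" "b \<notin> Q" "\<And>x. a (x, x) = 0"
        using prod(1) unfolding diagonal_stalk_def by blast
      have i: "i \<in> sqC Q" unfolding *(1) by (rule sqO_mem[OF *(2-4)])
      have "fraction_act (dbl g) i \<in> diagonal_stalk scale (point_act (dbl g) Q)" unfolding *(1) A2.fraction_act_fraction
        by (rule diagonal_stalkI[OF A2.deg(2)[OF *(2)] A2.deg(2)[OF *(3)]]) (simp_all add: A2.point_act_iff A2.inverse *(4,5) stab_inv[OF g])
      from ideal_prod.prod[OF this Suc.IH[OF prod(2)], of "sqO (point_act (dbl g) Q)"] show ?case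
        using A2.fraction_act_ops(1)[OF Q i Ic[OF prod(2)]] by (simp add: S.twist_ops)
    next
      case (sum s t)
      have "s \<in> sqC Q" "t \<in> sqC Q" using sum(1,2) Ic[of _ "Suc j"] unfolding Ipow_Suc by blast+
      then show ?case using ideal_prod.sum[OF sum(3,4)] A2.fraction_act_ops(2)[OF Q] by (simp add: S.twist_ops)
    qed
  qed
qed

lemma Jcos_act:
  assumes g: "g \<in> stab" and Q: "Q \<in> SP" and F: "F \<in> sqC Q"
  shows "fraction_act (dbl g) ` Jcos k Q F = Jcos k (point_act (dbl g) Q) (fraction_act (dbl g) F)"
proof -
  interpret A2: fun_graded_aut SR "dbl g" "dbl (iv g)" by (rule stab_aut(1)[OF g])
  let ?Q = "point_act (dbl g) Q"
  have Q': "?Q \<in> SP" by (rule A2.point_act_Proj[OF Q])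
  have Ic: "H \<in> sqC Q" if "H \<in> Ipow i Q" for i H using ideal.Icarr[OF Ipow_ideal[OF Q] that] .
  have J: "Jcos k P G = (\<lambda>H. fadd H G) ` Ipow (k + 1) P" for P G by (auto simp: a_r_coset_def' S.twist_ops)
  have eq: "fraction_act (dbl g) (fadd H F) = fadd (fraction_act (dbl g) H) (fraction_act (dbl g) F)"
    if "H \<in> Ipow (k + 1) Q" for H by (rule A2.fraction_act_ops(2)[OF Q Ic[OF that] F])
  have im: "fraction_act (dbl g) ` Ipow (k + 1) Q = Ipow (k + 1) ?Q"
  proof (intro equalityI subsetI)
    fix H assume "H \<in> fraction_act (dbl g) ` Ipow (k + 1) Q"
    then show "H \<in> Ipow (k + 1) ?Q" by (elim imageE) (simp only: Ipow_act[OF g Q])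
  next
    fix H assume H: "H \<in> Ipow (k + 1) ?Q"
    have "fraction_act (dbl (iv g)) H \<in> Ipow (k + 1) (point_act (dbl (iv g)) ?Q)" by (rule Ipow_act[OF stab_inv(1)[OF g] Q' H])
    then have "fraction_act (dbl (iv g)) H \<in> Ipow (k + 1) Q" unfolding A2.point_act_inverse .
    moreover have "H = fraction_act (dbl g) (fraction_act (dbl (iv g)) H)" by (simp only: fun_graded_aut.fraction_act_inverse[OF A2.swap])
    ultimately show "H \<in> fraction_act (dbl g) ` Ipow (k + 1) Q" by (rule rev_image_eqI)
  qed
  have "fraction_act (dbl g) ` Jcos k Q F = (\<lambda>H. fadd (fraction_act (dbl g) H) (fraction_act (dbl g) F)) ` Ipow (k + 1) Q"
    unfolding J image_image by (rule image_cong[OF refl eq])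
  also have "\<dots> = (\<lambda>H. fadd H (fraction_act (dbl g) F)) ` fraction_act (dbl g) ` Ipow (k + 1) Q" by (simp only: image_image)
  finally show ?thesis unfolding im J .
qed

lemma PB_smult_class:
  fixes d :: int
  assumes Q: "Q \<in> SP" and s: "s \<in> sqC Q"
  defines "G \<equiv> carrier (bcM Q) \<times> lnC d Q"
    and "E \<equiv> tensor_relations (lnO 0 (pr2 Q)) (bcM Q) (lnO d (pr2 Q))"
  shows "s \<odot>\<^bsub>presented_module G E (\<lambda>s (x, y). (s \<otimes>\<^bsub>sqO Q\<^esub> x, y))\<^esub> rel_class G E c =
    rel_class G E (gen_map (\<lambda>(x, y). (s \<otimes>\<^bsub>sqO Q\<^esub> x, y)) c)"
proof -
  note td = pullback_data[OF Q, of d]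
  show ?thesis unfolding G_def E_def by (rule presentation.presented_smult[OF tensor_presentation_of[OF td]], rule tensor_data.smult_rel[OF td])
      (rule bc_action(1)[OF Q s] bc_action(2)[OF Q s] bc_action(3)[OF Q s]; assumption)+
qed

abbreviation "PBact g \<equiv> tensor_map (fraction_act (dbl g)) (fraction_act g)"

lemma PB_transport:
  assumes g: "g \<in> stab" and Q: "Q \<in> SP"
  defines "Q' \<equiv> point_act (dbl g) Q"
  shows "tensor_transport (lnO 0 (pr2 Q)) (bcM Q) (lnO d (pr2 Q))
    (lnO 0 (pr2 Q')) (bcM Q') (lnO d (pr2 Q'))
    (fraction_act g) (fraction_act (iv g)) (fraction_act (dbl g)) (fraction_act (dbl (iv g))) (fraction_act g) (fraction_act (iv g))"
proof -
  have sl: "semilinear_on (lnO 0 (pr2 Q)) (fraction_act g) (bcM Q) (bcM (point_act (dbl g) Q)) (fraction_act (dbl g))"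
      "semilinear_on (lnO 0 (pr2 Q)) (fraction_act g) (lnO d (pr2 Q)) (lnO d (pr2 (point_act (dbl g) Q))) (fraction_act g)"
      "\<And>r. r \<in> lnC 0 Q \<Longrightarrow> fraction_act g r \<in> carrier (lnO 0 (pr2 (point_act (dbl g) Q)))"
    if g: "g \<in> stab" and Q: "Q \<in> SP" for g Q
  proof -
    interpret A2: fun_graded_aut SR "dbl g" "dbl (iv g)" by (rule stab_aut(1)[OF g])
    interpret A1: fun_graded_aut LR g "iv g" by (rule stab_aut(2)[OF g])
    note p = proj2_Proj[OF Q]
    show "semilinear_on (lnO 0 (pr2 Q)) (fraction_act g) (bcM Q) (bcM (point_act (dbl g) Q)) (fraction_act (dbl g))" unfolding semilinear_on_def
      using A2.fraction_act_mem[of _ 0 Q] A2.fraction_act_ops[OF Q, of _ 0 _ 0] pullback_local[OF Q] pb_act[OF g p] by (simp add: S.twist_ops)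
    show "semilinear_on (lnO 0 (pr2 Q)) (fraction_act g) (lnO d (pr2 Q)) (lnO d (pr2 (point_act (dbl g) Q))) (fraction_act g)"
      unfolding semilinear_on_def proj2_act[OF g] using A1.fraction_act_mem[of _ d "pr2 Q"] A1.fraction_act_ops[OF p] by (simp add: L.twist_ops)
    show "fraction_act g r \<in> carrier (lnO 0 (pr2 (point_act (dbl g) Q)))" if "r \<in> lnC 0 Q" for r
      unfolding proj2_act[OF g] by (rule A1.fraction_act_mem[OF that])
  qed
  interpret A2: fun_graded_aut SR "dbl g" "dbl (iv g)" by (rule stab_aut(1)[OF g])
  interpret A1: fun_graded_aut LR g "iv g" by (rule stab_aut(2)[OF g])
  have Q': "Q' \<in> SP" unfolding Q'_def by (rule A2.point_act_Proj[OF Q])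
  have QQ: "point_act (dbl (iv g)) Q' = Q" unfolding Q'_def by (rule A2.point_act_inverse)
  note a = sl[OF g Q, folded Q'_def] and b = sl[OF stab_inv(1)[OF g] Q', unfolded QQ]
  show ?thesis by (intro tensor_transport.intro tensor_transport_axioms.intro pullback_data Q Q' a b)
      (assumption | simp only: fun_graded_aut.fraction_act_inverse[OF A2.swap] fun_graded_aut.fraction_act_inverse[OF A1.swap])+
qed

lemma PBact:
  assumes g: "g \<in> stab" and Q: "Q \<in> SP"
  shows "semilinear_on (sqO Q) (fraction_act (dbl g)) (PB d Q) (PB d (point_act (dbl g) Q)) (PBact g)"
    "\<And>A. A \<in> carrier (PB d (point_act (dbl g) Q)) \<Longrightarrow> PBact g (PBact (iv g) A) = A"
    "PBact g (pure (PB d Q) x y) = pure (PB d (point_act (dbl g) Q)) (fraction_act (dbl g) x) (fraction_act g y)"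
proof -
  interpret A2: fun_graded_aut SR "dbl g" "dbl (iv g)" by (rule stab_aut(1)[OF g])
  let ?Q = "point_act (dbl g) Q"
  have Q': "?Q \<in> SP" by (rule A2.point_act_Proj[OF Q])
  note T = PB_transport[OF g Q, of d] and T' = PB_transport[OF stab_inv(1)[OF g] Q', of d, unfolded A2.point_act_inverse iv_iv[OF g]]
  show "semilinear_on (sqO Q) (fraction_act (dbl g)) (PB d Q) (PB d ?Q) (PBact g)" unfolding PB_eq
  proof (rule tensor_transport.semilinear_image[OF T PB_smult_class[OF Q] PB_smult_class[OF Q']])
    show "fraction_act (dbl g) s \<in> sqC ?Q" if "s \<in> sqC Q" for s by (rule A2.fraction_act_mem[OF that])
    show "fraction_act (dbl g) (s \<otimes>\<^bsub>sqO Q\<^esub> x) = fraction_act (dbl g) s \<otimes>\<^bsub>sqO ?Q\<^esub> fraction_act (dbl g) x"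
      if "s \<in> sqC Q" "x \<in> carrier (bcM Q)" for s x using A2.fraction_act_ops(1)[OF Q that(1), of x 0] that(2) by (simp add: S.twist_ops)
  qed
  show "PBact g (PBact (iv g) A) = A" if "A \<in> carrier (PB d ?Q)" for A
    by (rule tensor_transport.inverse_image[OF T that[unfolded PB_eq]]) (rule tensor_transport.class_image[OF T'])
  show "PBact g (pure (PB d Q) x y) = pure (PB d ?Q) (fraction_act (dbl g) x) (fraction_act g y)"
    unfolding PB_eq by (rule tensor_transport.pure_image[OF T])
qed

lemma jet_act_pure:
  assumes g: "g \<in> stab" and Q: "Q \<in> SP"
  shows "jet_act g (pure (JT k d Q) A B) = pure (JT k d (point_act (dbl g) Q)) (fraction_act (dbl g) ` A) (PBact g B)"
proof -
  have sl: "semilinear_on (sqO Q) (fraction_act (dbl g)) (TS k Q) (TS k (point_act (dbl g) Q)) ((`) (fraction_act (dbl g)))"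
    if g: "g \<in> stab" and Q: "Q \<in> SP" for g Q
  proof -
    interpret A2: fun_graded_aut SR "dbl g" "dbl (iv g)" by (rule stab_aut(1)[OF g])
    have Q': "point_act (dbl g) Q \<in> SP" by (rule A2.point_act_Proj[OF Q])
    note m = A2.fraction_act_mem[of _ 0 Q] and J = Jcos_act[OF g Q]
    show ?thesis unfolding semilinear_on_def
    proof (intro conjI ballI)
      fix A assume "A \<in> carrier (TS k Q)"
      then obtain F where F: "A = Jcos k Q F" "F \<in> sqC Q" unfolding thick_stalk(1)[OF Q] by (rule imageE)
      show "fraction_act (dbl g) ` A \<in> carrier (TS k (point_act (dbl g) Q))"
        unfolding F(1) J[OF F(2)] thick_stalk(1)[OF Q'] by (rule imageI) (rule m[OF F(2)])
      show "fraction_act (dbl g) ` (A \<oplus>\<^bsub>TS k Q\<^esub> B) =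
        fraction_act (dbl g) ` A \<oplus>\<^bsub>TS k (point_act (dbl g) Q)\<^esub> fraction_act (dbl g) ` B"
        if B: "B \<in> carrier (TS k Q)" for B
      proof -
        obtain G where G: "B = Jcos k Q G" "G \<in> sqC Q" using B unfolding thick_stalk(1)[OF Q] by (rule imageE)
        show ?thesis unfolding F(1) G(1) J[OF F(2)] J[OF G(2)] thick_stalk(2)[OF Q F(2) G(2)] thick_stalk(2)[OF Q' m[OF F(2)] m[OF G(2)]]
            J[OF S.twist_closed(1)[OF Q F(2) G(2) F(2)]] A2.fraction_act_ops(2)[OF Q F(2) G(2)] ..
      qed
      show "fraction_act (dbl g) ` (r \<odot>\<^bsub>TS k Q\<^esub> A) =
        fraction_act (dbl g) r \<odot>\<^bsub>TS k (point_act (dbl g) Q)\<^esub> fraction_act (dbl g) ` A"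
        if r: "r \<in> sqC Q" for r unfolding F(1) J[OF F(2)] thick_stalk(3)[OF Q r F(2)] thick_stalk(3)[OF Q' m[OF r] m[OF F(2)]]
            J[OF S.twist_closed(2)[OF Q F(2) F(2) r]] A2.fraction_act_ops(1)[OF Q r F(2)] ..
    qed
  qed
  interpret A2: fun_graded_aut SR "dbl g" "dbl (iv g)" by (rule stab_aut(1)[OF g])
  let ?Q = "point_act (dbl g) Q"
  have Q': "?Q \<in> SP" by (rule A2.point_act_Proj[OF Q])
  have QQ: "point_act (dbl (iv g)) ?Q = Q" by (rule A2.point_act_inverse)
  note h = stab_inv(1)[OF g]
  have ii: "fraction_act (dbl g) ` fraction_act (dbl (iv g)) ` A = A" for A :: "('f, 'v) sqfrac set"
    by (simp add: image_image fun_graded_aut.fraction_act_inverse[OF A2.swap])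
  have T: "tensor_transport (sqO Q) (TS k Q) (PB d Q) (sqO ?Q) (TS k ?Q) (PB d ?Q)
    (fraction_act (dbl g)) (fraction_act (dbl (iv g))) ((`) (fraction_act (dbl g))) ((`) (fraction_act (dbl (iv g)))) (PBact g) (PBact (iv g))"
  proof (intro tensor_transport.intro tensor_transport_axioms.intro jet_data Q Q' sl[OF g Q] sl[OF h Q', unfolded QQ]
        PBact(1)[OF g Q] PBact(1)[OF h Q', unfolded QQ] ii PBact(2)[OF g Q])
    show "fraction_act (dbl g) r \<in> sqC ?Q" if "r \<in> sqC Q" for r by (rule A2.fraction_act_mem[OF that])
    show "fraction_act (dbl (iv g)) r \<in> sqC Q" if "r \<in> sqC ?Q" for r using fun_graded_aut.fraction_act_mem[OF A2.swap that] unfolding QQ .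
  qed assumption+
  show ?thesis unfolding jet_act_def JT_eq by (rule tensor_transport.pure_image[OF T])
qed

lemma good_lin_act:
  assumes g: "g \<in> stab" and l: "good_lin l Q" shows "good_lin (\<lambda>w. l (iv g w)) (point_act (dbl g) Q)"
proof -
  interpret A2: fun_graded_aut SR "dbl g" "dbl (iv g)" by (rule stab_aut(1)[OF g])
  interpret A1: fun_graded_aut LR g "iv g" by (rule stab_aut(2)[OF g])
  show ?thesis using l aut_linear[OF stab_inv(1)[OF g]] A2.point_act_Proj
    unfolding good_lin_def proj2_act[OF g] A1.point_act_iff by (simp add: A1.inverse)
qed

text \<open>The trivializing form is moved together with the point. Since \<open>tau\<close> takes
  the form as a parameter, no change of trivialization has to be computed here; it is accounted for
  once, by the value at \<open>u\<close> in \<open>theta\<close>.\<close>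

lemma jet_act_tau:
  assumes g: "g \<in> stab" and l: "good_lin l Q" and F: "F \<in> sqC Q"
  shows "jet_act g (tau k d l Q F) = tau k d (\<lambda>w. l (iv g w)) (point_act (dbl g) Q) (fraction_act (dbl g) F)"
proof -
  interpret A2: fun_graded_aut SR "dbl g" "dbl (iv g)" by (rule stab_aut(1)[OF g])
  interpret A1: fun_graded_aut LR g "iv g" by (rule stab_aut(2)[OF g])
  have Q: "Q \<in> SP" using l by (simp add: good_lin_def)
  show ?thesis
    unfolding tau_def jet_act_pure[OF g Q] Jcos_act[OF g Q F] PBact(3)[OF g Q] xpow_def A2.fraction_act_fraction A1.fraction_act_fraction ..
qed

end

section \<open>The action on the fiber\<close>

text \<open>Links a substitution evaluated at points with the composition of formal series: clearing
  both by the same power of \<open>1 - e t\<close> gives one and the same polynomial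
  \<open>q\<close>. Identities between functions can thus be turned into identities between
  series.\<close>

lemma fractional_linear_numerator:
  fixes p :: "'f::field poly" and c e :: 'f
  defines "D \<equiv> 1 - fps_const e * fps_X" and "\<mu> \<equiv> fps_const c * fps_X * inverse (1 - fps_const e * fps_X)"
  shows "\<exists>N0. \<forall>N\<ge>N0. \<exists>q. (\<forall>t. 1 - e * t \<noteq> 0 \<longrightarrow> poly q t = (1 - e * t) ^ N * poly p (c * t / (1 - e * t))) \<and>
    fps_of_poly q = D ^ N * (fps_of_poly p oo \<mu>)"
proof (induction p rule: pCons_induct)
  case 0
  show ?case by (intro exI[of _ 0] allI impI exI[of _ "0 :: 'f poly"]) simp
next
  case (pCons a p)
  then obtain N0 where N0: "\<And>N. N \<ge> N0 \<Longrightarrow> \<exists>q. (\<forall>t. 1 - e * t \<noteq> 0 \<longrightarrow> poly q t = (1 - e * t) ^ N * poly p (c * t / (1 - e * t))) \<and>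
    fps_of_poly q = D ^ N * (fps_of_poly p oo \<mu>)" by blast
  have \<mu>0: "\<mu> $ 0 = 0" by (simp add: \<mu>_def)
  have D: "D * inverse D = 1" by (rule inverse_mult_eq_1') (simp add: D_def)
  have Dp: "fps_of_poly [:1, - e:] = D" by (simp add: fps_of_poly_pCons D_def fps_eq_iff)
  show ?case
  proof (intro exI[of _ "Suc N0"] allI impI)
    fix N assume "Suc N0 \<le> N"
    then obtain M where M: "N = Suc M" "N0 \<le> M" by (cases N) auto
    obtain q where q: "\<And>t. 1 - e * t \<noteq> 0 \<Longrightarrow> poly q t = (1 - e * t) ^ M * poly p (c * t / (1 - e * t))"
      "fps_of_poly q = D ^ M * (fps_of_poly p oo \<mu>)" using N0[OF M(2)] by blast
    \<comment> \<open>The Horner step \<open>a + x p(x)\<close> at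
      \<open>x = c t / (1 - e t)\<close>, multiplied by the power \<open>N = Suc M\<close> of
      \<open>1 - e t\<close>.\<close>
    let ?q = "smult a ([:1, - e:] ^ N) + [:0, c:] * q"
    have "poly ?q t = (1 - e * t) ^ N * poly (pCons a p) (c * t / (1 - e * t))" if "1 - e * t \<noteq> 0" for t
      using that by (simp add: M(1) q(1)[OF that] field_simps)
    moreover have "fps_of_poly ?q = D ^ N * (fps_of_poly (pCons a p) oo \<mu>)"
    proof -
      have "fps_of_poly ?q = fps_const a * D ^ N + fps_const c * fps_X * (D ^ M * (fps_of_poly p oo \<mu>))"
        by (simp add: fps_of_poly_add fps_of_poly_smult fps_of_poly_power fps_of_poly_mult Dp q(2) fps_of_poly_pCons[of 0] fps_of_poly_const mult_ac del: smult_power mult_pCons_left)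
      also have "fps_const c * fps_X = D * \<mu>" using D by (simp add: \<mu>_def D_def[symmetric] mult.assoc)
      also have "fps_const a * D ^ N + D * \<mu> * (D ^ M * (fps_of_poly p oo \<mu>)) = D ^ N * (fps_const a + (fps_of_poly p oo \<mu>) * \<mu>)"
        by (simp add: M(1) algebra_simps)
      also have "fps_const a + (fps_of_poly p oo \<mu>) * \<mu> = fps_of_poly (pCons a p) oo \<mu>"
        by (simp add: fps_of_poly_pCons fps_compose_add_distrib fps_compose_mult_distrib[OF \<mu>0] \<mu>0)
      finally show ?thesis .
    qed
    ultimately show "\<exists>q. (\<forall>t. 1 - e * t \<noteq> 0 \<longrightarrow> poly q t = (1 - e * t) ^ N * poly (pCons a p) (c * t / (1 - e * t))) \<and>
      fps_of_poly q = D ^ N * (fps_of_poly (pCons a p) oo \<mu>)" by blast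
  qed
qed

context plane begin

lemma inverse_coords:
  assumes g: "g \<in> stab"
  shows "xc (iv g w) = inverse (char g) * xc w - xc (g v) * yc w" "yc (iv g w) = char g * yc w"
proof -
  note h = stab_inv(1)[OF g]
  have nz: "char g \<noteq> 0" by (rule char_hom(3)[OF g])
  show y: "yc (iv g w) = char g * yc w" for w using stab_coords(3)[OF h, of w] stab_inv(5)[OF g] nz by (simp add: char_def field_simps)
  have "xc (g (iv g v)) = xc (iv g v) * char g + char g * xc (g v)" using stab_coords(2)[OF g, of "iv g v"] y[of v] by (simp add: char_def)
  then have "char g * (xc (iv g v) + xc (g v)) = 0" unfolding stab_inv(3)[OF g] by (simp add: algebra_simps)
  then have "xc (iv g v) = - xc (g v)" using nz by (simp add: eq_neg_iff_add_eq_0)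
  then show "xc (iv g w) = inverse (char g) * xc w - xc (g v) * yc w"
    using stab_coords(2)[OF h, of w] stab_inv(5)[OF g] by (simp add: char_def algebra_simps)
qed

text \<open>The inverse of \<open>g\<close> carries the curve \<open>u + t v\<close> to multiples of
  vectors \<open>u + s v\<close> with \<open>s\<close> a fractional linear function of
  \<open>t\<close>. Homogeneity in the first variable turns the multiples into a power of
  \<open>1 - e t\<close>, where \<open>e = char g * xc (g v)\<close>, and both degrees together give
  the power of \<open>char g\<close>.\<close>

lemma expand_act:
  assumes g: "g \<in> stab" and a: "a \<in> deg2 (int m, int n)"
  shows "fps_const (char g ^ (m + n)) * expand (\<lambda>z. a (dbl (iv g) z)) =
    (1 - fps_const (char g * xc (g v)) * fps_X) ^ m * (expand a oo moebius g)"
proof -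
  let ?\<alpha> = "char g" and ?e = "char g * xc (g v)"
  define D :: "'f fps" where "D = 1 - fps_const ?e * fps_X"
  have nz: "?\<alpha> \<noteq> 0" by (rule char_hom(3)[OF g])
  have ap: "a \<in> poly2" using deg2D(1)[OF a] .
  note tp = aut_poly(2)[OF stab_inv(1)[OF g] ap]
  obtain N0 where N0: "\<And>N. N \<ge> N0 \<Longrightarrow> \<exists>q. (\<forall>t. 1 - ?e * t \<noteq> 0 \<longrightarrow> poly q t = (1 - ?e * t) ^ N * poly (curve_poly a) (?\<alpha> ^ 2 * t / (1 - ?e * t))) \<and>
      fps_of_poly q = D ^ N * (fps_of_poly (curve_poly a) oo moebius g)"
    using fractional_linear_numerator[of ?e "curve_poly a" "?\<alpha> ^ 2"] unfolding moebius_def D_def by blast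
  \<comment> \<open>The surplus \<open>m\<close> over \<open>N0\<close> splits off the factor that
    occurs in the claim; the remaining power \<open>N0\<close> is cancelled at the end.\<close>
  define N where "N = N0 + m"
  obtain q where q: "\<And>t. 1 - ?e * t \<noteq> 0 \<Longrightarrow> poly q t = (1 - ?e * t) ^ N * poly (curve_poly a) (?\<alpha> ^ 2 * t / (1 - ?e * t))"
      "fps_of_poly q = D ^ N * (fps_of_poly (curve_poly a) oo moebius g)" using N0[of N] unfolding N_def by auto
  let ?B = "curve_poly (\<lambda>z. a (dbl (iv g) z))" and ?D = "[:1, - ?e:]"
  have val: "?\<alpha> ^ (m + n) * poly ?B t = (1 - ?e * t) ^ m * poly (curve_poly a) (?\<alpha> ^ 2 * t / (1 - ?e * t))" if t: "1 - ?e * t \<noteq> 0" for t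
  proof -
    let ?s = "?\<alpha> ^ 2 * t / (1 - ?e * t)"
    \<comment> \<open>Normalizing the first coordinate to 1 exhibits the Moebius
      transformation.\<close>
    have "iv g (u + scale t v) = scale (inverse ?\<alpha> * (1 - ?e * t)) (u + scale ?s v)" "iv g u = scale (inverse ?\<alpha>) u"
      by (rule coords_eqI; use nz t in \<open>simp add: inverse_coords[OF g] field_simps power2_eq_square\<close>)+
    then have "poly ?B t = (inverse ?\<alpha> * (1 - ?e * t)) ^ m * inverse ?\<alpha> ^ n * a (u + scale ?s v, u)"
      using curve_poly[OF tp, of t] deg2D(4)[OF a] by simp
    also have "a (u + scale ?s v, u) = poly (curve_poly a) ?s" using curve_poly[OF ap] by simp
    finally have B: "poly ?B t = (inverse ?\<alpha> * (1 - ?e * t)) ^ m * inverse ?\<alpha> ^ n * poly (curve_poly a) ?s" .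
    have "?\<alpha> ^ (m + n) * ((inverse ?\<alpha> * (1 - ?e * t)) ^ m * inverse ?\<alpha> ^ n) = (1 - ?e * t) ^ m"
      using nz by (simp add: power_mult_distrib power_add power_inverse field_simps)
    then show ?thesis unfolding B mult.assoc[symmetric] by simp
  qed
  \<comment> \<open>The extra factor \<open>?D\<close> on both sides makes the equality hold also at
    the pole, where \<open>val\<close> gives no information.\<close>
  have "smult (?\<alpha> ^ (m + n)) ?B * ?D ^ N0 * ?D = q * ?D"
  proof (rule poly_fun_eqI)
    fix t
    show "poly (smult (?\<alpha> ^ (m + n)) ?B * ?D ^ N0 * ?D) t = poly (q * ?D) t"
    proof (cases "1 - ?e * t = 0")
      case True
      then have "poly ?D t = 0" by (simp add: mult.commute)
      then show ?thesis by (simp only: poly_mult mult_zero_right)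
    next
      case False
      have Dt: "poly ?D t = 1 - ?e * t" by (simp add: mult.commute)
      have qt: "poly q t = (1 - ?e * t) ^ N0 * (?\<alpha> ^ (m + n) * poly ?B t)"
        unfolding val[OF False] q(1)[OF False] N_def by (simp add: power_add)
      show ?thesis unfolding poly_mult poly_smult poly_power Dt qt by (simp only: mult_ac)
    qed
  qed
  moreover have "?D \<noteq> 0" by simp
  ultimately have e: "smult (?\<alpha> ^ (m + n)) ?B * ?D ^ N0 = q" using mult_right_cancel by blast
  have "fps_of_poly (smult (?\<alpha> ^ (m + n)) ?B * ?D ^ N0) = D ^ N * (expand a oo moebius g)" unfolding e by (rule q(2)[folded expand_def])
  moreover have "fps_of_poly ?D = D" by (simp add: fps_of_poly_pCons D_def fps_eq_iff)
  ultimately have "D ^ N0 * (fps_const (?\<alpha> ^ (m + n)) * expand (\<lambda>z. a (dbl (iv g) z))) = D ^ N0 * (D ^ m * (expand a oo moebius g))"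
    by (simp only: fps_of_poly_mult fps_of_poly_smult fps_of_poly_power expand_def N_def power_add mult_ac)
  moreover have "D $ 0 = 1" by (simp add: D_def)
  then have "D ^ N0 \<noteq> 0" by (metis fps_zero_nth power_not_zero zero_neq_one)
  ultimately show ?thesis unfolding D_def by (metis mult_left_cancel)
qed

text \<open>Numerator and denominator have the same bidegree, so the factors produced by
  \<open>expand_act\<close> are equal and cancel in the fraction, leaving the bare
  substitution.\<close>

lemma germ_series_act:
  assumes g: "g \<in> stab" and F: "F \<in> sqC base_pt"
  shows "germ_series (fraction_act (dbl g) F) = germ_series F oo moebius g"
proof -
  interpret A2: fun_graded_aut SR "dbl g" "dbl (iv g)" by (rule stab_aut(1)[OF g])
  obtain a b d where ab: "F = quo a b" "a \<in> deg2 d" "b \<in> deg2 d" "b \<notin> base_pt" using sqO_memE[OF F] by metis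
  obtain m n where d: "d = (int m, int n)" using deg2E[OF ab(2)] by metis
  have p: "a \<in> poly2" "b \<in> poly2" "b (u, u) \<noteq> 0" using ab(2-4) base_pt_iff[OF ab(3)] S.deg_closed unfolding carriers by blast+
  let ?a = "\<lambda>z. a (dbl (iv g) z)" and ?b = "\<lambda>z. b (dbl (iv g) z)"
  note tp = aut_poly(2)[OF stab_inv(1)[OF g] p(1)] aut_poly(2)[OF stab_inv(1)[OF g] p(2)]
  have nz: "char g \<noteq> 0" by (rule char_hom(3)[OF g])
  have "b \<notin> point_act (dbl (iv g)) base_pt" unfolding base_pt_act[OF stab_inv(1)[OF g]] by (rule ab(4))
  then have "?b \<notin> base_pt" unfolding fun_graded_aut.point_act_iff[OF A2.swap] .
  then have bu: "?b (u, u) \<noteq> 0" using base_pt_iff[OF A2.deg(2)[OF ab(3)]] by simp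
  let ?c = "fps_const (char g ^ (m + n))" and ?D = "(1 - fps_const (char g * xc (g v)) * fps_X) ^ m"
  have \<mu>0: "moebius g $ 0 = 0" by (simp add: moebius_def)
  have D0: "?D \<noteq> 0"
  proof
    assume "?D = 0"
    then have "(1 - fps_const (char g * xc (g v)) * fps_X) = 0" by simp
    then have "(1 - fps_const (char g * xc (g v)) * fps_X) $ 0 = 0" by (simp only: fps_zero_nth)
    then show False by simp
  qed
  have ea: "?c * expand ?a = ?D * (expand a oo moebius g)" and eb: "?c * expand ?b = ?D * (expand b oo moebius g)"
    using expand_act[OF g] ab(2,3) unfolding d by blast+
  have ub: "expand ?b * inverse (expand ?b) = 1" by (rule expand_unit[OF tp(2) bu])
  have b0: "expand b $ 0 \<noteq> 0" using expand_0[OF p(2)] p(3) by simp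
  have uc: "(expand b oo moebius g) * inverse (expand b oo moebius g) = 1" by (rule inverse_mult_eq_1') (use b0 in simp)
  \<comment> \<open>Turns an equality of products into one of quotients, for series with given
    inverses.\<close>
  have cross: "p * iq = r * is" if "p * s = r * q" "q * iq = 1" "s * is = 1" for p q r s iq "is" :: "'f fps"
  proof -
    have "p * iq = p * iq * (s * is)" by (simp add: that(3))
    also have "\<dots> = (p * s) * (iq * is)" by (simp only: mult_ac)
    also have "\<dots> = r * is * (q * iq)" unfolding that(1) by (simp only: mult_ac)
    finally show ?thesis by (simp add: that(2))
  qed
  have "expand ?a * (expand b oo moebius g) = (expand a oo moebius g) * expand ?b"
  proof -
    have "?c * ?D * (expand ?a * (expand b oo moebius g)) = (?c * expand ?a) * (?D * (expand b oo moebius g))" by (simp only: mult_ac)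
    also have "\<dots> = (?D * (expand a oo moebius g)) * (?c * expand ?b)" unfolding ea eb ..
    also have "\<dots> = ?c * ?D * ((expand a oo moebius g) * expand ?b)" by (simp only: mult_ac)
    finally show ?thesis using D0 nz by simp
  qed
  then have "expand ?a * inverse (expand ?b) = (expand a oo moebius g) * inverse (expand b oo moebius g)" using cross ub uc by blast
  also have "\<dots> = (expand a * inverse (expand b)) oo moebius g"
    unfolding fps_compose_mult_distrib[OF \<mu>0] fps_inverse_compose[OF \<mu>0 b0] ..
  finally show ?thesis unfolding ab(1) A2.fraction_act_fraction germ_series_quo[OF p] germ_series_quo[OF tp bu] .
qed

section \<open>The action on sections, germs and the fiber\<close>

abbreviation "sec_act g U s \<equiv> \<lambda>P\<in>Zp (point_act g ` U). jet_act g (s (point_act (dbl (iv g)) P))"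

lemma Zp_act: assumes g: "g \<in> stab" shows "Q \<in> Zp (point_act g ` U) \<longleftrightarrow> point_act (dbl (iv g)) Q \<in> Zp U"
proof -
  interpret A2: fun_graded_aut SR "dbl g" "dbl (iv g)" by (rule stab_aut(1)[OF g])
  interpret A1: fun_graded_aut LR g "iv g" by (rule stab_aut(2)[OF g])
  have "Q \<in> SP \<longleftrightarrow> point_act (dbl (iv g)) Q \<in> SP"
    using A2.point_act_Proj[of "point_act (dbl (iv g)) Q"] fun_graded_aut.point_act_Proj[OF A2.swap, of Q]
      fun_graded_aut.point_act_inverse[OF A2.swap, of Q] by auto
  then show ?thesis unfolding preimage_iff A1.point_act_image_iff proj2_act[OF stab_inv(1)[OF g]] by simp
qed

lemma nb_act: assumes g: "g \<in> stab" and U: "nb U" shows "nb (point_act g ` U)"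
proof -
  interpret A1: fun_graded_aut LR g "iv g" by (rule stab_aut(2)[OF g])
  show ?thesis using U A1.point_act_open[of U] unfolding nbhd_def A1.point_act_image_iff pt_act[OF stab_inv(1)[OF g]] by simp
qed

lemma sec_act_section:
  assumes g: "g \<in> stab" and U: "nb U" and s: "s \<in> JS k d U" shows "sec_act g U s \<in> JS k d (point_act g ` U)"
proof (rule sectionsI)
  interpret A2: fun_graded_aut SR "dbl g" "dbl (iv g)" by (rule stab_aut(1)[OF g])
  let ?i = "point_act (dbl (iv g))"
  fix P assume P: "P \<in> Zp (point_act g ` U)"
  then have P': "?i P \<in> Zp U" unfolding Zp_act[OF g] .
  obtain l where l: "good_lin l (?i P)" using ex_good_lin Zp_sub[OF U] P' by blast
  obtain W F where W: "nbhd SR (?i P) W" "W \<subseteq> Zp U" "locfrac W F" "\<And>Q. Q \<in> W \<Longrightarrow> good_lin l Q"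
    "\<And>Q. Q \<in> W \<Longrightarrow> s Q = tau k d l Q (F Q)" using s P' l by (rule section_tau) (rule that)
  obtain a b m where ab: "W \<subseteq> SP" "a \<in> deg2 m" "b \<in> deg2 m" "\<And>Q. Q \<in> W \<Longrightarrow> b \<notin> Q" "\<And>Q. Q \<in> W \<Longrightarrow> F Q = quo a b"
    using W(3) by (rule locfracE) (rule that)
  let ?W = "point_act (dbl g) ` W" and ?F = "\<lambda>Q. fraction_act (dbl g) (F (?i Q))"
  have iW: "?i Q \<in> W" "point_act (dbl g) (?i Q) = Q" if "Q \<in> ?W" for Q
    using that unfolding A2.point_act_image_iff by (simp_all add: fun_graded_aut.point_act_inverse[OF A2.swap])
  have WZ: "?W \<subseteq> Zp (point_act g ` U)" using iW(1) W(2) unfolding subset_iff Zp_act[OF g] by blast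
  show "\<exists>l. loc_tau k d (Zp (point_act g ` U)) (sec_act g U s) l P"
  proof (rule loc_tauI[of P ?W _ ?F "\<lambda>w. l (iv g w)"])
    show "nbhd SR P ?W" using W(1) A2.point_act_open unfolding nbhd_def A2.point_act_image_iff by blast
    show "?W \<subseteq> Zp (point_act g ` U)" by (rule WZ)
    show "locfrac ?W ?F"
    proof (rule locfracI[OF _ A2.deg(2)[OF ab(2)] A2.deg(2)[OF ab(3)]])
      show "?W \<subseteq> SP" using A2.point_act_Proj ab(1) by blast
      fix Q assume Q: "Q \<in> ?W"
      show "(\<lambda>x. b (dbl (iv g) x)) \<notin> Q" using ab(4)[OF iW(1)[OF Q]] unfolding fun_graded_aut.point_act_iff[OF A2.swap] .
      show "?F Q = quo (\<lambda>x. a (dbl (iv g) x)) (\<lambda>x. b (dbl (iv g) x))" unfolding ab(5)[OF iW(1)[OF Q]] A2.fraction_act_fraction ..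
    qed
    fix Q assume Q: "Q \<in> ?W"
    show "good_lin (\<lambda>w. l (iv g w)) Q" using good_lin_act[OF g W(4)[OF iW(1)[OF Q]]] unfolding iW(2)[OF Q] .
    show "sec_act g U s Q = tau k d (\<lambda>w. l (iv g w)) Q (?F Q)"
      using subsetD[OF WZ Q] jet_act_tau[OF g W(4)[OF iW(1)[OF Q]] locfrac_mem[OF W(3) iW(1)[OF Q]]] W(5)[OF iW(1)[OF Q]]
      unfolding iW(2)[OF Q] by simp
  qed
qed simp

lemma jet_act_inverse:
  assumes g: "g \<in> stab" and U: "nb U" and s: "s \<in> JS k d U" and Q: "Q \<in> Zp U"
  shows "jet_act g (jet_act (iv g) (s Q)) = s Q"
proof -
  interpret A2: fun_graded_aut SR "dbl g" "dbl (iv g)" by (rule stab_aut(1)[OF g])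
  note h = stab_inv(1)[OF g]
  have QS: "Q \<in> SP" using Q Zp_sub[OF U] by blast
  obtain l where l: "good_lin l Q" using ex_good_lin[OF QS] by blast
  obtain F where F: "F \<in> sqC Q" "s Q = tau k d l Q F" using section_value[OF s Q l] by blast
  note F' = fun_graded_aut.fraction_act_mem[OF A2.swap F(1)] and l' = good_lin_act[OF h l]
  show ?thesis unfolding F(2) jet_act_tau[OF h l F(1)] jet_act_tau[OF g l' F']
    by (simp add: iv_iv[OF g] stab_inv(3)[OF g] fun_graded_aut.point_act_inverse[OF A2.swap] fun_graded_aut.fraction_act_inverse[OF A2.swap])
qed

lemma section_act_eq: "jet_section_act scale g (U, s) = (point_act g ` U, sec_act g U s)"
  by (simp add: jet_section_act_def)

lemma sec_act_cancel:
  assumes g: "g \<in> stab" and U: "nb U" and s: "s \<in> JS k d U"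
  shows "jet_section_act scale g (jet_section_act scale (iv g) (U, s)) = (U, s)"
proof -
  interpret A2: fun_graded_aut SR "dbl g" "dbl (iv g)" by (rule stab_aut(1)[OF g])
  interpret A1: fun_graded_aut LR g "iv g" by (rule stab_aut(2)[OF g])
  note h = stab_inv(1)[OF g]
  have UU: "point_act g ` point_act (iv g) ` U = U" by (simp add: image_image fun_graded_aut.point_act_inverse[OF A1.swap])
  have "sec_act g (point_act (iv g) ` U) (sec_act (iv g) U s) = s"
  proof (rule ext)
    fix P
    show "sec_act g (point_act (iv g) ` U) (sec_act (iv g) U s) P = s P"
    proof (cases "P \<in> Zp U")
      case True
      have "point_act (dbl (iv g)) P \<in> Zp (point_act (iv g) ` U)"
        using True unfolding Zp_act[OF h] iv_iv[OF g] fun_graded_aut.point_act_inverse[OF A2.swap] .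
      then show ?thesis using True jet_act_inverse[OF g U s True] by (simp add: UU iv_iv[OF g] fun_graded_aut.point_act_inverse[OF A2.swap])
    next
      case False
      \<comment> \<open>Sections are extensional, so outside their domain both sides are
        \<open>undefined\<close>.\<close>
      moreover have "s \<in> extensional (Zp U)" using s unfolding jet_sections_def by blast
      then have "s P = undefined" using False by (rule extensional_arb)
      ultimately show ?thesis by (simp add: UU)
    qed
  qed
  then show ?thesis unfolding section_act_eq UU by simp
qed

text \<open>One inclusion is compatibility with restriction; the same inclusion for the inverse of
  \<open>g\<close> gives the other, as the two actions cancel on sections.\<close>

lemma germ_act:
  assumes g: "g \<in> stab" and U: "nb U" and s: "s \<in> JS k d U"
  shows "jet_section_act scale g ` gm k d U s = gm k d (point_act g ` U) (sec_act g U s)"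
proof -
  have *: "jet_section_act scale g x \<in> gm k d (point_act g ` U) (sec_act g U s)"
    if g: "g \<in> stab" and x: "x \<in> gm k d U s" for g U s x
  proof -
    obtain U1 s1 where x1: "x = (U1, s1)" by (cases x)
    obtain V where V: "nb U1" "s1 \<in> JS k d U1" "nb V" "V \<subseteq> U \<inter> U1" "\<forall>Q\<in>Zp V. s Q = s1 Q"
      using x unfolding x1 germ_mem by blast
    show ?thesis unfolding x1 section_act_eq germ_mem
    proof (intro conjI nb_act[OF g] V(1) sec_act_section[OF g V(1,2)] exI[of _ "point_act g ` V"] V(3) ballI)
      show "point_act g ` V \<subseteq> point_act g ` U \<inter> point_act g ` U1" using V(4) by blast
      fix Q assume Q: "Q \<in> Zp (point_act g ` V)"
      then have "point_act (dbl (iv g)) Q \<in> Zp V" unfolding Zp_act[OF g] .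
      moreover have "Q \<in> Zp (point_act g ` U)" "Q \<in> Zp (point_act g ` U1)"
        using Q Zp_mono[of "point_act g ` V" "point_act g ` U"] Zp_mono[of "point_act g ` V" "point_act g ` U1"] V(4) by blast+
      ultimately show "sec_act g U s Q = sec_act g U1 s1 Q" using V(5) by simp
    qed
  qed
  note h = stab_inv(1)[OF g] and gs = sec_act_section[OF g U s]
  show ?thesis
  proof (intro equalityI subsetI)
    fix y assume "y \<in> jet_section_act scale g ` gm k d U s"
    then show "y \<in> gm k d (point_act g ` U) (sec_act g U s)" by (elim imageE) (simp only: *[OF g])
  next
    fix y assume y: "y \<in> gm k d (point_act g ` U) (sec_act g U s)"
    have "jet_section_act scale (iv g) (point_act g ` U, sec_act g U s) = (U, s)"
      using sec_act_cancel[OF h U s] unfolding iv_iv[OF g] section_act_eq .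
    then have c: "point_act (iv g) ` point_act g ` U = U \<and> sec_act (iv g) (point_act g ` U) (sec_act g U s) = s"
      unfolding section_act_eq[of "iv g"] prod.inject .
    have i: "jet_section_act scale (iv g) y \<in> gm k d U s" using *[OF h y] unfolding conjunct1[OF c] conjunct2[OF c, unfolded conjunct1[OF c]] .
    obtain U1 s1 where y1: "y = (U1, s1)" by (cases y)
    have "nb U1" "s1 \<in> JS k d U1" using y unfolding y1 germ_mem by blast+
    from sec_act_cancel[OF g this] have "y = jet_section_act scale g (jet_section_act scale (iv g) y)" unfolding y1 by (rule sym)
    then show "y \<in> jet_section_act scale g ` gm k d U s" using i by (rule image_eqI)
  qed
qed

text \<open>The power of \<open>char g\<close> with integer exponent \<open>- d\<close>, one natural
  exponent being 0: the value at \<open>u\<close> of \<open>xc ^ d\<close> after translation by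
  \<open>g\<close>.\<close>

definition jet_char :: "int \<Rightarrow> ('v \<Rightarrow> 'v) \<Rightarrow> 'f" where
  "jet_char d g = inverse (char g) ^ nat d * char g ^ nat (- d)"

text \<open>The substitution comes from expanding the moved fraction, and the character from
  evaluating the moved trivialization at \<open>u\<close>.\<close>

lemma germ_value_act:
  assumes g: "g \<in> stab" and x: "x \<in> StkC k d"
  shows "jet_section_act scale g ` x \<in> StkC k d"
    "germ_value k (jet_section_act scale g ` x) = jet_model_act k (jet_char d) g (germ_value k x)"
proof -
  interpret A2: fun_graded_aut SR "dbl g" "dbl (iv g)" by (rule stab_aut(1)[OF g])
  note h = stab_inv(1)[OF g]
  obtain U s where U: "nb U" "s \<in> JS k d U" "x = gm k d U s" using x unfolding stalk_carrier by blast
  note gU = nb_act[OF g U(1)] and gs = sec_act_section[OF g U(1,2)]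
  show "jet_section_act scale g ` x \<in> StkC k d" unfolding U(3) germ_act[OF g U(1,2)] stalk_carrier using gU gs by blast
  obtain F where F: "F \<in> sqC base_pt" "s base_pt = tau k d xc base_pt F" using section_value[OF U(2) base_pt_Zp[OF U(1)] good_lin_xc] by blast
  have F': "fraction_act (dbl g) F \<in> sqC base_pt" using A2.fraction_act_mem[OF F(1)] unfolding base_pt_act[OF g] .
  have l': "good_lin (\<lambda>w. xc (iv g w)) base_pt" using good_lin_act[OF g good_lin_xc] unfolding base_pt_act[OF g] .
  have xu: "xc (iv g u) = inverse (char g)" using stab_inv(5)[OF g] by (simp add: char_def)
  have "germ_value k (jet_section_act scale g ` x) = theta k (jet_act g (s base_pt))"
    unfolding U(3) germ_act[OF g U(1,2)] germ_value[OF gU gs] using base_pt_Zp[OF gU] base_pt_act[OF h] by simp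
  also have "\<dots> = fps_cutoff (k + 1) ((germ_series F oo moebius g) * fps_const (jet_char d g))"
    unfolding F(2) jet_act_tau[OF g good_lin_xc F(1)] base_pt_act[OF g] theta(2)[OF l' F'] germ_series_act[OF g F(1)] xu jet_char_def
    by (simp add: power_inverse)
  also have "\<dots> = jet_model_act k (jet_char d) g (fps_cutoff (k + 1) (germ_series F))"
  proof (rule fps_ext)
    fix i
    \<comment> \<open>Truncation may precede the substitution, since a coefficient of the composite
      at index \<open>i\<close> involves coefficients up to \<open>i\<close> only.\<close>
    have "(fps_cutoff (Suc k) (germ_series F) oo moebius g) $ i = (germ_series F oo moebius g) $ i" if "i \<le> k"
      using that by (simp add: fps_compose_nth)
    then show "fps_cutoff (k + 1) ((germ_series F oo moebius g) * fps_const (jet_char d g)) $ i =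
      jet_model_act k (jet_char d) g (fps_cutoff (k + 1) (germ_series F)) $ i" by (simp add: jet_model_act_nth mult.commute)
  qed
  also have "fps_cutoff (k + 1) (germ_series F) = germ_value k x" unfolding U(3) germ_value[OF U(1,2)] F(2) theta_tau[OF F(1)] ..
  finally show "germ_value k (jet_section_act scale g ` x) = jet_model_act k (jet_char d) g (germ_value k x)" .
qed

lemma stalk_act_cancel:
  assumes g: "g \<in> stab" and x: "x \<in> StkC k d"
  shows "jet_section_act scale g ` jet_section_act scale (iv g) ` x = x"
proof -
  obtain U s where U: "nb U" "s \<in> JS k d U" "x = gm k d U s" using x unfolding stalk_carrier by blast
  have "jet_section_act scale g (jet_section_act scale (iv g) y) = y" if "y \<in> x" for y
  proof -
    obtain U1 s1 where y: "y = (U1, s1)" by (cases y)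
    have "nb U1" "s1 \<in> JS k d U1" using that unfolding y U(3) germ_mem by blast+
    then show ?thesis unfolding y by (rule sec_act_cancel[OF g])
  qed
  then show ?thesis by (simp add: image_image)
qed

text \<open>Elements of the fiber are level sets of \<open>germ_value\<close>, and \<open>g\<close>
  acts on them by images. That the image is a full level set follows by going back with the inverse
  of \<open>g\<close>, for which the group law of the model is needed beforehand; it is therefore a
  hypothesis.\<close>

lemma jet_fiber_model:
  assumes la: "lin_act stab (polys_upto k) (jet_model_act k (jet_char d))"
  shows "fps_model stab (Fib k d, \<lambda>g. (`) ((`) (jet_section_act scale g))) (\<lambda>A. germ_value k (SOME x. x \<in> A)) (polys_upto k) (jet_model_act k (jet_char d))"
proof -
  let ?\<Phi> = "\<lambda>A. germ_value k (SOME x. x \<in> A)" and ?\<beta> = "jet_model_act k (jet_char d)"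
  let ?fib = "\<lambda>x. {y \<in> StkC k d. germ_value k y = germ_value k x}"
  have fa: "((`) (jet_section_act scale g)) ` ?fib x = ?fib (jet_section_act scale g ` x)" if g: "g \<in> stab" and x: "x \<in> StkC k d" for g x
  proof (intro equalityI subsetI)
    fix y assume "y \<in> ((`) (jet_section_act scale g)) ` ?fib x"
    then obtain z where z: "z \<in> StkC k d" "germ_value k z = germ_value k x" "y = jet_section_act scale g ` z" by blast
    show "y \<in> ?fib (jet_section_act scale g ` x)" using germ_value_act[OF g z(1)] germ_value_act(2)[OF g x] z(2) unfolding z(3) by simp
  next
    fix y assume y: "y \<in> ?fib (jet_section_act scale g ` x)"
    note h = stab_inv(1)[OF g]
    let ?z = "jet_section_act scale (iv g) ` y"
    have "germ_value k x \<in> polys_upto k" using germ_value_image x by blast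
    moreover have "iv g \<circ> g = id" using stab_inv(4)[OF g] by (auto simp: fun_eq_iff)
    \<comment> \<open>The operators of \<open>g\<close> and of its inverse cancel on values, by the
      group law and the identity law in \<open>lin_act\<close>.\<close>
    ultimately have "?\<beta> (iv g) (?\<beta> g (germ_value k x)) = germ_value k x" using la g h unfolding lin_act_def by metis
    then have "?z \<in> ?fib x" using y germ_value_act[OF h, of y k d] germ_value_act(2)[OF g x] by simp
    moreover have "y = jet_section_act scale g ` ?z" using stalk_act_cancel[OF g, of y k d] y by simp
    ultimately show "y \<in> ((`) (jet_section_act scale g)) ` ?fib x" by (rule rev_image_eqI)
  qed
  show ?thesis unfolding fps_model_def prod.case
  proof (intro conjI ballI fiber_model(1))
    fix g A assume g: "g \<in> stab" and "A \<in> carrier (Fib k d)"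
    then obtain x where x: "x \<in> StkC k d" "A = ?fib x" unfolding fiber_model(2) by (elim imageE)
    note gx = germ_value_act[OF g x(1)]
    show "((`) (jet_section_act scale g)) ` A \<in> carrier (Fib k d)" unfolding x(2) fa[OF g x(1)] fiber_model(2) by (rule imageI[OF gx(1)])
    show "?\<Phi> (((`) (jet_section_act scale g)) ` A) = ?\<beta> g (?\<Phi> A)"
      unfolding x(2) fa[OF g x(1)] fiber_model(3)[OF x(1)] fiber_model(3)[OF gx(1)] by (rule gx(2))
  qed
qed

section \<open>Characters of the one-dimensional factors\<close>

text \<open>The character \<open>\<chi>'\<close> is left free to have another form than a power, as
  long as it agrees with one on the stabilizer; this absorbs the rewriting of exponents in the three
  cases.\<close>

lemma sym_character:
  assumes "\<exists>\<Phi>. fps_model stab A \<Phi> scalars (\<lambda>g w. fps_const (\<chi> g) * w)"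
    and \<chi>: "\<chi> id = 1" "\<And>g h. g \<in> stab \<Longrightarrow> h \<in> stab \<Longrightarrow> \<chi> (g \<circ> h) = \<chi> g * \<chi> h"
    and eq: "\<And>g. g \<in> stab \<Longrightarrow> \<chi>' g = \<chi> g ^ n"
  shows "\<exists>\<Phi>. fps_model stab (rep_sym ground n A) \<Phi> scalars (\<lambda>g w. fps_const (\<chi>' g) * w)"
proof -
  obtain M a where A: "A = (M, a)" by (rule prod.exhaust)
  obtain \<Phi> where "fps_model stab (M, a) \<Phi> scalars (\<lambda>g w. fps_const (\<chi> g) * w)" using assms(1) unfolding A by blast
  note m = line_model_sym[OF this \<chi> stab_group, of n]
  obtain N b where N: "rep_sym ground n (M, a) = (N, b)" by (rule prod.exhaust)
  have "fps_model stab (N, b) (class_lift (sym_val \<Phi>)) scalars (\<lambda>g w. fps_const (\<chi>' g) * w)" unfolding fps_model_def prod.case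
  proof (intro conjI ballI)
    note m' = m[unfolded N fps_model_def prod.case]
    show "fps_lin_iso N (class_lift (sym_val \<Phi>)) scalars" by (rule conjunct1[OF m'])
    fix g x assume g: "g \<in> stab" and x: "x \<in> carrier N"
    note gx = bspec[OF bspec[OF conjunct2[OF m'] g] x]
    show "b g x \<in> carrier N" by (rule conjunct1[OF gx])
    show "class_lift (sym_val \<Phi>) (b g x) = fps_const (\<chi>' g) * class_lift (sym_val \<Phi>) x" unfolding eq[OF g] by (rule conjunct2[OF gx])
  qed
  then show ?thesis unfolding A N by blast
qed

text \<open>After this only two characters have to be matched: that of \<open>O(d)\<close> at the
  fixed point for the constants, and its twist by \<open>char g ^ (k + 1)\<close> for the line
  tensored with the symmetric power of the plane.\<close>

lemma jet_fiber_iso: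
  assumes A1: "\<exists>\<Phi>. fps_model stab A1 \<Phi> scalars (\<lambda>g w. fps_const (jet_char d g) * w)"
    and A2: "\<exists>\<Phi>. fps_model stab A2 \<Phi> scalars (\<lambda>g w. fps_const (jet_char d g * char g ^ (k + 1)) * w)" and k: "k \<ge> 1"
  shows "rep_iso stab ground (jet_fiber scale k d line)
    (rep_sum A1 (rep_tensor ground A2 (rep_sym ground (k - 1) (sub_rep scale UNIV))))"
proof -
  obtain M1 a1 where A1': "A1 = (M1, a1)" by (rule prod.exhaust)
  obtain M2 a2 where A2': "A2 = (M2, a2)" by (rule prod.exhaust)
  note A = A1' A2'
  obtain \<Phi>1 \<Phi>2 where M1: "fps_model stab (M1, a1) \<Phi>1 scalars (\<lambda>g w. fps_const (jet_char d g) * w)"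
    and M2: "fps_model stab (M2, a2) \<Phi>2 scalars (\<lambda>g w. fps_const (jet_char d g * char g ^ (k + 1)) * w)" using A1 A2 unfolding A by blast
  have \<chi>: "jet_char d id = 1" "\<And>g h. g \<in> stab \<Longrightarrow> h \<in> stab \<Longrightarrow> jet_char d (g \<circ> h) = jet_char d g * jet_char d h"
    by (simp_all add: jet_char_def char_hom power_mult_distrib mult_ac)
  note r = right_side_model(1)[OF M1 M2 \<chi> k]
  have la: "lin_act stab (polys_upto k) (jet_model_act k (jet_char d))" by (rule right_side_model(2)[OF M1 M2 \<chi> k])
  obtain N b where N: "rep_sum (M1, a1) (rep_tensor ground (M2, a2) (rep_sym ground (k - 1) (sub_rep scale UNIV))) = (N, b)" by (rule prod.exhaust)
  obtain \<Phi> where \<Phi>: "fps_model stab (N, b) \<Phi> (polys_upto k) (jet_model_act k (jet_char d))" using r unfolding N by blast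
  show ?thesis unfolding A N jet_fiber_def by (rule rep_iso_of_models[OF jet_fiber_model[OF la] \<Phi> la stab_group])
qed

text \<open>The second character is the eigenvalue to the power \<open>k + 1 - d\<close>, or
  \<open>k + 1 + d\<close> for the negative twist. Its sign decides whether it is realized by a
  symmetric power of the line or of the dual line, which splits the case of \<open>O(d)\<close> in
  two and matches the convention for negative symmetric powers.\<close>

lemma jet_fiber_decomposition:
  fixes d k :: nat
  assumes k: "k \<ge> 1"
  defines "F \<equiv> (ground :: 'f ring)" and "l \<equiv> sub_rep scale line" and "V \<equiv> sub_rep scale (UNIV :: 'v set)"
  shows "rep_iso stab F (jet_fiber scale k (- int d) line)
      (rep_sum (rep_sym F d l) (rep_tensor F (rep_sym F (k + d + 1) l) (rep_sym F (k - 1) V)))"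
    and "d \<ge> k + 1 \<Longrightarrow> rep_iso stab F (jet_fiber scale k (int d) line)
      (rep_sum (rep_sym F d (rep_dual F l)) (rep_tensor F (rep_sym F (d - k - 1) (rep_dual F l)) (rep_sym F (k - 1) V)))"
    and "d < k + 1 \<Longrightarrow> rep_iso stab F (jet_fiber scale k (int d) line)
      (rep_sum (rep_sym F d (rep_dual F l)) (rep_tensor F (rep_sym F (k + 1 - d) l) (rep_sym F (k - 1) V)))"
proof -
  have c: "inverse (char id) = 1" "\<And>g h. g \<in> stab \<Longrightarrow> h \<in> stab \<Longrightarrow> inverse (char (g \<circ> h)) = inverse (char g) * inverse (char h)"
    by (simp_all add: char_hom mult.commute)
  have ln: "\<exists>\<Phi>. fps_model stab l \<Phi> scalars (\<lambda>g w. fps_const (char g) * w)" unfolding l_def using line_model by blast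
  have dl: "\<exists>\<Phi>. fps_model stab (rep_dual F l) \<Phi> scalars (\<lambda>g w. fps_const (inverse (char g)) * w)"
    unfolding l_def F_def using dual_line_model by blast
  note sl = sym_character[OF ln char_hom(1,2), folded F_def] and sd = sym_character[OF dl c, folded F_def]
  show "rep_iso stab F (jet_fiber scale k (- int d) line)
      (rep_sum (rep_sym F d l) (rep_tensor F (rep_sym F (k + d + 1) l) (rep_sym F (k - 1) V)))" unfolding F_def V_def
    by (rule jet_fiber_iso[OF sl sl k, unfolded F_def]) (simp_all add: jet_char_def power_add mult_ac)
  have D: "\<exists>\<Phi>. fps_model stab (rep_sym F d (rep_dual F l)) \<Phi> scalars (\<lambda>g w. fps_const (jet_char (int d) g) * w)"
    by (rule sd) (simp_all add: jet_char_def)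
  show "rep_iso stab F (jet_fiber scale k (int d) line)
      (rep_sum (rep_sym F d (rep_dual F l)) (rep_tensor F (rep_sym F (d - k - 1) (rep_dual F l)) (rep_sym F (k - 1) V)))"
    if "d \<ge> k + 1"
  proof -
    define j where "j = d - (k + 1)"
    have j: "d = j + (k + 1)" using that by (simp add: j_def)
    have "jet_char (int d) g * char g ^ (k + 1) = inverse (char g) ^ (d - k - 1)" if "g \<in> stab" for g
    proof -
      have "jet_char (int d) g * char g ^ (k + 1) = inverse (char g) ^ j * (inverse (char g) * char g) ^ (k + 1)"
        unfolding jet_char_def nat_int power_mult_distrib j power_add by simp
      then show ?thesis using char_hom(3)[OF that] j by simp
    qed
    note e = this
    have "\<exists>\<Phi>. fps_model stab (rep_sym F (d - k - 1) (rep_dual F l)) \<Phi> scalars (\<lambda>g w. fps_const (jet_char (int d) g * char g ^ (k + 1)) * w)"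
      by (rule sd) (assumption | rule e)+
    from jet_fiber_iso[OF D this k] show ?thesis unfolding V_def F_def .
  qed
  show "rep_iso stab F (jet_fiber scale k (int d) line)
      (rep_sum (rep_sym F d (rep_dual F l)) (rep_tensor F (rep_sym F (k + 1 - d) l) (rep_sym F (k - 1) V)))"
    if "d < k + 1"
  proof -
    define j where "j = k + 1 - d"
    have j: "k + 1 = j + d" using that by (simp add: j_def)
    have "jet_char (int d) g * char g ^ (k + 1) = char g ^ (k + 1 - d)" if "g \<in> stab" for g
    proof -
      have "jet_char (int d) g * char g ^ (k + 1) = char g ^ j * (inverse (char g) * char g) ^ d"
        unfolding jet_char_def nat_int power_mult_distrib j power_add by simp
      also have "inverse (char g) * char g = 1" using char_hom(3)[OF that] by simp
      finally show ?thesis by (simp only: power_one mult_1_right j_def)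
    qed
    note e = this
    have "\<exists>\<Phi>. fps_model stab (rep_sym F (k + 1 - d) l) \<Phi> scalars (\<lambda>g w. fps_const (jet_char (int d) g * char g ^ (k + 1)) * w)"
      by (rule sl) (assumption | rule e)+
    from jet_fiber_iso[OF D this k] show ?thesis unfolding V_def F_def .
  qed
qed

end

section \<open>An adapted basis, and the theorem without coordinates\<close>

lemma plane_basis:
  fixes scale :: "'f::field_char_0 \<Rightarrow> 'v::ab_group_add \<Rightarrow> 'v"
  assumes "vector_space scale" and d2: "vector_space.dim scale (UNIV :: 'v set) = 2"
    and L: "Modules.module.subspace scale L" and d1: "vector_space.dim scale L = 1"
  shows "\<exists>u v xc yc. plane scale u v xc yc \<and> L = {w. yc w = 0}"
proof -
  interpret vector_space scale by fact
  obtain B where B: "B \<subseteq> L" "independent B" "L \<subseteq> span B" "card B = dim L" by (rule basis_exists)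
  then obtain u where u: "B = {u}" using d1 by (metis card_1_singletonE)
  \<comment> \<open>A basis vector of the line is extended to a basis of the plane; the coordinates
    are the coefficients with respect to it.\<close>
  obtain C where C: "B \<subseteq> C" "independent C" "UNIV \<subseteq> span C" 
    by (rule maximal_independent_subset_extend[OF subset_UNIV B(2)]) (rule that)
  have "card C = 2" using basis_card_eq_dim[of C UNIV] C d2 by simp
  then obtain x y where "C = {x, y}" "x \<noteq> y" by (auto simp: card_2_iff)
  moreover have "u \<in> C" using C(1) u by simp
  ultimately obtain v where v: "C = {u, v}" "u \<noteq> v" by (cases "u = x") auto
  let ?x = "\<lambda>w. representation C w u" and ?y = "\<lambda>w. representation C w v"
  have uv: "u \<in> C" "v \<in> C" "u \<noteq> v" "v \<noteq> u" using v by auto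
  have sp: "w \<in> span C" for w using C(3) by blast
  have co: "w = scale (?x w) u + scale (?y w) v" for w using sum_representation_eq[OF C(2) sp, of C w] v by simp
  have "plane scale u v ?x ?y"
    by unfold_locales (use co uv in \<open>simp_all add: representation_add[OF C(2) sp sp] representation_scale[OF C(2) sp] representation_basis[OF C(2)]\<close>)
  \<comment> \<open>The line is the span of \<open>u\<close>, which is where the coefficient of
    \<open>v\<close> vanishes.\<close>
  moreover have "L = {w. ?y w = 0}"
  proof (intro equalityI subsetI)
    fix w assume "w \<in> L"
    then obtain c where "w = scale c u" using B(3) u by (auto simp: span_singleton)
    then show "w \<in> {w. ?y w = 0}" using uv by (simp add: representation_scale[OF C(2) sp] representation_basis[OF C(2)])
  next
    fix w assume "w \<in> {w. ?y w = 0}"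
    then have "w = scale (?x w) u" using co[of w] by simp
    moreover have "scale (?x w) u \<in> L" using L B(1) u by (simp add: subspace_scale)
    ultimately show "w \<in> L" by simp
  qed
  ultimately show ?thesis by blast
qed

theorem theorem3p6:
  fixes scale :: "'f::field_char_0 \<Rightarrow> 'v::ab_group_add \<Rightarrow> 'v"
    and L :: "'v set" and k d :: nat
  assumes "vector_space scale"
    and "vector_space.dim scale (UNIV :: 'v set) = 2"
    and "Modules.module.subspace scale L"
    and "vector_space.dim scale L = 1"
    and "k \<ge> 1"
  shows "let F = (ring_of_type_algebra :: 'f ring);
             P = line_stabilizer scale L;
             V = sub_rep scale (UNIV :: 'v set);
             l = sub_rep scale L
         in (d > 0 \<longrightarrow>
              rep_iso P F (jet_fiber scale k (- int d) L)
                (rep_sum (rep_sym F d l)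
                   (rep_tensor F (rep_sym F (k + d + 1) l) (rep_sym F (k - 1) V)))) \<and>
            (d \<ge> k + 1 \<longrightarrow>
              rep_iso P F (jet_fiber scale k (int d) L)
                (rep_sum (rep_sym F d (rep_dual F l))
                   (rep_tensor F (rep_sym F (d - k - 1) (rep_dual F l)) (rep_sym F (k - 1) V)))) \<and>
            (d < k + 1 \<longrightarrow>
              rep_iso P F (jet_fiber scale k (int d) L)
                (rep_sum (rep_sym F d (rep_dual F l))
                   (rep_tensor F (rep_sym F (k + 1 - d) l) (rep_sym F (k - 1) V))))"
proof -
  obtain u v xc yc where pl: "plane scale u v xc yc" and L: "L = {w. yc w = 0}"
    using plane_basis[OF assms(1-4)] by blast
  interpret plane scale u v xc yc by (rule pl)
  have LL: "L = line" unfolding L line_def ..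
  show ?thesis
    unfolding Let_def LL using jet_fiber_decomposition[OF assms(5), of d] unfolding stab_def by blast
qed

end
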